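(* Let $(X^N(0))_{N\in\mathbb N^*}$ be the initial positions of the particles. Assume that there exist constants $\bar M,\mathcal E>0$ and a positive sequence $(\lambda^N)_{N\in\mathbb N^*}$ such that $(X^N(0))_{N\in\mathbb N^*}$ lies in the set $\mathcal X(\bar M,\mathcal E)$. If $\bar M^{1/3}r_0$ is small enough, there exist $N^*\in\mathbb N^*$ depending on $(r_0,\bar M,\mathcal E)$ and $T>0$ depending on $(r_0,\mathcal E,\bar M,\kappa|g|)$ such that for all $t\in[0,T]$ and $N\ge N^*$ $$d_{\min}^N(t)\ge \tfrac12 d_{\min}^N(0),\qquad M^N(t)\le 8^4M^N(0).$$
   Context: Fix $r_0>0$, $\kappa>0$, $g\in\mathbb R^3$ (all independent of $N$), and set $R=r_0/N$ for $N\in\mathbb N^*=\{1,2,\dots\}$. Configurations. For each $N$ let $X^N=(x_1,\dots,x_N)$ be a configuration of points of $\mathbb R^3$ (the dependence of $x_i$ on $N$ is not displayed) and $d_{\min}^N=\min_{i\neq j}|x_i-x_j|$. For a positive sequence $(\lambda^N)$ put $M^N=\sup_{x\in\mathbb R^3}\#\{i: x_i\in\overline{B_\infty(x,\lambda^N)}\}$, where $B_\infty(x,r)$ is the ball for the $\ell^\infty$ norm. Given $\bar M,\mathcal E>0$ and $(\lambda^N)$, $\mathcal X(\bar M,\mathcal E)$ is the set of sequences $(X^N)_N$ such that $\sup_N \frac{M^N}{N|\lambda^N|^3}\le\bar M$, $\sup_N\frac{|\lambda^N|^3}{|d_{\min}^N|^2}\le\mathcal E$, $\lambda^N\ge d_{\min}^N/2$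 for all $N$, and $\lim_{N\to\infty}\lambda^N=0$. Stokes problem. For a configuration with disjoint closed balls $\overline{B_i}$, $B_i=B(x_i,R)$, let $(u^N,p^N)$ and $(V_i,\Omega_i)_{1\le i\le N}\in(\mathbb R^3\times\mathbb R^3)^N$ be the unique solution of $-\Delta u^N+\nabla p^N=0$, $\operatorname{div}u^N=0$ in $\mathbb R^3\setminus\bigcup_i\overline{B_i}$, $u^N=V_i+\Omega_i\times(x-x_i)$ on $\partial B_i$, $|u^N(x)|\to0$ as $|x|\to\infty$, with finite Dirichlet energy, $p^N\in L^2$, and $\int_{\partial B_i}\sigma(u^N,p^N)n=-mg$, $\int_{\partial B_i}(x-x_i)\times[\sigma(u^N,p^N)n]=0$ for all $i$, where $\sigma(u,p)=\nabla u+\nabla u^\top-p\mathbb I$, $n$ is the unit outer normal to $\partial B_i$, and $mg=6\pi R\,\kappa g$. Dynamics. The particles move according to $\dot x_i(t)=V_i(t)$, $x_i(0)=x_i^0$, where $V_i(t)$ is the velocity determined by the Stokes problem for the configuration $X^N(t)=(x_1(t),\dots,x_N(t))$. $d_{\min}^N(t)$ and $M^N(t)$ denote the quantities above for $X^N(t)$ (with the same $\lambda^N$). *)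

theory Defs
  imports "HOL-Analysis.Analysis"
begin

text \<open>Configurations of \<open>N\<close> points are functions \<open>X :: nat \<Rightarrow> real^3\<close> of which only the
  values at \<open>i < N\<close> matter.\<close>

section \<open>Configurations\<close>

text \<open>Only meaningful for \<open>2 \<le> N\<close> (for \<open>N = 1\<close> there are no pairs).\<close>

definition dmin :: "nat \<Rightarrow> (nat \<Rightarrow> real^3) \<Rightarrow> real" where
  "dmin N X = Min {dist (X i) (X j) | i j. i < N \<and> j < N \<and> i \<noteq> j}"

definition max_count :: "nat \<Rightarrow> real \<Rightarrow> (nat \<Rightarrow> real^3) \<Rightarrow> nat" where
  "max_count N l X = (SUP x. card {i. i < N \<and> infnorm (X i - x) \<le> l})"

text \<open>The bounds on suprema over \<open>N\<close> are written pointwise. The conditions involving the minimal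
  distance are imposed for \<open>2 \<le> N\<close>, where that distance makes sense. The conjunct
  \<open>0 < dmin N (X N)\<close> is needed because division by zero yields zero; with a quotient valued in
  the extended reals it would follow from the bound by \<open>E\<close>.\<close>

definition admissible :: "real \<Rightarrow> real \<Rightarrow> (nat \<Rightarrow> real) \<Rightarrow> (nat \<Rightarrow> nat \<Rightarrow> real^3) set" where
  "admissible Mbar E l = {X.
     (\<forall>N\<ge>1. real (max_count N (l N) (X N)) / (real N * \<bar>l N\<bar> ^ 3) \<le> Mbar) \<and>
     (\<forall>N\<ge>2. 0 < dmin N (X N) \<and> \<bar>l N\<bar> ^ 3 / \<bar>dmin N (X N)\<bar> ^ 2 \<le> E) \<and>
     (\<forall>N\<ge>2. l N \<ge> dmin N (X N) / 2) \<and>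
     l \<longlonglongrightarrow> 0}"


section \<open>Differential operators\<close>

text \<open>All derivatives are taken within a set \<open>S\<close>. On an open set they are the usual derivatives.
  Below, \<open>S\<close> is also used for the closed complement of finitely many disjoint balls, where the
  derivative within \<open>S\<close> is still unique and gives the one-sided derivative on the boundary.\<close>

definition partial :: "(real^3) set \<Rightarrow> 3 \<Rightarrow> (real^3 \<Rightarrow> 'b::real_normed_vector) \<Rightarrow> real^3 \<Rightarrow> 'b" where
  "partial S k f x = frechet_derivative f (at x within S) (axis k 1)"

definition C1_on :: "(real^3) set \<Rightarrow> (real^3 \<Rightarrow> 'b::real_normed_vector) \<Rightarrow> bool" where
  "C1_on S f \<longleftrightarrow> f differentiable_on S \<and> (\<forall>k. continuous_on S (partial S k f))"

definition C2_on :: "(real^3) set \<Rightarrow> (real^3 \<Rightarrow> 'b::real_normed_vector) \<Rightarrow> bool" where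
  "C2_on S f \<longleftrightarrow> C1_on S f \<and> (\<forall>k. C1_on S (partial S k f))"

definition gradient :: "(real^3) set \<Rightarrow> (real^3 \<Rightarrow> real) \<Rightarrow> real^3 \<Rightarrow> real^3" where
  "gradient S p x = (\<chi> k. partial S k p x)"

definition divergence :: "(real^3) set \<Rightarrow> (real^3 \<Rightarrow> real^3) \<Rightarrow> real^3 \<Rightarrow> real" where
  "divergence S u x = (\<Sum>k\<in>UNIV. partial S k u x $ k)"

definition laplacian :: "(real^3) set \<Rightarrow> (real^3 \<Rightarrow> real^3) \<Rightarrow> real^3 \<Rightarrow> real^3" where
  "laplacian S u x = (\<Sum>k\<in>UNIV. partial S k (partial S k u) x)"

definition jacobian :: "(real^3) set \<Rightarrow> (real^3 \<Rightarrow> real^3) \<Rightarrow> real^3 \<Rightarrow> real^3^3" where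
  "jacobian S u x = (\<chi> i j. partial S j u x $ i)"

definition stress ::
    "(real^3) set \<Rightarrow> (real^3 \<Rightarrow> real^3) \<Rightarrow> (real^3 \<Rightarrow> real) \<Rightarrow> real^3 \<Rightarrow> real^3^3" where
  "stress S u p x = jacobian S u x + transpose (jacobian S u x) - mat (p x)"


section \<open>Surface integrals over spheres\<close>

text \<open>Integral with respect to surface measure on the sphere of centre \<open>c\<close> and radius \<open>R\<close>, in
  spherical coordinates: \<open>\<theta>\<close> is the polar angle, \<open>\<phi>\<close> the azimuth.\<close>

definition sphere_integral :: "real^3 \<Rightarrow> real \<Rightarrow> (real^3 \<Rightarrow> real^3) \<Rightarrow> real^3" where
  "sphere_integral c R f =
     integral {0..pi} (\<lambda>\<theta>. integral {0..2 * pi} (\<lambda>\<phi>.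
       (R ^ 2 * sin \<theta>) *\<^sub>R
         f (c + R *\<^sub>R vector [sin \<theta> * cos \<phi>, sin \<theta> * sin \<phi>, cos \<theta>])))"


section \<open>The Stokes problem\<close>

definition disjoint_balls :: "nat \<Rightarrow> real \<Rightarrow> (nat \<Rightarrow> real^3) \<Rightarrow> bool" where
  "disjoint_balls N R X \<longleftrightarrow>
     (\<forall>i<N. \<forall>j<N. i \<noteq> j \<longrightarrow> cball (X i) R \<inter> cball (X j) R = {})"

definition fluid :: "nat \<Rightarrow> real \<Rightarrow> (nat \<Rightarrow> real^3) \<Rightarrow> (real^3) set" where
  "fluid N R X = - (\<Union>i<N. cball (X i) R)"

definition fluid_closed :: "nat \<Rightarrow> real \<Rightarrow> (nat \<Rightarrow> real^3) \<Rightarrow> (real^3) set" where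
  "fluid_closed N R X = - (\<Union>i<N. ball (X i) R)"

definition outer_normal :: "real^3 \<Rightarrow> real \<Rightarrow> real^3 \<Rightarrow> real^3" where
  "outer_normal c R x = (1 / R) *\<^sub>R (x - c)"

text \<open>Classical solutions of the Stokes problem around \<open>N\<close> rigid balls of radius \<open>R\<close>, each
  subject to the external force \<open>F\<close> (that is, \<open>mg\<close>) and to no external torque. The solution is
  \<open>C\<^sup>2\<close> in velocity and \<open>C\<^sup>1\<close> in pressure in the open fluid domain, and velocity gradient and
  pressure are continuous up to the boundary, so that the stress has a pointwise trace on the
  spheres. The spheres being smooth and disjoint, the finite energy weak solution has this
  regularity. The values of \<open>u\<close> and \<open>p\<close> inside the open balls are irrelevant.\<close>

definition stokes_solution ::
    "nat \<Rightarrow> real \<Rightarrow> real^3 \<Rightarrow> (nat \<Rightarrow> real^3) \<Rightarrow>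
     (real^3 \<Rightarrow> real^3) \<Rightarrow> (real^3 \<Rightarrow> real) \<Rightarrow> (nat \<Rightarrow> real^3) \<Rightarrow> (nat \<Rightarrow> real^3) \<Rightarrow> bool" where
  "stokes_solution N R F X u p V \<Omega> \<longleftrightarrow>
    (let U = fluid N R X; D = fluid_closed N R X in
     C2_on U u \<and> C1_on U p \<and> C1_on D u \<and> continuous_on D p \<and>
     (\<forall>x\<in>U. - laplacian U u x + gradient U p x = 0) \<and>
     (\<forall>x\<in>U. divergence U u x = 0) \<and>
     (\<forall>i<N. \<forall>x\<in>sphere (X i) R. u x = V i + cross3 (\<Omega> i) (x - X i)) \<and>
     (u \<longlongrightarrow> 0) at_infinity \<and>
     set_integrable lborel U (\<lambda>x. (norm (jacobian U u x))\<^sup>2) \<and>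
     set_integrable lborel U (\<lambda>x. (p x)\<^sup>2) \<and>
     (\<forall>i<N. sphere_integral (X i) R
        (\<lambda>x. stress D u p x *v outer_normal (X i) R x) = - F) \<and>
     (\<forall>i<N. sphere_integral (X i) R
        (\<lambda>x. cross3 (x - X i) (stress D u p x *v outer_normal (X i) R x)) = 0))"


section \<open>The dynamics\<close>

text \<open>\<open>x t i\<close> is the position of the centre of particle \<open>i\<close> at time \<open>t\<close>. The equation of motion
  only makes sense while the closed balls are disjoint, so it is required at all times up to which
  no contact has occurred. From the first contact on (if there is one) nothing is required of the
  path but continuity.\<close>

definition sedimentation ::
    "real \<Rightarrow> real \<Rightarrow> real^3 \<Rightarrow> nat \<Rightarrow> (real \<Rightarrow> nat \<Rightarrow> real^3) \<Rightarrow> bool" where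
  "sedimentation r\<^sub>0 \<kappa> g N x \<longleftrightarrow>
    (let R = r\<^sub>0 / real N; F = (6 * pi * R * \<kappa>) *\<^sub>R g in
     (\<forall>i<N. continuous_on {0..} (\<lambda>t. x t i)) \<and>
     (\<forall>t\<ge>0. (\<forall>s\<in>{0..t}. disjoint_balls N R (x s)) \<longrightarrow>
        (\<exists>u p V \<Omega>. stokes_solution N R F (x t) u p V \<Omega> \<and>
           (\<forall>i<N. ((\<lambda>s. x s i) has_vector_derivative V i) (at t within {0..})))))"

end

theory Submission
  imports Defs
begin

text \<open>Testing the Stokes problem with \<open>u\<close> itself bounds the dissipation, the squared norm of the
  symmetric gradient of \<open>u\<close>, by the power of the forces. Testing it with the explicit flow around the
  ball \<open>i\<close> alone, corrected near each other ball by a divergence-free field so as to be constant there,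
  and testing the stress of that flow with \<open>u\<close>, expresses \<open>V i\<close> as the flow of point forces at the
  other centres plus the work of the stress of \<open>u\<close> on the correctors. By Young's inequality that work
  is controlled by the dissipation and by inverse powers of the distances between the centres. Sums of
  inverse squared distances are \<open>O(N)\<close> by counting points in dyadic cubes, and so
  \<open>norm (V i - V k) \<le> L * dist (X i) (X k)\<close> with \<open>L\<close> independent of \<open>N\<close>, as long as no distance has dropped
  below half its initial value. By Gronwall's argument no distance then drops below three quarters of
  its initial value in a short time, and the bounds propagate.\<close>

section \<open>A smooth step\<close>

text \<open>Three scales fit together. The radius is r/N. Since a cube around a point holds at least
  that point, the admissibility bounds keep distances above a multiple of N^(-1/2). Inverse squared
  distances sum to O(N). For two particles at distance d, the difference of their correctors near
  the centre j is of size d / dist^3, so its squared norm is R^3 d^2 / dist^6; the sum over j is at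
  most a multiple of R^3 d^2 N^3 = r^3 d^2. Young's inequality with weight d makes this a multiple
  of d: the Lipschitz bound, uniform in N. Two obstacles shape the estimates. The dissipation does
  not control the pressure, so fields paired with the stress of \<open>u\<close> are kept
  divergence-free; hence correctors are curls of truncated potentials. And \<open>u\<close> merely
  tends to zero at infinity, with square integrable gradient and pressure, so integrals over the
  unbounded domain are limits of integrals with cutoffs at radius n. The power of the forces
  contains the unknown velocities; a small weight in Young's inequality absorbs it.\<close>

text \<open>Integrating the quadratic B-spline with knots \<open>0, 1, 2, 3\<close>.\<close>

definition cubic_step :: "real \<Rightarrow> real" where
  "cubic_step t = (max 0 t ^ 3 - 3 * max 0 (t - 1) ^ 3 + 3 * max 0 (t - 2) ^ 3 - max 0 (t - 3) ^ 3) / 6"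

definition cubic_step' :: "real \<Rightarrow> real" where
  "cubic_step' t = (max 0 t ^ 2 - 3 * max 0 (t - 1) ^ 2 + 3 * max 0 (t - 2) ^ 2 - max 0 (t - 3) ^ 2) / 2"

definition cubic_step'' :: "real \<Rightarrow> real" where
  "cubic_step'' t = max 0 t - 3 * max 0 (t - 1) + 3 * max 0 (t - 2) - max 0 (t - 3)"

lemma max_power_deriv:
  fixes t a :: real
  assumes "n \<ge> 1"
  shows "((\<lambda>t::real. max 0 (t - a) ^ Suc n) has_real_derivative (Suc n * max 0 (t - a) ^ n)) (at t)"
proof -
  consider "t < a" | "t = a" | "t > a" by linarith
  then show ?thesis
  proof cases
    case 1
    have "((\<lambda>t::real. 0) has_real_derivative 0) (at t)" by simp
    then have "((\<lambda>t::real. max 0 (t - a) ^ Suc n) has_real_derivative 0) (at t)"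
      by (rule has_field_derivative_transform_within_open[where S="{..<a}"]) (use 1 in \<open>auto simp: max_def\<close>)
    moreover have "real (Suc n) * max 0 (t - a) ^ n = 0" using 1 assms by (simp add: max_def)
    ultimately show ?thesis by metis
  next
    case 3
    have "((\<lambda>t::real. (t - a) ^ Suc n) has_real_derivative (Suc n * (t-a)^n)) (at t)"
      by (rule derivative_eq_intros refl)+ simp
    then have "((\<lambda>t::real. max 0 (t - a) ^ Suc n) has_real_derivative (Suc n * (t-a)^n)) (at t)"
      by (rule has_field_derivative_transform_within_open[where S="{a<..}"]) (use 3 in \<open>auto simp: max_def\<close>)
    then show ?thesis using 3 by (simp add: max_def)
  next
    case 2
    \<comment> \<open>At the knot the difference quotient is at most |h|^n in absolute value, a null
      function because \<open>n\<close> is positive.\<close>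
    have "((\<lambda>h. (max 0 (t + h - a) ^ Suc n - max 0 (t - a) ^ Suc n) / h) \<longlongrightarrow> 0) (at 0)"
    proof (rule Lim_null_comparison[where g="\<lambda>h. \<bar>h\<bar> ^ n"])
      show "\<forall>\<^sub>F h in at 0. norm ((max 0 (t + h - a) ^ Suc n - max 0 (t - a) ^ Suc n) / h) \<le> \<bar>h\<bar> ^ n"
        using 2 by (auto simp: max_def eventually_at_filter abs_mult power_abs)
      show "((\<lambda>h::real. \<bar>h\<bar> ^ n) \<longlongrightarrow> 0) (at 0)"
        using assms by (auto intro!: tendsto_eq_intros)
    qed
    moreover have "real (Suc n) * max 0 (t - a) ^ n = 0" using 2 assms by simp
    ultimately show ?thesis unfolding DERIV_def by metis
  qed
qed

lemma cubic_step_deriv: "(cubic_step has_real_derivative cubic_step' t) (at t)"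
proof -
  have *: "((\<lambda>t::real. max 0 (t - a) ^ 3) has_real_derivative (3 * max 0 (t - a) ^ 2)) (at t)" for a
    using max_power_deriv[of 2 a t] by (simp add: eval_nat_numeral)
  show ?thesis unfolding cubic_step_def [abs_def] cubic_step'_def
    by (rule DERIV_cong[OF DERIV_cdivide[OF DERIV_diff[OF DERIV_add[OF DERIV_diff[OF *[of 0, simplified]
        DERIV_cmult[OF *[of 1], of 3]] DERIV_cmult[OF *[of 2], of 3]] *[of 3]], of 6]]) (simp add: field_simps)
qed

lemma cubic_step'_deriv: "(cubic_step' has_real_derivative cubic_step'' t) (at t)"
proof -
  have *: "((\<lambda>t::real. max 0 (t - a) ^ 2) has_real_derivative (2 * max 0 (t - a))) (at t)" for a
    using max_power_deriv[of 1 a t] by (simp add: eval_nat_numeral)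
  show ?thesis unfolding cubic_step'_def [abs_def] cubic_step''_def
    by (rule DERIV_cong[OF DERIV_cdivide[OF DERIV_diff[OF DERIV_add[OF DERIV_diff[OF *[of 0, simplified]
        DERIV_cmult[OF *[of 1], of 3]] DERIV_cmult[OF *[of 2], of 3]] *[of 3]], of 2]]) (simp add: field_simps)
qed

lemma continuous_cubic_step [continuous_intros]:
  "continuous_on S f \<Longrightarrow> continuous_on S (\<lambda>x. cubic_step (f x))"
  "continuous_on S f \<Longrightarrow> continuous_on S (\<lambda>x. cubic_step' (f x))"
  "continuous_on S f \<Longrightarrow> continuous_on S (\<lambda>x. cubic_step'' (f x))"
  unfolding cubic_step_def cubic_step'_def cubic_step''_def by (intro continuous_intros; simp)+

lemma cubic_step_eq_0: "t \<le> 0 \<Longrightarrow> cubic_step t = 0"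
  and cubic_step'_eq_0: "t \<le> 0 \<or> t \<ge> 3 \<Longrightarrow> cubic_step' t = 0"
  and cubic_step''_eq_0: "t \<le> 0 \<or> t \<ge> 3 \<Longrightarrow> cubic_step'' t = 0"
  and cubic_step_eq_1: "t \<ge> 3 \<Longrightarrow> cubic_step t = 1"
  unfolding cubic_step_def cubic_step'_def cubic_step''_def
  by (auto simp: max_def power2_eq_square power3_eq_cube field_simps)

text \<open>After completing squares each polynomial piece is half a square or 3/4 minus a square,
  so its range can be read off.\<close>

lemma cubic_step'_bounds: "0 \<le> cubic_step' t" "cubic_step' t \<le> 1"
proof -
  consider "t \<le> 0" | "0 \<le> t" "t \<le> 1" | "1 \<le> t" "t \<le> 2" | "2 \<le> t" "t \<le> 3" | "t \<ge> 3" by linarith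
  then have "0 \<le> cubic_step' t \<and> cubic_step' t \<le> 1"
  proof cases
    case 2
    then have "cubic_step' t = t^2/2" by (simp add: cubic_step'_def max_def)
    moreover have "t^2 \<le> 1" using 2 by (simp add: power_le_one)
    ultimately show ?thesis using zero_le_power2[of t] by linarith
  next
    case 3
    then have "cubic_step' t = 3/4 - (t - 3/2)^2"
      by (auto simp: cubic_step'_def max_def power2_eq_square field_simps)
    moreover have "\<bar>t - 3/2\<bar>^2 \<le> (1/2)^2" by (rule power_mono) (use 3 in \<open>auto simp: abs_if\<close>)
    then have "(t - 3/2)^2 \<le> 1/4" by (simp add: power_divide)
    ultimately show ?thesis using zero_le_power2[of "t - 3/2"] by linarith
  next
    case 4
    then have "cubic_step' t = (3 - t)^2/2"
      by (auto simp: cubic_step'_def max_def power2_eq_square field_simps)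
    moreover have "(3 - t)^2 \<le> 1" using 4 by (simp add: power_le_one)
    ultimately show ?thesis using zero_le_power2[of "3 - t"] by linarith
  qed (auto simp: cubic_step'_eq_0)
  then show "0 \<le> cubic_step' t" "cubic_step' t \<le> 1" by auto
qed

lemma cubic_step''_bound: "\<bar>cubic_step'' t\<bar> \<le> 1"
  unfolding cubic_step''_def by (auto simp: max_def abs_if)

lemma cubic_step_bounds: "0 \<le> cubic_step t" "cubic_step t \<le> 1"
proof -
  have mono: "s \<le> t \<Longrightarrow> cubic_step s \<le> cubic_step t" for s t
    by (rule DERIV_nonneg_imp_nondecreasing) (use cubic_step_deriv cubic_step'_bounds in blast)+
  show "0 \<le> cubic_step t"
    using mono[of 0 t] cubic_step_eq_0[of t] cubic_step_eq_0[of 0] by (cases "t \<le> 0") auto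
  show "cubic_step t \<le> 1"
    using mono[of t 3] cubic_step_eq_1[of t] cubic_step_eq_1[of 3] by (cases "t \<ge> 3") auto
qed

lemma has_derivative_cubic_step [derivative_intros]:
  assumes "(f has_derivative f') (at x within S)"
  shows "((\<lambda>x. cubic_step (f x)) has_derivative (\<lambda>h. f' h * cubic_step' (f x))) (at x within S)"
    and "((\<lambda>x. cubic_step' (f x)) has_derivative (\<lambda>h. f' h * cubic_step'' (f x))) (at x within S)"
  using has_derivative_compose[OF assms cubic_step_deriv[THEN has_field_derivative_imp_has_derivative]]
    has_derivative_compose[OF assms cubic_step'_deriv[THEN has_field_derivative_imp_has_derivative]]
  by (simp_all add: mult.commute)

section \<open>Partial derivatives and integration by parts\<close>

text \<open>The partial derivatives are explicit data, so that product rules compute them by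
  unification. The derivative is the full one at \<open>x\<close>, not the one within
  \<open>S\<close> as in \<open>partial\<close>; it is therefore unique.\<close>

definition has_partials ::
    "(real^3 \<Rightarrow> 'b::real_normed_vector) \<Rightarrow> (3 \<Rightarrow> real^3 \<Rightarrow> 'b) \<Rightarrow> (real^3) set \<Rightarrow> bool" where
  "has_partials f d S \<longleftrightarrow>
     (\<forall>x\<in>S. (f has_derivative (\<lambda>h. \<Sum>k\<in>UNIV. h $ k *\<^sub>R d k x)) (at x))"

lemma linear_axis_sum:
  fixes f' :: "real^3 \<Rightarrow> 'b::real_normed_vector"
  assumes "linear f'"
  shows "f' h = (\<Sum>k\<in>UNIV. h $ k *\<^sub>R f' (axis k 1))"
proof -
  have "h = (\<Sum>k\<in>UNIV. h $ k *\<^sub>R axis k 1)"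
    using basis_expansion[of h] by (simp add: scalar_mult_eq_scaleR)
  then have "f' h = f' (\<Sum>k\<in>UNIV. h $ k *\<^sub>R axis k 1)" by simp
  also have "\<dots> = (\<Sum>k\<in>UNIV. h $ k *\<^sub>R f' (axis k 1))"
    using assms by (simp add: linear_sum linear_cmul)
  finally show ?thesis .
qed

lemma has_partialsI:
  assumes "\<And>x. x \<in> S \<Longrightarrow> (f has_derivative f' x) (at x)"
    and "\<And>x k. x \<in> S \<Longrightarrow> d k x = f' x (axis k 1)"
  shows "has_partials f d S"
  unfolding has_partials_def
proof
  fix x assume x: "x \<in> S"
  have "f' x = (\<lambda>h. \<Sum>k\<in>UNIV. h $ k *\<^sub>R d k x)"
    unfolding assms(2)[OF x]
    by (rule ext, rule linear_axis_sum[OF has_derivative_linear[OF assms(1)[OF x]]])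
  with assms(1)[OF x] show "(f has_derivative (\<lambda>h. \<Sum>k\<in>UNIV. h $ k *\<^sub>R d k x)) (at x)"
    by metis
qed

lemma has_partialsD:
  "has_partials f d S \<Longrightarrow> x \<in> S \<Longrightarrow> (f has_derivative (\<lambda>h. \<Sum>k\<in>UNIV. h $ k *\<^sub>R d k x)) (at x)"
  unfolding has_partials_def by auto

lemma sum_axis [simp]: "(\<Sum>k\<in>UNIV. axis i (1::real) $ k *\<^sub>R (d k :: 'b::real_normed_vector)) = d i"
proof -
  have "(\<Sum>k\<in>UNIV. axis i (1::real) $ k *\<^sub>R d k) = (\<Sum>k\<in>UNIV. if k = i then d k else 0)"
    by (rule sum.cong) (auto simp: axis_def)
  then show ?thesis by simp
qed

lemma has_partials_dirD:
  assumes "has_partials f d S" "x + t *\<^sub>R axis k 1 \<in> S"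
  shows "((\<lambda>t. f (x + t *\<^sub>R axis k 1)) has_vector_derivative d k (x + t *\<^sub>R axis k 1)) (at t)"
proof -
  have "((\<lambda>t. f (x + t *\<^sub>R axis k 1)) has_derivative
      (\<lambda>h. (\<Sum>j\<in>UNIV. (h *\<^sub>R axis k 1) $ j *\<^sub>R d j (x + t *\<^sub>R axis k 1)))) (at t)"
    by (rule has_derivative_compose[where f="\<lambda>t. x + t *\<^sub>R axis k 1" and g=f, OF _ has_partialsD[OF assms]])
       (auto intro!: derivative_eq_intros)
  moreover have "(\<Sum>j\<in>UNIV. (h *\<^sub>R axis k (1::real)) $ j *\<^sub>R d j (x + t *\<^sub>R axis k 1))
     = h *\<^sub>R d k (x + t *\<^sub>R axis k 1)" for h
  proof -
    have "(\<Sum>j\<in>UNIV. (h *\<^sub>R axis k (1::real)) $ j *\<^sub>R d j (x + t *\<^sub>R axis k 1))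
      = h *\<^sub>R (\<Sum>j\<in>UNIV. (axis k (1::real)) $ j *\<^sub>R d j (x + t *\<^sub>R axis k 1))"
      unfolding scaleR_sum_right by simp
    then show ?thesis unfolding sum_axis .
  qed
  ultimately show ?thesis by (simp add: has_vector_derivative_def)
qed

lemma has_partials_continuous_on:
  "has_partials f d S \<Longrightarrow> continuous_on S f"
  by (rule continuous_at_imp_continuous_on) (auto dest!: has_partialsD has_derivative_continuous)

lemma has_partials_subset: "has_partials f d S \<Longrightarrow> T \<subseteq> S \<Longrightarrow> has_partials f d T"
  unfolding has_partials_def by auto

lemma has_partials_unique:
  assumes "has_partials f d S" "has_partials f d' S" "x \<in> S"
  shows "d k x = d' k x"
proof -
  have "(\<lambda>h. \<Sum>k\<in>UNIV. h $ k *\<^sub>R d k x) = (\<lambda>h. \<Sum>k\<in>UNIV. h $ k *\<^sub>R d' k x)"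
    using has_derivative_unique[OF has_partialsD[OF assms(1,3)] has_partialsD[OF assms(2,3)]] .
  from fun_cong[OF this, of "axis k 1"] show ?thesis by simp
qed

lemma has_partials_cong:
  assumes "has_partials f d S" "open S" "\<And>x. x \<in> S \<Longrightarrow> g x = f x" "\<And>k x. x \<in> S \<Longrightarrow> d' k x = d k x"
  shows "has_partials g d' S"
  unfolding has_partials_def
proof
  fix x assume x: "x \<in> S"
  have "(g has_derivative (\<lambda>h. \<Sum>k\<in>UNIV. h $ k *\<^sub>R d k x)) (at x)"
    by (rule has_derivative_transform_within_open[OF has_partialsD[OF assms(1) x] assms(2) x])
       (simp add: assms(3))
  then show "(g has_derivative (\<lambda>h. \<Sum>k\<in>UNIV. h $ k *\<^sub>R d' k x)) (at x)"
    using assms(4)[OF x] by simp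
qed

lemma has_partials_zero_outside:
  fixes f :: "real^3 \<Rightarrow> 'b::real_normed_vector"
  assumes "has_partials f d S" "open S" "closed K" "\<And>x. x \<notin> K \<Longrightarrow> f x = 0" "x \<in> S" "x \<notin> K"
  shows "d k x = 0"
proof -
  have 1: "has_partials f d (S - K)" by (rule has_partials_subset[OF assms(1)]) auto
  have 0: "has_partials (\<lambda>_. 0 :: 'b) (\<lambda>_ _. 0) (S - K)" unfolding has_partials_def by simp
  have 2: "has_partials f (\<lambda>_ _. 0) (S - K)"
    by (rule has_partials_cong[OF 0 open_Diff[OF assms(2,3)]]) (simp_all add: assms(4))
  show ?thesis using has_partials_unique[OF 1 2] assms(5,6) by blast
qed

lemma has_partials_Un:
  assumes "has_partials f d S" "has_partials f d T"
  shows "has_partials f d (S \<union> T)"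
  using assms unfolding has_partials_def by auto

text \<open>One product rule for scalar multiples, inner products, products of reals and cross
  products.\<close>

lemma has_partials_bilinear:
  assumes b: "bounded_bilinear b" and f: "has_partials f df S" and g: "has_partials g dg S"
  shows "has_partials (\<lambda>x. b (f x) (g x)) (\<lambda>k x. b (f x) (dg k x) + b (df k x) (g x)) S"
proof (rule has_partialsI[where f'="\<lambda>x. (\<lambda>h. b (f x) (\<Sum>k\<in>UNIV. h $ k *\<^sub>R dg k x) + b (\<Sum>k\<in>UNIV. h $ k *\<^sub>R df k x) (g x))"])
  fix x assume x: "x \<in> S"
  show "((\<lambda>x. b (f x) (g x)) has_derivative
     (\<lambda>h. b (f x) (\<Sum>k\<in>UNIV. h $ k *\<^sub>R dg k x) + b (\<Sum>k\<in>UNIV. h $ k *\<^sub>R df k x) (g x))) (at x)"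
    by (rule bounded_bilinear.FDERIV[OF b has_partialsD[OF f x] has_partialsD[OF g x]])
  show "b (f x) (dg k x) + b (df k x) (g x) = b (f x) (\<Sum>ka\<in>UNIV. axis k 1 $ ka *\<^sub>R dg ka x) +
           b (\<Sum>ka\<in>UNIV. axis k 1 $ ka *\<^sub>R df ka x) (g x)" for k
    by simp
qed

lemmas has_partials_scaleR = has_partials_bilinear[OF bounded_bilinear_scaleR]
lemmas has_partials_inner = has_partials_bilinear[OF bounded_bilinear_inner]

lemma has_partials_add:
  assumes f: "has_partials f df S" and g: "has_partials g dg S"
  shows "has_partials (\<lambda>x. f x + g x) (\<lambda>k x. df k x + dg k x) S"
proof (rule has_partialsI[where f'="\<lambda>x. (\<lambda>h. (\<Sum>k\<in>UNIV. h $ k *\<^sub>R df k x) + (\<Sum>k\<in>UNIV. h $ k *\<^sub>R dg k x))"])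
  fix x assume x: "x \<in> S"
  show "((\<lambda>x. f x + g x) has_derivative (\<lambda>h. (\<Sum>k\<in>UNIV. h $ k *\<^sub>R df k x) + (\<Sum>k\<in>UNIV. h $ k *\<^sub>R dg k x))) (at x)"
    by (rule has_derivative_add) (use x in \<open>auto intro: has_partialsD[OF f] has_partialsD[OF g]\<close>)
qed simp_all

lemma has_partials_diff:
  assumes f: "has_partials f df S" and g: "has_partials g dg S"
  shows "has_partials (\<lambda>x. f x - g x) (\<lambda>k x. df k x - dg k x) S"
proof (rule has_partialsI[where f'="\<lambda>x. (\<lambda>h. (\<Sum>k\<in>UNIV. h $ k *\<^sub>R df k x) - (\<Sum>k\<in>UNIV. h $ k *\<^sub>R dg k x))"])
  fix x assume x: "x \<in> S"
  show "((\<lambda>x. f x - g x) has_derivative (\<lambda>h. (\<Sum>k\<in>UNIV. h $ k *\<^sub>R df k x) - (\<Sum>k\<in>UNIV. h $ k *\<^sub>R dg k x))) (at x)"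
    by (rule has_derivative_diff) (use x in \<open>auto intro: has_partialsD[OF f] has_partialsD[OF g]\<close>)
qed simp_all

lemma has_partials_sum:
  assumes f: "\<And>i. i \<in> I \<Longrightarrow> has_partials (f i) (df i) S"
  shows "has_partials (\<lambda>x. \<Sum>i\<in>I. f i x) (\<lambda>k x. \<Sum>i\<in>I. df i k x) S"
proof (rule has_partialsI[where f'="\<lambda>x. (\<lambda>h. \<Sum>i\<in>I. (\<Sum>k\<in>UNIV. h $ k *\<^sub>R df i k x))"])
  fix x assume x: "x \<in> S"
  show "((\<lambda>x. \<Sum>i\<in>I. f i x) has_derivative (\<lambda>h. \<Sum>i\<in>I. (\<Sum>k\<in>UNIV. h $ k *\<^sub>R df i k x))) (at x)"
    by (rule has_derivative_sum) (use x in \<open>auto intro: has_partialsD[OF f]\<close>)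
qed simp_all

lemma has_partials_const: "has_partials (\<lambda>x. c) (\<lambda>k x. 0) S"
  unfolding has_partials_def by simp

lemma has_partials_linear:
  assumes L: "bounded_linear L" and f: "has_partials f df S"
  shows "has_partials (\<lambda>x. L (f x)) (\<lambda>k x. L (df k x)) S"
proof (rule has_partialsI[where f'="\<lambda>x. (\<lambda>h. L (\<Sum>k\<in>UNIV. h $ k *\<^sub>R df k x))"])
  fix x assume x: "x \<in> S"
  show "((\<lambda>x. L (f x)) has_derivative (\<lambda>h. L (\<Sum>k\<in>UNIV. h $ k *\<^sub>R df k x))) (at x)"
    by (rule bounded_linear.has_derivative[OF L]) (use x in \<open>auto intro: has_partialsD[OF f]\<close>)
qed simp_all

lemmas has_partials_nth = has_partials_linear[OF bounded_linear_vec_nth]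

text \<open>Both mixed partials are limits of the same second difference quotient.\<close>

lemma mixed_partials_commute:
  fixes f :: "real^3 \<Rightarrow> real"
  assumes U: "open U" and f: "has_partials f d U" and d: "\<And>k. has_partials (d k) (dd k) U"
    and c: "\<And>k l. continuous_on U (dd k l)" and x: "x \<in> U"
  shows "dd i j x = dd j i x"
proof -
  obtain r where r: "r > 0" "ball x r \<subseteq> U" using U x open_contains_ball by blast
  have main: "\<exists>s t. 0 \<le> s \<and> s \<le> h \<and> 0 \<le> t \<and> t \<le> h \<and>
      f (x + h *\<^sub>R axis i 1 + h *\<^sub>R axis j 1) - f (x + h *\<^sub>R axis i 1) - f (x + h *\<^sub>R axis j 1) + f x
        = h^2 * dd i j (x + s *\<^sub>R axis i 1 + t *\<^sub>R axis j 1)"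
    if h: "0 < h" "2 * h < r" for h i j
  proof -
    have inU: "x + s *\<^sub>R axis i 1 + t *\<^sub>R axis j 1 \<in> U" if "0 \<le> s" "s \<le> h" "0 \<le> t" "t \<le> h" for s t
    proof -
      have "norm (s *\<^sub>R axis i 1 + t *\<^sub>R axis j (1::real)) \<le> norm (s *\<^sub>R axis i (1::real)) + norm (t *\<^sub>R axis j (1::real))"
        by (rule norm_triangle_ineq)
      also have "\<dots> < r" using that h by simp
      finally have "dist (x + s *\<^sub>R axis i 1 + t *\<^sub>R axis j 1) x < r"
        by (simp add: dist_norm add.assoc)
      then show ?thesis using r by (auto simp: dist_commute)
    qed
    \<comment> \<open>The second difference is the increment of \<open>G\<close> over a step in
      direction i; the mean value theorem is applied to \<open>G\<close>, and then to
      \<open>d i\<close> along direction j.\<close>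
    define G where "G s = f (x + s *\<^sub>R axis i 1 + h *\<^sub>R axis j 1) - f (x + s *\<^sub>R axis i 1)" for s
    have G': "(G has_real_derivative (d i (x + s *\<^sub>R axis i 1 + h *\<^sub>R axis j 1) - d i (x + s *\<^sub>R axis i 1))) (at s)"
      if "0 \<le> s" "s \<le> h" for s
    proof -
      have eq: "x + s *\<^sub>R axis i 1 + h *\<^sub>R axis j 1 = (x + h *\<^sub>R axis j 1) + s *\<^sub>R axis i 1" for s
        by (simp add: algebra_simps)
      have 1: "((\<lambda>t. f (x + h *\<^sub>R axis j 1 + t *\<^sub>R axis i 1)) has_vector_derivative
                d i (x + h *\<^sub>R axis j 1 + s *\<^sub>R axis i 1)) (at s)"
        by (rule has_partials_dirD[OF f]) (use inU[of s h] that h eq in auto)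
      have 2: "((\<lambda>t. f (x + t *\<^sub>R axis i 1)) has_vector_derivative d i (x + s *\<^sub>R axis i 1)) (at s)"
        by (rule has_partials_dirD[OF f]) (use inU[of s 0] that h in auto)
      show ?thesis using has_vector_derivative_diff[OF 1 2]
        by (simp add: G_def[abs_def] eq has_real_derivative_iff_has_vector_derivative)
    qed
    obtain s where s: "0 < s" "s < h" "G h - G 0 = (h - 0) * (d i (x + s *\<^sub>R axis i 1 + h *\<^sub>R axis j 1) - d i (x + s *\<^sub>R axis i 1))"
      using MVT2[of 0 h G, OF h(1) G'] by auto
    have H': "((\<lambda>t. d i (x + s *\<^sub>R axis i 1 + t *\<^sub>R axis j 1)) has_real_derivative
         dd i j (x + s *\<^sub>R axis i 1 + t *\<^sub>R axis j 1)) (at t)" if "0 \<le> t" "t \<le> h" for t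
      unfolding has_real_derivative_iff_has_vector_derivative
      by (rule has_partials_dirD[OF d]) (use inU[of s t] s that in auto)
    obtain t where t: "0 < t" "t < h" "d i (x + s *\<^sub>R axis i 1 + h *\<^sub>R axis j 1) - d i (x + s *\<^sub>R axis i 1 + 0 *\<^sub>R axis j 1)
       = (h - 0) * dd i j (x + s *\<^sub>R axis i 1 + t *\<^sub>R axis j 1)"
      using MVT2[of 0 h "\<lambda>t. d i (x + s *\<^sub>R axis i 1 + t *\<^sub>R axis j 1)", OF h(1) H'] by auto
    show ?thesis
      by (rule exI[of _ s], rule exI[of _ t])
         (use s t in \<open>simp add: G_def power2_eq_square algebra_simps\<close>)
  qed
  have close: "\<forall>e>0. \<exists>h0>0. \<forall>h. 0 < h \<and> h < h0 \<longrightarrow> 2 * h < r \<and> (\<forall>s t. 0 \<le> s \<and> s \<le> h \<and> 0 \<le> t \<and> t \<le> h \<longrightarrow>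
       \<bar>dd i j (x + s *\<^sub>R axis i 1 + t *\<^sub>R axis j 1) - dd i j x\<bar> < e)" for i j
  proof (intro allI impI)
    fix e :: real assume "e > 0"
    have "isCont (dd i j) x" using c U x continuous_on_eq_continuous_at by blast
    then obtain \<delta> where \<delta>: "\<delta> > 0" "\<And>y. dist y x < \<delta> \<Longrightarrow> dist (dd i j y) (dd i j x) < e"
      using \<open>e > 0\<close> unfolding continuous_at_eps_delta by metis
    show "\<exists>h0>0. \<forall>h. 0 < h \<and> h < h0 \<longrightarrow> 2 * h < r \<and> (\<forall>s t. 0 \<le> s \<and> s \<le> h \<and> 0 \<le> t \<and> t \<le> h \<longrightarrow>
       \<bar>dd i j (x + s *\<^sub>R axis i 1 + t *\<^sub>R axis j 1) - dd i j x\<bar> < e)"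
    proof (rule exI[of _ "min (\<delta>/2) (r/2)"], intro conjI allI impI; (elim conjE)?)
      fix h s t assume h: "0 < h" "h < min (\<delta>/2) (r/2)" and st: "0 \<le> s" "s \<le> h" "0 \<le> t" "t \<le> h"
      have "norm (s *\<^sub>R axis i 1 + t *\<^sub>R axis j (1::real)) \<le> norm (s *\<^sub>R axis i (1::real)) + norm (t *\<^sub>R axis j (1::real))"
        by (rule norm_triangle_ineq)
      also have "\<dots> < \<delta>" using st h by simp
      finally have "dist (x + s *\<^sub>R axis i 1 + t *\<^sub>R axis j 1) x < \<delta>"
        by (simp add: dist_norm add.assoc)
      from \<delta>(2)[OF this] show "\<bar>dd i j (x + s *\<^sub>R axis i 1 + t *\<^sub>R axis j 1) - dd i j x\<bar> < e"
        by (simp add: dist_norm)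
    qed (use \<delta> r in auto)
  qed
  show ?thesis
  proof (rule ccontr)
    assume ne: "dd i j x \<noteq> dd j i x"
    define e where "e = \<bar>dd i j x - dd j i x\<bar> / 2"
    have e: "e > 0" using ne by (simp add: e_def)
    obtain h1 where h1: "h1 > 0" "\<And>h s t. 0 < h \<Longrightarrow> h < h1 \<Longrightarrow> 2 * h < r \<and> (0 \<le> s \<and> s \<le> h \<and> 0 \<le> t \<and> t \<le> h \<longrightarrow>
       \<bar>dd i j (x + s *\<^sub>R axis i 1 + t *\<^sub>R axis j 1) - dd i j x\<bar> < e)"
      using close[rule_format, OF e, of i j] by blast
    obtain h2 where h2: "h2 > 0" "\<And>h s t. 0 < h \<Longrightarrow> h < h2 \<Longrightarrow> 2 * h < r \<and> (0 \<le> s \<and> s \<le> h \<and> 0 \<le> t \<and> t \<le> h \<longrightarrow>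
       \<bar>dd j i (x + s *\<^sub>R axis j 1 + t *\<^sub>R axis i 1) - dd j i x\<bar> < e)"
      using close[rule_format, OF e, of j i] by blast
    define h where "h = min h1 h2 / 2"
    have h: "0 < h" "h < h1" "h < h2" using h1 h2 by (auto simp: h_def)
    have r2: "2 * h < r" using h1 h by blast
    obtain s t where st: "0 \<le> s" "s \<le> h" "0 \<le> t" "t \<le> h"
      "f (x + h *\<^sub>R axis i 1 + h *\<^sub>R axis j 1) - f (x + h *\<^sub>R axis i 1) - f (x + h *\<^sub>R axis j 1) + f x
        = h^2 * dd i j (x + s *\<^sub>R axis i 1 + t *\<^sub>R axis j 1)"
      using main[OF h(1) r2, of i j] by blast
    obtain s' t' where st': "0 \<le> s'" "s' \<le> h" "0 \<le> t'" "t' \<le> h"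
      "f (x + h *\<^sub>R axis j 1 + h *\<^sub>R axis i 1) - f (x + h *\<^sub>R axis j 1) - f (x + h *\<^sub>R axis i 1) + f x
        = h^2 * dd j i (x + s' *\<^sub>R axis j 1 + t' *\<^sub>R axis i 1)"
      using main[OF h(1) r2, of j i] by blast
    have sw: "f (x + h *\<^sub>R axis i 1 + h *\<^sub>R axis j 1) = f (x + h *\<^sub>R axis j 1 + h *\<^sub>R axis i 1)"
      by (simp add: algebra_simps)
    have "h^2 * dd i j (x + s *\<^sub>R axis i 1 + t *\<^sub>R axis j 1) = h^2 * dd j i (x + s' *\<^sub>R axis j 1 + t' *\<^sub>R axis i 1)"
      using st(5) st'(5) sw by linarith
    then have "dd i j (x + s *\<^sub>R axis i 1 + t *\<^sub>R axis j 1) = dd j i (x + s' *\<^sub>R axis j 1 + t' *\<^sub>R axis i 1)"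
      using h by simp
    moreover have "\<bar>dd i j (x + s *\<^sub>R axis i 1 + t *\<^sub>R axis j 1) - dd i j x\<bar> < e" using h1 h st by blast
    moreover have "\<bar>dd j i (x + s' *\<^sub>R axis j 1 + t' *\<^sub>R axis i 1) - dd j i x\<bar> < e" using h2 h st' by blast
    ultimately show False unfolding e_def by (auto simp: abs_if field_simps split: if_splits)
  qed
qed

section \<open>Integrals of compactly supported derivatives and the weak divergence\<close>

lemma integrable_compact_support:
  fixes f :: "'a::euclidean_space \<Rightarrow> 'b::{banach, second_countable_topology}"
  assumes "continuous_on UNIV f" "compact K" "\<And>x. x \<notin> K \<Longrightarrow> f x = 0"
  shows "integrable lborel f"
proof -
  have "integrable lborel (\<lambda>x. indicator K x *\<^sub>R f x)"
    by (rule borel_integrable_compact[OF assms(2) continuous_on_subset[OF assms(1) subset_UNIV]])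
  moreover have "(\<lambda>x. indicator K x *\<^sub>R f x) = f"
    using assms(3) by (auto simp: indicator_def)
  ultimately show ?thesis by simp
qed

lemma lborel_integral_shift:
  fixes f :: "'a::euclidean_space \<Rightarrow> real"
  assumes "f \<in> borel_measurable borel"
  shows "(\<integral>x. f (x + c) \<partial>lborel) = (\<integral>x. f x \<partial>lborel)"
proof -
  have "(\<integral>x. f x \<partial>lborel) = (\<integral>x. f x \<partial>distr lborel borel ((+) c))"
    by (simp add: lborel_distr_plus)
  also have "\<dots> = (\<integral>x. f (c + x) \<partial>lborel)"
    by (rule integral_distr) (use assms in auto)
  finally show ?thesis by (simp add: add.commute)
qed

text \<open>By translation invariance the difference quotients of \<open>f\<close> have integral zero.\<close>

lemma integral_partial_eq_0:
  fixes f :: "real^3 \<Rightarrow> real"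
  assumes f: "has_partials f d UNIV" and c: "continuous_on UNIV (d k)"
    and K: "compact K" "\<And>x. x \<notin> K \<Longrightarrow> f x = 0"
  shows "(\<integral>x. d k x \<partial>lborel) = 0"
proof -
  \<comment> \<open>All difference quotients with step at most one are supported in the unit
    neighbourhood \<open>K'\<close>, so a single integrable function dominates them.\<close>
  define K' where "K' = {x + y |x y. x \<in> K \<and> y \<in> cball (0::real^3) 1}"
  have K': "compact K'" unfolding K'_def by (rule compact_sums) (use K in auto)
  have out: "x \<notin> K \<and> x + h *\<^sub>R axis k 1 \<notin> K" if "x \<notin> K'" "\<bar>h\<bar> \<le> 1" for x h
  proof
    show "x \<notin> K" using that(1) unfolding K'_def by force
    show "x + h *\<^sub>R axis k 1 \<notin> K"
    proof
      assume "x + h *\<^sub>R axis k 1 \<in> K"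
      then have "(x + h *\<^sub>R axis k 1) + (- h *\<^sub>R axis k 1) \<in> K'"
        unfolding K'_def using that(2)
        by (intro CollectI exI[of _ "x + h *\<^sub>R axis k 1"] exI[of _ "- h *\<^sub>R axis k 1"]) auto
      then show False using that by simp
    qed
  qed
  have dz: "d k x = 0" if "x \<notin> K" for x
    using has_partials_zero_outside[OF f open_UNIV compact_imp_closed[OF K(1)] K(2)] that by auto
  have "bounded (d k ` K)"
    using compact_imp_bounded compact_continuous_image continuous_on_subset[OF c] K(1) by blast
  then obtain B0 where B0: "\<forall>x\<in>K. norm (d k x) \<le> B0" by (auto simp: bounded_iff)
  define B where "B = max B0 0"
  have B: "\<bar>d k x\<bar> \<le> B" for x using B0 dz by (cases "x \<in> K") (auto simp: B_def)
  define h where "h n = 1 / real (Suc n)" for n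
  have h: "0 < h n" "h n \<le> 1" for n by (auto simp: h_def)
  have h0: "h \<longlonglongrightarrow> 0" unfolding h_def by (rule lim_1_over_n[THEN LIMSEQ_Suc])
  define g where "g n x = (f (x + h n *\<^sub>R axis k 1) - f x) / h n" for n x
  have cf: "continuous_on UNIV f" using has_partials_continuous_on[OF f] .
  have fi: "integrable lborel f" by (rule integrable_compact_support[OF cf K])
  have der: "((\<lambda>t. f (x + t *\<^sub>R axis k 1)) has_real_derivative d k (x + t *\<^sub>R axis k 1)) (at t)" for x t
    unfolding has_real_derivative_iff_has_vector_derivative by (rule has_partials_dirD[OF f]) auto
  have gb: "\<bar>g n x\<bar> \<le> indicator K' x * B" for n x
  proof (cases "x \<in> K'")
    case False
    then show ?thesis using out[OF False, of "h n"] h[of n] K(2) by (simp add: g_def)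
  next
    case True
    obtain z where "f (x + h n *\<^sub>R axis k 1) - f (x + 0 *\<^sub>R axis k 1) = (h n - 0) * d k (x + z *\<^sub>R axis k 1)"
      using MVT2[of 0 "h n" "\<lambda>t. f (x + t *\<^sub>R axis k 1)", OF h(1) der] by auto
    then have "g n x = d k (x + z *\<^sub>R axis k 1)" using h[of n] by (simp add: g_def)
    then show ?thesis using B True by simp
  qed
  have "(\<lambda>n. \<integral>x. g n x \<partial>lborel) \<longlonglongrightarrow> (\<integral>x. d k x \<partial>lborel)"
  proof (rule integral_dominated_convergence[where w="\<lambda>x. indicator K' x * B"])
    show "d k \<in> borel_measurable lborel" using c by (simp add: borel_measurable_continuous_onI)
    show "g n \<in> borel_measurable lborel" for n
    proof -
      have "continuous_on UNIV (g n)"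
        unfolding g_def[abs_def] using h[of n]
        by (intro continuous_intros continuous_on_compose2[OF cf]) auto
      then show ?thesis by (simp add: borel_measurable_continuous_onI)
    qed
    show "integrable lborel (\<lambda>x. indicator K' x * B)"
      using borel_integrable_compact[OF K', of "\<lambda>_. B"] by simp
    show "AE x in lborel. (\<lambda>n. g n x) \<longlonglongrightarrow> d k x"
    proof (rule AE_I2)
      fix x :: "real^3"
      have "((\<lambda>t. (f (x + (0 + t) *\<^sub>R axis k 1) - f (x + 0 *\<^sub>R axis k 1)) / t) \<longlongrightarrow> d k (x + 0 *\<^sub>R axis k 1)) (at 0)"
        using der[of x 0] unfolding DERIV_def .
      then have "((\<lambda>t. (f (x + t *\<^sub>R axis k 1) - f x) / t) \<longlongrightarrow> d k x) (at 0)" by simp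
      from LIMSEQ_SEQ_conv[THEN iffD2, OF this, rule_format, of h] show "(\<lambda>n. g n x) \<longlonglongrightarrow> d k x"
        using h h0 unfolding g_def by (metis less_irrefl)
    qed
    show "AE x in lborel. norm (g n x) \<le> indicator K' x * B" for n using gb by auto
  qed
  moreover have "(\<integral>x. g n x \<partial>lborel) = 0" for n
  proof -
    have bm: "f \<in> borel_measurable borel" using cf by (simp add: borel_measurable_continuous_onI)
    have K'': "compact ((\<lambda>x. x - h n *\<^sub>R axis k 1) ` K)"
      by (intro compact_continuous_image K continuous_intros)
    have i2: "integrable lborel (\<lambda>x. f (x + h n *\<^sub>R axis k 1))"
    proof (rule integrable_compact_support[OF _ K''])
      show "continuous_on UNIV (\<lambda>x. f (x + h n *\<^sub>R axis k 1))"
        by (intro continuous_intros continuous_on_compose2[OF cf]) auto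
      show "f (x + h n *\<^sub>R axis k 1) = 0" if "x \<notin> (\<lambda>x. x - h n *\<^sub>R axis k 1) ` K" for x
      proof (rule K(2))
        show "x + h n *\<^sub>R axis k 1 \<notin> K"
          using that by (metis add_diff_cancel imageI)
      qed
    qed
    have "(\<integral>x. g n x \<partial>lborel) = ((\<integral>x. f (x + h n *\<^sub>R axis k 1) \<partial>lborel) - (\<integral>x. f x \<partial>lborel)) / h n"
      unfolding g_def using i2 fi by simp
    then show ?thesis by (simp add: lborel_integral_shift[OF bm])
  qed
  ultimately have "(\<lambda>n::nat. 0::real) \<longlonglongrightarrow> (\<integral>x. d k x \<partial>lborel)" by simp
  then show ?thesis using LIMSEQ_unique tendsto_const by blast
qed

text \<open>Only one continuous derivative is asked for: the test fields are products of cutoffs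
  with fields such as the velocity, whose gradient is merely continuous up to the spheres.\<close>

definition test_field :: "(real^3) set \<Rightarrow> (real^3 \<Rightarrow> real^3) \<Rightarrow> (3 \<Rightarrow> real^3 \<Rightarrow> real^3) \<Rightarrow> bool" where
  "test_field U \<phi> d\<phi> \<longleftrightarrow> has_partials \<phi> d\<phi> UNIV \<and> (\<forall>k. continuous_on UNIV (d\<phi> k)) \<and>
     (\<exists>K. compact K \<and> K \<subseteq> U \<and> (\<forall>x. x \<notin> K \<longrightarrow> \<phi> x = 0))"

text \<open>The Frobenius product of matrix fields stored by columns; the column \<open>k\<close> of
  a gradient is the derivative in direction \<open>k\<close>.\<close>

definition contr :: "(3 \<Rightarrow> real^3 \<Rightarrow> real^3) \<Rightarrow> (3 \<Rightarrow> real^3 \<Rightarrow> real^3) \<Rightarrow> real^3 \<Rightarrow> real" where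
  "contr S T x = (\<Sum>k\<in>UNIV. S k x \<bullet> T k x)"

text \<open>The column index is the one contracted with the derivative. This weak form is all that
  the divergence theorem uses of the equation for the stress.\<close>

definition weakly_div_free :: "(real^3) set \<Rightarrow> (3 \<Rightarrow> real^3 \<Rightarrow> real^3) \<Rightarrow> bool" where
  "weakly_div_free U T \<longleftrightarrow> (\<forall>\<phi> d\<phi>. test_field U \<phi> d\<phi> \<longrightarrow> (\<integral>x. contr T d\<phi> x \<partial>lborel) = 0)"

text \<open>The sum over k of the k-th derivative of \<open>T k x \<bullet> \<phi> x\<close> is
  \<open>contr T d\<phi> x\<close> plus the divergence of \<open>T\<close> paired with
  \<open>\<phi> x\<close>, and each of these derivatives has integral zero.\<close>

lemma weakly_div_freeI:
  assumes U: "open U" and T: "\<And>k. has_partials (T k) (dT k) U" and c: "\<And>k. continuous_on U (dT k k)"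
    and div: "\<And>x. x \<in> U \<Longrightarrow> (\<Sum>k\<in>UNIV. dT k k x) = 0"
  shows "weakly_div_free U T"
  unfolding weakly_div_free_def
proof (intro allI impI)
  fix \<phi> d\<phi> assume test: "test_field U \<phi> d\<phi>"
  then obtain K where K: "compact K" "K \<subseteq> U" "\<And>x. x \<notin> K \<Longrightarrow> \<phi> x = 0"
    and hp: "has_partials \<phi> d\<phi> UNIV" and cd: "\<And>k. continuous_on UNIV (d\<phi> k)"
    unfolding test_field_def by blast
  have dz: "d\<phi> k x = 0" if "x \<notin> K" for x k
    using has_partials_zero_outside[OF hp open_UNIV compact_imp_closed[OF K(1)] K(3)] that by auto
  have cphi: "continuous_on UNIV \<phi>" using has_partials_continuous_on[OF hp] .
  \<comment> \<open>\<open>T\<close> is differentiable only in \<open>U\<close>, so the product is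
    extended by zero; the open sets \<open>U\<close> and \<open>- K\<close> cover the space and the
    derivatives are glued.\<close>
  define F where "F k x = (if x \<in> K then T k x \<bullet> \<phi> x else 0)" for k x
  define dF where "dF k l x = (if x \<in> K then T k x \<bullet> d\<phi> l x + dT k l x \<bullet> \<phi> x else 0)" for k l x
  have FU: "F k x = T k x \<bullet> \<phi> x" if "x \<in> U" for k x using K(3) that by (auto simp: F_def)
  have dFU: "dF k l x = T k x \<bullet> d\<phi> l x + dT k l x \<bullet> \<phi> x" if "x \<in> U" for k l x
    using K(3) dz that by (auto simp: dF_def)
  have oK: "open (- K)" using K(1) by (simp add: compact_imp_closed open_Compl)
  have UN: "U \<union> - K = UNIV" using K(2) by auto
  have hF: "has_partials (F k) (dF k) UNIV" for k
  proof -
    have "has_partials (F k) (dF k) U"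
      by (rule has_partials_cong[OF has_partials_inner[OF T[of k] has_partials_subset[OF hp subset_UNIV]] U])
         (simp_all add: FU dFU)
    moreover have "has_partials (F k) (dF k) (- K)"
      by (rule has_partials_cong[OF has_partials_const[of 0] oK]) (auto simp: F_def dF_def)
    ultimately show ?thesis using has_partials_Un UN by metis
  qed
  have cF: "continuous_on UNIV (dF k k)" for k
  proof -
    have "continuous_on U (\<lambda>x. T k x \<bullet> d\<phi> k x + dT k k x \<bullet> \<phi> x)"
      by (intro continuous_intros c has_partials_continuous_on[OF T] continuous_on_subset[OF cd] continuous_on_subset[OF cphi]) auto
    then have 1: "continuous_on U (dF k k)"
      by (rule continuous_on_cong[THEN iffD1, rotated -1]) (auto simp: dFU)
    have "continuous_on (-K) (\<lambda>x. 0::real)" by simp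
    then have 2: "continuous_on (- K) (dF k k)"
      by (rule continuous_on_cong[THEN iffD1, rotated -1]) (auto simp: dF_def)
    show ?thesis using continuous_on_open_Un[OF U oK 1 2] UN by simp
  qed
  have Fz: "F k x = 0" if "x \<notin> K" for k x using that by (simp add: F_def)
  have dFz: "dF k l x = 0" if "x \<notin> K" for k l x using that by (simp add: dF_def)
  have int: "integrable lborel (dF k k)" for k
    by (rule integrable_compact_support[OF cF K(1) dFz])
  have "contr T d\<phi> x = (\<Sum>k\<in>UNIV. dF k k x)" for x
  proof (cases "x \<in> K")
    case True
    then have x: "x \<in> U" using K by auto
    have "(\<Sum>k\<in>UNIV. dF k k x) = contr T d\<phi> x + (\<Sum>k\<in>UNIV. dT k k x) \<bullet> \<phi> x"
      by (simp add: dFU[OF x] contr_def sum.distrib inner_sum_left)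
    then show ?thesis using div[OF x] by simp
  next
    case False
    then show ?thesis by (simp add: dFz dz contr_def)
  qed
  then have "(\<integral>x. contr T d\<phi> x \<partial>lborel) = (\<integral>x. (\<Sum>k\<in>UNIV. dF k k x) \<partial>lborel)" by simp
  also have "\<dots> = (\<Sum>k\<in>UNIV. (\<integral>x. dF k k x \<partial>lborel))" using int by simp
  also have "\<dots> = 0" using integral_partial_eq_0[OF hF cF K(1) Fz] by simp
  finally show "(\<integral>x. contr T d\<phi> x \<partial>lborel) = 0" .
qed

section \<open>Integrals over thin spherical shells\<close>

text \<open>Fubini's theorem is available for pairs, so the coordinates are first transported to
  nested pairs by a map that preserves the content of boxes.\<close>

lemma integral_vec3:
  fixes f :: "real^3 \<Rightarrow> 'b::euclidean_space"
  assumes c: "continuous_on (cbox (vector [a1, a2, a3]) (vector [b1, b2, b3])) f"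
  shows "integral (cbox (vector [a1, a2, a3]) (vector [b1, b2, b3])) f =
    integral {a1..b1} (\<lambda>x. integral {a2..b2} (\<lambda>y. integral {a3..b3} (\<lambda>z. f (vector [x, y, z]))))"
proof -
  define g where "g = (\<lambda>p::real \<times> real \<times> real. (vector [fst p, fst (snd p), snd (snd p)] :: real^3))"
  define h where "h = (\<lambda>v::real^3. (v$1, v$2, v$3))"
  have hg: "h (g x) = x" for x by (simp add: g_def h_def)
  have gh: "g (h x) = x" for x by (simp add: g_def h_def vec_eq_iff forall_3)
  have vexp: "(vector [a, b, c] :: real^3) = a *\<^sub>R axis 1 1 + b *\<^sub>R axis 2 1 + c *\<^sub>R axis 3 1" for a b c :: real
    by (simp add: vec_eq_iff forall_3 axis_def)
  have contg: "continuous (at x) g" for x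
    unfolding g_def vexp by (intro continuous_intros)
  have hc: "h ` cbox u v = cbox (h u) (h v)" for u v
  proof
    show "h ` cbox u v \<subseteq> cbox (h u) (h v)"
      by (auto simp: h_def mem_box_cart cbox_Pair_iff forall_3)
    show "cbox (h u) (h v) \<subseteq> h ` cbox u v"
    proof
      fix p assume p: "p \<in> cbox (h u) (h v)"
      have "g p \<in> cbox u v" using p by (cases p) (auto simp: h_def g_def mem_box_cart cbox_Pair_iff forall_3)
      then show "p \<in> h ` cbox u v" using hg[of p] by (metis imageI)
    qed
  qed
  have gc: "g ` cbox p q = cbox (g p) (g q)" for p q
  proof -
    have "cbox p q = h ` cbox (g p) (g q)" using hc[of "g p" "g q"] hg by simp
    then show ?thesis using gh by (force simp: image_iff)
  qed
  have cont: "measure lborel (g ` cbox p q) = 1 * measure lborel (cbox p q)" for p q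
  proof -
    obtain p1 p2 p3 q1 q2 q3 where pq: "p = (p1, p2, p3)" "q = (q1, q2, q3)"
      using prod_cases3[of p] prod_cases3[of q] by metis
    have e: "cbox (g p) (g q) \<noteq> {} \<longleftrightarrow> p1 \<le> q1 \<and> p2 \<le> q2 \<and> p3 \<le> q3"
      unfolding pq g_def interval_ne_empty_cart by (simp add: forall_3)
    have "measure lborel (cbox (g p) (g q)) = measure lborel (cbox p q)"
    proof (cases "p1 \<le> q1 \<and> p2 \<le> q2 \<and> p3 \<le> q3")
      case True
      then have "cbox (g p) (g q) \<noteq> {}" using e by blast
      from content_cbox_cart[OF this]
      have "measure lborel (cbox (g p) (g q)) = (q1 - p1) * (q2 - p2) * (q3 - p3)"
        unfolding UNIV_3 by (simp add: pq g_def)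
      then show ?thesis using True by (simp add: pq content_Pair)
    next
      case False
      then have "cbox (g p) (g q) = {}" using e by blast
      then show ?thesis using False by (auto simp: pq content_Pair)
    qed
    then show ?thesis by (simp add: gc)
  qed
  have fi: "f integrable_on cbox (vector [a1, a2, a3]) (vector [b1, b2, b3])"
    using integrable_continuous[OF c] .
  have "((\<lambda>x. f (g x)) has_integral (1 / 1) *\<^sub>R integral (cbox (vector [a1, a2, a3]) (vector [b1, b2, b3])) f)
         (h ` cbox (vector [a1, a2, a3]) (vector [b1, b2, b3]))"
    by (rule has_integral_twiddle[OF zero_less_one hg gh contg _ _ cont integrable_integral[OF fi]])
       (use hc gc in blast)+
  then have "((\<lambda>x. f (g x)) has_integral integral (cbox (vector [a1, a2, a3]) (vector [b1, b2, b3])) f)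
         (cbox (a1, a2, a3) (b1, b2, b3))"
    by (simp add: hc) (simp add: h_def)
  from integral_unique[OF this]
  have 1: "integral (cbox (vector [a1, a2, a3]) (vector [b1, b2, b3])) f
      = integral (cbox (a1, a2, a3) (b1, b2, b3)) (\<lambda>x. f (g x))" by simp
  have cg: "continuous_on (cbox (a1, a2, a3) (b1, b2, b3)) (\<lambda>x. f (g x))"
  proof (rule continuous_on_compose2[OF c])
    show "continuous_on (cbox (a1, a2, a3) (b1, b2, b3)) g"
      using contg continuous_at_imp_continuous_on by blast
    show "g ` cbox (a1, a2, a3) (b1, b2, b3) \<subseteq> cbox (vector [a1, a2, a3]) (vector [b1, b2, b3])"
      by (simp add: gc) (simp add: g_def)
  qed
  have "integral (cbox (a1, a2, a3) (b1, b2, b3)) (\<lambda>x. f (g x))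
     = integral (cbox a1 b1) (\<lambda>x. integral (cbox (a2, a3) (b2, b3)) (\<lambda>y. f (g (x, y))))"
    by (rule integral_prod_continuous[OF cg])
  also have "\<dots> = integral (cbox a1 b1) (\<lambda>x. integral (cbox a2 b2) (\<lambda>y. integral (cbox a3 b3) (\<lambda>z. f (g (x, y, z)))))"
  proof (rule integral_cong)
    fix x assume x: "x \<in> cbox a1 b1"
    show "integral (cbox (a2, a3) (b2, b3)) (\<lambda>y. f (g (x, y)))
        = integral (cbox a2 b2) (\<lambda>y. integral (cbox a3 b3) (\<lambda>z. f (g (x, y, z))))"
      by (rule integral_prod_continuous[where f="\<lambda>y. f (g (x, y))"])
         (use x in \<open>auto intro!: continuous_on_compose2[OF cg] continuous_intros simp: cbox_Pair_eq\<close>)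
  qed
  finally show ?thesis using 1 by (simp add: g_def)
qed

section \<open>Spherical coordinates\<close>

definition sph :: "real \<Rightarrow> real \<Rightarrow> real^3" where
  "sph \<theta> \<phi> = vector [sin \<theta> * cos \<phi>, sin \<theta> * sin \<phi>, cos \<theta>]"

lemma sph_eq: "sph \<theta> \<phi> = (sin \<theta> * cos \<phi>) *\<^sub>R axis 1 1 + (sin \<theta> * sin \<phi>) *\<^sub>R axis 2 1 + cos \<theta> *\<^sub>R axis 3 1"
  by (simp add: sph_def vec_eq_iff forall_3 axis_def)

lemma norm_sph [simp]: "norm (sph \<theta> \<phi>) = 1"
proof -
  have "(sin \<theta> * cos \<phi>)^2 + (sin \<theta> * sin \<phi>)^2 + (cos \<theta>)^2
      = (sin \<theta>)^2 * ((cos \<phi>)^2 + (sin \<phi>)^2) + (cos \<theta>)^2"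
    by (simp only: power_mult_distrib distrib_left)
  also have "\<dots> = 1" by simp
  finally show ?thesis
    unfolding norm_eq_1 inner_vec_def sum_3 sph_def power2_eq_square by simp
qed

lemma sph_inj:
  assumes "sph \<theta> \<phi> = sph \<theta>' \<phi>'" "0 < \<theta>" "\<theta> < pi" "0 < \<theta>'" "\<theta>' < pi"
    "0 < \<phi>" "\<phi> < 2 * pi" "0 < \<phi>'" "\<phi>' < 2 * pi"
  shows "\<theta> = \<theta>' \<and> \<phi> = \<phi>'"
proof -
  have e: "sin \<theta> * cos \<phi> = sin \<theta>' * cos \<phi>'" "sin \<theta> * sin \<phi> = sin \<theta>' * sin \<phi>'" "cos \<theta> = cos \<theta>'"
    using assms(1) by (simp_all add: sph_def vec_eq_iff forall_3)
  have t: "\<theta> = \<theta>'" using e(3) assms by (auto intro: cos_inj_pi)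
  have "sin \<theta> > 0" using assms by (simp add: sin_gt_zero)
  then have "cos \<phi> = cos \<phi>'" "sin \<phi> = sin \<phi>'" using e t by auto
  then obtain n :: int where n: "\<phi> = \<phi>' + 2 * pi * n" using sin_cos_eq_iff by metis
  have "2 * pi * n < 2 * pi * 1" "2 * pi * (-1) < 2 * pi * n" using n assms(6-9) by linarith+
  then have "real_of_int n < 1" "-1 < real_of_int n"
    using mult_less_cancel_left_pos[of "2 * pi"] pi_gt_zero by (metis mult_2 add_pos_pos)+
  then have n0: "n = 0" by linarith
  have "\<phi> = \<phi>'" using n unfolding n0 by simp
  with t show ?thesis by blast
qed

text \<open>The excluded closed half circle contains the poles and the points of azimuth zero. It
  lies in a plane, hence will be negligible.\<close>

lemma sph_surj:
  fixes z :: "real^3"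
  assumes "norm z = 1" "\<not> (z$2 = 0 \<and> z$1 \<ge> 0)"
  obtains \<theta> \<phi> where "0 < \<theta>" "\<theta> < pi" "0 < \<phi>" "\<phi> < 2 * pi" "z = sph \<theta> \<phi>"
proof -
  have n: "(z$1)^2 + (z$2)^2 + (z$3)^2 = 1"
    using assms(1) by (simp add: norm_eq_1 inner_vec_def sum_3 power2_eq_square)
  have pos: "(z$1)^2 + (z$2)^2 > 0"
    using assms(2) by (auto simp: sum_power2_gt_zero_iff)
  then have z3: "(z$3)^2 < 1" using n by linarith
  then have z3': "-1 < z$3" "z$3 < 1" by (auto simp: abs_square_less_1 abs_less_iff)
  define \<theta> where "\<theta> = arccos (z$3)"
  have th: "0 < \<theta>" "\<theta> < pi" "cos \<theta> = z$3"
    using z3' arccos_lt_bounded[of "z$3"] by (auto simp: \<theta>_def)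
  have s: "sin \<theta> > 0" using th by (simp add: sin_gt_zero)
  have s2: "(sin \<theta>)^2 = (z$1)^2 + (z$2)^2"
    using n sin_cos_squared_add[of \<theta>] th(3) by simp
  have "(z$1 / sin \<theta>)^2 + (z$2 / sin \<theta>)^2 = 1"
    unfolding power_divide s2 add_divide_distrib[symmetric] using pos by (metis divide_self less_irrefl)
  then obtain \<phi> where ph: "0 \<le> \<phi>" "\<phi> < 2 * pi" "z$1 / sin \<theta> = cos \<phi>" "z$2 / sin \<theta> = sin \<phi>"
    using sincos_total_2pi by blast
  have e: "z$1 = sin \<theta> * cos \<phi>" "z$2 = sin \<theta> * sin \<phi>" using ph s by (auto simp: field_simps)
  have "\<phi> \<noteq> 0" using e assms(2) s by auto
  then show ?thesis using that[of \<theta> \<phi>] ph th e by (simp add: sph_def vec_eq_iff forall_3)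
qed

text \<open>The radial coordinate \<open>v $ 1\<close> is chosen such that \<open>(norm (x - c))^2 = R^2 + e + e * v $ 1\<close>.\<close>

lemma shell_integral:
  fixes f :: "real^3 \<Rightarrow> real^3" and c :: "real^3"
  assumes R: "R > 0" and e: "e > 0" "4 * e \<le> 3 * R^2"
    and cf: "continuous_on {x. R \<le> dist c x \<and> dist c x \<le> 2 * R} f"
  shows "(\<integral>x. indicator {x. R \<le> dist c x \<and> dist c x \<le> 2 * R} x *\<^sub>R
            ((2 / e * cubic_step' (((norm (x - c))^2 - R^2 - e) / e)) *\<^sub>R f x) \<partial>lborel) =
    integral (cbox (vector [0,0,0]) (vector [3,pi,2*pi]))
      (\<lambda>v::real^3. (cubic_step' (v$1) * sqrt (R^2 + e + e * v$1) * sin (v$2)) *\<^sub>R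
          f (c + sqrt (R^2 + e + e * v$1) *\<^sub>R sph (v$2) (v$3)))"
proof -
  define A where "A = {x. R \<le> dist c x \<and> dist c x \<le> 2 * R}"
  define w where "w x = 2 / e * cubic_step' (((norm (x - c))^2 - R^2 - e) / e)" for x :: "real^3"
  define F where "F x = indicator A x *\<^sub>R (w x *\<^sub>R f x)" for x
  define r where "r t = sqrt (R^2 + e + e * t)" for t
  define g where "g v = c + r (v$1) *\<^sub>R sph (v$2) (v$3)" for v :: "real^3"
  define S where "S = box (vector [0,0,0] :: real^3) (vector [3,pi,2*pi])"
  define H where "H v = (cubic_step' (v$1) * r (v$1) * sin (v$2)) *\<^sub>R f (g v)" for v
  have inS: "v \<in> S \<longleftrightarrow> 0 < v$1 \<and> v$1 < 3 \<and> 0 < v$2 \<and> v$2 < pi \<and> 0 < v$3 \<and> v$3 < 2 * pi" for v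
    by (auto simp: S_def mem_box_cart forall_3)
  have rpos: "r t > 0" if "t \<ge> 0" for t
    using R e that by (simp add: r_def add_pos_nonneg)
  have r2: "(r t)^2 = R^2 + e + e * t" if "t \<ge> 0" for t
    using R e that by (simp add: r_def)
  \<comment> \<open>The largest squared radius is R^2 + e + 3 e, and 4 e is at most 3 R^2; so the
    shell stays within radius 2 R.\<close>
  have rA: "R \<le> r t \<and> r t \<le> 2 * R" if "0 \<le> t" "t \<le> 3" for t
  proof
    have "e * t \<le> e * 3" using that e by (intro mult_left_mono) auto
    moreover have "(2 * R)^2 = 4 * R^2" by (simp add: power_mult_distrib)
    ultimately have u: "R^2 + e + e * t \<le> (2 * R)^2" using e by linarith
    have l: "R^2 \<le> R^2 + e + e * t" using e that by simp
    show "R \<le> r t" unfolding r_def by (rule real_le_rsqrt[OF l])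
    show "r t \<le> 2 * R" unfolding r_def by (rule real_le_lsqrt) (use u l R in \<open>auto intro: order_trans[OF zero_le_power2]\<close>)
  qed
  have gA: "g v \<in> A" if "0 \<le> v$1" "v$1 \<le> 3" for v
    using rA[OF that] R by (simp add: g_def A_def dist_norm)
  have wg: "w (g v) = 2 / e * cubic_step' (v$1)" if "0 \<le> v$1" for v
  proof -
    have "(norm (g v - c))^2 = R^2 + e + e * v$1"
      using r2[OF that] by (simp add: g_def)
    then show ?thesis using e by (simp add: w_def)
  qed
  define g' where "g' v h = (e * h$1 / (2 * r (v$1))) *\<^sub>R sph (v$2) (v$3) +
     r (v$1) *\<^sub>R ((cos (v$2) * cos (v$3) * h$2 - sin (v$2) * sin (v$3) * h$3) *\<^sub>R axis 1 1 +
      (cos (v$2) * sin (v$3) * h$2 + sin (v$2) * cos (v$3) * h$3) *\<^sub>R axis 2 1 - (sin (v$2) * h$2) *\<^sub>R axis 3 1)"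
     for v h :: "real^3"
  have dr: "((\<lambda>v. r (v$1)) has_derivative (\<lambda>h. e * h$1 / (2 * r (v$1)))) (at v within S)" if "v \<in> S" for v :: "real^3"
  proof -
    have p: "R^2 + e + e * v$1 > 0" using R e that[unfolded inS] by (simp add: add_pos_pos)
    show ?thesis unfolding r_def
      by (rule derivative_eq_intros refl p bounded_linear.has_derivative[OF bounded_linear_vec_nth])+
         (use p in \<open>auto simp: field_simps\<close>)
  qed
  have dg: "(g has_derivative g' v) (at v within S)" if v: "v \<in> S" for v
    unfolding g_def[abs_def] g'_def[abs_def] sph_eq
    by (rule derivative_eq_intros refl dr[OF v] bounded_linear.has_derivative[OF bounded_linear_vec_nth])+
       (auto simp: fun_eq_iff vec_eq_iff forall_3 axis_def algebra_simps)
  \<comment> \<open>The usual Jacobian r^2 sin \<theta> times dr/dt = e / (2 r). The factor e / 2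
    cancels the weight 2 / e of the shell.\<close>
  have det: "\<bar>det (matrix (g' v))\<bar> = e / 2 * r (v$1) * sin (v$2)" if v: "v \<in> S" for v
  proof -
    have rp: "r (v$1) > 0" using rpos v inS by auto
    have sp: "sin (v$2) > 0" using v inS by (auto intro: sin_gt_zero)
    define s1 c1 s2 c2 \<rho> where "s1 = sin (v$2)" and "c1 = cos (v$2)" and "s2 = sin (v$3)" and "c2 = cos (v$3)" and "\<rho> = r (v$1)"
    have t1: "s1 * s1 + c1 * c1 = 1" "s2 * s2 + c2 * c2 = 1"
      using sin_cos_squared_add[of "v$2"] sin_cos_squared_add[of "v$3"]
      by (auto simp: s1_def c1_def s2_def c2_def power2_eq_square)
    have "\<rho> \<noteq> 0" using rp by (simp add: \<rho>_def)
    have "det (matrix (g' v)) = (s1 * s1 + c1 * c1) * (s2 * s2 + c2 * c2) * (e / 2 * \<rho> * s1)"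
      unfolding det_3 matrix_def g'_def using \<open>\<rho> \<noteq> 0\<close>
      by (simp add: axis_def sph_def flip: s1_def c1_def s2_def c2_def \<rho>_def) (simp add: algebra_simps)
    also have "\<dots> = e / 2 * \<rho> * s1" unfolding t1 by simp
    finally have dd: "det (matrix (g' v)) = e / 2 * r (v$1) * sin (v$2)" by (simp add: \<rho>_def s1_def)
    show ?thesis unfolding dd by (rule abs_of_nonneg) (use rp sp e in simp)
  qed
  have inj: "inj_on g S"
  proof (rule inj_onI)
    fix v v' assume v: "v \<in> S" "v' \<in> S" "g v = g v'"
    have p: "r (v$1) > 0" "r (v'$1) > 0" "0 \<le> v$1" "0 \<le> v'$1" using v inS rpos by auto
    have eq: "r (v$1) *\<^sub>R sph (v$2) (v$3) = r (v'$1) *\<^sub>R sph (v'$2) (v'$3)" using v by (simp add: g_def)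
    from arg_cong[OF this, of norm] have rr: "r (v$1) = r (v'$1)" using p by simp
    then have "R^2 + e + e * v$1 = R^2 + e + e * v'$1" using r2[OF p(3)] r2[OF p(4)] by metis
    then have 1: "v$1 = v'$1" using e by auto
    have "sph (v$2) (v$3) = sph (v'$2) (v'$3)" using eq rr p by simp
    then have "v$2 = v'$2 \<and> v$3 = v'$3" using v inS by (intro sph_inj) auto
    then show "v = v'" using 1 by (simp add: vec_eq_iff forall_3)
  qed
  have HS: "continuous_on (cbox (vector [0,0,0]) (vector [3,pi,2*pi])) H"
  proof -
    have cr: "continuous_on X (\<lambda>v::real^3. r (v$1))" for X
      unfolding r_def by (intro continuous_intros)
    have cg: "continuous_on X g" for X
      unfolding g_def[abs_def] sph_eq by (intro continuous_intros cr)
    show ?thesis unfolding H_def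
      by (intro continuous_intros cr continuous_on_compose2[OF cf cg])
         (use gA in \<open>auto simp: A_def mem_box_cart forall_3\<close>)
  qed
  have eqH: "\<bar>det (matrix (g' v))\<bar> *\<^sub>R F (g v) = H v" if v: "v \<in> S" for v
  proof -
    have "0 \<le> v$1" "v$1 \<le> 3" using v inS by auto
    then show ?thesis using gA[of v] wg[of v] e
      by (simp add: det[OF v] F_def H_def)
  qed
  have "H absolutely_integrable_on cbox (vector [0,0,0]) (vector [3,pi,2*pi])"
    by (rule absolutely_integrable_continuous[OF HS])
  then have HSi: "H absolutely_integrable_on S"
    by (rule set_integrable_subset) (auto simp: S_def box_subset_cbox)
  have "(\<lambda>v. \<bar>det (matrix (g' v))\<bar> *\<^sub>R F (g v)) absolutely_integrable_on S \<longleftrightarrow> H absolutely_integrable_on S"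
    by (rule set_integrable_cong[OF refl refl eqH])
  with HSi have "(\<lambda>v. \<bar>det (matrix (g' v))\<bar> *\<^sub>R F (g v)) absolutely_integrable_on S" by blast
  moreover have "S \<in> sets lebesgue" unfolding S_def by simp
  ultimately have "integral (g ` S) F = integral S (\<lambda>v. \<bar>det (matrix (g' v))\<bar> *\<^sub>R F (g v))"
    using has_absolute_integral_change_of_variables[OF _ dg inj] by blast
  also have "\<dots> = integral S H" by (rule integral_cong) (rule eqH)
  also have "\<dots> = integral (cbox (vector [0,0,0]) (vector [3,pi,2*pi])) H"
    unfolding S_def by (rule integral_open_interval)
  finally have 1: "integral (g ` S) F = integral (cbox (vector [0,0,0]) (vector [3,pi,2*pi])) H" .
  \<comment> \<open>The part of the support missed by the coordinates lies in a plane through the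
    centre.\<close>
  have "integral (g ` S) F = integral UNIV F"
  proof (rule integral_spike_set)
    have "{x \<in> UNIV - g ` S. F x \<noteq> 0} \<subseteq> {x. x \<bullet> axis 2 1 = c$2}"
    proof
      fix x assume x: "x \<in> {x \<in> UNIV - g ` S. F x \<noteq> 0}"
      then have "w x \<noteq> 0" by (auto simp: F_def)
      define t where "t = ((norm (x - c))^2 - R^2 - e) / e"
      have t: "0 < t" "t < 3" using \<open>w x \<noteq> 0\<close> cubic_step'_eq_0[of t] by (auto simp: w_def t_def[symmetric] not_le[symmetric])
      have nt: "(norm (x - c))^2 = R^2 + e + e * t" using e by (simp add: t_def field_simps)
      have nr: "norm (x - c) = r t" unfolding r_def nt[symmetric] by simp
      have rt: "r t > 0" using rpos t by auto
      define z where "z = (1 / r t) *\<^sub>R (x - c)"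
      have z: "norm z = 1" using nr rt by (simp add: z_def)
      have xz: "x = c + r t *\<^sub>R z" using rt by (simp add: z_def)
      have "z$2 = 0"
      proof (rule ccontr)
        assume "z$2 \<noteq> 0"
        then obtain \<theta> \<phi> where a: "0 < \<theta>" "\<theta> < pi" "0 < \<phi>" "\<phi> < 2 * pi" "z = sph \<theta> \<phi>"
          using sph_surj[OF z] by blast
        have "x = g (vector [t, \<theta>, \<phi>])" using a xz by (simp add: g_def)
        moreover have "vector [t, \<theta>, \<phi>] \<in> S" using a t by (simp add: inS)
        ultimately show False using x by blast
      qed
      then show "x \<in> {x. x \<bullet> axis 2 1 = c$2}" using xz by (simp add: inner_axis)
    qed
    then show "negligible {x \<in> UNIV - g ` S. F x \<noteq> 0}"
      by (rule negligible_subset[OF negligible_standard_hyperplane, rotated]) simp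
  qed simp
  moreover have "integrable lborel F"
    unfolding F_def
  proof (rule borel_integrable_compact)
    have "A = cball c (2 * R) - ball c R" by (auto simp: A_def)
    then show "compact A" by (simp add: compact_diff)
    show "continuous_on A (\<lambda>x. w x *\<^sub>R f x)"
      unfolding w_def using cf e by (intro continuous_intros) (auto simp: A_def)
  qed
  ultimately have "(\<integral>x. F x \<partial>lborel) = integral (cbox (vector [0,0,0]) (vector [3,pi,2*pi])) H"
    using 1 integral_lborel[of F] by simp
  then show ?thesis unfolding F_def w_def A_def H_def g_def r_def .
qed

lemma cubic_step'_has_integral: "(cubic_step' has_integral 1) {0..3}"
  using fundamental_theorem_of_calculus[of 0 3 cubic_step cubic_step']
    cubic_step_deriv[THEN has_field_derivative_at_within]
  by (simp add: has_real_derivative_iff_has_vector_derivative cubic_step_eq_0 cubic_step_eq_1)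

text \<open>In the coordinates of \<open>shell_integral\<close> the domain is a fixed box, so
  dominated convergence applies while the radius tends to R, and the integral over
  \<open>v $ 1\<close> is that of \<open>cubic_step'\<close>, which is one. The factor 1 / R appears
  because the coordinate is affine in the squared distance: the density is r sin \<theta> instead of
  r^2 sin \<theta>.\<close>

lemma shell_limit:
  fixes f :: "real^3 \<Rightarrow> real^3" and c :: "real^3"
  assumes R: "R > 0" and e: "\<And>n. e n > 0" "\<And>n. 4 * e n \<le> 3 * R^2" "e \<longlonglongrightarrow> 0"
    and cf: "continuous_on {x. R \<le> dist c x \<and> dist c x \<le> 2 * R} f"
  shows "(\<lambda>n. \<integral>x. indicator {x. R \<le> dist c x \<and> dist c x \<le> 2 * R} x *\<^sub>R
            ((2 / e n * cubic_step' (((norm (x - c))^2 - R^2 - e n) / e n)) *\<^sub>R f x) \<partial>lborel)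
     \<longlonglongrightarrow> (1 / R) *\<^sub>R sphere_integral c R f"
proof -
  define A where "A = {x. R \<le> dist c x \<and> dist c x \<le> 2 * R}"
  define Q where "Q = cbox (vector [0,0,0] :: real^3) (vector [3,pi,2*pi])"
  define r where "r n t = sqrt (R^2 + e n + e n * t)" for n t
  define H where "H n v = (cubic_step' (v$1) * r n (v$1) * sin (v$2)) *\<^sub>R
          f (c + r n (v$1) *\<^sub>R sph (v$2) (v$3))" for n and v :: "real^3"
  define H0 where "H0 v = (cubic_step' (v$1) * R * sin (v$2)) *\<^sub>R f (c + R *\<^sub>R sph (v$2) (v$3))" for v :: "real^3"
  have rA: "R \<le> r n t \<and> r n t \<le> 2 * R" if "0 \<le> t" "t \<le> 3" for n t
  proof
    have "e n * t \<le> e n * 3" using that e(1)[of n] by (intro mult_left_mono) auto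
    moreover have "(2 * R)^2 = 4 * R^2" by (simp add: power_mult_distrib)
    ultimately have u: "R^2 + e n + e n * t \<le> (2 * R)^2" using e(2)[of n] by linarith
    have l: "R^2 \<le> R^2 + e n + e n * t" using e(1)[of n] that by simp
    show "R \<le> r n t" unfolding r_def by (rule real_le_rsqrt[OF l])
    show "r n t \<le> 2 * R" unfolding r_def by (rule real_le_lsqrt) (use u l R in \<open>auto intro: order_trans[OF zero_le_power2]\<close>)
  qed
  have inA: "c + \<rho> *\<^sub>R sph \<theta> \<phi> \<in> A" if "R \<le> \<rho>" "\<rho> \<le> 2 * R" for \<rho> \<theta> \<phi>
    using that R by (simp add: A_def dist_norm)
  have inQ: "0 \<le> v$1 \<and> v$1 \<le> 3" if "v \<in> Q" for v using that by (auto simp: Q_def mem_box_cart forall_3)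
  have cfA: "continuous_on A f" using cf by (simp add: A_def)
  have "A = cball c (2 * R) - ball c R" by (auto simp: A_def)
  then have "compact A" by (simp add: compact_diff)
  then have "bounded (f ` A)" using cfA compact_continuous_image compact_imp_bounded by blast
  then obtain B where B: "\<forall>x\<in>A. norm (f x) \<le> B" by (auto simp: bounded_iff)
  have cH: "continuous_on Q (H n)" for n
    unfolding H_def r_def sph_eq
    by (intro continuous_intros continuous_on_compose2[OF cfA])
       (use inA inQ rA[unfolded r_def] in \<open>auto simp: sph_eq[symmetric]\<close>)
  have cH0: "continuous_on Q H0"
    unfolding H0_def sph_eq
    by (intro continuous_intros continuous_on_compose2[OF cfA])
       (use inA[of R] R in \<open>auto simp: sph_eq[symmetric]\<close>)
  have "(\<lambda>n. integral Q (H n)) \<longlonglongrightarrow> integral Q H0"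
  proof (rule dominated_convergence(2))
    show "H n integrable_on Q" for n unfolding Q_def by (rule integrable_continuous) (use cH Q_def in auto)
    show "(\<lambda>_. 2 * R * B) integrable_on Q" unfolding Q_def by (rule integrable_const)
    show "norm (H n v) \<le> 2 * R * B" if v: "v \<in> Q" for n v
    proof -
      have r: "R \<le> r n (v$1)" "r n (v$1) \<le> 2 * R" using rA inQ[OF v] by auto
      have "\<bar>cubic_step' (v$1) * r n (v$1) * sin (v$2)\<bar> \<le> 1 * (2 * R) * 1"
        unfolding abs_mult using r R cubic_step'_bounds[of "v$1"] by (intro mult_mono) auto
      moreover have "norm (f (c + r n (v$1) *\<^sub>R sph (v$2) (v$3))) \<le> B" using B inA r by blast
      ultimately show ?thesis unfolding H_def norm_scaleR using R by (intro mult_mono) auto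
    qed
    show "(\<lambda>n. H n v) \<longlonglongrightarrow> H0 v" if v: "v \<in> Q" for v
    proof -
      have "(\<lambda>n. r n (v$1)) \<longlonglongrightarrow> sqrt (R^2 + 0 + 0 * v$1)"
        unfolding r_def by (intro tendsto_intros e(3))
      then have rl: "(\<lambda>n. r n (v$1)) \<longlonglongrightarrow> R" using R by simp
      show ?thesis unfolding H_def H0_def
      proof (intro tendsto_intros rl)
        show "(\<lambda>n. f (c + r n (v$1) *\<^sub>R sph (v$2) (v$3))) \<longlonglongrightarrow> f (c + R *\<^sub>R sph (v$2) (v$3))"
          by (rule continuous_on_tendsto_compose[OF cfA])
             (use inA rA inQ[OF v] R in \<open>auto intro!: tendsto_intros rl\<close>)
      qed
    qed
  qed
  moreover have "integral Q H0 = (1 / R) *\<^sub>R sphere_integral c R f"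
  proof -
    have eq: "(cubic_step' x * R * sin y) *\<^sub>R w = (cubic_step' x / R) *\<^sub>R ((R^2 * sin y) *\<^sub>R w)"
      for x y and w :: "real^3" using R by (simp add: power2_eq_square)
    have "integral Q H0 = integral {0..3} (\<lambda>x. (cubic_step' x / R) *\<^sub>R sphere_integral c R f)"
      unfolding Q_def integral_vec3[OF cH0[unfolded Q_def]]
      unfolding H0_def sphere_integral_def sph_def[symmetric] by (simp only: vector_3 eq integral_cmul)
    also have "\<dots> = (1 / R) *\<^sub>R sphere_integral c R f"
      by (rule integral_unique has_integral_scaleR_left has_integral_divide cubic_step'_has_integral)+
    finally show ?thesis .
  qed
  ultimately show ?thesis
    using shell_integral[OF R e(1,2) cf] by (simp add: H_def[abs_def] r_def Q_def)
qed

text \<open>The tensor applied to the outer unit normal of the ball, extended to all points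
  \<open>x\<close> by a linear formula.\<close>

definition traction :: "(3 \<Rightarrow> real^3 \<Rightarrow> real^3) \<Rightarrow> real^3 \<Rightarrow> real \<Rightarrow> real^3 \<Rightarrow> real^3" where
  "traction T c R x = (1 / R) *\<^sub>R (\<Sum>k\<in>UNIV. (x - c) $ k *\<^sub>R T k x)"

lemma sphere_integral_scaleR:
  "sphere_integral c R (\<lambda>x. a *\<^sub>R f x) = a *\<^sub>R sphere_integral c R f"
proof -
  have "(R^2 * sin \<theta>) *\<^sub>R a *\<^sub>R w = a *\<^sub>R ((R^2 * sin \<theta>) *\<^sub>R w)" for \<theta> and w :: "real^3"
    by simp
  then show ?thesis unfolding sphere_integral_def by (simp only: integral_cmul)
qed

lemma sphere_integral_cong:
  assumes "R > 0" "\<And>x. x \<in> sphere c R \<Longrightarrow> f x = g x"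
  shows "sphere_integral c R f = sphere_integral c R g"
proof -
  have "c + R *\<^sub>R sph \<theta> \<phi> \<in> sphere c R" for \<theta> \<phi> using assms(1) by (simp add: dist_norm)
  then have "f (c + R *\<^sub>R sph \<theta> \<phi>) = g (c + R *\<^sub>R sph \<theta> \<phi>)" for \<theta> \<phi> using assms(2) by blast
  then show ?thesis unfolding sphere_integral_def sph_def[symmetric] by simp
qed

lemma sphere_integral_zero: "sphere_integral c R (\<lambda>x. 0) = 0"
  by (simp add: sphere_integral_def)

section \<open>The divergence theorem outside the balls\<close>

text \<open>A function of the squared distance, hence differentiable at the centre too; the
  transition takes place between the squared radii \<open>s\<close> and
  \<open>s + 3 * d\<close>.\<close>

definition cut :: "real^3 \<Rightarrow> real \<Rightarrow> real \<Rightarrow> real^3 \<Rightarrow> real" where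
  "cut c s d x = 1 - cubic_step (((norm (x - c))^2 - s) / d)"

definition dcut :: "real^3 \<Rightarrow> real \<Rightarrow> real \<Rightarrow> 3 \<Rightarrow> real^3 \<Rightarrow> real" where
  "dcut c s d k x = - cubic_step' (((norm (x - c))^2 - s) / d) * (2 * (x - c) $ k / d)"

lemma has_derivative_norm2:
  "((\<lambda>x. ((norm (x - c))^2 - s) / d) has_derivative (\<lambda>h. 2 * ((x - c) \<bullet> h) / d)) (at (x::'a::real_inner))"
proof -
  have 1: "((\<lambda>x. x - c) has_derivative (\<lambda>h. h)) (at x)" by (auto intro!: derivative_eq_intros)
  have 2: "((\<lambda>x. ((x - c) \<bullet> (x - c) - s) / d) has_derivative
      (\<lambda>h. ((x - c) \<bullet> h + h \<bullet> (x - c) - 0) / d)) (at x)"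
    by (intro bounded_linear.has_derivative[OF bounded_linear_divide] has_derivative_diff has_derivative_const
        has_derivative_inner 1)
  have 4: "(\<lambda>h. ((x - c) \<bullet> h + h \<bullet> (x - c) - 0) / d) = (\<lambda>h. 2 * ((x - c) \<bullet> h) / d)"
    by (rule ext) (simp add: inner_commute)
  show ?thesis using 2 unfolding power2_norm_eq_inner 4 .
qed

lemma has_partials_cut: "has_partials (cut c s d) (dcut c s d) S"
proof (rule has_partialsI)
  fix x :: "real^3"
  show "(cut c s d has_derivative (\<lambda>h. 0 - (2 * ((x - c) \<bullet> h) / d) * cubic_step' (((norm (x - c))^2 - s) / d))) (at x)"
    unfolding cut_def[abs_def]
    by (intro has_derivative_diff has_derivative_const has_derivative_cubic_step(1) has_derivative_norm2)
  show "dcut c s d k x = 0 - (2 * ((x - c) \<bullet> axis k 1) / d) * cubic_step' (((norm (x - c))^2 - s) / d)" for k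
    unfolding dcut_def by (simp add: inner_axis)
qed

lemma continuous_cut: "d \<noteq> 0 \<Longrightarrow> continuous_on S (cut c s d)"
  and continuous_dcut: "d \<noteq> 0 \<Longrightarrow> continuous_on S (dcut c s d k)"
  unfolding cut_def dcut_def by (intro continuous_intros; simp)+

lemma cut_bounds: "0 \<le> cut c s d x" "cut c s d x \<le> 1"
  using cubic_step_bounds by (auto simp: cut_def)

lemma cut_eq_1: "d > 0 \<Longrightarrow> (norm (x - c))^2 \<le> s \<Longrightarrow> cut c s d x = 1"
  unfolding cut_def by (simp add: cubic_step_eq_0 divide_nonpos_pos)

lemma cut_eq_0: "d > 0 \<Longrightarrow> (norm (x - c))^2 \<ge> s + 3 * d \<Longrightarrow> cut c s d x = 0"
  unfolding cut_def by (simp add: cubic_step_eq_1 pos_le_divide_eq)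

lemma dcut_eq_0:
  assumes "d > 0" "(norm (x - c))^2 \<le> s \<or> (norm (x - c))^2 \<ge> s + 3 * d"
  shows "dcut c s d k x = 0"
proof -
  have "((norm (x - c))^2 - s) / d \<le> 0 \<or> ((norm (x - c))^2 - s) / d \<ge> 3"
    using assms by (auto simp: pos_le_divide_eq divide_nonpos_pos)
  then show ?thesis unfolding dcut_def by (simp add: cubic_step'_eq_0)
qed

lemma abs_dcut_le:
  assumes "d > 0" "s + 3 * d \<le> r^2" "r \<ge> 0"
  shows "\<bar>dcut c s d k x\<bar> \<le> 2 * r / d"
proof (cases "(norm (x - c))^2 \<ge> s + 3 * d")
  case True
  then show ?thesis using assms by (simp add: dcut_eq_0)
next
  case False
  then have "(norm (x - c))^2 \<le> r^2" using assms(2) by linarith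
  then have "norm (x - c) \<le> r" using assms(3) by (rule power2_le_imp_le)
  then have "\<bar>(x - c) $ k\<bar> \<le> r" using component_le_norm_cart[of "x - c" k] by linarith
  then have "\<bar>2 * (x - c) $ k / d\<bar> \<le> 2 * r / d" using assms(1) by (simp add: divide_right_mono abs_mult)
  moreover have "\<bar>cubic_step' (((norm (x - c))^2 - s) / d)\<bar> \<le> 1"
    using cubic_step'_bounds[of "((norm (x - c))^2 - s) / d"] by linarith
  ultimately have "\<bar>cubic_step' (((norm (x - c))^2 - s) / d)\<bar> * \<bar>2 * (x - c) $ k / d\<bar> \<le> 1 * (2 * r / d)"
    by (intro mult_mono) auto
  then show ?thesis unfolding dcut_def abs_mult by simp
qed

text \<open>The squared radii n^2 and n^2 + 3 n^2 place the transition between n and 2 n, where the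
  gradient is of order 1 / n.\<close>

definition bigcut :: "nat \<Rightarrow> real^3 \<Rightarrow> real" where "bigcut n = cut 0 ((real n)^2) ((real n)^2)"
definition dbigcut :: "nat \<Rightarrow> 3 \<Rightarrow> real^3 \<Rightarrow> real" where "dbigcut n = dcut 0 ((real n)^2) ((real n)^2)"

lemma bigcut_partials: "has_partials (bigcut n) (dbigcut n) S"
  unfolding bigcut_def dbigcut_def by (rule has_partials_cut)

lemma bigcut_close: "\<bar>1 - bigcut n x\<bar> \<le> 1"
  using cut_bounds[of 0 "(real n)^2" "(real n)^2" x] unfolding bigcut_def by linarith

lemma bigcut_facts:
  assumes "n \<ge> 1"
  shows "norm x \<le> real n \<Longrightarrow> bigcut n x = 1"
    and "2 * real n \<le> norm x \<Longrightarrow> bigcut n x = 0"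
    and "norm x \<le> real n \<or> 2 * real n \<le> norm x \<Longrightarrow> dbigcut n k x = 0"
    and "\<bar>dbigcut n k x\<bar> \<le> 4 / real n"
    and "continuous_on S (bigcut n)" and "continuous_on S (dbigcut n k)"
proof -
  have p: "0 < (real n)^2" using assms by simp
  have 1: "(norm (x - 0))^2 \<le> (real n)^2" if "norm x \<le> real n" using that by (intro power_mono) auto
  have 2: "(norm (x - 0))^2 \<ge> (real n)^2 + 3 * (real n)^2" if "2 * real n \<le> norm x"
    using power_mono[OF that, of 2] by (simp add: power_mult_distrib)
  show "norm x \<le> real n \<Longrightarrow> bigcut n x = 1" using cut_eq_1[OF p 1] by (simp add: bigcut_def)
  show "2 * real n \<le> norm x \<Longrightarrow> bigcut n x = 0" using cut_eq_0[OF p 2] by (simp add: bigcut_def)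
  show "norm x \<le> real n \<or> 2 * real n \<le> norm x \<Longrightarrow> dbigcut n k x = 0"
    unfolding dbigcut_def by (rule dcut_eq_0[OF p]) (use 1 2 in blast)
  have "\<bar>dbigcut n k x\<bar> \<le> 2 * (2 * real n) / (real n)^2"
    unfolding dbigcut_def by (rule abs_dcut_le[OF p]) (auto simp: power_mult_distrib)
  also have "\<dots> = 4 / real n" using assms by (simp add: power2_eq_square)
  finally show "\<bar>dbigcut n k x\<bar> \<le> 4 / real n" .
  show "continuous_on S (bigcut n)" "continuous_on S (dbigcut n k)"
    unfolding bigcut_def dbigcut_def using p by (intro continuous_cut continuous_dcut; simp)+
qed

text \<open>The factor 16 makes the balls of radius 4 R around the centres disjoint with a wide
  margin: a point of one of them is at least 12 R away from all other centres. Cutoffs and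
  correctors live in these balls.\<close>

locale separated_balls =
  fixes N :: nat and R :: real and X :: "nat \<Rightarrow> real^3"
  assumes R_pos: "R > 0"
    and sep: "\<And>i j. i < N \<Longrightarrow> j < N \<Longrightarrow> i \<noteq> j \<Longrightarrow> 16 * R \<le> dist (X i) (X j)"
begin

abbreviation "U \<equiv> fluid N R X"
abbreviation "D \<equiv> fluid_closed N R X"

definition annulus :: "nat \<Rightarrow> (real^3) set" where
  "annulus i = {x. R \<le> dist (X i) x \<and> dist (X i) x \<le> 2 * R}"

lemma in_U: "x \<in> U \<longleftrightarrow> (\<forall>i<N. R < dist (X i) x)"
  and in_D: "x \<in> D \<longleftrightarrow> (\<forall>i<N. R \<le> dist (X i) x)"
  by (auto simp: fluid_def fluid_closed_def not_le not_less)

lemma open_U: "open U" and closed_D: "closed D" and U_subset_D: "U \<subseteq> D"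
proof -
  show "open U" unfolding fluid_def by (rule open_Compl, rule closed_UN) auto
  show "closed D" unfolding fluid_closed_def by (rule closed_Compl, rule open_UN) auto
  show "U \<subseteq> D" by (metis in_U in_D less_imp_le subsetI)
qed

lemma far_from_others:
  assumes "i < N" "j < N" "i \<noteq> j" "dist (X i) x \<le> 4 * R"
  shows "12 * R \<le> dist (X j) x"
proof -
  have "dist (X i) (X j) \<le> dist (X i) x + dist (X j) x" by (metis dist_commute dist_triangle)
  then show ?thesis using sep[OF assms(1-3)] assms(4) by linarith
qed

lemma annulus_subset_D: "i < N \<Longrightarrow> annulus i \<subseteq> D"
proof
  fix x assume i: "i < N" and x: "x \<in> annulus i"
  show "x \<in> D" unfolding in_D
  proof (intro allI impI)
    fix j assume j: "j < N"
    show "R \<le> dist (X j) x"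
    proof (cases "j = i")
      case False
      then have "12 * R \<le> dist (X j) x"
        using far_from_others[OF i j] x R_pos by (auto simp: annulus_def)
      then show ?thesis using R_pos by linarith
    qed (use x in \<open>auto simp: annulus_def\<close>)
  qed
qed

lemma compact_annulus: "compact (annulus i)"
proof -
  have "annulus i = cball (X i) (2 * R) - ball (X i) R" by (auto simp: annulus_def)
  then show ?thesis by (simp add: compact_diff)
qed

lemma exists_radius: "\<exists>n0::nat. n0 \<ge> 1 \<and> (\<forall>i<N. norm (X i) + 4 * R \<le> real n0)"
proof -
  obtain m :: nat where m: "Max (insert 0 ((\<lambda>i. norm (X i) + 4 * R) ` {..<N})) < real m"
    using reals_Archimedean2 by blast
  have "norm (X i) + 4 * R \<le> real (Suc m)" if "i < N" for i
  proof -
    have "norm (X i) + 4 * R \<le> Max (insert 0 ((\<lambda>i. norm (X i) + 4 * R) ` {..<N}))"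
      using that by (intro Max_ge) auto
    then show ?thesis using m unfolding of_nat_Suc by linarith
  qed
  then show ?thesis by (intro exI[of _ "Suc m"]) auto
qed

text \<open>Test with \<open>\<zeta> \<Phi>\<close>, where the cutoff \<open>\<zeta>\<close> vanishes near the balls; its gradient concentrates on the
  spheres and produces the surface integrals.\<close>

theorem divergence_theorem:
  assumes T: "\<And>k. continuous_on D (T k)" "weakly_div_free U T"
    and c\<Phi>: "continuous_on D \<Phi>" and h\<Phi>: "has_partials \<Phi> d\<Phi> U" and cd\<Phi>: "\<And>k. continuous_on D (d\<Phi> k)"
    and supp: "\<And>x. x \<in> D \<Longrightarrow> norm x > B \<Longrightarrow> \<Phi> x = 0"
    and rigid: "\<And>i x. i < N \<Longrightarrow> x \<in> sphere (X i) R \<Longrightarrow> \<Phi> x = a i + cross3 (b i) (x - X i)"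
  shows "(\<integral>x. indicator U x * contr T d\<Phi> x \<partial>lborel) =
     - (\<Sum>i<N. a i \<bullet> sphere_integral (X i) R (traction T (X i) R)
            + b i \<bullet> sphere_integral (X i) R (\<lambda>x. cross3 (x - X i) (traction T (X i) R x)))"
proof -
  define e where "e n = (3 * R^2 / 4) / real (Suc n)" for n
  have e: "e n > 0" "4 * e n \<le> 3 * R^2" for n
    using R_pos by (auto simp: e_def field_simps)
  have e0: "e \<longlonglongrightarrow> 0" unfolding e_def
    by (rule real_tendsto_divide_at_top[OF tendsto_const])
       (rule filterlim_compose[OF filterlim_real_sequentially filterlim_Suc])
  define s where "s n i x = ((norm (x - X i))^2 - R^2 - e n) / e n" for n i x
  \<comment> \<open>At each point at most one summand is nonzero, so this is a cutoff: it vanishes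
    up to squared distance R^2 + e from a centre and is one beyond squared distance R^2 + 4 e from
    all of them.\<close>
  define \<zeta> where "\<zeta> n x = 1 - (\<Sum>i<N. 1 - cubic_step (s n i x))" for n x
  define d\<zeta> where "d\<zeta> n k x = (\<Sum>i<N. cubic_step' (s n i x) * (2 * (x - X i) $ k / e n))" for n k x
  define \<phi> where "\<phi> n x = (if x \<in> U then \<zeta> n x *\<^sub>R \<Phi> x else 0)" for n x
  define d\<phi> where "d\<phi> n k x = (if x \<in> U then \<zeta> n x *\<^sub>R d\<Phi> k x + d\<zeta> n k x *\<^sub>R \<Phi> x else 0)" for n k x
  have hs: "((\<lambda>x. s n i x) has_derivative (\<lambda>h. 2 * ((x - X i) \<bullet> h) / e n)) (at x)" for n i x
    using has_derivative_norm2[of "X i" "R^2 + e n" "e n" x] unfolding s_def diff_diff_eq .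
  have h\<zeta>: "has_partials (\<zeta> n) (d\<zeta> n) UNIV" for n
  proof (rule has_partialsI)
    fix x :: "real^3"
    show "(\<zeta> n has_derivative (\<lambda>h. 0 - (\<Sum>i<N. 0 - (2 * ((x - X i) \<bullet> h) / e n) * cubic_step' (s n i x)))) (at x)"
      unfolding \<zeta>_def[abs_def]
      by (intro has_derivative_diff has_derivative_sum has_derivative_const has_derivative_cubic_step(1) hs)
    show "d\<zeta> n k x = 0 - (\<Sum>i<N. 0 - (2 * ((x - X i) \<bullet> axis k 1) / e n) * cubic_step' (s n i x))" for k
      unfolding d\<zeta>_def by (simp add: inner_axis sum_negf mult.commute)
  qed
  have cs: "continuous_on S (s n i)" for S n i
    unfolding s_def using e[of n] by (intro continuous_intros) auto
  have c\<zeta>: "continuous_on S (\<zeta> n)" for S n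
    unfolding \<zeta>_def by (intro continuous_intros cs)
  have cd\<zeta>: "continuous_on S (d\<zeta> n k)" for S n k
    unfolding d\<zeta>_def using e[of n] by (intro continuous_intros cs) auto
  have s3: "s n j x \<ge> 3" if "2 * R \<le> dist (X j) x" for n j x
  proof -
    have "(2 * R)^2 \<le> (norm (x - X j))^2" using that R_pos by (intro power_mono) (auto simp: dist_norm norm_minus_commute)
    moreover have "(2 * R)^2 = 4 * R^2" by (simp add: power_mult_distrib)
    ultimately show ?thesis using e[of n] by (simp add: s_def field_simps)
  qed
  have \<zeta>0: "\<zeta> n x = 0" if "i < N" "s n i x \<le> 0" for n i x
  proof -
    have "dist (X i) x \<le> 2 * R"
    proof (rule ccontr)
      assume "\<not> ?thesis"
      then show False using s3[of i x n] that by simp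
    qed
    then have o: "cubic_step (s n j x) = 1" if "j < N" "j \<noteq> i" for j
    proof -
      have "12 * R \<le> dist (X j) x"
        using far_from_others[OF \<open>i < N\<close> that(1)] that \<open>dist (X i) x \<le> 2 * R\<close> R_pos by auto
      then show ?thesis using R_pos by (intro cubic_step_eq_1 s3) auto
    qed
    have "(\<Sum>j<N. 1 - cubic_step (s n j x)) = (\<Sum>j<N. if j = i then 1 else 0)"
      by (rule sum.cong) (use o that cubic_step_eq_0 in auto)
    then show ?thesis using that by (simp add: \<zeta>_def)
  qed
  define K where "K n = cball 0 B \<inter> (\<Inter>i<N. {x. 0 \<le> s n i x})" for n
  have K: "compact (K n)" for n
  proof -
    have "closed {x. 0 \<le> s n i x}" for i by (rule closed_Collect_le[OF continuous_on_const cs])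
    then have "closed (\<Inter>i<N. {x. 0 \<le> s n i x})" by blast
    then show ?thesis unfolding K_def by (rule compact_Int_closed[OF compact_cball])
  qed
  have KU: "K n \<subseteq> U" for n
  proof
    fix x assume x: "x \<in> K n"
    show "x \<in> U" unfolding in_U
    proof (intro allI impI)
      fix i assume "i < N"
      then have "0 \<le> s n i x" using x by (auto simp: K_def)
      then have "R^2 < (norm (x - X i))^2" using e[of n] by (simp add: s_def field_simps)
      then have "R < norm (x - X i)" using R_pos by (simp add: power2_less_imp_less)
      then show "R < dist (X i) x" by (simp add: dist_norm norm_minus_commute)
    qed
  qed
  have \<phi>out: "\<phi> n x = 0" if "x \<notin> K n" for n x
  proof (cases "x \<in> U")
    case True
    have "\<not> (norm x \<le> B \<and> (\<forall>i<N. 0 \<le> s n i x))" using that by (auto simp: K_def)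
    then consider "norm x > B" | i where "i < N" "s n i x < 0" by (meson not_le)
    then show ?thesis
    proof cases
      case 1
      then show ?thesis using supp U_subset_D True by (auto simp: \<phi>_def)
    next
      case 2
      then show ?thesis using \<zeta>0[of i n x] by (auto simp: \<phi>_def)
    qed
  qed (simp add: \<phi>_def)
  have h\<phi>U: "has_partials (\<phi> n) (d\<phi> n) U" for n
    by (rule has_partials_cong[OF has_partials_scaleR[OF has_partials_subset[OF h\<zeta>[of n] subset_UNIV] h\<Phi>] open_U])
       (simp_all add: \<phi>_def d\<phi>_def)
  have d\<phi>out: "d\<phi> n k x = 0" if "x \<notin> K n" for n k x
  proof (cases "x \<in> U")
    case True
    show ?thesis
      by (rule has_partials_zero_outside[OF h\<phi>U open_U compact_imp_closed[OF K] \<phi>out True that])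
  qed (simp add: d\<phi>_def)
  have UN: "U \<union> - K n = UNIV" for n using KU by auto
  have oK: "open (- K n)" for n using K by (simp add: compact_imp_closed open_Compl)
  have test: "test_field U (\<phi> n) (d\<phi> n)" for n
    unfolding test_field_def
  proof (intro conjI allI exI[of _ "K n"] impI K KU \<phi>out)
    have "has_partials (\<phi> n) (d\<phi> n) (- K n)"
      by (rule has_partials_cong[OF has_partials_const[of 0] oK]) (auto simp: \<phi>out d\<phi>out)
    then show "has_partials (\<phi> n) (d\<phi> n) UNIV" using has_partials_Un[OF h\<phi>U] UN by metis
    show "continuous_on UNIV (d\<phi> n k)" for k
    proof -
      have "continuous_on U (\<lambda>x. \<zeta> n x *\<^sub>R d\<Phi> k x + d\<zeta> n k x *\<^sub>R \<Phi> x)"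
        by (intro continuous_intros c\<zeta> cd\<zeta> continuous_on_subset[OF cd\<Phi> U_subset_D] continuous_on_subset[OF c\<Phi> U_subset_D])
      then have 1: "continuous_on U (d\<phi> n k)"
        by (rule continuous_on_cong[THEN iffD1, rotated -1]) (auto simp: d\<phi>_def)
      have 2: "continuous_on (- K n) (d\<phi> n k)"
        by (rule continuous_on_cong[THEN iffD1, rotated -1, OF continuous_on_const[of _ 0]]) (auto simp: d\<phi>out)
      show ?thesis using continuous_on_open_Un[OF open_U oK 1 2] UN by simp
    qed
  qed
  have zero: "(\<integral>x. contr T (d\<phi> n) x \<partial>lborel) = 0" for n
    using T(2) test unfolding weakly_div_free_def by blast

  \<comment> \<open>The gradient of the cutoff is the sum over \<open>i\<close> of
    \<open>w n i x\<close> times \<open>x - X i\<close>; it is the weight for which the shell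
    integrals converge.\<close>
  define w where "w n i x = 2 / e n * cubic_step' (s n i x)" for n i x
  define F where "F i x = (\<Sum>k\<in>UNIV. (x - X i) $ k *\<^sub>R T k x)" for i x
  have cT: "continuous_on (annulus i) (F i)" if "i < N" for i
    unfolding F_def by (intro continuous_intros continuous_on_subset[OF T(1) annulus_subset_D[OF that]])
  have c\<Phi>a: "continuous_on (annulus i) \<Phi>" if "i < N" for i
    by (rule continuous_on_subset[OF c\<Phi> annulus_subset_D[OF that]])
  have wnz: "x \<in> U \<and> x \<in> annulus i" if "i < N" "w n i x \<noteq> 0" for n i x
  proof -
    have s: "0 < s n i x" "s n i x < 3"
      using that cubic_step'_eq_0[of "s n i x"] by (auto simp: w_def not_le[symmetric])
    have "R^2 < (norm (x - X i))^2" using s(1) e[of n] by (simp add: s_def field_simps)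
    then have 1: "R < dist (X i) x" using R_pos by (simp add: power2_less_imp_less dist_norm norm_minus_commute)
    have 2: "dist (X i) x < 2 * R" using s3[of i x n] s by (meson not_le)
    have "R < dist (X j) x" if "j < N" for j
    proof (cases "j = i")
      case False
      moreover have "dist (X i) x \<le> 4 * R" using 2 R_pos by linarith
      ultimately have "12 * R \<le> dist (X j) x" using far_from_others[OF \<open>i < N\<close> that] by blast
      then show ?thesis using R_pos by linarith
    qed (use 1 in simp)
    then show ?thesis using 1 2 by (auto simp: in_U annulus_def)
  qed
  have Aeq: "{x. R \<le> dist (X i) x \<and> dist (X i) x \<le> 2 * R} = annulus i" for i
    by (simp add: annulus_def)
  have lim: "(\<lambda>n. \<integral>x. indicator (annulus i) x *\<^sub>R (w n i x *\<^sub>R f x) \<partial>lborel) \<longlonglongrightarrow> (1 / R) *\<^sub>R sphere_integral (X i) R f"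
    if "continuous_on (annulus i) f" for f i
    using shell_limit[OF R_pos e e0, of "X i" f] that unfolding Aeq w_def s_def by simp
  have intw: "integrable lborel (\<lambda>x. indicator (annulus i) x *\<^sub>R (w n i x *\<^sub>R f x))"
    if "continuous_on (annulus i) f" for f :: "real^3 \<Rightarrow> 'z::{banach,second_countable_topology}" and i n
    by (rule borel_integrable_compact[OF compact_annulus]) (use e[of n] in \<open>auto simp: w_def intro!: continuous_intros cs that\<close>)
  define J where "J n i = (\<integral>x. indicator (annulus i) x *\<^sub>R (w n i x *\<^sub>R (F i x \<bullet> \<Phi> x)) \<partial>lborel)" for n i
  have limJ: "(\<lambda>n. J n i) \<longlonglongrightarrow> a i \<bullet> sphere_integral (X i) R (traction T (X i) R)
            + b i \<bullet> sphere_integral (X i) R (\<lambda>x. cross3 (x - X i) (traction T (X i) R x))" if i: "i < N" for i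
  proof -
    define G where "G x = cross3 (x - X i) (F i x)" for x
    define \<omega> where "\<omega> x = \<Phi> x - (a i + cross3 (b i) (x - X i))" for x
    have cG: "continuous_on (annulus i) G" unfolding G_def by (intro continuous_on_cross continuous_intros cT i)
    have c\<omega>: "continuous_on (annulus i) \<omega>" unfolding \<omega>_def
      by (intro continuous_intros continuous_on_cross c\<Phi>a i)
    \<comment> \<open>The deviation \<open>\<omega>\<close> from the rigid motion vanishes on the
      sphere, so its contribution disappears in the limit. The scalar is carried by a fixed axis
      vector because \<open>shell_limit\<close> is about vector fields.\<close>
    define Z where "Z x = (F i x \<bullet> \<omega> x) *\<^sub>R (axis 1 1 :: real^3)" for x
    have cZ: "continuous_on (annulus i) Z" unfolding Z_def by (intro continuous_intros cT c\<omega> i)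
    have split: "F i x \<bullet> \<Phi> x = a i \<bullet> F i x + b i \<bullet> G x + axis 1 1 \<bullet> Z x" for x
    proof -
      have "\<Phi> x = a i + cross3 (b i) (x - X i) + \<omega> x" by (simp add: \<omega>_def)
      moreover have "F i x \<bullet> cross3 (b i) (x - X i) = b i \<bullet> G x"
        unfolding G_def by (simp add: cross3_simps)
      ultimately show ?thesis by (simp add: Z_def inner_add_right inner_commute inner_axis_axis)
    qed
    have Jeq: "J n i = a i \<bullet> (\<integral>x. indicator (annulus i) x *\<^sub>R (w n i x *\<^sub>R F i x) \<partial>lborel)
      + b i \<bullet> (\<integral>x. indicator (annulus i) x *\<^sub>R (w n i x *\<^sub>R G x) \<partial>lborel)
      + axis 1 1 \<bullet> (\<integral>x. indicator (annulus i) x *\<^sub>R (w n i x *\<^sub>R Z x) \<partial>lborel)" for n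
    proof -
      have "J n i = (\<integral>x. a i \<bullet> (indicator (annulus i) x *\<^sub>R (w n i x *\<^sub>R F i x))
          + b i \<bullet> (indicator (annulus i) x *\<^sub>R (w n i x *\<^sub>R G x))
          + axis 1 1 \<bullet> (indicator (annulus i) x *\<^sub>R (w n i x *\<^sub>R Z x)) \<partial>lborel)"
        unfolding J_def split by (simp add: algebra_simps)
      also have "\<dots> = (\<integral>x. a i \<bullet> (indicator (annulus i) x *\<^sub>R (w n i x *\<^sub>R F i x)) \<partial>lborel)
          + (\<integral>x. b i \<bullet> (indicator (annulus i) x *\<^sub>R (w n i x *\<^sub>R G x)) \<partial>lborel)
          + (\<integral>x. axis 1 1 \<bullet> (indicator (annulus i) x *\<^sub>R (w n i x *\<^sub>R Z x)) \<partial>lborel)"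
        by (simp only: Bochner_Integration.integral_add integrable_inner_right integrable_add Bochner_Integration.integrable_add
            intw[OF cT[OF i]] intw[OF cG] intw[OF cZ])
      finally show ?thesis
        by (simp only: integral_inner_right intw[OF cT[OF i]] intw[OF cG] intw[OF cZ])
    qed
    have "(\<lambda>n. J n i) \<longlonglongrightarrow> a i \<bullet> ((1 / R) *\<^sub>R sphere_integral (X i) R (F i))
      + b i \<bullet> ((1 / R) *\<^sub>R sphere_integral (X i) R G) + axis 1 1 \<bullet> ((1 / R) *\<^sub>R sphere_integral (X i) R Z)"
      unfolding Jeq by (intro tendsto_intros lim cT cG cZ i)
    moreover have "sphere_integral (X i) R Z = 0"
    proof -
      have "sphere_integral (X i) R Z = sphere_integral (X i) R (\<lambda>x. 0)"
        by (rule sphere_integral_cong[OF R_pos]) (simp add: Z_def \<omega>_def rigid[OF i])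
      then show ?thesis by (simp add: sphere_integral_zero)
    qed
    moreover have "(1 / R) *\<^sub>R sphere_integral (X i) R (F i) = sphere_integral (X i) R (traction T (X i) R)"
      unfolding sphere_integral_scaleR[symmetric] by (simp add: F_def traction_def[abs_def])
    moreover have "(1 / R) *\<^sub>R sphere_integral (X i) R G = sphere_integral (X i) R (\<lambda>x. cross3 (x - X i) (traction T (X i) R x))"
      unfolding sphere_integral_scaleR[symmetric] by (simp add: F_def G_def traction_def[abs_def] cross_mult_right)
    ultimately show ?thesis by simp
  qed

  define C where "C = D \<inter> cball 0 B"
  have C: "compact C" unfolding C_def using closed_D by (simp add: closed_Int_compact)
  have ccontr: "continuous_on D (contr T d\<Phi>)"
    unfolding contr_def by (intro continuous_intros T(1) cd\<Phi>)
  have d\<Phi>out: "d\<Phi> k x = 0" if "x \<in> U" "norm x > B" for k x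
  proof -
    have h: "has_partials \<Phi> d\<Phi> (U - cball 0 B)" by (rule has_partials_subset[OF h\<Phi>]) auto
    have o: "open (U - cball 0 B)" using open_U by (simp add: open_Diff)
    have "has_partials (\<lambda>_. 0) d\<Phi> (U - cball 0 B)"
      by (rule has_partials_cong[OF h o]) (use supp U_subset_D in \<open>auto simp: not_le\<close>)
    then show ?thesis
      by (rule has_partials_zero_outside[OF _ o closed_empty]) (use that in auto)
  qed
  have "bounded (contr T d\<Phi> ` C)"
    using C ccontr compact_continuous_image compact_imp_bounded continuous_on_subset unfolding C_def by (metis inf_le1)
  then obtain M where M: "\<forall>x\<in>C. norm (contr T d\<Phi> x) \<le> M" by (auto simp: bounded_iff)
  define M' where "M' = max M 0"
  have bM: "\<bar>indicator U x * contr T d\<Phi> x\<bar> \<le> indicator C x * M'" for x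
  proof (cases "x \<in> U")
    case True
    show ?thesis
    proof (cases "norm x > B")
      case True
      then have "contr T d\<Phi> x = 0" using d\<Phi>out[OF \<open>x \<in> U\<close>] by (simp add: contr_def)
      then show ?thesis by (simp add: M'_def)
    next
      case False
      then have "x \<in> C" using \<open>x \<in> U\<close> U_subset_D by (auto simp: C_def)
      then show ?thesis using M True by (auto simp: M'_def)
    qed
  qed (simp add: M'_def)
  have intC: "integrable lborel (\<lambda>x. indicator C x * M'')" for M'' :: real
    using borel_integrable_compact[OF C, of "\<lambda>_. M''"] by simp
  have mU: "(\<lambda>x. indicator U x * contr T d\<Phi> x) \<in> borel_measurable lborel"
    using borel_measurable_continuous_on_indicator[OF borel_open[OF open_U] continuous_on_subset[OF ccontr U_subset_D]] by simp
  have m\<zeta>: "\<zeta> n \<in> borel_measurable lborel" for n using c\<zeta> by (simp add: borel_measurable_continuous_onI)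
  have b\<zeta>: "\<bar>\<zeta> n x\<bar> \<le> 1 + real N" for n x
  proof -
    have "\<bar>\<Sum>i<N. 1 - cubic_step (s n i x)\<bar> \<le> (\<Sum>i<N. 1)"
    proof (rule order_trans[OF sum_abs sum_mono])
      show "\<bar>1 - cubic_step (s n i x)\<bar> \<le> 1" for i
        using cubic_step_bounds[of "s n i x"] by linarith
    qed
    then show ?thesis unfolding \<zeta>_def by simp
  qed
  define I where "I n = (\<integral>x. \<zeta> n x * (indicator U x * contr T d\<Phi> x) \<partial>lborel)" for n
  have bI: "\<bar>\<zeta> n x * (indicator U x * contr T d\<Phi> x)\<bar> \<le> indicator C x * ((1 + real N) * M')" for n x
    unfolding abs_mult[of "\<zeta> n x"] using mult_mono[OF b\<zeta> bM] by (simp add: mult_ac)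
  have intI: "integrable lborel (\<lambda>x. \<zeta> n x * (indicator U x * contr T d\<Phi> x))" for n
  proof (rule Bochner_Integration.integrable_bound[OF intC[of "(1 + real N) * M'"]])
    show "(\<lambda>x. \<zeta> n x * (indicator U x * contr T d\<Phi> x)) \<in> borel_measurable lborel"
      by (intro borel_measurable_times m\<zeta> mU)
    show "AE x in lborel. norm (\<zeta> n x * (indicator U x * contr T d\<Phi> x)) \<le> norm (indicator C x * ((1 + real N) * M'))"
      unfolding real_norm_def by (intro AE_I2 order_trans[OF bI abs_ge_self])
  qed
  have limI: "I \<longlonglongrightarrow> (\<integral>x. indicator U x * contr T d\<Phi> x \<partial>lborel)"
    unfolding I_def
  proof (rule integral_dominated_convergence[where w="\<lambda>x. indicator C x * ((1 + real N) * M')"])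
    show "AE x in lborel. (\<lambda>n. \<zeta> n x * (indicator U x * contr T d\<Phi> x)) \<longlonglongrightarrow> indicator U x * contr T d\<Phi> x"
    proof (rule AE_I2)
      fix x
      show "(\<lambda>n. \<zeta> n x * (indicator U x * contr T d\<Phi> x)) \<longlonglongrightarrow> indicator U x * contr T d\<Phi> x"
      proof (cases "x \<in> U")
        case True
        have "\<forall>\<^sub>F n in sequentially. \<forall>i\<in>{..<N}. s n i x \<ge> 3"
        proof (rule eventually_ball_finite; (intro ballI)?)
          fix i assume "i \<in> {..<N}"
          then have "R < norm (x - X i)" using True by (simp add: in_U dist_norm norm_minus_commute)
          then have "0 < (norm (x - X i))^2 - R^2" using R_pos by (simp add: power_strict_mono)
          then have "\<forall>\<^sub>F n in sequentially. e n < ((norm (x - X i))^2 - R^2) / 4"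
            by (intro order_tendstoD(2)[OF e0]) simp
          then show "\<forall>\<^sub>F n in sequentially. 3 \<le> s n i x"
            by eventually_elim (use e in \<open>simp add: s_def field_simps\<close>)
        qed simp
        then have "\<forall>\<^sub>F n in sequentially. \<zeta> n x * (indicator U x * contr T d\<Phi> x) = indicator U x * contr T d\<Phi> x"
          by eventually_elim (simp add: \<zeta>_def cubic_step_eq_1)
        then show ?thesis by (rule tendsto_eventually)
      qed simp
    qed
  qed (use m\<zeta> mU intC bI in auto)
  have "I n + (\<Sum>i<N. J n i) = 0" for n
  proof -
    have "contr T (d\<phi> n) x = \<zeta> n x * (indicator U x * contr T d\<Phi> x)
        + (\<Sum>i<N. indicator (annulus i) x *\<^sub>R (w n i x *\<^sub>R (F i x \<bullet> \<Phi> x)))" for x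
    proof (cases "x \<in> U")
      case True
      have "contr T (d\<phi> n) x = \<zeta> n x * contr T d\<Phi> x + (\<Sum>k\<in>UNIV. \<Sum>i<N. cubic_step' (s n i x) * (2 * (x - X i) $ k / e n) * (T k x \<bullet> \<Phi> x))"
        using True by (simp add: contr_def d\<phi>_def d\<zeta>_def sum.distrib sum_distrib_left sum_distrib_right inner_add_right)
      also have "(\<Sum>k\<in>UNIV. \<Sum>i<N. cubic_step' (s n i x) * (2 * (x - X i) $ k / e n) * (T k x \<bullet> \<Phi> x))
         = (\<Sum>i<N. w n i x * (F i x \<bullet> \<Phi> x))"
        unfolding w_def F_def inner_sum_left sum_distrib_left inner_scaleR_left
        by (subst sum.swap, intro sum.cong refl) (simp only: times_divide_eq_left times_divide_eq_right mult_ac)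
      also have "\<dots> = (\<Sum>i<N. indicator (annulus i) x *\<^sub>R (w n i x *\<^sub>R (F i x \<bullet> \<Phi> x)))"
        by (rule sum.cong) (use wnz in \<open>auto simp: indicator_def\<close>)
      finally show ?thesis using True by simp
    next
      case False
      then have "w n i x = 0" if "i < N" for i using wnz that by blast
      then show ?thesis using False by (simp add: contr_def d\<phi>_def)
    qed
    then have "(\<integral>x. contr T (d\<phi> n) x \<partial>lborel) = I n + (\<Sum>i<N. J n i)"
      unfolding I_def J_def
      by (simp only:) (subst Bochner_Integration.integral_add[OF intI], (intro Bochner_Integration.integrable_sum intw continuous_intros cT c\<Phi>a; simp),
        subst Bochner_Integration.integral_sum, (intro intw continuous_intros cT c\<Phi>a; simp), simp)
    then show ?thesis using zero[of n] by simp
  qed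
  then have IJ: "I n = - (\<Sum>i<N. J n i)" for n by (simp add: eq_neg_iff_add_eq_0)
  have "I \<longlonglongrightarrow> - (\<Sum>i<N. a i \<bullet> sphere_integral (X i) R (traction T (X i) R)
            + b i \<bullet> sphere_integral (X i) R (\<lambda>x. cross3 (x - X i) (traction T (X i) R x)))"
    unfolding IJ by (intro tendsto_intros limJ) simp
  then show ?thesis using limI LIMSEQ_unique by blast
qed

end

section \<open>Solutions of the Stokes problem\<close>

lemma tail_integral_tendsto_0:
  fixes W :: "real^3 \<Rightarrow> real"
  assumes "integrable lborel W"
  shows "(\<lambda>n. \<integral>x. indicator {x. real n \<le> norm x} x * W x \<partial>lborel) \<longlonglongrightarrow> 0"
proof -
  have "(\<lambda>n. \<integral>x. indicator {x. real n \<le> norm x} x * W x \<partial>lborel) \<longlonglongrightarrow> (\<integral>x. (0::real) \<partial>(lborel::(real^3) measure))"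
  proof (rule integral_dominated_convergence[where w="\<lambda>x. norm (W x)"])
    show "(\<lambda>x. indicator {x. real n \<le> norm x} x * W x) \<in> borel_measurable lborel" for n
    proof (intro borel_measurable_times borel_measurable_indicator)
      have "closed {x::real^3. real n \<le> norm x}" by (intro closed_Collect_le continuous_intros)
      then show "{x::real^3. real n \<le> norm x} \<in> sets lborel" by simp
    qed (use assms in simp)
    show "AE x in lborel. (\<lambda>n. indicator {x. real n \<le> norm x} x * W x) \<longlonglongrightarrow> 0"
    proof (rule AE_I2, rule tendsto_eventually)
      fix x :: "real^3"
      obtain m :: nat where m: "norm x < real m" using reals_Archimedean2 by blast
      show "\<forall>\<^sub>F n in sequentially. indicator {x. real n \<le> norm x} x * W x = 0"
        by (rule eventually_sequentiallyI[of m]) (use m in \<open>auto simp: indicator_def\<close>)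
    qed
    show "AE x in lborel. norm (indicator {x. real n \<le> norm x} x * W x) \<le> norm (W x)" for n
      by (rule AE_I2) (auto simp: indicator_def)
  qed (use assms in auto)
  then show ?thesis by simp
qed

text \<open>The form of the cutoff errors at radius n: a tail of an integrable function, plus a null
  sequence over n^3 on a ball whose volume is a multiple of n^3. It replaces any rate of decay of
  the integrands.\<close>

lemma integral_close_limit:
  fixes g h :: "nat \<Rightarrow> real^3 \<Rightarrow> real"
  assumes g: "\<And>n. integrable lborel (g n)" and h: "\<And>n. integrable lborel (h n)" and W: "integrable lborel W"
    and le: "\<And>n x. n \<ge> n0 \<Longrightarrow> \<bar>g n x - h n x\<bar> \<le> indicator {x. real n \<le> norm x} x * W x
               + indicator (cball 0 (2 * real n)) x * (C n / real n ^ 3)"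
    and C: "C \<longlonglongrightarrow> 0"
  shows "(\<lambda>n. (\<integral>x. g n x \<partial>lborel) - (\<integral>x. h n x \<partial>lborel)) \<longlonglongrightarrow> 0"
proof (rule Lim_null_comparison)
  \<comment> \<open>\<open>4 / 3 * pi * 8\<close> is the volume of a ball of radius 2.\<close>
  define b where "b n = (\<integral>x. indicator {x. real n \<le> norm x} x * W x \<partial>lborel) + (4 / 3 * pi * 8) * C n" for n :: nat
  show "b \<longlonglongrightarrow> 0"
    unfolding b_def by (rule tendsto_eq_intros refl tail_integral_tendsto_0[OF W] C)+ simp
  show "\<forall>\<^sub>F n in sequentially. norm ((\<integral>x. g n x \<partial>lborel) - (\<integral>x. h n x \<partial>lborel)) \<le> b n"
  proof (rule eventually_sequentiallyI[of "max n0 1"])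
    fix n assume n: "max n0 1 \<le> n"
    have i1: "integrable lborel (\<lambda>x. indicator {x. real n \<le> norm x} x * W x)"
    proof -
      have "closed {x::real^3. real n \<le> norm x}" by (intro closed_Collect_le continuous_intros)
      then show ?thesis using integrable_mult_indicator[OF _ W, of "{x. real n \<le> norm x}"] by simp
    qed
    have i2: "integrable lborel (\<lambda>x. indicator (cball (0::real^3) (2 * real n)) x * (C n / real n ^ 3))"
      using borel_integrable_compact[OF compact_cball[of "0::real^3" "2 * real n"], of "\<lambda>_. C n / real n ^ 3"] by simp
    have "\<bar>(\<integral>x. g n x \<partial>lborel) - (\<integral>x. h n x \<partial>lborel)\<bar> = \<bar>\<integral>x. g n x - h n x \<partial>lborel\<bar>"
      using g h by simp
    also have "\<dots> \<le> (\<integral>x. \<bar>g n x - h n x\<bar> \<partial>lborel)" by (rule integral_abs_bound)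
    also have "\<dots> \<le> (\<integral>x. indicator {x. real n \<le> norm x} x * W x
               + indicator (cball 0 (2 * real n)) x * (C n / real n ^ 3) \<partial>lborel)"
      by (rule integral_mono) (use g h i1 i2 le n in auto)
    also have "\<dots> = (\<integral>x. indicator {x. real n \<le> norm x} x * W x \<partial>lborel)
        + measure lborel (cball (0::real^3) (2 * real n)) * (C n / real n ^ 3)"
      using i1 i2 by simp
    also have "\<dots> = b n"
      using n by (simp add: b_def content_cball unit_ball_vol_3 power_mult_distrib)
    finally show "norm ((\<integral>x. g n x \<partial>lborel) - (\<integral>x. h n x \<partial>lborel)) \<le> b n" by simp
  qed
qed

text \<open>Column \<open>k\<close> of the gradient plus its transpose, not halved, so that it is
  the viscous part of the stress.\<close>

definition sym_grad :: "(3 \<Rightarrow> real^3 \<Rightarrow> real^3) \<Rightarrow> 3 \<Rightarrow> real^3 \<Rightarrow> real^3" where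
  "sym_grad d k x = d k x + (\<chi> a. d a x $ k)"

text \<open>A symmetric matrix sees only the symmetric part of its partner, which is one half of its
  \<open>sym_grad\<close>.\<close>

lemma contr_sym_grad:
  "contr (sym_grad d) d' x = 1 / 2 * contr (sym_grad d) (sym_grad d') x"
  "contr (sym_grad d) d' x = contr (sym_grad d') d x"
  unfolding contr_def sym_grad_def inner_vec_def sum_3
  by (simp_all add: algebra_simps)

locale stokes_flow = separated_balls +
  fixes F :: "real^3" and u :: "real^3 \<Rightarrow> real^3" and p :: "real^3 \<Rightarrow> real" and V \<Omega> :: "nat \<Rightarrow> real^3"
  assumes sol: "stokes_solution N R F X u p V \<Omega>"
begin

text \<open>Derivatives within the closed domain \<open>D\<close>: in the fluid they are the usual
  ones, and they are continuous up to the spheres, where the traction is evaluated.\<close>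

definition du :: "3 \<Rightarrow> real^3 \<Rightarrow> real^3" where "du k = partial D k u"

definition \<sigma> :: "3 \<Rightarrow> real^3 \<Rightarrow> real^3" where "\<sigma> k x = sym_grad du k x - p x *\<^sub>R axis k 1"

lemma at_within_D: "x \<in> U \<Longrightarrow> at x within D = at x"
  by (rule at_within_interior) (use interior_maximal[OF U_subset_D open_U] in auto)

lemma at_within_U: "x \<in> U \<Longrightarrow> at x within U = at x"
  by (rule at_within_open[OF _ open_U])

lemma partial_U: "x \<in> U \<Longrightarrow> partial U k u x = du k x"
  unfolding du_def partial_def by (simp add: at_within_D at_within_U)

lemma C1_on_U_has_partials:
  assumes "C1_on U f"
  shows "has_partials f (\<lambda>k. partial U k f) U"
proof (rule has_partialsI)
  fix x assume x: "x \<in> U"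
  have "f differentiable (at x)"
    using assms x by (auto simp: C1_on_def differentiable_on_def at_within_U)
  then show "(f has_derivative frechet_derivative f (at x)) (at x)"
    by (simp add: frechet_derivative_works)
  show "partial U k f x = frechet_derivative f (at x) (axis k 1)" for k
    using x by (simp add: partial_def at_within_U)
qed

lemma u_partials: "has_partials u du U"
proof -
  have "C1_on U u" using sol by (auto simp: stokes_solution_def C2_on_def Let_def)
  show ?thesis
    by (rule has_partials_cong[OF C1_on_U_has_partials[OF \<open>C1_on U u\<close>] open_U]) (simp_all add: partial_U)
qed

lemma continuous_du: "continuous_on D (du k)" and continuous_u: "continuous_on D u" and continuous_p: "continuous_on D p"
  using sol by (auto simp: stokes_solution_def Let_def C1_on_def du_def differentiable_imp_continuous_on)

lemma continuous_sym_grad: "(\<And>k. continuous_on S (d k)) \<Longrightarrow> continuous_on S (sym_grad d k)"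
  unfolding sym_grad_def by (intro continuous_intros)

lemma continuous_\<sigma>: "continuous_on D (\<sigma> k)"
  unfolding \<sigma>_def by (intro continuous_intros continuous_sym_grad continuous_du continuous_p)

lemma div_u: "x \<in> U \<Longrightarrow> (\<Sum>k\<in>UNIV. du k x $ k) = 0"
  using sol partial_U by (auto simp: stokes_solution_def Let_def divergence_def)

lemma u_rigid: "i < N \<Longrightarrow> x \<in> sphere (X i) R \<Longrightarrow> u x = V i + cross3 (\<Omega> i) (x - X i)"
  using sol by (auto simp: stokes_solution_def Let_def)

lemma u_vanishes: "(u \<longlongrightarrow> 0) at_infinity"
  using sol by (auto simp: stokes_solution_def Let_def)

text \<open>The gradient contributes the Laplacian of \<open>u\<close>. The transposed gradient
  contributes the gradient of the divergence, since mixed derivatives commute, and this is zero. The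
  pressure part contributes minus the gradient of \<open>p\<close>, so the Stokes equation
  remains.\<close>

lemma \<sigma>_weakly_div_free: "weakly_div_free U \<sigma>"
proof -
  define ddu where "ddu k l = partial U l (partial U k u)" for k l
  define dp where "dp k = partial U k p" for k
  have C: "C1_on U p" "\<And>k. C1_on U (partial U k u)"
    using sol by (auto simp: stokes_solution_def C2_on_def Let_def)
  have hp: "has_partials p dp U" using C1_on_U_has_partials[OF C(1)] by (simp add: dp_def[abs_def])
  have hdu: "has_partials (du k) (ddu k) U" for k
    by (rule has_partials_cong[OF C1_on_U_has_partials[OF C(2)[of k]] open_U])
       (simp_all add: ddu_def partial_U)
  have cp: "continuous_on U (dp k)" and cdd: "continuous_on U (ddu k l)" for k l
    using C by (auto simp: C1_on_def dp_def ddu_def)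
  have comm: "ddu i j x $ k = ddu j i x $ k" if "x \<in> U" for i j k x
    by (rule mixed_partials_commute[OF open_U has_partials_nth[OF u_partials] has_partials_nth[OF hdu] _ that])
       (intro continuous_intros cdd)
  have ddiv: "(\<Sum>k\<in>UNIV. ddu k a x $ k) = 0" if x: "x \<in> U" for a x
  proof -
    have "has_partials (\<lambda>x. \<Sum>k\<in>UNIV. du k x $ k) (\<lambda>a x. \<Sum>k\<in>UNIV. ddu k a x $ k) U"
      by (intro has_partials_sum has_partials_nth hdu)
    moreover have "has_partials (\<lambda>x. \<Sum>k\<in>UNIV. du k x $ k) (\<lambda>a x. 0) U"
      by (rule has_partials_cong[OF has_partials_const[of 0] open_U]) (auto simp: div_u)
    ultimately show ?thesis using has_partials_unique x by blast
  qed
  have eq: "(\<Sum>k\<in>UNIV. ddu k k x) = (\<chi> k. dp k x)" if "x \<in> U" for x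
  proof -
    have "- laplacian U u x + gradient U p x = 0"
      using sol that by (auto simp: stokes_solution_def Let_def)
    then show ?thesis by (simp add: laplacian_def gradient_def ddu_def dp_def)
  qed
  define d\<sigma> where "d\<sigma> k l x = ddu k l x + (\<chi> a. ddu a l x $ k) - dp l x *\<^sub>R axis k 1" for k l x
  show ?thesis
  proof (rule weakly_div_freeI[OF open_U])
    show "has_partials (\<sigma> k) (d\<sigma> k) U" for k
    proof -
      have 1: "has_partials (\<lambda>x. p x *\<^sub>R axis k 1 :: real^3) (\<lambda>l x. dp l x *\<^sub>R axis k 1) U"
        by (rule has_partials_linear[OF bounded_linear_scaleR_left hp])
      have 2: "has_partials (\<lambda>x. \<chi> a. du a x $ k) (\<lambda>l x. \<chi> a. ddu a l x $ k) U"
      proof -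
        have "has_partials (\<lambda>x. \<Sum>a\<in>UNIV. du a x $ k *\<^sub>R axis a 1 :: real^3) (\<lambda>l x. \<Sum>a\<in>UNIV. ddu a l x $ k *\<^sub>R axis a 1) U"
          by (intro has_partials_sum has_partials_linear[OF bounded_linear_scaleR_left] has_partials_nth hdu)
        moreover have "(\<Sum>a\<in>UNIV. v a *\<^sub>R axis a 1) = (\<chi> a. v a)" for v :: "3 \<Rightarrow> real"
          by (simp add: vec_eq_iff sum_3 forall_3 axis_def)
        ultimately show ?thesis by simp
      qed
      show ?thesis unfolding \<sigma>_def[abs_def] d\<sigma>_def[abs_def] sym_grad_def
        by (intro has_partials_diff has_partials_add hdu 1 2)
    qed
    show "continuous_on U (d\<sigma> k k)" for k
      unfolding d\<sigma>_def by (intro continuous_intros cdd cp)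
    show "(\<Sum>k\<in>UNIV. d\<sigma> k k x) = 0" if x: "x \<in> U" for x
    proof -
      have "(\<Sum>k\<in>UNIV. d\<sigma> k k x) $ a = 0" for a
      proof -
        have "(\<Sum>k\<in>UNIV. d\<sigma> k k x) $ a = (\<Sum>k\<in>UNIV. ddu k k x) $ a + (\<Sum>k\<in>UNIV. ddu a k x $ k) - (\<Sum>k\<in>UNIV. dp k x *\<^sub>R axis k 1) $ a"
          by (simp add: d\<sigma>_def sum.distrib sum_subtractf)
        also have "(\<Sum>k\<in>UNIV. ddu a k x $ k) = (\<Sum>k\<in>UNIV. ddu k a x $ k)" using comm[OF x] by simp
        also have "(\<Sum>k\<in>UNIV. dp k x *\<^sub>R axis k 1) $ a = dp a x"
          using exhaust_3[of a] by (auto simp: sum_3 axis_def)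
        finally show ?thesis using ddiv[OF x] eq[OF x] by simp
      qed
      then show ?thesis by (simp add: vec_eq_iff)
    qed
  qed
qed

lemma \<sigma>_force: "i < N \<Longrightarrow> sphere_integral (X i) R (traction \<sigma> (X i) R) = - F"
  and \<sigma>_torque: "i < N \<Longrightarrow> sphere_integral (X i) R (\<lambda>x. cross3 (x - X i) (traction \<sigma> (X i) R x)) = 0"
proof -
  have eq: "stress D u p x *v outer_normal (X i) R x = traction \<sigma> (X i) R x" for x i
    unfolding traction_def \<sigma>_def sym_grad_def stress_def outer_normal_def jacobian_def du_def
      vec_eq_iff matrix_vector_mult_def transpose_def mat_def
    by (simp add: sum_3 forall_3 axis_def algebra_simps)
  show "i < N \<Longrightarrow> sphere_integral (X i) R (traction \<sigma> (X i) R) = - F"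
    "i < N \<Longrightarrow> sphere_integral (X i) R (\<lambda>x. cross3 (x - X i) (traction \<sigma> (X i) R x)) = 0"
    using sol by (auto simp: stokes_solution_def Let_def eq)
qed

text \<open>Rotations of the test field on the spheres drop out because the torques vanish; the sign
  of the surface term cancels the one of the surface force \<open>- F\<close>.\<close>

theorem weak_formulation:
  assumes "continuous_on D \<Phi>" "has_partials \<Phi> d\<Phi> U" "\<And>k. continuous_on D (d\<Phi> k)"
    and "\<And>x. x \<in> D \<Longrightarrow> norm x > B \<Longrightarrow> \<Phi> x = 0"
    and "\<And>i x. i < N \<Longrightarrow> x \<in> sphere (X i) R \<Longrightarrow> \<Phi> x = a i + cross3 (b i) (x - X i)"
  shows "(\<integral>x. indicator U x * contr \<sigma> d\<Phi> x \<partial>lborel) = (\<Sum>i<N. a i \<bullet> F)"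
  using divergence_theorem[OF continuous_\<sigma> \<sigma>_weakly_div_free assms]
  by (simp add: \<sigma>_force \<sigma>_torque sum_negf)

lemma norm_du_le_jacobian: "x \<in> U \<Longrightarrow> (norm (du k x))^2 \<le> (norm (jacobian U u x))^2"
proof -
  assume x: "x \<in> U"
  have "(norm (jacobian U u x))^2 = (\<Sum>k\<in>UNIV. (norm (du k x))^2)"
    unfolding power2_norm_eq_inner inner_vec_def jacobian_def
    by (simp add: sum_3 partial_U[OF x])
  also have "\<dots> \<ge> (norm (du k x))^2"
    using member_le_sum[of k UNIV "\<lambda>k. (norm (du k x))^2"] by simp
  finally show ?thesis .
qed

lemma integrable_du: "integrable lborel (\<lambda>x. indicator U x * (norm (du k x))^2)"
proof (rule Bochner_Integration.integrable_bound)
  show "integrable lborel (\<lambda>x. indicator U x * (norm (jacobian U u x))^2)"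
    using sol by (auto simp: stokes_solution_def Let_def set_integrable_def)
  show "(\<lambda>x. indicator U x * (norm (du k x))^2) \<in> borel_measurable lborel"
    using borel_measurable_continuous_on_indicator[OF borel_open[OF open_U], of "\<lambda>x. (norm (du k x))^2"]
    by (simp add: continuous_on_subset[OF continuous_du U_subset_D] continuous_intros)
  show "AE x in lborel. norm (indicator U x * (norm (du k x))^2) \<le> norm (indicator U x * (norm (jacobian U u x))^2)"
    by (rule AE_I2) (use norm_du_le_jacobian in \<open>simp add: indicator_def\<close>)
qed

lemma integrable_p: "integrable lborel (\<lambda>x. indicator U x * (p x)^2)"
  using sol by (auto simp: stokes_solution_def Let_def set_integrable_def)

text \<open>An integrable majorant for the squares of gradient and pressure alike; its tails control
  the cutoff errors.\<close>

definition W :: "real^3 \<Rightarrow> real" where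
  "W x = indicator U x * ((\<Sum>k\<in>UNIV. (norm (du k x))^2) + (p x)^2)"

lemma integrable_W: "integrable lborel W"
proof -
  have "integrable lborel (\<lambda>x. (\<Sum>k\<in>UNIV. indicator U x * (norm (du k x))^2) + indicator U x * (p x)^2)"
    by (intro Bochner_Integration.integrable_add Bochner_Integration.integrable_sum integrable_du integrable_p)
  then show ?thesis by (simp add: W_def[abs_def] distrib_left sum_distrib_left)
qed

lemma W_nonneg: "0 \<le> W x"
  unfolding W_def by (intro mult_nonneg_nonneg add_nonneg_nonneg sum_nonneg) auto

lemma norm_du_W: "x \<in> U \<Longrightarrow> (norm (du k x))^2 \<le> W x"
proof -
  assume x: "x \<in> U"
  have "(norm (du k x))^2 \<le> (\<Sum>k\<in>UNIV. (norm (du k x))^2)"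
    using member_le_sum[of k UNIV "\<lambda>k. (norm (du k x))^2"] by simp
  also have "\<dots> \<le> W x" using x by (simp add: W_def)
  finally show ?thesis .
qed

lemma norm_\<sigma>_W: "x \<in> U \<Longrightarrow> (norm (\<sigma> k x))^2 \<le> 9 * W x"
proof -
  assume x: "x \<in> U"
  have 3: "(norm (a + b - c))^2 \<le> 3 * ((norm a)^2 + (norm b)^2 + (norm c)^2)" for a b c :: "real^3"
  proof -
    have "norm (a + b - c) \<le> norm a + norm b + norm c" by norm
    then have "(norm (a + b - c))^2 \<le> (norm a + norm b + norm c)^2" by (rule power_mono) simp
    also have "\<dots> \<le> 3 * ((norm a)^2 + (norm b)^2 + (norm c)^2)"
      using sum_squares_bound[of "norm a" "norm b"] sum_squares_bound[of "norm a" "norm c"] sum_squares_bound[of "norm b" "norm c"]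
      by (simp add: power2_eq_square algebra_simps)
    finally show ?thesis .
  qed
  have a: "(norm (du k x))^2 \<le> W x" using norm_du_W[OF x] .
  have b: "(norm (\<chi> a. du a x $ k))^2 \<le> W x"
  proof -
    have "(norm (\<chi> a. du a x $ k))^2 = (\<Sum>a\<in>UNIV. (du a x $ k)^2)"
      unfolding power2_norm_eq_inner inner_vec_def by (simp add: power2_eq_square)
    also have "\<dots> \<le> (\<Sum>a\<in>UNIV. (norm (du a x))^2)"
    proof (rule sum_mono)
      fix a show "(du a x $ k)^2 \<le> (norm (du a x))^2"
        using power_mono[OF component_le_norm_cart[of "du a x" k], of 2] by simp
    qed
    also have "\<dots> \<le> W x" using x by (simp add: W_def)
    finally show ?thesis .
  qed
  have c: "(norm (p x *\<^sub>R axis k 1 :: real^3))^2 \<le> W x"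
    using x by (simp add: W_def sum_nonneg)
  show ?thesis unfolding \<sigma>_def sym_grad_def
  proof (rule order_trans[OF 3])
    have "3 * ((norm (du k x))\<^sup>2 + (norm (\<chi> a. du a x $ k))\<^sup>2 + (norm (p x *\<^sub>R axis k 1 :: real^3))\<^sup>2)
        \<le> 3 * (W x + W x + W x)"
      by (intro mult_left_mono add_mono a b c) simp
    then show "3 * ((norm (du k x))\<^sup>2 + (norm (\<chi> a. du a x $ k))\<^sup>2 + (norm (p x *\<^sub>R axis k 1 :: real^3))\<^sup>2)
        \<le> 9 * W x" by simp
  qed
qed

text \<open>The pressure is paired with the divergence alone and disappears for divergence-free
  fields.\<close>

lemma contr_\<sigma>: "contr \<sigma> d x = contr (sym_grad du) d x - p x * (\<Sum>k\<in>UNIV. d k x $ k)"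
  by (simp add: contr_def \<sigma>_def inner_diff_left sum_subtractf sum_distrib_left inner_axis' )

end

section \<open>The energy identity\<close>

lemma has_partials_cubic_step:
  assumes g: "has_partials g dg S"
  shows "has_partials (\<lambda>x. cubic_step (g x)) (\<lambda>k x. dg k x * cubic_step' (g x)) S"
proof (rule has_partialsI)
  fix x assume x: "x \<in> S"
  show "((\<lambda>x. cubic_step (g x)) has_derivative (\<lambda>h. (\<Sum>k\<in>UNIV. h $ k *\<^sub>R dg k x) * cubic_step' (g x))) (at x)"
    by (rule has_derivative_cubic_step(1)[OF has_partialsD[OF g x]])
  show "dg k x * cubic_step' (g x) = (\<Sum>ka\<in>UNIV. axis k 1 $ ka *\<^sub>R dg ka x) * cubic_step' (g x)" for k
    by (simp only: sum_axis)
qed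

lemma abs_inner_le_half: "\<bar>a \<bullet> b\<bar> \<le> ((norm a)^2 + (norm b)^2) / 2"
proof -
  have "\<bar>a \<bullet> b\<bar> \<le> norm a * norm b" by (rule Cauchy_Schwarz_ineq2)
  also have "\<dots> \<le> ((norm a)^2 + (norm b)^2) / 2"
    using sum_squares_bound[of "norm a" "norm b"] by simp
  finally show ?thesis .
qed

context stokes_flow
begin

lemma integrable_on_U:
  fixes f g :: "real^3 \<Rightarrow> real"
  assumes "continuous_on U f" "\<And>x. x \<in> U \<Longrightarrow> \<bar>f x\<bar> \<le> g x" "integrable lborel g" "\<And>x. 0 \<le> g x"
  shows "integrable lborel (\<lambda>x. indicator U x * f x)"
proof (rule Bochner_Integration.integrable_bound[OF assms(3)])
  show "(\<lambda>x. indicator U x * f x) \<in> borel_measurable lborel"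
    using borel_measurable_continuous_on_indicator[OF borel_open[OF open_U] assms(1)] by simp
  show "AE x in lborel. norm (indicator U x * f x) \<le> norm (g x)"
    by (rule AE_I2) (use assms(2,4) in \<open>auto simp: indicator_def intro: order_trans[OF _ abs_ge_self]\<close>)
qed

lemma abs_contr_\<sigma>_du: "x \<in> U \<Longrightarrow> \<bar>contr \<sigma> du x\<bar> \<le> 15 * W x"
proof -
  assume x: "x \<in> U"
  have "\<bar>\<sigma> k x \<bullet> du k x\<bar> \<le> 5 * W x" for k
    using abs_inner_le_half[of "\<sigma> k x" "du k x"] norm_\<sigma>_W[OF x, of k] norm_du_W[OF x, of k] by argo
  then have "(\<Sum>k\<in>UNIV. \<bar>\<sigma> k x \<bullet> du k x\<bar>) \<le> (\<Sum>k\<in>(UNIV::3 set). 5 * W x)" by (intro sum_mono)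
  then have "(\<Sum>k\<in>UNIV. \<bar>\<sigma> k x \<bullet> du k x\<bar>) \<le> 15 * W x" by simp
  then show ?thesis unfolding contr_def by (rule order_trans[OF sum_abs])
qed

lemma continuous_contr: "(\<And>k. continuous_on S (A k)) \<Longrightarrow> (\<And>k. continuous_on S (B k)) \<Longrightarrow> continuous_on S (contr A B)"
  unfolding contr_def by (intro continuous_intros)

text \<open>The test field is \<open>u\<close> itself, cut off where both \<open>x\<close> is far away and \<open>u\<close> is small; as \<open>u\<close> tends to
  zero this has bounded support, and its gradient is dominated by the one of \<open>u\<close>, so that no decay
  rate of \<open>u\<close> is needed.\<close>

theorem energy_identity: "(\<integral>x. indicator U x * contr \<sigma> du x \<partial>lborel) = (\<Sum>i<N. V i \<bullet> F)"
proof -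
  obtain n0 :: nat where n0: "n0 \<ge> 1" "\<And>i. i < N \<Longrightarrow> norm (X i) + 4 * R \<le> real n0"
    using exists_radius by blast
  define g where "g n x = (real n)^2 * (u x \<bullet> u x) - 1" for n :: nat and x
  define dg where "dg n k x = (real n)^2 * (u x \<bullet> du k x + du k x \<bullet> u x)" for n :: nat and k x
  \<comment> \<open>This equals one where |x| is at most n or n |u| is at least 2, and zero where
    |x| is at least 2 n and n |u| is at most 1.\<close>
  define \<theta> where "\<theta> n x = bigcut n x + (1 - bigcut n x) * cubic_step (g n x)" for n and x :: "real^3"
  define d\<theta> where "d\<theta> n k x = dbigcut n k x * (1 - cubic_step (g n x)) + (1 - bigcut n x) * (dg n k x * cubic_step' (g n x))" for n k and x :: "real^3"
  define \<Phi> where "\<Phi> n x = \<theta> n x *\<^sub>R u x" for n x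
  define d\<Phi> where "d\<Phi> n k x = \<theta> n x *\<^sub>R du k x + d\<theta> n k x *\<^sub>R u x" for n k x
  have hg: "has_partials (g n) (dg n) U" for n
  proof -
    have "has_partials (\<lambda>x. (real n)^2 *\<^sub>R (u x \<bullet> u x) - 1) (\<lambda>k x. (real n)^2 *\<^sub>R (u x \<bullet> du k x + du k x \<bullet> u x) - 0) U"
      by (intro has_partials_diff has_partials_const has_partials_linear[OF bounded_linear_scaleR_right] has_partials_inner u_partials)
    then show ?thesis by (simp add: g_def[abs_def] dg_def[abs_def])
  qed
  have h\<theta>: "has_partials (\<theta> n) (d\<theta> n) U" for n
  proof -
    have "has_partials (\<lambda>x. bigcut n x + (1 - bigcut n x) *\<^sub>R cubic_step (g n x))
      (\<lambda>k x. dbigcut n k x + ((1 - bigcut n x) *\<^sub>R (dg n k x * cubic_step' (g n x)) + (0 - dbigcut n k x) *\<^sub>R cubic_step (g n x))) U"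
      by (intro has_partials_add has_partials_scaleR has_partials_diff has_partials_const bigcut_partials
          has_partials_cubic_step hg)
    then show ?thesis by (simp add: \<theta>_def[abs_def] d\<theta>_def[abs_def] algebra_simps)
  qed
  have h\<Phi>: "has_partials (\<Phi> n) (d\<Phi> n) U" for n
    unfolding \<Phi>_def[abs_def] d\<Phi>_def[abs_def] by (rule has_partials_scaleR[OF h\<theta> u_partials])
  note \<kappa> = bigcut_facts[OF order_trans[OF n0(1)]]
  have c\<Phi>: "continuous_on D (\<Phi> n)" and cd\<Phi>: "continuous_on D (d\<Phi> n k)" if n: "n \<ge> n0" for n k
    unfolding \<Phi>_def d\<Phi>_def \<theta>_def d\<theta>_def g_def dg_def
    by (intro continuous_intros continuous_u continuous_du \<kappa>(5,6)[OF n])+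
  have weak: "(\<integral>x. indicator U x * contr \<sigma> (d\<Phi> n) x \<partial>lborel) = (\<Sum>i<N. V i \<bullet> F)" if n: "n \<ge> n0" for n
  proof -
    have "\<forall>\<^sub>F x in at_infinity. dist (u x) 0 < 1 / real n"
      using u_vanishes n n0 by (intro tendstoD) auto
    then obtain b where b: "\<And>x. norm x \<ge> b \<Longrightarrow> norm (u x) < 1 / real n"
      unfolding eventually_at_infinity by auto
    show ?thesis
    proof (rule weak_formulation[OF c\<Phi>[OF n] h\<Phi> cd\<Phi>[OF n], where B="max (2 * real n) b"])
      fix x :: "real^3" assume x: "norm x > max (2 * real n) b"
      have "bigcut n x = 0" by (rule \<kappa>(2)[OF n]) (use x in simp)
      moreover have "g n x \<le> 0"
      proof -
        have "norm (u x) * real n < 1" using b[of x] x n n0 by (simp add: pos_less_divide_eq)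
        then have "(norm (u x) * real n)^2 \<le> 1" by (simp add: power_le_one)
        then show ?thesis by (simp add: g_def power2_norm_eq_inner[symmetric] power_mult_distrib mult.commute)
      qed
      ultimately show "\<Phi> n x = 0" by (simp add: \<Phi>_def \<theta>_def cubic_step_eq_0)
    next
      fix i and x :: "real^3" assume i: "i < N" and x: "x \<in> sphere (X i) R"
      have "norm x \<le> norm (X i) + R"
        using x norm_triangle_ineq[of "X i" "x - X i"] by (simp add: dist_norm norm_minus_commute)
      then have "norm x \<le> real n" using n0(2)[OF i] n R_pos by linarith
      then have "bigcut n x = 1" by (rule \<kappa>(1)[OF n])
      then show "\<Phi> n x = V i + cross3 (\<Omega> i) (x - X i)"
        using u_rigid[OF i x] by (simp add: \<Phi>_def \<theta>_def)
    qed
  qed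
  \<comment> \<open>The constants collect the errors below: 15 from replacing the factor
    \<open>\<theta>\<close> by one and three times 9/2 + 40 from its derivatives, rounded up to 150;
    and three times 32.\<close>
  define bnd where "bnd n x = indicator {x. real n \<le> norm x} x * (150 * W x)
       + indicator (cball 0 (2 * real n)) x * ((96 / real n) / real n ^ 3)" for n :: nat and x :: "real^3"
  have close: "\<bar>contr \<sigma> (d\<Phi> n) x - contr \<sigma> du x\<bar> \<le> bnd n x" if n: "n \<ge> n0" and x: "x \<in> U" for n x
  proof (cases "real n \<le> norm x")
    case False
    then have "norm x \<le> real n" by simp
    then have "bigcut n x = 1" "\<And>k. dbigcut n k x = 0" using \<kappa>(1,3)[OF n] by blast+
    then have "d\<Phi> n k x = du k x" for k by (simp add: d\<Phi>_def \<theta>_def d\<theta>_def)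
    then show ?thesis by (simp add: contr_def bnd_def W_nonneg)
  next
    case True
    define \<tau> where "\<tau> = (if norm x \<le> 2 * real n then 32 / real n ^ 4 else 0)"
    have \<theta>01: "\<bar>\<theta> n x - 1\<bar> \<le> 1"
    proof -
      have "\<theta> n x - 1 = - ((1 - bigcut n x) * (1 - cubic_step (g n x)))" by (simp add: \<theta>_def algebra_simps)
      moreover have "\<bar>1 - bigcut n x\<bar> \<le> 1" by (rule bigcut_close)
      moreover have "\<bar>1 - cubic_step (g n x)\<bar> \<le> 1" using cubic_step_bounds[of "g n x"] by linarith
      ultimately show ?thesis using mult_mono[of "\<bar>1 - bigcut n x\<bar>" 1 "\<bar>1 - cubic_step (g n x)\<bar>" 1] by (simp add: abs_mult)
    qed
    have u4: "g n x < 3 \<Longrightarrow> (real n * norm (u x))^2 \<le> 4"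
      by (simp add: g_def power_mult_distrib power2_norm_eq_inner)
    \<comment> \<open>Where this term is nonzero, |u| is at most 2 / n, and the derivative of the
      big cutoff is at most 4 / n. Young's inequality leaves a multiple of n^(-4), which beats the
      volume n^3.\<close>
    have t1: "\<bar>dbigcut n k x * (1 - cubic_step (g n x)) * (\<sigma> k x \<bullet> u x)\<bar> \<le> \<tau> + 9 / 2 * W x" for k
    proof (cases "norm x \<le> 2 * real n \<and> g n x < 3")
      case False
      then consider "\<not> norm x \<le> 2 * real n" | "\<not> g n x < 3" by blast
      then have "dbigcut n k x * (1 - cubic_step (g n x)) = 0"
      proof cases
        case 1
        then show ?thesis using \<kappa>(3)[OF n, of x k] by simp
      qed (simp add: cubic_step_eq_1)
      then show ?thesis using W_nonneg[of x] by (auto simp: \<tau>_def)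
    next
      case True
      have n1: "real n > 0" using n n0 by simp
      have a: "\<bar>dbigcut n k x\<bar> \<le> 4 / real n" by (rule \<kappa>(4)[OF n])
      have b: "\<bar>1 - cubic_step (g n x)\<bar> \<le> 1" using cubic_step_bounds[of "g n x"] by linarith
      have "(real n * norm (u x))^2 \<le> 2^2" using u4 True by simp
      then have "real n * norm (u x) \<le> 2" by (rule power2_le_imp_le) simp
      then have c: "norm (u x) \<le> 2 / real n" using n1 by (simp add: pos_le_divide_eq mult.commute)
      have "\<bar>\<sigma> k x \<bullet> u x\<bar> \<le> norm (\<sigma> k x) * (2 / real n)"
        by (rule order_trans[OF Cauchy_Schwarz_ineq2]) (intro mult_left_mono c norm_ge_zero)
      then have "\<bar>dbigcut n k x * (1 - cubic_step (g n x)) * (\<sigma> k x \<bullet> u x)\<bar> \<le> (4 / real n * 1) * (norm (\<sigma> k x) * (2 / real n))"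
        unfolding abs_mult using a b n1 by (intro mult_mono) auto
      also have "\<dots> = (8 / (real n)^2) * norm (\<sigma> k x)" by (simp add: power2_eq_square)
      also have "\<dots> \<le> ((8 / (real n)^2)^2 + (norm (\<sigma> k x))^2) / 2"
        using sum_squares_bound[of "8 / (real n)^2" "norm (\<sigma> k x)"] by simp
      also have "\<dots> \<le> 32 / real n ^ 4 + 9 / 2 * W x"
      proof -
        have "(8 / (real n)^2)^2 = 64 / real n ^ 4" by (simp add: power_divide power_mult[symmetric])
        then show ?thesis using norm_\<sigma>_W[OF x, of k] by simp
      qed
      finally show ?thesis using True by (simp add: \<tau>_def)
    qed
    have t2: "\<bar>(1 - bigcut n x) * (dg n k x * cubic_step' (g n x)) * (\<sigma> k x \<bullet> u x)\<bar> \<le> 40 * W x" for k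
    proof (cases "g n x < 3")
      case False
      then show ?thesis using W_nonneg[of x] by (simp add: cubic_step'_eq_0)
    next
      case True
      have a: "\<bar>1 - bigcut n x\<bar> \<le> 1" by (rule bigcut_close)
      have b: "\<bar>cubic_step' (g n x)\<bar> \<le> 1" using cubic_step'_bounds[of "g n x"] by linarith
      have "\<bar>u x \<bullet> du k x\<bar> \<le> norm (u x) * norm (du k x)" by (rule Cauchy_Schwarz_ineq2)
      then have c: "\<bar>dg n k x\<bar> \<le> (real n)^2 * (2 * (norm (u x) * norm (du k x)))"
        unfolding dg_def by (simp add: abs_mult inner_commute mult_left_mono)
      have d: "\<bar>\<sigma> k x \<bullet> u x\<bar> \<le> norm (\<sigma> k x) * norm (u x)" by (rule Cauchy_Schwarz_ineq2)
      have "\<bar>(1 - bigcut n x) * (dg n k x * cubic_step' (g n x)) * (\<sigma> k x \<bullet> u x)\<bar>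
          \<le> (1 * ((real n)^2 * (2 * (norm (u x) * norm (du k x))) * 1)) * (norm (\<sigma> k x) * norm (u x))"
        unfolding abs_mult using a b c d by (intro mult_mono) auto
      also have "\<dots> = (real n * norm (u x))^2 * (2 * (norm (\<sigma> k x) * norm (du k x)))"
        by (simp add: power2_eq_square)
      also have "\<dots> \<le> 4 * (2 * (norm (\<sigma> k x) * norm (du k x)))"
        by (intro mult_right_mono u4 True) auto
      also have "\<dots> \<le> 4 * ((norm (\<sigma> k x))^2 + (norm (du k x))^2)"
        using sum_squares_bound[of "norm (\<sigma> k x)" "norm (du k x)"] by simp
      also have "\<dots> \<le> 40 * W x" using norm_\<sigma>_W[OF x, of k] norm_du_W[OF x, of k] by simp
      finally show ?thesis .
    qed
    have eq: "contr \<sigma> (d\<Phi> n) x - contr \<sigma> du x = (\<theta> n x - 1) * contr \<sigma> du x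
       + (\<Sum>k\<in>UNIV. dbigcut n k x * (1 - cubic_step (g n x)) * (\<sigma> k x \<bullet> u x)
          + (1 - bigcut n x) * (dg n k x * cubic_step' (g n x)) * (\<sigma> k x \<bullet> u x))"
      unfolding contr_def d\<Phi>_def d\<theta>_def sum_3 by (simp add: inner_add_right algebra_simps)
    have "\<bar>contr \<sigma> (d\<Phi> n) x - contr \<sigma> du x\<bar> \<le> 1 * (15 * W x) + (\<Sum>k\<in>(UNIV::3 set). (\<tau> + 9 / 2 * W x) + 40 * W x)"
    proof -
      have "\<bar>(\<theta> n x - 1) * contr \<sigma> du x\<bar> \<le> 1 * (15 * W x)"
        unfolding abs_mult by (rule mult_mono[OF \<theta>01 abs_contr_\<sigma>_du[OF x]]) simp_all
      moreover have "\<bar>\<Sum>k\<in>UNIV. dbigcut n k x * (1 - cubic_step (g n x)) * (\<sigma> k x \<bullet> u x)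
          + (1 - bigcut n x) * (dg n k x * cubic_step' (g n x)) * (\<sigma> k x \<bullet> u x)\<bar>
          \<le> (\<Sum>k\<in>(UNIV::3 set). (\<tau> + 9 / 2 * W x) + 40 * W x)"
        by (rule order_trans[OF sum_abs], rule sum_mono, rule order_trans[OF abs_triangle_ineq], rule add_mono[OF t1 t2])
      ultimately show ?thesis unfolding eq by (rule order_trans[OF abs_triangle_ineq add_mono])
    qed
    also have "\<dots> \<le> bnd n x"
    proof -
      have n1: "real n > 0" using n n0 by simp
      have "(\<tau> :: real) = indicator (cball 0 (2 * real n)) x * (32 / real n ^ 4)"
        by (simp add: \<tau>_def indicator_def)
      moreover have "96 / real n / real n ^ 3 = 3 * (32 / real n ^ 4)" using n1 by (simp add: eval_nat_numeral)
      moreover have "indicator {x. real n \<le> norm x} x = (1::real)" using True by simp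
      ultimately show ?thesis using W_nonneg[of x] unfolding bnd_def by (simp add: algebra_simps)
    qed
    finally show ?thesis .
  qed
  have ih: "integrable lborel (\<lambda>x. indicator U x * contr \<sigma> du x)"
    by (rule integrable_on_U[where g="\<lambda>x. 15 * W x"])
       (use abs_contr_\<sigma>_du integrable_W W_nonneg in \<open>auto intro!: continuous_contr continuous_on_subset[OF continuous_\<sigma> U_subset_D] continuous_on_subset[OF continuous_du U_subset_D]\<close>)
  have ib: "integrable lborel (bnd n)" for n
  proof -
    have "closed {x::real^3. real n \<le> norm x}" by (intro closed_Collect_le continuous_intros)
    then have i1: "integrable lborel (\<lambda>x. indicator {x. real n \<le> norm x} x * (150 * W x))"
      using integrable_mult_indicator[of "{x. real n \<le> norm x}" lborel "\<lambda>x. 150 * W x"] integrable_W by simp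
    have i2: "integrable lborel (\<lambda>x. indicator (cball (0::real^3) (2 * real n)) x * ((96 / real n) / real n ^ 3))"
      using borel_integrable_compact[OF compact_cball[of "0::real^3" "2 * real n"], of "\<lambda>_. (96 / real n) / real n ^ 3"] by simp
    show ?thesis unfolding bnd_def using i1 i2 by (rule Bochner_Integration.integrable_add)
  qed
  have bnd0: "0 \<le> bnd n x" for n x unfolding bnd_def using W_nonneg[of x] by simp
  have ig: "integrable lborel (\<lambda>x. indicator U x * contr \<sigma> (d\<Phi> n) x)" if n: "n \<ge> n0" for n
  proof (rule integrable_on_U[where g="\<lambda>x. bnd n x + 15 * W x"])
    show "continuous_on U (contr \<sigma> (d\<Phi> n))"
      by (intro continuous_contr continuous_on_subset[OF continuous_\<sigma> U_subset_D] continuous_on_subset[OF cd\<Phi>[OF n] U_subset_D])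
    show "\<bar>contr \<sigma> (d\<Phi> n) x\<bar> \<le> bnd n x + 15 * W x" if "x \<in> U" for x
      using close[OF n that] abs_contr_\<sigma>_du[OF that] by linarith
    show "integrable lborel (\<lambda>x. bnd n x + 15 * W x)" using ib integrable_W by simp
    show "0 \<le> bnd n x + 15 * W x" for x using bnd0[of n x] W_nonneg[of x] by linarith
  qed
  \<comment> \<open>The value zero for small n is a dummy, as \<open>integral_close_limit\<close>
    asks for integrability at every n.\<close>
  define G where "G n x = (if n \<ge> n0 then indicator U x * contr \<sigma> (d\<Phi> n) x else 0)" for n x
  have "(\<lambda>n. (\<integral>x. G n x \<partial>lborel) - (\<integral>x. indicator U x * contr \<sigma> du x \<partial>lborel)) \<longlonglongrightarrow> 0"
  proof (rule integral_close_limit[where W="\<lambda>x. 150 * W x" and C="\<lambda>n. 96 / real n" and ?n0.0=n0])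
    show "integrable lborel (G n)" for n unfolding G_def using ig by (cases "n \<ge> n0") auto
    show "integrable lborel (\<lambda>x. 150 * W x)" using integrable_W by simp
    show "(\<lambda>n. 96 / real n) \<longlonglongrightarrow> 0"
      using tendsto_mult_right_zero[OF lim_1_over_n, of 96] by simp
    show "\<bar>G n x - indicator U x * contr \<sigma> du x\<bar> \<le> indicator {x. real n \<le> norm x} x * (150 * W x)
       + indicator (cball 0 (2 * real n)) x * ((96 / real n) / real n ^ 3)" if n: "n0 \<le> n" for n x
      using close[OF n, of x] bnd0[of n x] n unfolding bnd_def by (cases "x \<in> U") (auto simp: G_def)
  qed (rule ih)
  moreover have "\<forall>\<^sub>F n in sequentially. (\<integral>x. G n x \<partial>lborel) - (\<integral>x. indicator U x * contr \<sigma> du x \<partial>lborel)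
      = (\<Sum>i<N. V i \<bullet> F) - (\<integral>x. indicator U x * contr \<sigma> du x \<partial>lborel)"
    by (rule eventually_sequentiallyI[of n0]) (simp add: G_def weak)
  ultimately have "(\<lambda>n. (\<Sum>i<N. V i \<bullet> F) - (\<integral>x. indicator U x * contr \<sigma> du x \<partial>lborel)) \<longlonglongrightarrow> 0"
    by (rule Lim_transform_eventually)
  then show ?thesis by (simp add: LIMSEQ_const_iff)
qed

end

section \<open>The flow around a single sphere\<close>

lemma has_partials_shift:
  assumes "has_partials f d S"
  shows "has_partials (\<lambda>x. f (x - c)) (\<lambda>k x. d k (x - c)) {x. x - c \<in> S}"
  unfolding has_partials_def
proof
  fix x assume "x \<in> {x. x - c \<in> S}"
  then have *: "(f has_derivative (\<lambda>h. \<Sum>k\<in>UNIV. h $ k *\<^sub>R d k (x - c))) (at (x - c))"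
    using has_partialsD[OF assms] by blast
  have "((\<lambda>x. x - c) has_derivative (\<lambda>h. h)) (at x)" by (auto intro!: derivative_eq_intros)
  from has_derivative_compose[OF this *]
  show "((\<lambda>x. f (x - c)) has_derivative (\<lambda>h. \<Sum>k\<in>UNIV. h $ k *\<^sub>R d k (x - c))) (at x)" .
qed

lemma has_partials_id: "has_partials (\<lambda>x. x) (\<lambda>k x. axis k 1) S"
  by (rule has_partialsI[where f'="\<lambda>x h. h"]) (auto intro!: derivative_eq_intros)

definition rinv :: "real^3 \<Rightarrow> real" where "rinv y = inverse (norm y)"

text \<open>The relation that ties \<open>rinv y\<close> to the coordinates. Modulo it the curl,
  divergence and traction formulas below become polynomial identities, which \<open>algebra\<close>
  settles.\<close>

lemma rinv_sq: "y \<noteq> 0 \<Longrightarrow> (rinv y)^2 * ((y$1)^2 + (y$2)^2 + (y$3)^2) = 1"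
proof -
  assume "y \<noteq> 0"
  have "(y$1)^2 + (y$2)^2 + (y$3)^2 = (norm y)^2"
    unfolding power2_norm_eq_inner inner_vec_def by (simp add: sum_3 power2_eq_square)
  then show ?thesis using \<open>y \<noteq> 0\<close> by (simp add: rinv_def power_inverse)
qed

lemma has_partials_rinv: "has_partials rinv (\<lambda>k y. - (y $ k * rinv y ^ 3)) (- {0})"
proof (rule has_partialsI)
  fix y :: "real^3" assume y: "y \<in> - {0}"
  have "(norm has_derivative (\<lambda>h. h \<bullet> sgn y)) (at y)"
    using has_derivative_norm[of y] y by auto
  from Deriv.has_derivative_inverse[OF _ this] y
  show "(rinv has_derivative (\<lambda>h. - (inverse (norm y) * (h \<bullet> sgn y) * inverse (norm y)))) (at y)"
    unfolding rinv_def[abs_def] by auto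
  show "- (y $ k * rinv y ^ 3) = - (inverse (norm y) * (axis k 1 \<bullet> sgn y) * inverse (norm y))" for k
    by (simp add: rinv_def sgn_div_norm inner_axis' power3_eq_cube divide_inverse)
qed

lemma has_partials_rinv_power:
  "has_partials (\<lambda>y. rinv y ^ j) (\<lambda>k y. - (real j * y $ k * rinv y ^ (j + 2))) (- {0})"
proof (induction j)
  case 0
  show ?case using has_partials_const[of 1] by simp
next
  case (Suc j)
  have "has_partials (\<lambda>y. rinv y *\<^sub>R rinv y ^ j)
     (\<lambda>k y. rinv y *\<^sub>R (- (real j * y $ k * rinv y ^ (j + 2))) + (- (y $ k * rinv y ^ 3)) *\<^sub>R rinv y ^ j) (- {0})"
    by (rule has_partials_scaleR[OF has_partials_rinv Suc])
  moreover have "rinv y *\<^sub>R (- (real j * y $ k * rinv y ^ (j + 2))) + (- (y $ k * rinv y ^ 3)) *\<^sub>R rinv y ^ j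
     = - (real (Suc j) * y $ k * rinv y ^ (Suc j + 2))" for k :: 3 and y
    by (simp add: algebra_simps power3_eq_cube)
  ultimately show ?case by simp
qed

text \<open>Every radial coefficient of the flow is a combination of two powers; the definitions
  below keep factors 1 or 0 and the exponent 0 so that this rule unifies.\<close>

lemma has_partials_rinv_comb:
  "has_partials (\<lambda>y. a * rinv y ^ i + b * rinv y ^ j)
     (\<lambda>k y. - (y $ k * (a * real i * rinv y ^ (i + 2) + b * real j * rinv y ^ (j + 2)))) (- {0})"
proof -
  have "has_partials (\<lambda>y. a *\<^sub>R rinv y ^ i + b *\<^sub>R rinv y ^ j)
     (\<lambda>k y. a *\<^sub>R (- (real i * y $ k * rinv y ^ (i + 2))) + b *\<^sub>R (- (real j * y $ k * rinv y ^ (j + 2)))) (- {0})"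
    by (intro has_partials_add has_partials_linear[OF bounded_linear_scaleR_right] has_partials_rinv_power)
  moreover have "a *\<^sub>R (- (real i * y $ k * rinv y ^ (i + 2))) + b *\<^sub>R (- (real j * y $ k * rinv y ^ (j + 2)))
     = - (y $ k * (a * real i * rinv y ^ (i + 2) + b * real j * rinv y ^ (j + 2)))" for k :: 3 and y :: "real^3"
    by (simp add: algebra_simps)
  ultimately show ?thesis by simp
qed

text \<open>The flow around a single sphere of radius \<open>R\<close> centred at the origin and pulled with force
  \<open>8 \<pi> e\<close>: velocity \<open>sphere_flow\<close>, a vector potential of it, and its stress tensor.\<close>

definition sphere_flow :: "real \<Rightarrow> real^3 \<Rightarrow> real^3 \<Rightarrow> real^3" where
  "sphere_flow R e y = (1 * rinv y ^ 1 + (R^2 / 3) * rinv y ^ 3) *\<^sub>R e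
     + (1 * rinv y ^ 3 + (- (R^2)) * rinv y ^ 5) *\<^sub>R ((e \<bullet> y) *\<^sub>R y)"

definition dsphere_flow :: "real \<Rightarrow> real^3 \<Rightarrow> 3 \<Rightarrow> real^3 \<Rightarrow> real^3" where
  "dsphere_flow R e k y = (- (y $ k * (rinv y ^ 3 + R^2 * rinv y ^ 5))) *\<^sub>R e
     + (rinv y ^ 3 - R^2 * rinv y ^ 5) *\<^sub>R (e $ k *\<^sub>R y + (e \<bullet> y) *\<^sub>R axis k 1)
     + (- (y $ k * (3 * rinv y ^ 5 - 5 * R^2 * rinv y ^ 7))) *\<^sub>R ((e \<bullet> y) *\<^sub>R y)"

definition flow_potential :: "real \<Rightarrow> real^3 \<Rightarrow> real^3 \<Rightarrow> real^3" where
  "flow_potential R e y = (1 * rinv y ^ 1 + (- (R^2) / 3) * rinv y ^ 3) *\<^sub>R cross3 e y"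

definition dflow_potential :: "real \<Rightarrow> real^3 \<Rightarrow> 3 \<Rightarrow> real^3 \<Rightarrow> real^3" where
  "dflow_potential R e k y = (1 * rinv y ^ 1 + (- (R^2) / 3) * rinv y ^ 3) *\<^sub>R cross3 e (axis k 1)
     + ((-1) * rinv y ^ 3 + R^2 * rinv y ^ 5) *\<^sub>R (y $ k *\<^sub>R cross3 e y)"

definition ddflow_potential :: "real \<Rightarrow> real^3 \<Rightarrow> 3 \<Rightarrow> 3 \<Rightarrow> real^3 \<Rightarrow> real^3" where
  "ddflow_potential R e k l y =
     ((-1) * rinv y ^ 3 + R^2 * rinv y ^ 5) *\<^sub>R
        (y $ l *\<^sub>R cross3 e (axis k 1) + y $ k *\<^sub>R cross3 e (axis l 1) + axis l 1 $ k *\<^sub>R cross3 e y)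
     + (3 * rinv y ^ 5 - 5 * R^2 * rinv y ^ 7) *\<^sub>R ((y $ l * y $ k) *\<^sub>R cross3 e y)"

definition sphere_stress :: "real \<Rightarrow> real^3 \<Rightarrow> 3 \<Rightarrow> real^3 \<Rightarrow> real^3" where
  "sphere_stress R e k y = ((-6) * rinv y ^ 5 + (10 * R^2) * rinv y ^ 7) *\<^sub>R (((e \<bullet> y) * y $ k) *\<^sub>R y)
     + (0 * rinv y ^ 0 + (- 2 * R^2) * rinv y ^ 5) *\<^sub>R (y $ k *\<^sub>R e + e $ k *\<^sub>R y + (e \<bullet> y) *\<^sub>R axis k 1)"

definition curl_of :: "(3 \<Rightarrow> real^3 \<Rightarrow> real^3) \<Rightarrow> real^3 \<Rightarrow> real^3" where
  "curl_of d x = vector [d 2 x $ 3 - d 3 x $ 2, d 3 x $ 1 - d 1 x $ 3, d 1 x $ 2 - d 2 x $ 1]"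

lemma has_partials_inner_left: "has_partials (\<lambda>y. e \<bullet> y) (\<lambda>k y. e $ k) S"
  using has_partials_linear[OF bounded_linear_inner_right has_partials_id, of e S] by (simp add: inner_axis)

lemma has_partials_nth_id: "has_partials (\<lambda>y. y $ l) (\<lambda>k y. axis k 1 $ l) S"
  by (rule has_partials_nth[OF has_partials_id])

lemma bounded_linear_cross3: "bounded_linear (cross3 e)"
  using bilinear_conv_bounded_bilinear[of cross3] bilinear_cross bounded_bilinear.bounded_linear_right by blast

lemma has_partials_cross3: "has_partials (\<lambda>y. cross3 e y) (\<lambda>k y. cross3 e (axis k 1)) S"
  by (rule has_partials_linear[OF bounded_linear_cross3 has_partials_id])

lemma open_punctured: "open (- {0 :: real^3})" by (simp add: open_Compl)

lemma sphere_flow_partials: "has_partials (sphere_flow R e) (dsphere_flow R e) (- {0})"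
proof (rule has_partials_cong[OF _ open_punctured])
  show "has_partials (\<lambda>y. (1 * rinv y ^ 1 + (R^2 / 3) * rinv y ^ 3) *\<^sub>R e
     + (1 * rinv y ^ 3 + (- (R^2)) * rinv y ^ 5) *\<^sub>R ((e \<bullet> y) *\<^sub>R y))
    (\<lambda>k y. ((1 * rinv y ^ 1 + (R^2 / 3) * rinv y ^ 3) *\<^sub>R 0
        + (- (y $ k * (1 * real 1 * rinv y ^ (1 + 2) + R^2 / 3 * real 3 * rinv y ^ (3 + 2)))) *\<^sub>R e)
     + ((1 * rinv y ^ 3 + (- (R^2)) * rinv y ^ 5) *\<^sub>R ((e \<bullet> y) *\<^sub>R axis k 1 + e $ k *\<^sub>R y)
       + (- (y $ k * (1 * real 3 * rinv y ^ (3 + 2) + (- (R^2)) * real 5 * rinv y ^ (5 + 2)))) *\<^sub>R ((e \<bullet> y) *\<^sub>R y))) (- {0})"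
    by (intro has_partials_add has_partials_scaleR has_partials_rinv_comb has_partials_const has_partials_inner_left has_partials_id)
qed (auto simp: sphere_flow_def dsphere_flow_def power3_eq_cube algebra_simps)

lemma flow_potential_partials: "has_partials (flow_potential R e) (dflow_potential R e) (- {0})"
proof (rule has_partials_cong[OF _ open_punctured])
  show "has_partials (\<lambda>y. (1 * rinv y ^ 1 + (- (R^2) / 3) * rinv y ^ 3) *\<^sub>R cross3 e y)
    (\<lambda>k y. (1 * rinv y ^ 1 + (- (R^2) / 3) * rinv y ^ 3) *\<^sub>R cross3 e (axis k 1)
      + (- (y $ k * (1 * real 1 * rinv y ^ (1 + 2) + (- (R^2) / 3) * real 3 * rinv y ^ (3 + 2)))) *\<^sub>R cross3 e y) (- {0})"
    by (intro has_partials_scaleR has_partials_rinv_comb has_partials_cross3)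
qed (auto simp: flow_potential_def dflow_potential_def power3_eq_cube algebra_simps)

lemma dflow_potential_partials: "has_partials (dflow_potential R e k) (ddflow_potential R e k) (- {0})"
proof (rule has_partials_cong[OF _ open_punctured])
  show "has_partials (\<lambda>y. (1 * rinv y ^ 1 + (- (R^2) / 3) * rinv y ^ 3) *\<^sub>R cross3 e (axis k 1)
     + ((-1) * rinv y ^ 3 + R^2 * rinv y ^ 5) *\<^sub>R (y $ k *\<^sub>R cross3 e y))
    (\<lambda>l y. ((1 * rinv y ^ 1 + (- (R^2) / 3) * rinv y ^ 3) *\<^sub>R 0
        + (- (y $ l * (1 * real 1 * rinv y ^ (1 + 2) + (- (R^2) / 3) * real 3 * rinv y ^ (3 + 2)))) *\<^sub>R cross3 e (axis k 1))
     + (((-1) * rinv y ^ 3 + R^2 * rinv y ^ 5) *\<^sub>R (y $ k *\<^sub>R cross3 e (axis l 1) + axis l 1 $ k *\<^sub>R cross3 e y)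
       + (- (y $ l * ((-1) * real 3 * rinv y ^ (3 + 2) + R^2 * real 5 * rinv y ^ (5 + 2)))) *\<^sub>R (y $ k *\<^sub>R cross3 e y))) (- {0})"
    by (intro has_partials_add has_partials_scaleR has_partials_rinv_comb has_partials_const has_partials_nth_id has_partials_cross3)
qed (auto simp: dflow_potential_def ddflow_potential_def power3_eq_cube algebra_simps)

lemma curl_flow_potential: "y \<noteq> 0 \<Longrightarrow> curl_of (dflow_potential R e) y = sphere_flow R e y"
proof -
  assume "y \<noteq> 0"
  define m where "m = rinv y"
  have r: "m^2 * ((y$1)^2 + (y$2)^2 + (y$3)^2) = 1" using rinv_sq[OF \<open>y \<noteq> 0\<close>] by (simp add: m_def)
  show ?thesis
    unfolding curl_of_def dflow_potential_def sphere_flow_def vec_eq_iff forall_3 cross3_def inner_vec_def sum_3 m_def[symmetric]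
    apply (simp add: axis_def)
    using r by (intro conjI; algebra)
qed

lemma div_sphere_flow: "y \<noteq> 0 \<Longrightarrow> (\<Sum>k\<in>UNIV. dsphere_flow R e k y $ k) = 0"
proof -
  assume "y \<noteq> 0"
  define m where "m = rinv y"
  have r: "m^2 * ((y$1)^2 + (y$2)^2 + (y$3)^2) = 1" using rinv_sq[OF \<open>y \<noteq> 0\<close>] by (simp add: m_def)
  show ?thesis
    unfolding dsphere_flow_def inner_vec_def sum_3 m_def[symmetric]
    apply (simp add: axis_def)
    using r by algebra
qed

text \<open>This identifies the pressure of the flow as 2 (e . y) / |y|^3.\<close>

lemma sym_grad_sphere_flow:
  "y \<noteq> 0 \<Longrightarrow> sym_grad (dsphere_flow R e) k y = sphere_stress R e k y + (2 * (e \<bullet> y) * rinv y ^ 3) *\<^sub>R axis k 1"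
proof -
  assume "y \<noteq> 0"
  define m where "m = rinv y"
  show ?thesis
    unfolding sym_grad_def dsphere_flow_def sphere_stress_def m_def[symmetric]
    using exhaust_3[of k]
    by (auto simp: vec_eq_iff forall_3 inner_vec_def sum_3 axis_def algebra_simps)
qed

definition dsphere_stress :: "real \<Rightarrow> real^3 \<Rightarrow> 3 \<Rightarrow> 3 \<Rightarrow> real^3 \<Rightarrow> real^3" where
  "dsphere_stress R e k l y =
     (((-6) * rinv y ^ 5 + (10 * R^2) * rinv y ^ 7) *\<^sub>R
        (((e \<bullet> y) * y $ k) *\<^sub>R axis l 1 + ((e \<bullet> y) * axis l 1 $ k + e $ l * y $ k) *\<^sub>R y)
      + (- (y $ l * ((-6) * real 5 * rinv y ^ (5 + 2) + (10 * R^2) * real 7 * rinv y ^ (7 + 2)))) *\<^sub>R (((e \<bullet> y) * y $ k) *\<^sub>R y))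
    + ((0 * rinv y ^ 0 + (- 2 * R^2) * rinv y ^ 5) *\<^sub>R
        ((y $ k *\<^sub>R 0 + axis l 1 $ k *\<^sub>R e) + e $ k *\<^sub>R axis l 1 + ((e \<bullet> y) *\<^sub>R 0 + e $ l *\<^sub>R axis k 1))
      + (- (y $ l * (0 * real 0 * rinv y ^ (0 + 2) + (- 2 * R^2) * real 5 * rinv y ^ (5 + 2)))) *\<^sub>R
        (y $ k *\<^sub>R e + e $ k *\<^sub>R y + (e \<bullet> y) *\<^sub>R axis k 1))"

lemma sphere_stress_partials: "has_partials (sphere_stress R e k) (dsphere_stress R e k) (- {0})"
  unfolding sphere_stress_def[abs_def] dsphere_stress_def[abs_def]
  by (intro has_partials_add has_partials_scaleR has_partials_rinv_comb has_partials_const has_partials_nth_id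
      has_partials_inner_left has_partials_id has_partials_linear[OF bounded_linear_scaleR_right]
      has_partials_bilinear[OF bounded_bilinear_mult])

lemma div_sphere_stress: "y \<noteq> 0 \<Longrightarrow> (\<Sum>k\<in>UNIV. dsphere_stress R e k k y) = 0"
proof -
  assume "y \<noteq> 0"
  define m where "m = rinv y"
  have r: "m^2 * ((y$1)^2 + (y$2)^2 + (y$3)^2) = 1" using rinv_sq[OF \<open>y \<noteq> 0\<close>] by (simp add: m_def)
  show ?thesis
    unfolding dsphere_stress_def vec_eq_iff forall_3 inner_vec_def sum_3 m_def[symmetric]
    apply (simp add: axis_def)
    using r by (intro conjI; algebra)
qed

text \<open>The translating sphere has constant traction. Force and torque can then be read off: the
  area 4 \<pi> R^2 times 2 / R^2 gives 8 \<pi>.\<close>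

lemma sphere_stress_traction:
  assumes "R > 0" "norm y = R"
  shows "(\<Sum>k\<in>UNIV. y $ k *\<^sub>R sphere_stress R e k y) = (- 2 / R) *\<^sub>R e"
proof -
  define m where "m = rinv y"
  have "y \<noteq> 0" using assms by auto
  have m: "m * R = 1" using assms by (simp add: m_def rinv_def)
  have r: "m^2 * ((y$1)^2 + (y$2)^2 + (y$3)^2) = 1" using rinv_sq[OF \<open>y \<noteq> 0\<close>] by (simp add: m_def)
  have "(\<Sum>k\<in>UNIV. y $ k *\<^sub>R sphere_stress R e k y) = (- 2 * m) *\<^sub>R e"
    unfolding sphere_stress_def vec_eq_iff forall_3 inner_vec_def sum_3 m_def[symmetric]
    apply (simp add: axis_def)
    using r m by (intro conjI; algebra)
  then show ?thesis using m assms(1) by (simp add: m_def[symmetric] field_simps)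
qed

text \<open>In accordance with Stokes' law: 6 \<pi> R times the speed 4 / (3 R) is the force 8
  \<pi>.\<close>

lemma sphere_flow_on_sphere:
  assumes "R > 0" "norm y = R"
  shows "sphere_flow R e y = (4 / (3 * R)) *\<^sub>R e"
proof -
  define m where "m = rinv y"
  have m: "m = 1 / R" using assms by (simp add: m_def rinv_def divide_inverse)
  show ?thesis unfolding sphere_flow_def m_def[symmetric] m using assms(1)
    by (simp add: vec_eq_iff forall_3 field_simps eval_nat_numeral)
qed

lemma sphere_flow_even: "sphere_flow R e (- y) = sphere_flow R e y"
  by (simp add: sphere_flow_def rinv_def)

section \<open>Force and torque of a constant traction\<close>

lemma sphere_integral_const: "sphere_integral c R (\<lambda>x. v) = (4 * pi * R^2) *\<^sub>R v"
proof -
  have i: "(sin has_integral 2) {0..pi}"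
    using fundamental_theorem_of_calculus[of 0 pi "\<lambda>t. - cos t" sin]
    by (force intro!: derivative_eq_intros simp: has_real_derivative_iff_has_vector_derivative[symmetric])
  have "sphere_integral c R (\<lambda>x. v) = integral {0..pi} (\<lambda>\<theta>. sin \<theta> *\<^sub>R ((2 * pi * R^2) *\<^sub>R v))"
    unfolding sphere_integral_def by (simp add: mult_ac)
  also have "\<dots> = 2 *\<^sub>R ((2 * pi * R^2) *\<^sub>R v)"
    by (rule integral_unique has_integral_scaleR_left i)+
  finally show ?thesis by simp
qed

text \<open>By symmetry the position vector has mean zero: integration over the azimuth removes the
  horizontal components, the one over the polar angle the vertical component.\<close>

lemma sphere_integral_moment_const: "sphere_integral c R (\<lambda>x. cross3 (x - c) v) = 0"
proof -
  have ic: "(cos has_integral 0) {0..2 * pi}"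
    using fundamental_theorem_of_calculus[of 0 "2 * pi" sin cos]
    by (force intro!: derivative_eq_intros simp: has_real_derivative_iff_has_vector_derivative[symmetric])
  have isn: "(sin has_integral 0) {0..2 * pi}"
    using fundamental_theorem_of_calculus[of 0 "2 * pi" "\<lambda>t. - cos t" sin]
    by (force intro!: derivative_eq_intros simp: has_real_derivative_iff_has_vector_derivative[symmetric])
  have isc: "((\<lambda>t. sin t * cos t) has_integral 0) {0..pi}"
    using fundamental_theorem_of_calculus[of 0 pi "\<lambda>t. (sin t)^2 / 2" "\<lambda>t. sin t * cos t"]
    by (force intro!: derivative_eq_intros simp: has_real_derivative_iff_has_vector_derivative[symmetric])
  have exp: "(R^2 * sin \<theta>) *\<^sub>R cross3 (c + R *\<^sub>R sph \<theta> \<phi> - c) v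
     = cos \<phi> *\<^sub>R ((R^3 * (sin \<theta>)^2) *\<^sub>R cross3 (axis 1 1) v) + sin \<phi> *\<^sub>R ((R^3 * (sin \<theta>)^2) *\<^sub>R cross3 (axis 2 1) v)
       + (sin \<theta> * cos \<theta> * R^3) *\<^sub>R cross3 (axis 3 1) v" for \<theta> \<phi>
    by (simp add: sph_eq cross_add_left cross_mult_left scaleR_add_right power2_eq_square power3_eq_cube mult_ac)
  have inner: "integral {0..2 * pi} (\<lambda>\<phi>. (R^2 * sin \<theta>) *\<^sub>R cross3 (c + R *\<^sub>R sph \<theta> \<phi> - c) v)
      = (sin \<theta> * cos \<theta>) *\<^sub>R ((2 * pi * R^3) *\<^sub>R cross3 (axis 3 1) v)" for \<theta>
  proof -
    have "((\<lambda>\<phi>. (R^2 * sin \<theta>) *\<^sub>R cross3 (c + R *\<^sub>R sph \<theta> \<phi> - c) v) has_integral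
        (0 *\<^sub>R ((R^3 * (sin \<theta>)^2) *\<^sub>R cross3 (axis 1 1) v) + 0 *\<^sub>R ((R^3 * (sin \<theta>)^2) *\<^sub>R cross3 (axis 2 1) v)
         + (2 * pi - 0) *\<^sub>R ((sin \<theta> * cos \<theta> * R^3) *\<^sub>R cross3 (axis 3 1) v))) {0..2 * pi}"
      unfolding exp
      by (intro has_integral_add has_integral_scaleR_left ic isn has_integral_const_real[of _ 0 "2 * pi", simplified, THEN has_integral_eq_rhs]) simp_all
    from integral_unique[OF this] show ?thesis by (simp add: mult_ac)
  qed
  have "sphere_integral c R (\<lambda>x. cross3 (x - c) v)
      = integral {0..pi} (\<lambda>\<theta>. (sin \<theta> * cos \<theta>) *\<^sub>R ((2 * pi * R^3) *\<^sub>R cross3 (axis 3 1) v))"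
    unfolding sphere_integral_def sph_def[symmetric] inner ..
  also have "\<dots> = 0 *\<^sub>R ((2 * pi * R^3) *\<^sub>R cross3 (axis 3 1) v)"
    by (rule integral_unique has_integral_scaleR_left isc)+
  finally show ?thesis by simp
qed

section \<open>Scale invariant kernel bounds\<close>

text \<open>Kernels of homogeneity degree \<open>-j\<close> up to an admissible dependence on the radius \<open>R\<close>: they and
  their difference quotients obey the scale invariant bounds outside the ball of radius \<open>R\<close>,
  uniformly in \<open>R\<close>.\<close>

definition kern :: "nat \<Rightarrow> (real \<Rightarrow> real^3 \<Rightarrow> 'b::real_normed_vector) \<Rightarrow> bool" where
  "kern j f \<longleftrightarrow> (\<exists>C\<ge>0. \<forall>R>0. \<forall>x y. R \<le> norm x \<longrightarrow> R \<le> norm y \<longrightarrow>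
     norm (f R x) \<le> C / norm x ^ j \<and> norm (f R x - f R y) \<le> C * norm (x - y) / min (norm x) (norm y) ^ (j + 1))"

lemma kern_const: "kern 0 (\<lambda>R y. c)"
  unfolding kern_def by (rule exI[of _ "norm c"]) auto

lemma inverse_norm_diff:
  fixes x y :: "'a::real_normed_vector"
  assumes "x \<noteq> 0" "y \<noteq> 0"
  shows "\<bar>inverse (norm x) - inverse (norm y)\<bar> \<le> norm (x - y) / (norm x * norm y)"
proof -
  have "inverse (norm x) - inverse (norm y) = (norm y - norm x) / (norm x * norm y)"
    using assms by (simp add: field_simps)
  moreover have "\<bar>norm y - norm x\<bar> \<le> norm (x - y)"
    using norm_triangle_ineq3[of y x] by (simp add: norm_minus_commute)
  ultimately show ?thesis by (simp add: abs_div divide_right_mono)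
qed

lemma kern_rinv: "kern 1 (\<lambda>R. rinv)"
  unfolding kern_def
proof (intro exI[of _ 1] conjI allI impI)
  fix R :: real and x y :: "real^3" assume R: "0 < R" "R \<le> norm x" "R \<le> norm y"
  then have nz: "x \<noteq> 0" "y \<noteq> 0" by auto
  show "norm (rinv x) \<le> 1 / norm x ^ 1" by (simp add: rinv_def divide_inverse)
  have "min (norm x) (norm y) ^ (1 + 1) \<le> norm x * norm y"
    using mult_mono[of "min (norm x) (norm y)" "norm x" "min (norm x) (norm y)" "norm y"] by (simp add: power2_eq_square)
  moreover have "0 < min (norm x) (norm y) ^ (1 + 1)" using nz by simp
  ultimately have "norm (x - y) / (norm x * norm y) \<le> norm (x - y) / min (norm x) (norm y) ^ (1 + 1)"
    by (intro divide_left_mono) (use nz in auto)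
  then show "norm (rinv x - rinv y) \<le> 1 * norm (x - y) / min (norm x) (norm y) ^ (1 + 1)"
    using inverse_norm_diff[OF nz] unfolding rinv_def by simp
qed simp

text \<open>Since R is at most |y|, the radius counts as a factor of degree zero when divided by
  |y|. In this way the R^2 terms of the kernels share the degree of the leading term.\<close>

lemma kern_R_rinv: "kern 0 (\<lambda>R y. R * rinv y)"
  unfolding kern_def
proof (intro exI[of _ 1] conjI allI impI)
  fix R :: real and x y :: "real^3" assume R: "0 < R" "R \<le> norm x" "R \<le> norm y"
  then have nz: "x \<noteq> 0" "y \<noteq> 0" by auto
  show "norm (R * rinv x) \<le> 1 / norm x ^ 0" using R nz by (simp add: rinv_def divide_inverse[symmetric] abs_mult)
  have mm: "R * min (norm x) (norm y) \<le> norm x * norm y"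
  proof -
    have "R * min (norm x) (norm y) \<le> norm x * norm y"
      using R by (intro mult_mono) auto
    then show ?thesis .
  qed
  have p: "0 < min (norm x) (norm y)" "0 < norm x * norm y" using nz by auto
  have "norm (R * rinv x - R * rinv y) = R * \<bar>inverse (norm x) - inverse (norm y)\<bar>"
    using R by (simp add: rinv_def right_diff_distrib[symmetric] abs_mult)
  also have "\<dots> \<le> R * (norm (x - y) / (norm x * norm y))"
    using R by (intro mult_left_mono inverse_norm_diff nz) auto
  also have "\<dots> = norm (x - y) * (R / (norm x * norm y))" by simp
  also have "\<dots> \<le> norm (x - y) * (1 / min (norm x) (norm y))"
    by (intro mult_left_mono) (use mm p in \<open>simp_all add: field_simps\<close>)
  finally show "norm (R * rinv x - R * rinv y) \<le> 1 * norm (x - y) / min (norm x) (norm y) ^ (0 + 1)" by simp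
qed simp

lemma kern_unit: "kern 0 (\<lambda>R y. rinv y *\<^sub>R y)"
  unfolding kern_def
proof (intro exI[of _ 2] conjI allI impI)
  fix R :: real and x y :: "real^3" assume R: "0 < R" "R \<le> norm x" "R \<le> norm y"
  then have nz: "x \<noteq> 0" "y \<noteq> 0" by auto
  show "norm (rinv x *\<^sub>R x) \<le> 2 / norm x ^ 0" using nz by (simp add: rinv_def)
  have p: "0 < min (norm x) (norm y)" using nz by auto
  have "rinv x *\<^sub>R x - rinv y *\<^sub>R y = rinv x *\<^sub>R (x - y) + (rinv x - rinv y) *\<^sub>R y"
    by (simp add: algebra_simps)
  then have "norm (rinv x *\<^sub>R x - rinv y *\<^sub>R y) \<le> norm (x - y) / norm x + \<bar>rinv x - rinv y\<bar> * norm y"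
    using norm_triangle_ineq[of "rinv x *\<^sub>R (x - y)" "(rinv x - rinv y) *\<^sub>R y"] by (simp add: rinv_def divide_inverse mult.commute)
  also have "\<bar>rinv x - rinv y\<bar> * norm y \<le> norm (x - y) / (norm x * norm y) * norm y"
    unfolding rinv_def by (intro mult_right_mono inverse_norm_diff nz) auto
  also have "norm (x - y) / (norm x * norm y) * norm y = norm (x - y) / norm x" using nz by simp
  also have "norm (x - y) / norm x \<le> norm (x - y) / min (norm x) (norm y)"
    by (intro divide_left_mono) (use nz p in auto)
  finally show "norm (rinv x *\<^sub>R x - rinv y *\<^sub>R y) \<le> 2 * norm (x - y) / min (norm x) (norm y) ^ (0 + 1)"
    by simp
qed simp

text \<open>Degrees add, and differences follow the discrete product rule; the minimum of the norms
  bounds the value of one factor at x and of the other at y simultaneously.\<close>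

lemma kern_bilinear:
  assumes b: "bounded_bilinear b" and f: "kern i f" and g: "kern j g"
  shows "kern (i + j) (\<lambda>R y. b (f R y) (g R y))"
proof -
  obtain K where K: "0 \<le> K" "\<And>u v. norm (b u v) \<le> norm u * norm v * K"
    using bounded_bilinear.nonneg_bounded[OF b] by blast
  obtain C where C: "0 \<le> C" "\<And>R x y. R > 0 \<Longrightarrow> R \<le> norm x \<Longrightarrow> R \<le> norm y \<Longrightarrow>
     norm (f R x) \<le> C / norm x ^ i \<and> norm (f R x - f R y) \<le> C * norm (x - y) / min (norm x) (norm y) ^ (i + 1)"
    using f unfolding kern_def by blast
  obtain B where B: "0 \<le> B" "\<And>R x y. R > 0 \<Longrightarrow> R \<le> norm x \<Longrightarrow> R \<le> norm y \<Longrightarrow>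
     norm (g R x) \<le> B / norm x ^ j \<and> norm (g R x - g R y) \<le> B * norm (x - y) / min (norm x) (norm y) ^ (j + 1)"
    using g unfolding kern_def by blast
  show ?thesis unfolding kern_def
  proof (intro exI[of _ "2 * C * B * K"] conjI allI impI)
    show "0 \<le> 2 * C * B * K" using C B K by simp
    fix R :: real and x y :: "real^3" assume R: "0 < R" "R \<le> norm x" "R \<le> norm y"
    define \<mu> where "\<mu> = min (norm x) (norm y)"
    have \<mu>: "0 < \<mu>" "\<mu> \<le> norm x" "\<mu> \<le> norm y" using R by (auto simp: \<mu>_def)
    have "norm (b (f R x) (g R x)) \<le> (C / norm x ^ i) * (B / norm x ^ j) * K"
      by (rule order_trans[OF K(2)]) (intro mult_right_mono mult_mono; use C B K R in auto)
    also have "\<dots> = C * B * K / norm x ^ (i + j)" by (simp add: power_add)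
    also have "\<dots> \<le> 2 * C * B * K / norm x ^ (i + j)" using C B K by (intro divide_right_mono) auto
    finally show "norm (b (f R x) (g R x)) \<le> 2 * C * B * K / norm x ^ (i + j)" .
    have pw: "c / norm x ^ n \<le> c / \<mu> ^ n" "c / norm y ^ n \<le> c / \<mu> ^ n" if "0 \<le> c" for c n
      by (intro divide_left_mono power_mono zero_less_power mult_pos_pos; use \<mu> R that in auto)+
    have fx: "norm (f R x) \<le> C / \<mu> ^ i" using C(2)[OF R] pw(1)[OF C(1), of i] by auto
    have gy: "norm (g R y) \<le> B / \<mu> ^ j" using B(2)[OF R(1,3,2)] pw(2)[OF B(1), of j] by auto
    have df: "norm (f R x - f R y) \<le> C * norm (x - y) / \<mu> ^ (i + 1)" using C(2)[OF R] by (simp add: \<mu>_def)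
    have dg: "norm (g R x - g R y) \<le> B * norm (x - y) / \<mu> ^ (j + 1)" using B(2)[OF R] by (simp add: \<mu>_def)
    have "b (f R x) (g R x) - b (f R y) (g R y) = b (f R x) (g R x - g R y) + b (f R x - f R y) (g R y)"
      by (simp add: bounded_bilinear.diff_left[OF b] bounded_bilinear.diff_right[OF b])
    then have "norm (b (f R x) (g R x) - b (f R y) (g R y)) \<le> norm (b (f R x) (g R x - g R y)) + norm (b (f R x - f R y) (g R y))"
      by (simp only: norm_triangle_ineq)
    also have "\<dots> \<le> norm (f R x) * norm (g R x - g R y) * K + norm (f R x - f R y) * norm (g R y) * K"
      by (intro add_mono K(2))
    also have "\<dots> \<le> (C / \<mu> ^ i) * (B * norm (x - y) / \<mu> ^ (j + 1)) * K + (C * norm (x - y) / \<mu> ^ (i + 1)) * (B / \<mu> ^ j) * K"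
      by (intro add_mono mult_right_mono mult_mono fx gy df dg) (use C B K \<mu> in auto)
    also have "\<dots> = 2 * C * B * K * norm (x - y) / \<mu> ^ (i + j + 1)"
      using \<mu> by (simp add: power_add field_simps)
    finally show "norm (b (f R x) (g R x) - b (f R y) (g R y)) \<le> 2 * C * B * K * norm (x - y) / min (norm x) (norm y) ^ (i + j + 1)"
      by (simp add: \<mu>_def)
  qed
qed

lemma kern_add:
  assumes f: "kern j f" and g: "kern j g"
  shows "kern j (\<lambda>R y. f R y + g R y)"
proof -
  obtain C where C: "0 \<le> C" "\<And>R x y. R > 0 \<Longrightarrow> R \<le> norm x \<Longrightarrow> R \<le> norm y \<Longrightarrow>
     norm (f R x) \<le> C / norm x ^ j \<and> norm (f R x - f R y) \<le> C * norm (x - y) / min (norm x) (norm y) ^ (j + 1)"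
    using f unfolding kern_def by blast
  obtain B where B: "0 \<le> B" "\<And>R x y. R > 0 \<Longrightarrow> R \<le> norm x \<Longrightarrow> R \<le> norm y \<Longrightarrow>
     norm (g R x) \<le> B / norm x ^ j \<and> norm (g R x - g R y) \<le> B * norm (x - y) / min (norm x) (norm y) ^ (j + 1)"
    using g unfolding kern_def by blast
  show ?thesis unfolding kern_def
  proof (intro exI[of _ "C + B"] conjI allI impI)
    show "0 \<le> C + B" using C B by simp
    fix R :: real and x y :: "real^3" assume R: "0 < R" "R \<le> norm x" "R \<le> norm y"
    have "norm (f R x + g R x) \<le> C / norm x ^ j + B / norm x ^ j"
      by (rule norm_triangle_le, rule add_mono) (use C(2)[OF R] B(2)[OF R] in auto)
    then show "norm (f R x + g R x) \<le> (C + B) / norm x ^ j" by (simp add: add_divide_distrib)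
    have "norm ((f R x - f R y) + (g R x - g R y)) \<le> C * norm (x - y) / min (norm x) (norm y) ^ (j + 1) + B * norm (x - y) / min (norm x) (norm y) ^ (j + 1)"
      by (rule norm_triangle_le, rule add_mono) (use C(2)[OF R] B(2)[OF R] in auto)
    then show "norm (f R x + g R x - (f R y + g R y)) \<le> (C + B) * norm (x - y) / min (norm x) (norm y) ^ (j + 1)"
      by (simp add: add_divide_distrib distrib_right algebra_simps)
  qed
qed

lemmas kern_scaleR = kern_bilinear[OF bounded_bilinear_scaleR]
lemmas kern_mult = kern_bilinear[OF bounded_bilinear_mult]
lemmas kern_inner = kern_bilinear[OF bounded_bilinear_inner]

lemma kern_cross: "kern i f \<Longrightarrow> kern j g \<Longrightarrow> kern (i + j) (\<lambda>R y. cross3 (f R y) (g R y))"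
  by (rule kern_bilinear[OF bilinear_conv_bounded_bilinear[THEN iffD1, OF bilinear_cross]])

text \<open>Degree \<open>j + 0\<close> is simplified in advance, because a sum of degrees would not
  unify with a numeral goal.\<close>

lemma kern0_scaleR: "kern j f \<Longrightarrow> kern 0 g \<Longrightarrow> kern j (\<lambda>R y. f R y *\<^sub>R g R y)"
  and kern0_mult: "kern j f' \<Longrightarrow> kern 0 g' \<Longrightarrow> kern j (\<lambda>R y. f' R y * g' R y :: real)"
  and kern0_inner: "kern j g \<Longrightarrow> kern 0 h \<Longrightarrow> kern j (\<lambda>R y. g R y \<bullet> h R y)"
  and kern0_cross: "kern j a \<Longrightarrow> kern 0 b \<Longrightarrow> kern j (\<lambda>R y. cross3 (a R y) (b R y))"
  using kern_scaleR[of j f 0 g] kern_mult[of j f' 0 g'] kern_inner[of j g 0 h] kern_cross[of j a 0 b] by simp_all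

lemma kern_rinv2: "kern 2 (\<lambda>R y. rinv y * rinv y)"
  using kern_mult[OF kern_rinv kern_rinv] by (simp only: one_add_one)

lemma kern_unit_nth: "kern 0 (\<lambda>R y. rinv y * y $ k)"
  using kern_inner[OF kern_unit kern_const[of "axis k 1"]] by (simp add: inner_axis)

lemmas kern_intros = kern0_scaleR[OF kern_rinv] kern0_scaleR[OF kern_rinv2] kern_add kern_unit kern_R_rinv kern_unit_nth
  kern_const kern0_scaleR kern0_mult kern0_inner kern0_cross

lemma kern_cong: "kern j f \<Longrightarrow> i = j \<Longrightarrow> (\<And>R y. f R y = g R y) \<Longrightarrow> kern i g"
  by (metis (no_types, lifting) ext)

lemma kern_bound:
  assumes "kern j f"
  obtains C where "0 \<le> C" "\<And>R x. 0 < R \<Longrightarrow> R \<le> norm x \<Longrightarrow> norm (f R x) \<le> C / norm x ^ j"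
    "\<And>R x y. 0 < R \<Longrightarrow> R \<le> norm x \<Longrightarrow> R \<le> norm y \<Longrightarrow>
       norm (f R x - f R y) \<le> C * norm (x - y) / min (norm x) (norm y) ^ (j + 1)"
  using assms unfolding kern_def by (metis order_refl)

text \<open>One factor carries the degree; the rest is a polynomial in kernels of degree zero,
  \<open>R * rinv y\<close> and \<open>rinv y *\<^sub>R y\<close>. The next two kernels are treated
  alike.\<close>

lemma kern_sphere_flow: "kern 1 (\<lambda>R. sphere_flow R e)"
proof (rule kern_cong)
  show "kern 1 (\<lambda>R y. rinv y *\<^sub>R (e + ((1 / 3) * ((R * rinv y) * (R * rinv y))) *\<^sub>R e
     + ((1 + (-1) * ((R * rinv y) * (R * rinv y))) * (e \<bullet> (rinv y *\<^sub>R y))) *\<^sub>R (rinv y *\<^sub>R y)))"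
    by (intro kern_intros)
qed (simp_all add: sphere_flow_def algebra_simps eval_nat_numeral)

lemma kern_sphere_stress: "kern 2 (\<lambda>R. sphere_stress R e k)"
proof (rule kern_cong)
  show "kern 2 (\<lambda>R y. (rinv y * rinv y) *\<^sub>R (
      ((-6) + 10 * ((R * rinv y) * (R * rinv y))) *\<^sub>R (((e \<bullet> (rinv y *\<^sub>R y)) * (rinv y * y $ k)) *\<^sub>R (rinv y *\<^sub>R y))
     + ((-2) * ((R * rinv y) * (R * rinv y))) *\<^sub>R ((rinv y * y $ k) *\<^sub>R e + e $ k *\<^sub>R (rinv y *\<^sub>R y) + (e \<bullet> (rinv y *\<^sub>R y)) *\<^sub>R axis k 1)))"
    by (intro kern_intros)
qed (simp_all add: sphere_stress_def algebra_simps eval_nat_numeral)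

lemma kern_ddflow_potential: "kern 2 (\<lambda>R. ddflow_potential R e k l)"
proof (rule kern_cong)
  show "kern 2 (\<lambda>R y. (rinv y * rinv y) *\<^sub>R (
      ((-1) + (R * rinv y) * (R * rinv y)) *\<^sub>R ((rinv y * y $ l) *\<^sub>R cross3 e (axis k 1) + (rinv y * y $ k) *\<^sub>R cross3 e (axis l 1)
         + axis l 1 $ k *\<^sub>R cross3 e (rinv y *\<^sub>R y))
     + (3 + (-5) * ((R * rinv y) * (R * rinv y))) *\<^sub>R (((rinv y * y $ l) * (rinv y * y $ k)) *\<^sub>R cross3 e (rinv y *\<^sub>R y))))"
    by (intro kern_intros)
qed (simp_all add: ddflow_potential_def algebra_simps eval_nat_numeral cross_mult_right)

lemma norm_cross3_le: "norm (cross3 a b) \<le> norm a * norm b"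
proof (rule power2_le_imp_le)
  show "(norm (cross3 a b))^2 \<le> (norm a * norm b)^2" using norm_cross_dot[of a b] zero_le_power2[of "a \<bullet> b"] by linarith
qed simp

lemma norm_curl_of_le:
  assumes "\<And>k. norm (d k x) \<le> M"
  shows "norm (curl_of d x) \<le> 6 * M"
proof -
  have c: "\<bar>d k x $ l\<bar> \<le> M" for k l using component_le_norm_cart[of "d k x" l] assms[of k] by linarith
  have "norm (curl_of d x) \<le> (\<Sum>i\<in>UNIV. \<bar>curl_of d x $ i\<bar>)" by (rule norm_le_l1_cart)
  also have "\<dots> = \<bar>d 2 x $ 3 - d 3 x $ 2\<bar> + \<bar>d 3 x $ 1 - d 1 x $ 3\<bar> + \<bar>d 1 x $ 2 - d 2 x $ 1\<bar>"
    by (simp add: curl_of_def sum_3)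
  also have "\<dots> \<le> 6 * M"
    using c[of 2 3] c[of 3 2] c[of 3 1] c[of 1 3] c[of 1 2] c[of 2 1] by linarith
  finally show ?thesis .
qed

lemma curl_of_expand:
  "curl_of d x = cross3 (axis 1 1) (d 1 x) + cross3 (axis 2 1) (d 2 x) + cross3 (axis 3 1) (d 3 x)"
  by (simp add: curl_of_def cross3_def vec_eq_iff forall_3 axis_def)

lemma has_partials_cross:
  assumes "has_partials f df S" "has_partials g dg S"
  shows "has_partials (\<lambda>x. cross3 (f x) (g x)) (\<lambda>k x. cross3 (f x) (dg k x) + cross3 (df k x) (g x)) S"
  by (rule has_partials_bilinear[OF bilinear_conv_bounded_bilinear[THEN iffD1, OF bilinear_cross] assms])

lemma has_partials_curl_of:
  assumes "\<And>k. has_partials (d k) (dd k) S"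
  shows "has_partials (curl_of d) (\<lambda>l. curl_of (\<lambda>k. dd k l)) S"
  unfolding curl_of_expand[abs_def]
  by (intro has_partials_add has_partials_linear[OF bounded_linear_cross3] assms)

lemma continuous_on_curl_of:
  "(\<And>k. continuous_on S (d k)) \<Longrightarrow> continuous_on S (curl_of d)"
  unfolding curl_of_expand[abs_def] by (intro continuous_intros continuous_on_cross)

lemma has_partials_bound:
  fixes f :: "real^3 \<Rightarrow> real^3"
  assumes f: "has_partials f d S" and S: "convex S" "open S" and b: "\<And>k x. x \<in> S \<Longrightarrow> norm (d k x) \<le> M"
    and xy: "x \<in> S" "y \<in> S"
  shows "norm (f x - f y) \<le> 3 * M * norm (x - y)"
proof (rule differentiable_bound[OF S(1) _ _ xy])
  fix z assume z: "z \<in> S"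
  show "(f has_derivative (\<lambda>h. \<Sum>k\<in>UNIV. h $ k *\<^sub>R d k z)) (at z within S)"
    by (rule has_derivative_at_withinI[OF has_partialsD[OF f z]])
  show "onorm (\<lambda>h. \<Sum>k\<in>UNIV. h $ k *\<^sub>R d k z) \<le> 3 * M"
  proof (rule onorm_le)
    fix h :: "real^3"
    have "norm (\<Sum>k\<in>UNIV. h $ k *\<^sub>R d k z) \<le> (\<Sum>k\<in>(UNIV::3 set). norm h * M)"
      by (rule order_trans[OF norm_sum], rule sum_mono)
         (use b[OF z] component_le_norm_cart in \<open>auto intro!: mult_mono\<close>)
    then show "norm (\<Sum>k\<in>UNIV. h $ k *\<^sub>R d k z) \<le> 3 * M * norm h" by (simp add: mult_ac)
  qed
qed

section \<open>Divergence-free correctors\<close>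

text \<open>Divergence-free truncation: the curl of a cutoff times the first order Taylor remainder at \<open>c\<close>
  of the vector potential \<open>A\<close>. It equals \<open>curl A - (curl A) c\<close> near the ball of radius \<open>R\<close> around
  \<open>c\<close> and has support in a ball of comparable size.\<close>

definition taylor_rem :: "real^3 \<Rightarrow> (real^3 \<Rightarrow> real^3) \<Rightarrow> (3 \<Rightarrow> real^3 \<Rightarrow> real^3) \<Rightarrow> real^3 \<Rightarrow> real^3" where
  "taylor_rem c A dA x = A x - (A c + (\<Sum>k\<in>UNIV. (x - c) $ k *\<^sub>R dA k c))"

text \<open>The gradient of the cutoff divided by \<open>x - c\<close>; it is a function of the
  distance alone.\<close>

definition slope :: "real^3 \<Rightarrow> real \<Rightarrow> real^3 \<Rightarrow> real" where
  "slope c R x = (- 2 / R^2) * cubic_step' (((norm (x - c))^2 - 2 * R^2) / R^2)"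

definition dslope :: "real^3 \<Rightarrow> real \<Rightarrow> 3 \<Rightarrow> real^3 \<Rightarrow> real" where
  "dslope c R k x = (- 2 / R^2) * (2 * (x - c) $ k / R^2 * cubic_step'' (((norm (x - c))^2 - 2 * R^2) / R^2))"

text \<open>The product rule curl (cut B) = cut curl B + grad cut x B, with \<open>B\<close> the
  Taylor remainder. In this form the second derivatives of \<open>A\<close> suffice for one
  derivative of the corrector.\<close>

definition corrector :: "real \<Rightarrow> real^3 \<Rightarrow> (real^3 \<Rightarrow> real^3) \<Rightarrow> (3 \<Rightarrow> real^3 \<Rightarrow> real^3) \<Rightarrow> real^3 \<Rightarrow> real^3" where
  "corrector R c A dA x = cut c (2 * R^2) (R^2) x *\<^sub>R (curl_of dA x - curl_of dA c)
     + slope c R x *\<^sub>R cross3 (x - c) (taylor_rem c A dA x)"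

definition dcorrector ::
    "real \<Rightarrow> real^3 \<Rightarrow> (real^3 \<Rightarrow> real^3) \<Rightarrow> (3 \<Rightarrow> real^3 \<Rightarrow> real^3) \<Rightarrow> (3 \<Rightarrow> 3 \<Rightarrow> real^3 \<Rightarrow> real^3) \<Rightarrow> 3 \<Rightarrow> real^3 \<Rightarrow> real^3" where
  "dcorrector R c A dA ddA k x =
     cut c (2 * R^2) (R^2) x *\<^sub>R curl_of (\<lambda>i. ddA i k) x + dcut c (2 * R^2) (R^2) k x *\<^sub>R (curl_of dA x - curl_of dA c)
     + (slope c R x *\<^sub>R (cross3 (x - c) (dA k x - dA k c) + cross3 (axis k 1) (taylor_rem c A dA x))
        + dslope c R k x *\<^sub>R cross3 (x - c) (taylor_rem c A dA x))"

lemma dcut_slope: "R > 0 \<Longrightarrow> dcut c (2 * R^2) (R^2) k x = slope c R x * (x - c) $ k"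
  by (simp add: dcut_def slope_def)

lemma slope_partials: "has_partials (slope c R) (dslope c R) S"
proof (rule has_partialsI)
  fix x :: "real^3"
  show "(slope c R has_derivative (\<lambda>h. (- 2 / R^2) * ((2 * ((x - c) \<bullet> h) / R^2) * cubic_step'' (((norm (x - c))^2 - 2 * R^2) / R^2)))) (at x)"
    unfolding slope_def[abs_def]
    by (intro has_derivative_mult_right has_derivative_cubic_step(2) has_derivative_norm2)
  show "dslope c R k x = (- 2 / R^2) * ((2 * ((x - c) \<bullet> axis k 1) / R^2) * cubic_step'' (((norm (x - c))^2 - 2 * R^2) / R^2))" for k
    unfolding dslope_def by (simp add: inner_axis)
qed

text \<open>The squared radii of the transition are 2 R^2 and 2 R^2 + 3 R^2, so the support has
  radius \<surd>5 R, which lies between R and 4 R.\<close>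

lemma outer_zero:
  assumes "R > 0" "5 * R^2 \<le> (norm (x - c))^2"
  shows "cut c (2 * R^2) (R^2) x = 0" "dcut c (2 * R^2) (R^2) k x = 0" "slope c R x = 0" "dslope c R k x = 0"
proof -
  have "((norm (x - c))^2 - 2 * R^2) / R^2 \<ge> 3" using assms by (simp add: pos_le_divide_eq)
  then show "slope c R x = 0" "dslope c R k x = 0"
    by (simp_all add: slope_def dslope_def cubic_step'_eq_0 cubic_step''_eq_0)
  show "cut c (2 * R^2) (R^2) x = 0" "dcut c (2 * R^2) (R^2) k x = 0"
    using assms by (simp_all add: cut_eq_0 dcut_eq_0)
qed

lemma corrector_outside: "R > 0 \<Longrightarrow> 5 * R^2 \<le> (norm (x - c))^2 \<Longrightarrow> corrector R c A dA x = 0"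
  and dcorrector_outside: "R > 0 \<Longrightarrow> 5 * R^2 \<le> (norm (x - c))^2 \<Longrightarrow> dcorrector R c A dA ddA k x = 0"
  by (simp_all add: corrector_def dcorrector_def outer_zero)

lemma corrector_inside:
  assumes "R > 0" "(norm (x - c))^2 \<le> 2 * R^2"
  shows "corrector R c A dA x = curl_of dA x - curl_of dA c"
proof -
  have "((norm (x - c))^2 - 2 * R^2) / R^2 \<le> 0" using assms by (simp add: divide_nonpos_pos)
  then have "slope c R x = 0" by (simp add: slope_def cubic_step'_eq_0)
  moreover have "cut c (2 * R^2) (R^2) x = 1" using assms by (simp add: cut_eq_1)
  ultimately show ?thesis by (simp add: corrector_def)
qed

lemma taylor_rem_partials:
  assumes "has_partials A dA S"
  shows "has_partials (taylor_rem c A dA) (\<lambda>k x. dA k x - dA k c) S"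
proof -
  have "has_partials (\<lambda>x. A x - (A c + (\<Sum>j\<in>UNIV. (x - c) $ j *\<^sub>R dA j c)))
     (\<lambda>k x. dA k x - (0 + (\<Sum>j\<in>UNIV. axis k 1 $ j *\<^sub>R dA j c))) S"
  proof (intro has_partials_diff has_partials_add has_partials_const has_partials_sum assms)
    fix j
    have "has_partials (\<lambda>x. x $ j - c $ j) (\<lambda>k x. axis k 1 $ j - 0) S"
      by (intro has_partials_diff has_partials_nth_id has_partials_const)
    from has_partials_linear[OF bounded_linear_scaleR_left this, of "dA j c"]
    show "has_partials (\<lambda>x. (x - c) $ j *\<^sub>R dA j c) (\<lambda>k x. axis k 1 $ j *\<^sub>R dA j c) S" by simp
  qed
  then show ?thesis by (simp add: taylor_rem_def[abs_def])
qed

locale smooth_potential =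
  fixes R :: real and c :: "real^3" and A :: "real^3 \<Rightarrow> real^3" and dA :: "3 \<Rightarrow> real^3 \<Rightarrow> real^3"
    and ddA :: "3 \<Rightarrow> 3 \<Rightarrow> real^3 \<Rightarrow> real^3"
  assumes R_pos': "R > 0"
    and A: "has_partials A dA (ball c (4 * R))"
    and dA: "\<And>k. has_partials (dA k) (ddA k) (ball c (4 * R))"
    and cddA: "\<And>k l. continuous_on (ball c (4 * R)) (ddA k l)"
begin

lemma far_out: "x \<notin> ball c (4 * R) \<Longrightarrow> 5 * R^2 \<le> (norm (x - c))^2"
proof -
  assume "x \<notin> ball c (4 * R)"
  then have "4 * R \<le> norm (x - c)" by (simp add: dist_norm norm_minus_commute)
  then have "(4 * R)^2 \<le> (norm (x - c))^2" using R_pos' by (intro power_mono) auto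
  moreover have "5 * R^2 \<le> (4 * R)^2" by (simp add: power_mult_distrib)
  ultimately show ?thesis by linarith
qed

definition "K0 = {x. (norm (x - c))^2 \<le> 5 * R^2}"

lemma K0: "closed K0" "ball c (4 * R) \<union> - K0 = UNIV"
proof -
  show "closed K0" unfolding K0_def by (intro closed_Collect_le continuous_intros)
  have "x \<in> ball c (4 * R)" if "x \<in> K0" for x
  proof (rule ccontr)
    assume "\<not> ?thesis"
    then have "4 * R \<le> norm (x - c)" by (simp add: dist_norm norm_minus_commute)
    then have "(4 * R)^2 \<le> (norm (x - c))^2" using R_pos' by (intro power_mono) auto
    moreover have "(4 * R)^2 = 16 * R^2" by (simp add: power_mult_distrib)
    moreover have "(norm (x - c))^2 \<le> 5 * R^2" using that by (simp add: K0_def)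
    moreover have "0 < R^2" using R_pos' by simp
    ultimately show False by linarith
  qed
  then show "ball c (4 * R) \<union> - K0 = UNIV" by blast
qed

lemma corrector_partials: "has_partials (corrector R c A dA) (dcorrector R c A dA ddA) UNIV"
proof -
  have 1: "has_partials (corrector R c A dA) (dcorrector R c A dA ddA) (ball c (4 * R))"
  proof (rule has_partials_cong[OF _ open_ball])
    have z: "has_partials (\<lambda>x. x - c) (\<lambda>k x. axis k 1 - 0) S" for S
      by (intro has_partials_diff has_partials_id has_partials_const)
    show "has_partials (\<lambda>x. cut c (2 * R^2) (R^2) x *\<^sub>R (curl_of dA x - curl_of dA c)
       + slope c R x *\<^sub>R cross3 (x - c) (taylor_rem c A dA x))
      (\<lambda>k x. (cut c (2 * R^2) (R^2) x *\<^sub>R (curl_of (\<lambda>i. ddA i k) x - 0) + dcut c (2 * R^2) (R^2) k x *\<^sub>R (curl_of dA x - curl_of dA c))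
        + (slope c R x *\<^sub>R (cross3 (x - c) (dA k x - dA k c) + cross3 (axis k 1 - 0) (taylor_rem c A dA x))
          + dslope c R k x *\<^sub>R cross3 (x - c) (taylor_rem c A dA x))) (ball c (4 * R))"
      by (rule has_partials_add has_partials_scaleR has_partials_cut slope_partials has_partials_cross z
          has_partials_diff has_partials_const has_partials_curl_of dA taylor_rem_partials A)+
  qed (simp_all add: corrector_def dcorrector_def)
  have 2: "has_partials (corrector R c A dA) (dcorrector R c A dA ddA) (- K0)"
    by (rule has_partials_cong[OF has_partials_const[of 0]])
       (use K0 R_pos' in \<open>auto simp: K0_def intro!: corrector_outside dcorrector_outside\<close>)
  show ?thesis using has_partials_Un[OF 1 2] K0 by simp
qed

lemma continuous_dcorrector: "continuous_on UNIV (dcorrector R c A dA ddA k)"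
proof -
  have R2: "R^2 \<noteq> 0" using R_pos' by simp
  have 1: "continuous_on (ball c (4 * R)) (dcorrector R c A dA ddA k)"
    unfolding dcorrector_def slope_def dslope_def using R2
    by (intro continuous_intros continuous_cut continuous_dcut continuous_on_curl_of cddA continuous_on_cross
        has_partials_continuous_on[OF dA] has_partials_continuous_on[OF taylor_rem_partials[OF A]]) auto
  have 2: "continuous_on (- K0) (dcorrector R c A dA ddA k)"
    by (rule continuous_on_cong[THEN iffD1, rotated -1, OF continuous_on_const[of _ 0]])
       (use R_pos' in \<open>auto simp: K0_def intro!: dcorrector_outside[symmetric] dcorrector_outside\<close>)
  show ?thesis using continuous_on_open_Un[OF open_ball _ 1 2] K0 by (simp add: open_Compl)
qed

lemma div_curl: "x \<in> ball c (4 * R) \<Longrightarrow> (\<Sum>k\<in>UNIV. curl_of (\<lambda>i. ddA i k) x $ k) = 0"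
proof -
  assume x: "x \<in> ball c (4 * R)"
  have "ddA i j x $ k = ddA j i x $ k" for i j k
    by (rule mixed_partials_commute[OF open_ball has_partials_nth[OF A] has_partials_nth[OF dA] _ x])
       (intro continuous_intros cddA)
  then show ?thesis by (simp add: curl_of_def sum_3)
qed

text \<open>The corrector is a curl. In coordinates: the gradient of the cutoff against the curl
  difference cancels the divergence of the cross product, the derivative of \<open>slope\<close>
  meets a vector orthogonal to \<open>x - c\<close>, and mixed derivatives of \<open>A\<close>
  commute.\<close>

lemma div_corrector: "(\<Sum>k\<in>UNIV. dcorrector R c A dA ddA k x $ k) = 0"
proof (cases "x \<in> ball c (4 * R)")
  case False
  then show ?thesis using far_out R_pos' by (simp add: dcorrector_outside)
next
  case True
  define B where "B = taylor_rem c A dA x"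
  define s where "s = slope c R x"
  define t where "t = (- 2 / R^2) * (2 / R^2 * cubic_step'' (((norm (x - c))^2 - 2 * R^2) / R^2))"
  have "(\<Sum>k\<in>UNIV. dcorrector R c A dA ddA k x $ k) = cut c (2 * R^2) (R^2) x * (\<Sum>k\<in>UNIV. curl_of (\<lambda>i. ddA i k) x $ k)
     + (\<Sum>k\<in>UNIV. (s * (x - c) $ k) * (curl_of dA x - curl_of dA c) $ k
       + s * (cross3 (x - c) (dA k x - dA k c) + cross3 (axis k 1) B) $ k
       + t * (x - c) $ k * cross3 (x - c) B $ k)"
  proof -
    have ds: "dslope c R k x = t * (x - c) $ k" for k by (simp add: dslope_def t_def)
    show ?thesis unfolding dcorrector_def dcut_slope[OF R_pos'] B_def[symmetric] s_def[symmetric] ds sum_3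
      by (simp add: algebra_simps)
  qed
  also have "(\<Sum>k\<in>UNIV. (s * (x - c) $ k) * (curl_of dA x - curl_of dA c) $ k
       + s * (cross3 (x - c) (dA k x - dA k c) + cross3 (axis k 1) B) $ k
       + t * (x - c) $ k * cross3 (x - c) B $ k) = 0"
    unfolding curl_of_def cross3_def sum_3 by (simp add: axis_def algebra_simps)
  finally show ?thesis using div_curl[OF True] by simp
qed

text \<open>On the ball of radius 4 R the Taylor remainder is O(K R^2) and its gradient O(K R),
  while each derivative of the cutoff costs 1 / R; all powers of R cancel. The sum of the explicit
  constants is 10182.\<close>

lemma dcorrector_bound:
  assumes K: "\<And>k l x. x \<in> ball c (4 * R) \<Longrightarrow> norm (ddA k l x) \<le> K"
  shows "norm (dcorrector R c A dA ddA k x) \<le> 20000 * K"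
proof -
  have c: "c \<in> ball c (4 * R)" using R_pos' by simp
  have K0: "0 \<le> K" using K[OF c, of 1 1] norm_ge_zero order_trans by blast
  show ?thesis
  proof (cases "x \<in> ball c (4 * R)")
    case False
    then show ?thesis using far_out R_pos' K0 by (simp add: dcorrector_outside)
  next
    case True
    have z: "norm (x - c) \<le> 4 * R" using True by (simp add: dist_norm norm_minus_commute)
    have d: "norm (dA j y - dA j c) \<le> 12 * K * R" if y: "y \<in> ball c (4 * R)" for j y
    proof -
      have "norm (dA j y - dA j c) \<le> 3 * K * norm (y - c)"
        by (rule has_partials_bound[OF dA convex_ball open_ball K y c])
      also have "\<dots> \<le> 3 * K * (4 * R)"
        by (rule mult_left_mono) (use y K0 in \<open>auto simp: dist_norm norm_minus_commute\<close>)
      finally show ?thesis by simp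
    qed
    have B: "norm (taylor_rem c A dA x) \<le> 144 * K * R^2"
    proof -
      have "norm (taylor_rem c A dA x - taylor_rem c A dA c) \<le> 3 * (12 * K * R) * norm (x - c)"
        by (rule has_partials_bound[OF taylor_rem_partials[OF A] convex_ball open_ball d True c])
      also have "\<dots> \<le> 3 * (12 * K * R) * (4 * R)"
        by (rule mult_left_mono[OF z]) (use K0 R_pos' in auto)
      also have "taylor_rem c A dA c = 0" by (simp add: taylor_rem_def)
      finally show ?thesis by (simp add: power2_eq_square)
    qed
    have C: "norm (curl_of dA x - curl_of dA c) \<le> 72 * K * R"
    proof -
      have "curl_of dA x - curl_of dA c = curl_of (\<lambda>k x. dA k x - dA k c) x"
        by (simp add: curl_of_def vec_eq_iff forall_3)
      then show ?thesis using norm_curl_of_le[of "\<lambda>k x. dA k x - dA k c" x, OF d[OF True]] by simp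
    qed
    have dC: "norm (curl_of (\<lambda>i. ddA i k) x) \<le> 6 * K" by (rule norm_curl_of_le[where d="\<lambda>i. ddA i k", OF K[OF True]])
    have s: "\<bar>slope c R x\<bar> \<le> 2 / R^2"
      using cubic_step'_bounds[of "((norm (x - c))^2 - 2 * R^2) / R^2"] R_pos'
      by (simp add: slope_def abs_mult divide_right_mono)
    have dc: "\<bar>dcut c (2 * R^2) (R^2) k x\<bar> \<le> 8 / R"
    proof -
      have "\<bar>dcut c (2 * R^2) (R^2) k x\<bar> \<le> 2 * (4 * R) / R^2"
        by (rule abs_dcut_le) (use R_pos' in \<open>auto simp: power_mult_distrib\<close>)
      also have "2 * (4 * R) / R^2 = 8 / R" using R_pos' by (simp add: power2_eq_square)
      finally show ?thesis .
    qed
    have ds: "\<bar>dslope c R k x\<bar> \<le> 16 / R^3"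
    proof -
      have "\<bar>(x - c) $ k\<bar> \<le> 4 * R" using component_le_norm_cart[of "x - c" k] z by linarith
      then have "\<bar>(x - c) $ k\<bar> * \<bar>cubic_step'' (((norm (x - c))^2 - 2 * R^2) / R^2)\<bar> \<le> 4 * R * 1"
        using cubic_step''_bound R_pos' by (intro mult_mono) auto
      then have "(4 / R^4) * (\<bar>(x - c) $ k\<bar> * \<bar>cubic_step'' (((norm (x - c))^2 - 2 * R^2) / R^2)\<bar>) \<le> (4 / R^4) * (4 * R * 1)"
        using R_pos' by (intro mult_left_mono) auto
      moreover have "\<bar>dslope c R k x\<bar> = (4 / R^4) * (\<bar>(x - c) $ k\<bar> * \<bar>cubic_step'' (((norm (x - c))^2 - 2 * R^2) / R^2)\<bar>)"
      proof -
        have gen: "(- 2 / R^2) * (2 * v / R^2 * q) = - (4 / R^4) * (v * q)" for v q :: real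
          by (simp add: eval_nat_numeral)
        show ?thesis unfolding dslope_def gen using R_pos' by (simp add: abs_mult)
      qed
      moreover have "(4 / R^4) * (4 * R * 1) = 16 / R^3" using R_pos' by (simp add: eval_nat_numeral)
      ultimately show ?thesis by simp
    qed
    have cu: "\<bar>cut c (2 * R^2) (R^2) x\<bar> \<le> 1" using cut_bounds[of c "2 * R^2" "R^2" x] by linarith
    have cr1: "norm (cross3 (x - c) (dA k x - dA k c)) \<le> (4 * R) * (12 * K * R)"
      by (rule order_trans[OF norm_cross3_le]) (intro mult_mono z d True; use R_pos' in simp)
    have cr2: "norm (cross3 (axis k 1) (taylor_rem c A dA x)) \<le> 1 * (144 * K * R^2)"
      by (rule order_trans[OF norm_cross3_le]) (intro mult_mono B; simp)
    have cr3: "norm (cross3 (x - c) (taylor_rem c A dA x)) \<le> (4 * R) * (144 * K * R^2)"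
      by (rule order_trans[OF norm_cross3_le]) (intro mult_mono z B; use R_pos' in simp)
    have "norm (dcorrector R c A dA ddA k x) \<le> (1 * (6 * K) + (8 / R) * (72 * K * R))
       + ((2 / R^2) * ((4 * R) * (12 * K * R) + 1 * (144 * K * R^2)) + (16 / R^3) * ((4 * R) * (144 * K * R^2)))"
    proof -
      have 1: "norm (cut c (2 * R^2) (R^2) x *\<^sub>R curl_of (\<lambda>i. ddA i k) x) \<le> 1 * (6 * K)"
        unfolding norm_scaleR by (intro mult_mono cu dC) auto
      have 2: "norm (dcut c (2 * R^2) (R^2) k x *\<^sub>R (curl_of dA x - curl_of dA c)) \<le> (8 / R) * (72 * K * R)"
        unfolding norm_scaleR by (intro mult_mono dc C) (use R_pos' in auto)
      have 3: "norm (slope c R x *\<^sub>R (cross3 (x - c) (dA k x - dA k c) + cross3 (axis k 1) (taylor_rem c A dA x)))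
          \<le> (2 / R^2) * ((4 * R) * (12 * K * R) + 1 * (144 * K * R^2))"
        unfolding norm_scaleR by (intro mult_mono s norm_triangle_le add_mono cr1 cr2) (use R_pos' in auto)
      have 4: "norm (dslope c R k x *\<^sub>R cross3 (x - c) (taylor_rem c A dA x)) \<le> (16 / R^3) * ((4 * R) * (144 * K * R^2))"
        unfolding norm_scaleR by (intro mult_mono ds cr3) (use R_pos' in auto)
      show ?thesis unfolding dcorrector_def
        by (intro norm_triangle_le add_mono 1 2 3 4)
    qed
    also have "\<dots> = 10182 * K" using R_pos' by (simp add: field_simps eval_nat_numeral)
    also have "\<dots> \<le> 20000 * K" using K0 by simp
    finally show ?thesis .
  qed
qed

end

text \<open>Correctors are linear in the potential, so the bound for one corrector also applies to
  the difference of the correctors for two sources.\<close>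

lemma dcorrector_diff:
  "dcorrector R c A dA ddA k x - dcorrector R c A' dA' ddA' k x =
    dcorrector R c (\<lambda>x. A x - A' x) (\<lambda>k x. dA k x - dA' k x) (\<lambda>k l x. ddA k l x - ddA' k l x) k x"
proof -
  have c: "curl_of (\<lambda>k x. a k x - b k x) x = curl_of a x - curl_of b x" for a b :: "3 \<Rightarrow> real^3 \<Rightarrow> real^3" and x
    by (simp add: curl_of_def vec_eq_iff forall_3)
  have t: "taylor_rem c (\<lambda>x. A x - A' x) (\<lambda>k x. dA k x - dA' k x) x = taylor_rem c A dA x - taylor_rem c A' dA' x"
    by (simp add: taylor_rem_def sum_subtractf scaleR_diff_right)
  have m: "cross3 a (b - d) = cross3 a b - cross3 a d" for a b d by (simp add: cross3_simps)
  show ?thesis unfolding dcorrector_def c t m by (simp add: algebra_simps m)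
qed

section \<open>A formula for the velocities\<close>

text \<open>The supremum outside radius n serves as \<epsilon>. Truncation at 1 keeps it finite for
  small n; from the index m on the truncation has no effect.\<close>

lemma decay_sequence:
  fixes f :: "real^3 \<Rightarrow> real^3"
  assumes "(f \<longlongrightarrow> 0) at_infinity"
  obtains \<epsilon> :: "nat \<Rightarrow> real" and m :: nat
  where "\<epsilon> \<longlonglongrightarrow> 0" "\<And>n x. n \<ge> m \<Longrightarrow> real n \<le> norm x \<Longrightarrow> norm (f x) \<le> \<epsilon> n"
proof -
  define S where "S n = (\<lambda>x. min 1 (norm (f x))) ` {x. real n \<le> norm x}" for n :: nat
  define \<epsilon> where "\<epsilon> n = Sup (S n)" for n
  have bdd: "bdd_above (S n)" for n unfolding S_def by (rule bdd_aboveI[of _ 1]) auto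
  have ne: "S n \<noteq> {}" for n
  proof -
    have "(real n *\<^sub>R axis 1 1 :: real^3) \<in> {x. real n \<le> norm x}" by simp
    then show ?thesis unfolding S_def by blast
  qed
  have ev: "\<exists>b. \<forall>x. b \<le> norm x \<longrightarrow> norm (f x) < d" if "d > 0" for d
    using tendstoD[OF assms that] by (simp add: eventually_at_infinity)
  obtain b where b: "\<And>x. b \<le> norm x \<Longrightarrow> norm (f x) < 1" using ev[of 1] by auto
  obtain m :: nat where m: "b \<le> real m" using real_arch_simple by blast
  show ?thesis
  proof (rule that[of \<epsilon> m])
    show "\<epsilon> \<longlonglongrightarrow> 0"
    proof (rule LIMSEQ_I)
      fix r :: real assume "r > 0"
      then obtain b where b: "\<And>x. b \<le> norm x \<Longrightarrow> norm (f x) < r / 2" using ev[of "r / 2"] by auto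
      obtain k :: nat where k: "b \<le> real k" using real_arch_simple by blast
      have "norm (\<epsilon> n - 0) < r" if "k \<le> n" for n
      proof -
        have "\<epsilon> n \<le> r / 2" unfolding \<epsilon>_def
        proof (rule cSup_least[OF ne])
          fix v assume "v \<in> S n"
          then obtain x where x: "real n \<le> norm x" "v = min 1 (norm (f x))" by (auto simp: S_def)
          have "b \<le> norm x" using k that x(1) by linarith
          then show "v \<le> r / 2" using b[of x] x(2) by simp
        qed
        moreover have "0 \<le> \<epsilon> n"
        proof -
          obtain v where v: "v \<in> S n" using ne by blast
          then have "0 \<le> v" by (auto simp: S_def)
          also have "v \<le> \<epsilon> n" unfolding \<epsilon>_def by (rule cSup_upper[OF v bdd])
          finally show ?thesis .
        qed
        ultimately show ?thesis using \<open>r > 0\<close> by simp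
      qed
      then show "\<exists>no. \<forall>n\<ge>no. norm (\<epsilon> n - 0) < r" by blast
    qed
  next
    fix n and x :: "real^3" assume n: "m \<le> n" "real n \<le> norm x"
    then have "norm (f x) < 1" using b[of x] m by linarith
    then have "norm (f x) \<in> S n" unfolding S_def using n by (intro image_eqI[of _ _ x]) auto
    then show "norm (f x) \<le> \<epsilon> n" unfolding \<epsilon>_def by (rule cSup_upper[OF _ bdd])
  qed
qed

lemma weakly_div_free_subset: "weakly_div_free S T \<Longrightarrow> U \<subseteq> S \<Longrightarrow> weakly_div_free U T"
  unfolding weakly_div_free_def test_field_def by blast

context stokes_flow
begin

lemma integrable_bounded_support:
  fixes f :: "real^3 \<Rightarrow> real"
  assumes "continuous_on D f" "\<And>x. x \<in> D \<Longrightarrow> norm x > B \<Longrightarrow> f x = 0"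
  shows "integrable lborel (\<lambda>x. indicator U x * f x)"
proof -
  define C where "C = D \<inter> cball 0 B"
  have C: "compact C" unfolding C_def using closed_D by (simp add: closed_Int_compact)
  have cC: "continuous_on C f" using assms(1) by (rule continuous_on_subset) (simp add: C_def)
  have "compact (f ` C)" by (rule compact_continuous_image[OF cC C])
  then obtain M where M: "\<forall>x\<in>C. norm (f x) \<le> M" using compact_imp_bounded by (force simp: bounded_iff)
  show ?thesis
  proof (rule integrable_on_U[where g="\<lambda>x. indicator C x * max M 0"])
    show "continuous_on U f" by (rule continuous_on_subset[OF assms(1) U_subset_D])
    show "\<bar>f x\<bar> \<le> indicator C x * max M 0" if "x \<in> U" for x
    proof (cases "x \<in> C")
      case True
      then show ?thesis using M by auto
    next
      case False
      then have "norm x > B" using that U_subset_D by (auto simp: C_def)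
      then show ?thesis using assms(2) that U_subset_D by auto
    qed
    show "integrable lborel (\<lambda>x. indicator C x * max M 0)"
      using borel_integrable_compact[OF C, of "\<lambda>_. max M 0"] by simp
  qed simp
qed

text \<open>Flow, stress and vector potential of the sphere \<open>i\<close> alone, and the corrector \<open>cor e i j\<close> which,
  subtracted from \<open>Psi e i\<close>, makes it constant on the sphere \<open>j\<close>.\<close>

definition Psi :: "real^3 \<Rightarrow> nat \<Rightarrow> real^3 \<Rightarrow> real^3" where "Psi e i x = sphere_flow R e (x - X i)"
definition dPsi :: "real^3 \<Rightarrow> nat \<Rightarrow> 3 \<Rightarrow> real^3 \<Rightarrow> real^3" where "dPsi e i k x = dsphere_flow R e k (x - X i)"
definition Sten :: "real^3 \<Rightarrow> nat \<Rightarrow> 3 \<Rightarrow> real^3 \<Rightarrow> real^3" where "Sten e i k x = sphere_stress R e k (x - X i)"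
definition pot :: "real^3 \<Rightarrow> nat \<Rightarrow> real^3 \<Rightarrow> real^3" where "pot e i x = flow_potential R e (x - X i)"
definition dpot :: "real^3 \<Rightarrow> nat \<Rightarrow> 3 \<Rightarrow> real^3 \<Rightarrow> real^3" where "dpot e i k x = dflow_potential R e k (x - X i)"
definition ddpot :: "real^3 \<Rightarrow> nat \<Rightarrow> 3 \<Rightarrow> 3 \<Rightarrow> real^3 \<Rightarrow> real^3" where
  "ddpot e i k l x = ddflow_potential R e k l (x - X i)"
definition cor :: "real^3 \<Rightarrow> nat \<Rightarrow> nat \<Rightarrow> real^3 \<Rightarrow> real^3" where
  "cor e i j = corrector R (X j) (pot e i) (dpot e i)"
definition dcor :: "real^3 \<Rightarrow> nat \<Rightarrow> nat \<Rightarrow> 3 \<Rightarrow> real^3 \<Rightarrow> real^3" where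
  "dcor e i j = dcorrector R (X j) (pot e i) (dpot e i) (ddpot e i)"

lemma shifted_punctured: "{x. x - c \<in> - {0}} = - {c :: real^3}" by auto

lemma Psi_partials: "has_partials (Psi e i) (dPsi e i) (- {X i})"
  using has_partials_shift[OF sphere_flow_partials, of R e "X i"]
  unfolding shifted_punctured Psi_def[abs_def] dPsi_def[abs_def] .

lemma pot_partials: "has_partials (pot e i) (dpot e i) (- {X i})"
  using has_partials_shift[OF flow_potential_partials, of R e "X i"]
  unfolding shifted_punctured pot_def[abs_def] dpot_def[abs_def] .

lemma dpot_partials: "has_partials (dpot e i k) (ddpot e i k) (- {X i})"
  using has_partials_shift[OF dflow_potential_partials, of R e k "X i"]
  unfolding shifted_punctured dpot_def[abs_def] ddpot_def[abs_def] .

lemma continuous_kernels: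
  assumes "X i \<notin> S"
  shows "continuous_on S (Psi e i)" "continuous_on S (dPsi e i k)" "continuous_on S (Sten e i k)"
    "continuous_on S (ddpot e i k l)"
proof -
  have r: "continuous_on S (\<lambda>x. rinv (x - X i))"
    unfolding rinv_def by (intro continuous_intros) (use assms in auto)
  show "continuous_on S (Psi e i)" "continuous_on S (dPsi e i k)" "continuous_on S (Sten e i k)"
    "continuous_on S (ddpot e i k l)"
    unfolding Psi_def dPsi_def Sten_def ddpot_def sphere_flow_def dsphere_flow_def sphere_stress_def ddflow_potential_def
    by (intro continuous_intros continuous_on_cross r)+
qed

lemma X_notin_D: "i < N \<Longrightarrow> X i \<notin> D" using R_pos by (auto simp: in_D intro!: exI[of _ i])

lemma U_subset_punctured: "i < N \<Longrightarrow> U \<subseteq> - {X i}" using X_notin_D U_subset_D by auto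

lemma Sten_weakly_div_free: "weakly_div_free (- {X i}) (Sten e i)"
proof (rule weakly_div_freeI)
  show "has_partials (Sten e i k) (\<lambda>l x. dsphere_stress R e k l (x - X i)) (- {X i})" for k
    using has_partials_shift[OF sphere_stress_partials, of R e k "X i"]
    unfolding shifted_punctured Sten_def[abs_def] .
  show "continuous_on (- {X i}) (\<lambda>x. dsphere_stress R e k k (x - X i))" for k
  proof -
    have r: "continuous_on (- {X i}) (\<lambda>x. rinv (x - X i))"
      unfolding rinv_def by (intro continuous_intros) auto
    show ?thesis unfolding dsphere_stress_def by (intro continuous_intros r)
  qed
qed (auto simp: div_sphere_stress open_Compl)

lemma Sten_traction:
  assumes "x \<in> sphere (X i) R"
  shows "traction (Sten e i) (X i) R x = (- 2 / R^2) *\<^sub>R e"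
proof -
  have "norm (x - X i) = R" using assms by (simp add: dist_norm norm_minus_commute)
  from sphere_stress_traction[OF R_pos this] show ?thesis
    using R_pos by (simp add: traction_def Sten_def power2_eq_square)
qed

lemma Sten_force: "sphere_integral (X i) R (traction (Sten e i) (X i) R) = (- 8 * pi) *\<^sub>R e"
proof -
  have "sphere_integral (X i) R (traction (Sten e i) (X i) R) = sphere_integral (X i) R (\<lambda>x. (- 2 / R^2) *\<^sub>R e)"
    by (rule sphere_integral_cong[OF R_pos Sten_traction])
  then show ?thesis using R_pos by (simp add: sphere_integral_const)
qed

lemma Sten_torque: "sphere_integral (X i) R (\<lambda>x. cross3 (x - X i) (traction (Sten e i) (X i) R x)) = 0"
proof -
  have "sphere_integral (X i) R (\<lambda>x. cross3 (x - X i) (traction (Sten e i) (X i) R x))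
      = sphere_integral (X i) R (\<lambda>x. cross3 (x - X i) ((- 2 / R^2) *\<^sub>R e))"
    by (rule sphere_integral_cong[OF R_pos]) (simp add: Sten_traction)
  then show ?thesis by (simp only: sphere_integral_moment_const)
qed

lemma contr_Sten:
  assumes "x \<noteq> X i" "(\<Sum>k\<in>UNIV. d k x $ k) = 0"
  shows "contr (Sten e i) d x = contr (sym_grad (dPsi e i)) d x"
proof -
  have "sym_grad (dPsi e i) k x = Sten e i k x + (2 * (e \<bullet> (x - X i)) * rinv (x - X i) ^ 3) *\<^sub>R axis k 1" for k
    using sym_grad_sphere_flow[of "x - X i" R e k] assms(1)
    unfolding sym_grad_def dPsi_def Sten_def by simp
  then have "contr (sym_grad (dPsi e i)) d x = contr (Sten e i) d x + (2 * (e \<bullet> (x - X i)) * rinv (x - X i) ^ 3) * (\<Sum>k\<in>UNIV. d k x $ k)"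
    by (simp add: contr_def inner_add_left sum.distrib sum_distrib_left inner_axis')
  then show ?thesis using assms(2) by simp
qed

text \<open>A symmetric tensor is orthogonal to the antisymmetric gradient of a rotation.\<close>

lemma Sten_symmetric: "contr (Sten e i) (\<lambda>k x. cross3 w (axis k 1)) x = 0"
proof -
  have "(\<Sum>k\<in>UNIV. (\<alpha> *\<^sub>R ((\<gamma> * y $ k) *\<^sub>R y) + \<beta> *\<^sub>R (y $ k *\<^sub>R e + e $ k *\<^sub>R y + \<gamma> *\<^sub>R axis k 1)) \<bullet> cross3 w (axis k 1)) = 0"
    for \<alpha> \<beta> \<gamma> and y :: "real^3"
    unfolding sum_3 inner_vec_def cross3_def by (simp add: axis_def) (simp add: algebra_simps)
  then show ?thesis unfolding contr_def Sten_def sphere_stress_def .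
qed

lemma potential:
  assumes "i < N" "j < N" "j \<noteq> i"
  shows "smooth_potential R (X j) (pot e i) (dpot e i) (ddpot e i)"
proof -
  have s: "ball (X j) (4 * R) \<subseteq> - {X i}"
  proof
    fix x assume "x \<in> ball (X j) (4 * R)"
    then have "12 * R \<le> dist (X i) x" using far_from_others[OF assms(2,1,3)] by auto
    then show "x \<in> - {X i}" using R_pos by auto
  qed
  show ?thesis
  proof
    show "has_partials (pot e i) (dpot e i) (ball (X j) (4 * R))" by (rule has_partials_subset[OF pot_partials s])
    show "has_partials (dpot e i k) (ddpot e i k) (ball (X j) (4 * R))" for k by (rule has_partials_subset[OF dpot_partials s])
    show "continuous_on (ball (X j) (4 * R)) (ddpot e i k l)" for k l
      by (rule continuous_kernels) (use s in auto)
  qed (rule R_pos)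
qed

lemma curl_dpot: "x \<noteq> X i \<Longrightarrow> curl_of (dpot e i) x = Psi e i x"
  using curl_flow_potential[of "x - X i" R e] by (simp add: curl_of_def dpot_def Psi_def)

lemma cor_outside:
  assumes "4 * R \<le> dist (X j) x"
  shows "cor e i j x = 0" "dcor e i j k x = 0"
proof -
  have "(4 * R)^2 \<le> (norm (x - X j))^2" using assms R_pos by (intro power_mono) (auto simp: dist_norm norm_minus_commute)
  moreover have "5 * R^2 \<le> (4 * R)^2" by (simp add: power_mult_distrib)
  ultimately have "5 * R^2 \<le> (norm (x - X j))^2" by linarith
  then show "cor e i j x = 0" "dcor e i j k x = 0"
    using R_pos by (simp_all add: cor_def dcor_def corrector_outside dcorrector_outside)
qed

lemma cor_on_sphere:
  assumes "i < N" "j < N" "j \<noteq> i" "x \<in> sphere (X j) R"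
  shows "cor e i j x = Psi e i x - Psi e i (X j)"
proof -
  have "(norm (x - X j))^2 \<le> 2 * R^2" using assms(4) by (simp add: dist_norm norm_minus_commute)
  then have "cor e i j x = curl_of (dpot e i) x - curl_of (dpot e i) (X j)"
    unfolding cor_def by (rule corrector_inside[OF R_pos])
  moreover have "x \<noteq> X i"
    using far_from_others[OF assms(2,1,3), of x] assms(4) R_pos by auto
  moreover have "X j \<noteq> X i" using sep[OF assms(1,2)] assms(3) R_pos by auto
  ultimately show ?thesis by (simp add: curl_dpot)
qed

definition dcor_sum :: "real^3 \<Rightarrow> nat \<Rightarrow> 3 \<Rightarrow> real^3 \<Rightarrow> real^3" where
  "dcor_sum e i k x = (\<Sum>j\<in>{..<N} - {i}. dcor e i j k x)"

lemma far_at_distance: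
  assumes "i < N" "\<And>i. i < N \<Longrightarrow> norm (X i) + 4 * R \<le> real n0" "n \<ge> 2 * n0" "real n \<le> norm x"
  shows "real n / 2 \<le> norm (x - X i)" "R \<le> norm (x - X i)" "4 * R \<le> dist (X i) x"
proof -
  have "norm x \<le> norm (x - X i) + norm (X i)" using norm_triangle_ineq[of "x - X i" "X i"] by simp
  moreover have "norm (X i) + 4 * R \<le> real n0" using assms(1,2) by blast
  moreover have "2 * real n0 \<le> real n" using assms(3) by linarith
  ultimately show "real n / 2 \<le> norm (x - X i)" "R \<le> norm (x - X i)" "4 * R \<le> dist (X i) x"
    using assms(4) R_pos by (simp_all add: dist_norm norm_minus_commute)
qed

lemma contr_add_right: "contr A (\<lambda>k x. B k x + C k x) x = contr A B x + contr A C x"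
  and contr_diff_right: "contr A (\<lambda>k x. B k x - C k x) x = contr A B x - contr A C x"
  and contr_sum_right: "contr A (\<lambda>k x. \<Sum>j\<in>J. E j k x) x = (\<Sum>j\<in>J. contr A (E j) x)"
  and contr_scale_right: "contr A (\<lambda>k x. f x *\<^sub>R B k x) x = f x * contr A B x"
  by (simp_all add: contr_def inner_add_right inner_diff_right sum.distrib sum_subtractf inner_sum_right sum_distrib_left)
     (rule sum.swap)

lemma contr_eq_0: "(\<And>k. B k x = 0) \<Longrightarrow> contr A B x = 0"
  by (simp add: contr_def)

text \<open>The stress of \<open>Psi e i\<close> is tested with \<open>u\<close>, whose boundary
  value on the sphere i meets the force 8 \<pi> e without torque. On every other sphere
  \<open>u\<close> is a rigid motion; a cut off copy \<open>Z j\<close> of it is subtracted, so that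
  no surface integral arises there.\<close>

lemma reciprocal_limit:
  assumes i: "i < N"
  shows "(\<lambda>n. \<integral>x. indicator U x * (bigcut n x * contr (sym_grad (dPsi e i)) du x) \<partial>lborel)
    \<longlonglongrightarrow> 8 * pi * (e \<bullet> V i)"
proof -
  obtain n0 :: nat where n0: "n0 \<ge> 1" "\<And>i. i < N \<Longrightarrow> norm (X i) + 4 * R \<le> real n0"
    using exists_radius by blast
  obtain \<epsilon> m where \<epsilon>: "\<epsilon> \<longlonglongrightarrow> 0" "\<And>n x. n \<ge> m \<Longrightarrow> real n \<le> norm x \<Longrightarrow> norm (u x) \<le> \<epsilon> n"
    using decay_sequence[OF u_vanishes] by blast
  obtain C where C: "0 \<le> C" "\<And>k y. R \<le> norm y \<Longrightarrow> norm (sphere_stress R e k y) \<le> C / norm y ^ 2"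
  proof -
    have "\<exists>C\<ge>0. \<forall>y. R \<le> norm y \<longrightarrow> norm (sphere_stress R e k y) \<le> C / norm y ^ 2" for k
      using kern_bound[OF kern_sphere_stress[of e k]] R_pos by metis
    then obtain C where C: "\<And>k. C k \<ge> 0" "\<And>k y. R \<le> norm y \<Longrightarrow> norm (sphere_stress R e k y) \<le> C k / norm y ^ 2"
      by metis
    show ?thesis
    proof (rule that[of "\<Sum>k\<in>UNIV. C k"])
      show "0 \<le> (\<Sum>k\<in>UNIV. C k)" using C(1) by (simp add: sum_nonneg)
      fix k and y :: "real^3" assume y: "R \<le> norm y"
      have "C k \<le> (\<Sum>k\<in>UNIV. C k)" using C(1) by (intro member_le_sum) auto
      then have "C k / norm y ^ 2 \<le> (\<Sum>k\<in>UNIV. C k) / norm y ^ 2" by (intro divide_right_mono) auto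
      then show "norm (sphere_stress R e k y) \<le> (\<Sum>k\<in>UNIV. C k) / norm y ^ 2" using C(2)[OF y, of k] by linarith
    qed
  qed
  define J where "J = {..<N} - {i}"
  have J: "j < N" "j \<noteq> i" if "j \<in> J" for j using that by (auto simp: J_def)
  define r where "r j x = V j + cross3 (\<Omega> j) (x - X j)" for j and x :: "real^3"
  define \<rho> where "\<rho> j = cut (X j) (2 * R^2) (R^2)" for j
  define d\<rho> where "d\<rho> j = dcut (X j) (2 * R^2) (R^2)" for j
  define Z where "Z j x = \<rho> j x *\<^sub>R r j x" for j x
  define dZ where "dZ j k x = \<rho> j x *\<^sub>R cross3 (\<Omega> j) (axis k 1) + d\<rho> j k x *\<^sub>R r j x" for j k x
  have R2: "0 < R^2" using R_pos by simp
  have hr: "has_partials (r j) (\<lambda>k x. cross3 (\<Omega> j) (axis k 1)) S" for j S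
  proof -
    have "has_partials (\<lambda>x. V j + cross3 (\<Omega> j) (x - X j)) (\<lambda>k x. 0 + cross3 (\<Omega> j) (axis k 1 - 0)) S"
      by (intro has_partials_add has_partials_const has_partials_linear[OF bounded_linear_cross3] has_partials_diff has_partials_id)
    then show ?thesis by (simp add: r_def[abs_def])
  qed
  have hZ: "has_partials (Z j) (dZ j) S" for j S
    unfolding Z_def[abs_def] dZ_def[abs_def] \<rho>_def d\<rho>_def
    by (rule has_partials_scaleR[OF has_partials_cut hr])
  have cr: "continuous_on S (r j)" for S j
    unfolding r_def by (intro continuous_intros continuous_on_cross)
  have cZ: "continuous_on S (Z j)" and cdZ: "continuous_on S (dZ j k)" for S j k
    unfolding Z_def dZ_def \<rho>_def d\<rho>_def using R2
    by (intro continuous_intros cr continuous_cut continuous_dcut; simp)+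
  have Zout: "Z j x = 0" "dZ j k x = 0" if "4 * R \<le> dist (X j) x" for j k x
  proof -
    have "(4 * R)^2 \<le> (norm (x - X j))^2" using that R_pos by (intro power_mono) (auto simp: dist_norm norm_minus_commute)
    moreover have "5 * R^2 \<le> (4 * R)^2" by (simp add: power_mult_distrib)
    ultimately have "5 * R^2 \<le> (norm (x - X j))^2" by linarith
    then show "Z j x = 0" "dZ j k x = 0"
      using outer_zero[OF R_pos] by (simp_all add: Z_def dZ_def \<rho>_def d\<rho>_def)
  qed
  have Zin: "Z j x = r j x" "dZ j k x = cross3 (\<Omega> j) (axis k 1)" if "dist (X j) x \<le> R" for j k x
  proof -
    have "(norm (x - X j))^2 \<le> R^2" using that by (intro power_mono) (auto simp: dist_norm norm_minus_commute)
    then have "(norm (x - X j))^2 \<le> 2 * R^2" using R2 by linarith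
    then show "Z j x = r j x" "dZ j k x = cross3 (\<Omega> j) (axis k 1)"
      using cut_eq_1[OF R2, of x "X j" "2 * R^2"] dcut_eq_0[OF R2, of x "X j" "2 * R^2" k]
      by (simp_all add: Z_def dZ_def \<rho>_def d\<rho>_def)
  qed
  \<comment> \<open>The stress of \<open>Psi e i\<close> is divergence-free inside the ball j too,
    so the integral over the whole space vanishes. The ball j itself contributes nothing because
    there the gradient of \<open>Z j\<close> is antisymmetric, and \<open>Z j\<close> is zero near
    the other balls.\<close>
  have Zzero: "(\<integral>x. indicator U x * contr (Sten e i) (dZ j) x \<partial>lborel) = 0" if j: "j \<in> J" for j
  proof -
    have "test_field (- {X i}) (Z j) (dZ j)"
      unfolding test_field_def
    proof (intro conjI allI hZ cdZ exI[of _ "cball (X j) (4 * R)"] impI)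
      show "cball (X j) (4 * R) \<subseteq> - {X i}"
        using sep[OF J(1)[OF j] i J(2)[OF j]] R_pos by (auto simp: dist_commute)
      show "Z j x = 0" if "x \<notin> cball (X j) (4 * R)" for x using that by (intro Zout) auto
    qed simp
    then have 0: "(\<integral>x. contr (Sten e i) (dZ j) x \<partial>lborel) = 0"
      using Sten_weakly_div_free unfolding weakly_div_free_def by blast
    have eqx: "indicator U x * contr (Sten e i) (dZ j) x = contr (Sten e i) (dZ j) x" for x
    proof (cases "x \<in> U")
      case False
      then obtain l where l: "l < N" "dist (X l) x \<le> R" by (auto simp: in_U not_less)
      have "contr (Sten e i) (dZ j) x = 0"
      proof (cases "l = j")
        case True
        then have "contr (Sten e i) (dZ j) x = contr (Sten e i) (\<lambda>k x. cross3 (\<Omega> j) (axis k 1)) x"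
          using Zin(2) l by (simp add: contr_def)
        then show ?thesis by (simp add: Sten_symmetric)
      next
        case False
        have "12 * R \<le> dist (X j) x"
          by (rule far_from_others[OF l(1) J(1)[OF j]]) (use False l R_pos in auto)
        then have "4 * R \<le> dist (X j) x" using R_pos by linarith
        then show ?thesis by (intro contr_eq_0 Zout)
      qed
      then show ?thesis by simp
    qed simp
    show ?thesis unfolding eqx by (rule 0)
  qed
  define \<Phi> where "\<Phi> n x = bigcut n x *\<^sub>R u x - (\<Sum>j\<in>J. Z j x)" for n x
  define d\<Phi> where "d\<Phi> n k x = (bigcut n x *\<^sub>R du k x + dbigcut n k x *\<^sub>R u x) - (\<Sum>j\<in>J. dZ j k x)" for n k x
  have XiD: "X i \<notin> D" by (rule X_notin_D[OF i])
  have cS: "continuous_on D (Sten e i k)" for k by (rule continuous_kernels[OF XiD])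
  have cdP: "continuous_on D (dPsi e i k)" for k by (rule continuous_kernels[OF XiD])
  have weak: "(\<integral>x. indicator U x * contr (Sten e i) (d\<Phi> n) x \<partial>lborel) = 8 * pi * (e \<bullet> V i)" if n: "n \<ge> n0" for n
  proof -
    have n1: "n \<ge> 1" using n n0 by simp
    define a where "a k = (if k = i then V i else 0)" for k
    define b where "b k = (if k = i then \<Omega> i else 0)" for k
    have "(\<integral>x. indicator U x * contr (Sten e i) (d\<Phi> n) x \<partial>lborel) =
     - (\<Sum>k<N. a k \<bullet> sphere_integral (X k) R (traction (Sten e i) (X k) R)
            + b k \<bullet> sphere_integral (X k) R (\<lambda>x. cross3 (x - X k) (traction (Sten e i) (X k) R x)))"
    proof (rule divergence_theorem[where \<Phi>="\<Phi> n" and B="2 * real n"])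
      show "weakly_div_free U (Sten e i)"
        by (rule weakly_div_free_subset[OF Sten_weakly_div_free U_subset_punctured[OF i]])
      show "continuous_on D (\<Phi> n)" "\<And>k. continuous_on D (d\<Phi> n k)"
        unfolding \<Phi>_def d\<Phi>_def
        by (intro continuous_intros continuous_u continuous_du bigcut_facts[OF n1] cZ cdZ)+
      show "has_partials (\<Phi> n) (d\<Phi> n) U" unfolding \<Phi>_def[abs_def] d\<Phi>_def[abs_def]
        by (intro has_partials_diff has_partials_scaleR bigcut_partials u_partials has_partials_sum hZ)
      show "\<Phi> n x = 0" if "x \<in> D" "2 * real n < norm x" for x
      proof -
        have "Z j x = 0" if j: "j \<in> J" for j
        proof (rule Zout)
          have "norm x \<le> norm (x - X j) + norm (X j)" using norm_triangle_ineq[of "x - X j" "X j"] by simp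
          moreover have "norm (X j) + 4 * R \<le> real n0" using n0(2)[OF J(1)[OF j]] .
          moreover have "real n0 \<le> real n" using n by simp
          ultimately show "4 * R \<le> dist (X j) x"
            using \<open>2 * real n < norm x\<close> by (simp add: dist_norm norm_minus_commute)
        qed
        then show ?thesis using bigcut_facts(2)[OF n1, of x] that by (simp add: \<Phi>_def)
      qed
      fix l and x :: "real^3" assume l: "l < N" and x: "x \<in> sphere (X l) R"
      have "norm x \<le> norm (X l) + R"
        using x norm_triangle_ineq[of "X l" "x - X l"] by (simp add: dist_norm norm_minus_commute)
      also have "\<dots> \<le> real n" using n0(2)[OF l] n R_pos by simp
      finally have k1: "bigcut n x = 1" by (rule bigcut_facts(1)[OF n1])
      have uz: "u x = r l x" using u_rigid[OF l x] by (simp add: r_def)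
      have o: "Z j x = 0" if "j \<in> J" "j \<noteq> l" for j
      proof -
        have "12 * R \<le> dist (X j) x"
          by (rule far_from_others[OF l J(1)[OF that(1)]]) (use that x R_pos in auto)
        then show ?thesis using R_pos by (intro Zout) linarith
      qed
      have "(\<Sum>j\<in>J. Z j x) = (\<Sum>j\<in>J. if j = l then r l x else 0)"
        by (rule sum.cong) (use o Zin(1)[of l x] x in auto)
      also have "\<dots> = (if l = i then 0 else r l x)" using l by (auto simp: J_def)
      finally show "\<Phi> n x = a l + cross3 (b l) (x - X l)"
        by (simp add: \<Phi>_def k1 uz a_def b_def) (simp add: r_def)
    qed (rule cS)
    also have "\<dots> = - (\<Sum>k<N. if k = i then V i \<bullet> ((- 8 * pi) *\<^sub>R e) else 0)"
      by (intro arg_cong[where f=uminus] sum.cong) (auto simp: a_def b_def Sten_force Sten_torque)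
    also have "\<dots> = 8 * pi * (e \<bullet> V i)" using i by (simp add: inner_commute)
    finally show ?thesis .
  qed
  \<comment> \<open>Adding the vanishing integrals of the \<open>Z j\<close> back makes the
    integrands \<open>g\<close> and \<open>h\<close> differ only by derivatives of the big
    cutoff.\<close>
  define g where "g n x = (if n \<ge> max (2 * n0) m then indicator U x * contr (Sten e i) (d\<Phi> n) x
      + (\<Sum>j\<in>J. indicator U x * contr (Sten e i) (dZ j) x) else 0)" for n x
  define h where "h n x = (if n \<ge> max (2 * n0) m then indicator U x * (bigcut n x * contr (sym_grad (dPsi e i)) du x) else 0)" for n x
  have iZ: "integrable lborel (\<lambda>x. indicator U x * contr (Sten e i) (dZ j) x)" if j: "j \<in> J" for j
  proof (rule integrable_bounded_support[where B="real n0"])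
    show "continuous_on D (contr (Sten e i) (dZ j))" by (intro continuous_contr cS cdZ)
    show "contr (Sten e i) (dZ j) x = 0" if "real n0 < norm x" for x
    proof (intro contr_eq_0 Zout)
      have "norm x \<le> norm (x - X j) + norm (X j)" using norm_triangle_ineq[of "x - X j" "X j"] by simp
      then show "4 * R \<le> dist (X j) x" using n0(2)[OF J(1)[OF j]] that by (simp add: dist_norm norm_minus_commute)
    qed
  qed
  have exp: "contr (Sten e i) (d\<Phi> n) x + (\<Sum>j\<in>J. contr (Sten e i) (dZ j) x)
     = bigcut n x * contr (sym_grad (dPsi e i)) du x + (\<Sum>k\<in>UNIV. dbigcut n k x * (Sten e i k x \<bullet> u x))" if x: "x \<in> U" for n x
  proof -
    have "x \<noteq> X i" using x U_subset_punctured[OF i] by auto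
    then have "contr (sym_grad (dPsi e i)) du x = contr (Sten e i) du x" using contr_Sten div_u[OF x] by simp
    then show ?thesis
      unfolding d\<Phi>_def contr_diff_right contr_add_right contr_sum_right contr_scale_right
      by (simp add: contr_def)
  qed
  have i\<Phi>: "integrable lborel (\<lambda>x. indicator U x * contr (Sten e i) (d\<Phi> n) x)" if n: "n \<ge> n0" for n
  proof -
    have n1: "n \<ge> 1" using n n0 by simp
    have "integrable lborel (\<lambda>x. indicator U x * (contr (Sten e i) (d\<Phi> n) x + (\<Sum>j\<in>J. contr (Sten e i) (dZ j) x)))"
    proof -
      have "integrable lborel (\<lambda>x. indicator U x * (bigcut n x * contr (sym_grad (dPsi e i)) du x + (\<Sum>k\<in>UNIV. dbigcut n k x * (Sten e i k x \<bullet> u x))))"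
        by (rule integrable_bounded_support[where B="2 * real n"])
           (auto intro!: continuous_intros continuous_contr bigcut_facts[OF n1] continuous_sym_grad cdP continuous_du cS continuous_u
             simp: bigcut_facts(2,3)[OF n1])
      moreover have "(\<lambda>x. indicator U x * (bigcut n x * contr (sym_grad (dPsi e i)) du x + (\<Sum>k\<in>UNIV. dbigcut n k x * (Sten e i k x \<bullet> u x))))
         = (\<lambda>x. indicator U x * (contr (Sten e i) (d\<Phi> n) x + (\<Sum>j\<in>J. contr (Sten e i) (dZ j) x)))"
        using exp by (auto simp: indicator_def)
      ultimately show ?thesis by simp
    qed
    moreover have "integrable lborel (\<lambda>x. \<Sum>j\<in>J. indicator U x * contr (Sten e i) (dZ j) x)"
      using iZ by (intro Bochner_Integration.integrable_sum)
    ultimately have "integrable lborel (\<lambda>x. indicator U x * (contr (Sten e i) (d\<Phi> n) x + (\<Sum>j\<in>J. contr (Sten e i) (dZ j) x))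
        - (\<Sum>j\<in>J. indicator U x * contr (Sten e i) (dZ j) x))"
      by (rule Bochner_Integration.integrable_diff)
    then show ?thesis by (simp add: distrib_left sum_distrib_left)
  qed
  have "(\<lambda>n. (\<integral>x. g n x \<partial>lborel) - (\<integral>x. h n x \<partial>lborel)) \<longlonglongrightarrow> 0"
  \<comment> \<open>Three terms, each at most 4 / n for the cutoff, 4 C / n^2 for the stress and
    \<epsilon> for \<open>u\<close>. The quadratic decay of the stress lets decay of
    \<open>u\<close> without a rate suffice.\<close>
  proof (rule integral_close_limit[where W="\<lambda>x. 0" and C="\<lambda>n. 48 * C * \<epsilon> n" and ?n0.0="max (2 * n0) m"])
    show "integrable lborel (g n)" for n
      unfolding g_def using i\<Phi>[of n] iZ by (cases "n \<ge> max (2 * n0) m") auto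
    show "integrable lborel (h n)" for n
    proof (cases "n \<ge> max (2 * n0) m")
      case True
      then have n1: "n \<ge> 1" using n0 by simp
      have "integrable lborel (\<lambda>x. indicator U x * (bigcut n x * contr (sym_grad (dPsi e i)) du x))"
        by (rule integrable_bounded_support[where B="2 * real n"])
           (auto intro!: continuous_intros continuous_contr bigcut_facts[OF n1] continuous_sym_grad cdP continuous_du
             simp: bigcut_facts(2)[OF n1])
      then show ?thesis unfolding h_def using True by simp
    next
      case False
      then have "h n = (\<lambda>x. 0)" unfolding h_def by (simp only: if_False)
      then show ?thesis by simp
    qed
    show "(\<lambda>n. 48 * C * \<epsilon> n) \<longlonglongrightarrow> 0" using tendsto_mult_right_zero[OF \<epsilon>(1), of "48 * C"] by simp
    fix n and x :: "real^3" assume n: "max (2 * n0) m \<le> n"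
    have n1: "n \<ge> 1" using n n0 by simp
    have np: "0 < real n" using n1 by simp
    have rhs: "indicator {x. real n \<le> norm x} x * 0 + indicator (cball 0 (2 * real n)) x * (48 * C * \<epsilon> n / real n ^ 3)
         = indicator (cball 0 (2 * real n)) x * (48 * C * \<epsilon> n / real n ^ 3)" by simp
    have \<epsilon>0: "0 \<le> \<epsilon> n"
    proof -
      have "norm (u (real n *\<^sub>R axis 1 1)) \<le> \<epsilon> n" by (rule \<epsilon>(2)) (use n in auto)
      then show ?thesis using norm_ge_zero order_trans by blast
    qed
    have gh: "g n x - h n x = indicator U x * (\<Sum>k\<in>UNIV. dbigcut n k x * (Sten e i k x \<bullet> u x))"
      using exp[of x n] n by (cases "x \<in> U") (auto simp: g_def h_def)
    have "\<bar>g n x - h n x\<bar> \<le> indicator (cball 0 (2 * real n)) x * (48 * C * \<epsilon> n / real n ^ 3)"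
    proof (cases "real n < norm x \<and> norm x < 2 * real n")
      case False
      then have "dbigcut n k x = 0" for k using bigcut_facts(3)[OF n1, of x k] by linarith
      then show ?thesis using gh C(1) \<epsilon>0 by simp
    next
      case True
      have f: "real n / 2 \<le> norm (x - X i)" "R \<le> norm (x - X i)"
        using far_at_distance[OF i n0(2)] n True by auto
      have S: "norm (Sten e i k x) \<le> 4 * C / (real n)^2" for k
      proof -
        have "norm (Sten e i k x) \<le> C / norm (x - X i) ^ 2" unfolding Sten_def by (rule C(2)[OF f(2)])
        also have "\<dots> \<le> C / (real n / 2)^2"
          by (intro divide_left_mono power_mono f(1) C(1) mult_pos_pos) (use np f in auto)
        finally show ?thesis by (simp add: power_divide mult.commute)
      qed
      have "\<bar>dbigcut n k x * (Sten e i k x \<bullet> u x)\<bar> \<le> 16 * C * \<epsilon> n / real n ^ 3" for k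
      proof -
        have "\<bar>Sten e i k x \<bullet> u x\<bar> \<le> norm (Sten e i k x) * norm (u x)" by (rule Cauchy_Schwarz_ineq2)
        also have "\<dots> \<le> (4 * C / (real n)^2) * \<epsilon> n"
          by (intro mult_mono S \<epsilon>(2)) (use n True C np in auto)
        finally have "\<bar>dbigcut n k x * (Sten e i k x \<bullet> u x)\<bar> \<le> (4 / real n) * ((4 * C / (real n)^2) * \<epsilon> n)"
          unfolding abs_mult by (intro mult_mono bigcut_facts(4)[OF n1]) (use np in auto)
        then show ?thesis by (simp add: eval_nat_numeral)
      qed
      then have "\<bar>\<Sum>k\<in>UNIV. dbigcut n k x * (Sten e i k x \<bullet> u x)\<bar> \<le> (\<Sum>k\<in>(UNIV::3 set). 16 * C * \<epsilon> n / real n ^ 3)"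
        by (intro order_trans[OF sum_abs sum_mono])
      moreover have "\<bar>g n x - h n x\<bar> \<le> \<bar>\<Sum>k\<in>UNIV. dbigcut n k x * (Sten e i k x \<bullet> u x)\<bar>"
        unfolding gh by (cases "x \<in> U") auto
      ultimately show ?thesis using True by simp
    qed
    then show "\<bar>g n x - h n x\<bar> \<le> indicator {x. real n \<le> norm x} x * 0 + indicator (cball 0 (2 * real n)) x * (48 * C * \<epsilon> n / real n ^ 3)"
      unfolding rhs .
  qed simp
  moreover have "\<forall>\<^sub>F n in sequentially. (\<integral>x. g n x \<partial>lborel) - (\<integral>x. h n x \<partial>lborel)
     = 8 * pi * (e \<bullet> V i) - (\<integral>x. indicator U x * (bigcut n x * contr (sym_grad (dPsi e i)) du x) \<partial>lborel)"
  proof (rule eventually_sequentiallyI[of "max (2 * n0) m"])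
    fix n assume n: "max (2 * n0) m \<le> n"
    then have nn: "n0 \<le> n" by simp
    have "(\<integral>x. g n x \<partial>lborel) = (\<integral>x. indicator U x * contr (Sten e i) (d\<Phi> n) x \<partial>lborel)
        + (\<Sum>j\<in>J. \<integral>x. indicator U x * contr (Sten e i) (dZ j) x \<partial>lborel)"
      unfolding g_def using n i\<Phi>[OF nn] iZ by simp
    then have "(\<integral>x. g n x \<partial>lborel) = 8 * pi * (e \<bullet> V i)" using weak[OF nn] Zzero by simp
    then show "(\<integral>x. g n x \<partial>lborel) - (\<integral>x. h n x \<partial>lborel)
     = 8 * pi * (e \<bullet> V i) - (\<integral>x. indicator U x * (bigcut n x * contr (sym_grad (dPsi e i)) du x) \<partial>lborel)"
      unfolding h_def using n by simp
  qed
  ultimately have "(\<lambda>n. 8 * pi * (e \<bullet> V i) - (\<integral>x. indicator U x * (bigcut n x * contr (sym_grad (dPsi e i)) du x) \<partial>lborel)) \<longlonglongrightarrow> 0"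
    by (rule Lim_transform_eventually)
  from tendsto_diff[OF tendsto_const[of "8 * pi * (e \<bullet> V i)"] this] show ?thesis by simp
qed

lemma cor_partials:
  assumes "i < N" "j \<in> {..<N} - {i}"
  shows "has_partials (cor e i j) (dcor e i j) S" "continuous_on S (cor e i j)" "continuous_on S (dcor e i j k)"
    "(\<Sum>k\<in>UNIV. dcor e i j k x $ k) = 0"
proof -
  interpret P: smooth_potential R "X j" "pot e i" "dpot e i" "ddpot e i"
    using potential[OF assms(1)] assms(2) by auto
  have h: "has_partials (cor e i j) (dcor e i j) UNIV"
    unfolding cor_def dcor_def by (rule P.corrector_partials)
  then show "has_partials (cor e i j) (dcor e i j) S" by (rule has_partials_subset) simp
  show "continuous_on S (cor e i j)" by (rule continuous_on_subset[OF has_partials_continuous_on[OF h]]) simp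
  show "continuous_on S (dcor e i j k)"
    unfolding dcor_def by (rule continuous_on_subset[OF P.continuous_dcorrector]) simp
  show "(\<Sum>k\<in>UNIV. dcor e i j k x $ k) = 0" unfolding dcor_def by (rule P.div_corrector)
qed

text \<open>The constant value on the sphere j of \<open>Psi e i\<close> minus its
  correctors.\<close>

definition drift :: "real^3 \<Rightarrow> nat \<Rightarrow> nat \<Rightarrow> real^3" where
  "drift e i j = (if j = i then (4 / (3 * R)) *\<^sub>R e else Psi e i (X j))"

text \<open>The stress of \<open>u\<close> is tested with the corrected \<open>Psi e i\<close>,
  which is constant on every sphere, so that only the prescribed forces appear. What the correctors
  change in the fluid remains as the work integral.\<close>

lemma corrected_limit:
  assumes i: "i < N"
  shows "(\<lambda>n. \<integral>x. indicator U x * (bigcut n x * contr (sym_grad (dPsi e i)) du x) \<partial>lborel)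
    \<longlonglongrightarrow> (\<Sum>j<N. drift e i j \<bullet> F) + (\<integral>x. indicator U x * contr (sym_grad du) (dcor_sum e i) x \<partial>lborel)"
proof -
  obtain n0 :: nat where n0: "n0 \<ge> 1" "\<And>i. i < N \<Longrightarrow> norm (X i) + 4 * R \<le> real n0"
    using exists_radius by blast
  obtain C where C: "0 \<le> C" "\<And>y. R \<le> norm y \<Longrightarrow> norm (sphere_flow R e y) \<le> C / norm y ^ 1"
    using kern_bound[OF kern_sphere_flow[of e]] R_pos by metis
  define J where "J = {..<N} - {i}"
  have J: "j < N" "j \<noteq> i" if "j \<in> J" for j using that by (auto simp: J_def)
  have XiD: "X i \<notin> D" by (rule X_notin_D[OF i])
  note cP = continuous_kernels(1)[OF XiD, of e]
  note cdP = continuous_kernels(2)[OF XiD, of e]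
  have ccor: "continuous_on S (cor e i j)" "continuous_on S (dcor e i j k)" if "j \<in> J" for S j k
    using cor_partials[OF i] that by (auto simp: J_def)
  have cds: "continuous_on S (dcor_sum e i k)" for S k
    unfolding dcor_sum_def J_def[symmetric] by (intro continuous_intros ccor)
  have corout: "cor e i j x = 0" "dcor e i j k x = 0" if "j \<in> J" "real n0 \<le> norm x" for j k x
  proof -
    have "norm x \<le> norm (x - X j) + norm (X j)" using norm_triangle_ineq[of "x - X j" "X j"] by simp
    then have "4 * R \<le> dist (X j) x" using n0(2)[OF J(1)[OF that(1)]] that(2) by (simp add: dist_norm norm_minus_commute)
    then show "cor e i j x = 0" "dcor e i j k x = 0" by (rule cor_outside)+
  qed
  define Q where "Q x = Psi e i x - (\<Sum>j\<in>J. cor e i j x)" for x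
  define dQ where "dQ k x = dPsi e i k x - dcor_sum e i k x" for k x
  have hQ: "has_partials Q dQ U"
    unfolding Q_def[abs_def] dQ_def[abs_def] dcor_sum_def J_def[symmetric]
    by (intro has_partials_diff has_partials_sum has_partials_subset[OF Psi_partials U_subset_punctured[OF i]])
       (use cor_partials(1)[OF i] in \<open>simp add: J_def\<close>)
  have cQ: "continuous_on D Q" unfolding Q_def by (intro continuous_intros cP ccor)
  have cdQ: "continuous_on D (dQ k)" for k unfolding dQ_def by (intro continuous_intros cdP cds)
  \<comment> \<open>It removes the pressure of \<open>u\<close>, for which there is no quantitative
    bound.\<close>
  have divQ: "(\<Sum>k\<in>UNIV. dQ k x $ k) = 0" if "x \<in> U" for x
  proof -
    have "x - X i \<noteq> 0" using that U_subset_punctured[OF i] by auto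
    then have "(\<Sum>k\<in>UNIV. dPsi e i k x $ k) = 0" unfolding dPsi_def by (rule div_sphere_flow)
    moreover have "(\<Sum>k\<in>UNIV. dcor_sum e i k x $ k) = (\<Sum>j\<in>J. \<Sum>k\<in>UNIV. dcor e i j k x $ k)"
      unfolding dcor_sum_def J_def[symmetric] by (simp add: sum.swap[of _ UNIV])
    moreover have "\<dots> = 0" using cor_partials(4)[OF i] by (intro sum.neutral) (auto simp: J_def)
    ultimately show ?thesis by (simp add: dQ_def sum_subtractf)
  qed
  define \<Phi> where "\<Phi> n x = bigcut n x *\<^sub>R Q x" for n x
  define d\<Phi> where "d\<Phi> n k x = bigcut n x *\<^sub>R dQ k x + dbigcut n k x *\<^sub>R Q x" for n k x
  have weak: "(\<integral>x. indicator U x * contr \<sigma> (d\<Phi> n) x \<partial>lborel) = (\<Sum>j<N. drift e i j \<bullet> F)" if n: "n \<ge> n0" for n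
  proof -
    have n1: "n \<ge> 1" using n n0 by simp
    show ?thesis
    proof (rule weak_formulation[where \<Phi>="\<Phi> n" and B="2 * real n" and b="\<lambda>_. 0"])
      show "continuous_on D (\<Phi> n)" "\<And>k. continuous_on D (d\<Phi> n k)"
        unfolding \<Phi>_def d\<Phi>_def by (intro continuous_intros cQ cdQ bigcut_facts[OF n1])+
      show "has_partials (\<Phi> n) (d\<Phi> n) U" unfolding \<Phi>_def[abs_def] d\<Phi>_def[abs_def]
        by (intro has_partials_scaleR bigcut_partials hQ)
      show "\<Phi> n x = 0" if "2 * real n < norm x" for x
        using bigcut_facts(2)[OF n1, of x] that by (simp add: \<Phi>_def)
      fix l and x :: "real^3" assume l: "l < N" and x: "x \<in> sphere (X l) R"
      have "norm x \<le> norm (X l) + R"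
        using x norm_triangle_ineq[of "X l" "x - X l"] by (simp add: dist_norm norm_minus_commute)
      also have "\<dots> \<le> real n" using n0(2)[OF l] n R_pos by simp
      finally have k1: "bigcut n x = 1" by (rule bigcut_facts(1)[OF n1])
      have o: "cor e i j x = 0" if "j \<in> J" "j \<noteq> l" for j
      proof -
        have "12 * R \<le> dist (X j) x"
          by (rule far_from_others[OF l J(1)[OF that(1)]]) (use that x R_pos in auto)
        then show ?thesis using R_pos by (intro cor_outside) linarith
      qed
      have "(\<Sum>j\<in>J. cor e i j x) = (\<Sum>j\<in>J. if j = l then cor e i l x else 0)"
        by (rule sum.cong) (use o in auto)
      also have "\<dots> = (if l = i then 0 else cor e i l x)" using l by (auto simp: J_def)
      also have "\<dots> = (if l = i then 0 else Psi e i x - Psi e i (X l))"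
        using cor_on_sphere[OF i l _ x] by auto
      finally have "Q x = (if l = i then Psi e i x else Psi e i (X l))" by (simp add: Q_def)
      also have "\<dots> = drift e i l"
      proof (cases "l = i")
        case True
        then have "norm (x - X i) = R" using x by (simp add: dist_norm norm_minus_commute)
        then show ?thesis using True sphere_flow_on_sphere[OF R_pos, of "x - X i" e] by (simp add: drift_def Psi_def)
      qed (simp add: drift_def)
      finally show "\<Phi> n x = drift e i l + cross3 0 (x - X l)" by (simp add: \<Phi>_def k1 cross_zero_left)
    qed
  qed
  have idc: "integrable lborel (\<lambda>x. indicator U x * contr (sym_grad du) (dcor_sum e i) x)"
  proof (rule integrable_bounded_support[where B="real n0"])
    show "continuous_on D (contr (sym_grad du) (dcor_sum e i))"
      by (intro continuous_contr continuous_sym_grad continuous_du cds)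
    show "contr (sym_grad du) (dcor_sum e i) x = 0" if "real n0 < norm x" for x
      by (intro contr_eq_0) (use that corout in \<open>simp add: dcor_sum_def J_def[symmetric]\<close>)
  qed
  define g where "g n x = (if n \<ge> 2 * n0 then indicator U x * contr \<sigma> (d\<Phi> n) x
      + indicator U x * contr (sym_grad du) (dcor_sum e i) x else 0)" for n x
  define h where "h n x = (if n \<ge> 2 * n0 then indicator U x * (bigcut n x * contr (sym_grad (dPsi e i)) du x) else 0)" for n x
  have exp: "contr \<sigma> (d\<Phi> n) x + contr (sym_grad du) (dcor_sum e i) x
     = bigcut n x * contr (sym_grad (dPsi e i)) du x + (1 - bigcut n x) * contr (sym_grad du) (dcor_sum e i) x
       + (\<Sum>k\<in>UNIV. dbigcut n k x * (\<sigma> k x \<bullet> Q x))" if x: "x \<in> U" for n x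
  proof -
    have 1: "contr \<sigma> dQ x = contr (sym_grad du) (dPsi e i) x - contr (sym_grad du) (dcor_sum e i) x"
    proof -
      have "contr (sym_grad du) dQ x = contr (sym_grad du) (dPsi e i) x - contr (sym_grad du) (dcor_sum e i) x"
        unfolding dQ_def[abs_def] by (rule contr_diff_right)
      then show ?thesis unfolding contr_\<sigma> divQ[OF x] by simp
    qed
    have 2: "contr (sym_grad du) (dPsi e i) x = contr (sym_grad (dPsi e i)) du x" by (rule contr_sym_grad(2))
    have 3: "contr \<sigma> (d\<Phi> n) x = bigcut n x * contr \<sigma> dQ x + (\<Sum>k\<in>UNIV. dbigcut n k x * (\<sigma> k x \<bullet> Q x))"
      unfolding d\<Phi>_def contr_add_right contr_scale_right by (simp add: contr_def)
    show ?thesis unfolding 3 1 2 by (simp add: algebra_simps)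
  qed
  have i\<Phi>: "integrable lborel (\<lambda>x. indicator U x * contr \<sigma> (d\<Phi> n) x)" if n: "n \<ge> n0" for n
  proof -
    have n1: "n \<ge> 1" using n n0 by simp
    show ?thesis
    proof (rule integrable_bounded_support[where B="2 * real n"])
      show "continuous_on D (contr \<sigma> (d\<Phi> n))" unfolding d\<Phi>_def
        by (intro continuous_contr continuous_intros continuous_\<sigma> cQ cdQ bigcut_facts[OF n1])
      show "contr \<sigma> (d\<Phi> n) x = 0" if "2 * real n < norm x" for x
        by (intro contr_eq_0) (use that bigcut_facts(2,3)[OF n1, of x] in \<open>simp add: d\<Phi>_def\<close>)
    qed
  qed
  have "(\<lambda>n. (\<integral>x. g n x \<partial>lborel) - (\<integral>x. h n x \<partial>lborel)) \<longlonglongrightarrow> 0"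
  \<comment> \<open>Young's inequality for the product of |\<sigma>| with 4 / n times 2 C / n gives
    9/2 W + 32 C^2 / n^4 for each of the three directions; \<open>Psi e i\<close> decays like 1 /
    |x|.\<close>
  proof (rule integral_close_limit[where W="\<lambda>x. 27 / 2 * W x" and C="\<lambda>n. 96 * C^2 / real n" and ?n0.0="2 * n0"])
    show "integrable lborel (g n)" for n
      unfolding g_def using i\<Phi>[of n] idc by (cases "n \<ge> 2 * n0") auto
    show "integrable lborel (h n)" for n
    proof (cases "n \<ge> 2 * n0")
      case True
      then have n1: "n \<ge> 1" using n0 by simp
      have "integrable lborel (\<lambda>x. indicator U x * (bigcut n x * contr (sym_grad (dPsi e i)) du x))"
        by (rule integrable_bounded_support[where B="2 * real n"])
           (auto intro!: continuous_intros continuous_contr bigcut_facts[OF n1] continuous_sym_grad cdP continuous_du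
             simp: bigcut_facts(2)[OF n1])
      then show ?thesis unfolding h_def using True by simp
    next
      case False
      then have "h n = (\<lambda>x. 0)" unfolding h_def by (simp only: if_False)
      then show ?thesis by simp
    qed
    show "integrable lborel (\<lambda>x. 27 / 2 * W x)" using integrable_W by simp
    show "(\<lambda>n. 96 * C^2 / real n) \<longlonglongrightarrow> 0"
      using tendsto_mult_right_zero[OF lim_1_over_n, of "96 * C^2"] by simp
    fix n and x :: "real^3" assume n: "2 * n0 \<le> n"
    have n1: "n \<ge> 1" using n n0 by simp
    have np: "0 < real n" using n1 by simp
    have z: "(1 - bigcut n x) * contr (sym_grad du) (dcor_sum e i) x = 0"
    proof (cases "norm x \<le> real n")
      case True
      then show ?thesis using bigcut_facts(1)[OF n1] by simp
    next
      case False
      then have "dcor_sum e i k x = 0" for k using corout(2)[of _ x k] n by (simp add: dcor_sum_def J_def[symmetric])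
      then show ?thesis by (simp add: contr_def)
    qed
    have gh: "g n x - h n x = indicator U x * (\<Sum>k\<in>UNIV. dbigcut n k x * (\<sigma> k x \<bullet> Q x))"
      using exp[of x n] z n by (cases "x \<in> U") (auto simp: g_def h_def)
    show "\<bar>g n x - h n x\<bar> \<le> indicator {x. real n \<le> norm x} x * (27 / 2 * W x)
        + indicator (cball 0 (2 * real n)) x * (96 * C^2 / real n / real n ^ 3)"
    proof (cases "x \<in> U \<and> real n < norm x \<and> norm x < 2 * real n")
      case False
      then consider "x \<notin> U" | "norm x \<le> real n \<or> 2 * real n \<le> norm x" by linarith
      then have "g n x - h n x = 0"
      proof cases
        case 2
        then show ?thesis unfolding gh using bigcut_facts(3)[OF n1] by simp
      qed (simp add: gh)
      moreover have "0 \<le> indicator {x. real n \<le> norm x} x * (27 / 2 * W x)" using W_nonneg[of x] by simp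
      moreover have "0 \<le> indicator (cball 0 (2 * real n)) x * (96 * C^2 / real n / real n ^ 3)" by simp
      ultimately show ?thesis by linarith
    next
      case True
      then have x: "x \<in> U" by blast
      have f: "real n / 2 \<le> norm (x - X i)" "R \<le> norm (x - X i)"
        using far_at_distance[OF i n0(2)] n True by auto
      have "Q x = Psi e i x" unfolding Q_def using corout(1) True n by simp
      then have "norm (Q x) \<le> C / norm (x - X i) ^ 1" using C(2)[OF f(2)] by (simp add: Psi_def)
      also have "\<dots> \<le> C / (real n / 2)"
        unfolding power_one_right by (rule divide_left_mono[OF f(1) C(1)], rule mult_pos_pos) (use np f R_pos in linarith)+
      finally have Qb: "norm (Q x) \<le> 2 * C / real n" by (simp add: mult.commute)
      have "\<bar>dbigcut n k x * (\<sigma> k x \<bullet> Q x)\<bar> \<le> 9 / 2 * W x + 32 * C^2 / real n ^ 4" for k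
      proof -
        have "\<bar>\<sigma> k x \<bullet> Q x\<bar> \<le> norm (\<sigma> k x) * norm (Q x)" by (rule Cauchy_Schwarz_ineq2)
        also have "\<dots> \<le> norm (\<sigma> k x) * (2 * C / real n)" by (intro mult_left_mono Qb) simp
        finally have "\<bar>dbigcut n k x * (\<sigma> k x \<bullet> Q x)\<bar> \<le> (4 / real n) * (norm (\<sigma> k x) * (2 * C / real n))"
          unfolding abs_mult by (intro mult_mono bigcut_facts(4)[OF n1]) (use np in auto)
        also have "\<dots> = norm (\<sigma> k x) * (8 * C / (real n)^2)" by (simp add: power2_eq_square)
        also have "\<dots> \<le> ((norm (\<sigma> k x))^2 + (8 * C / (real n)^2)^2) / 2"
          using sum_squares_bound[of "norm (\<sigma> k x)" "8 * C / (real n)^2"] by simp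
        also have "(8 * C / (real n)^2)^2 = 64 * C^2 / real n ^ 4"
          by (simp add: power_divide power_mult_distrib power_mult[symmetric])
        also have "((norm (\<sigma> k x))^2 + 64 * C^2 / real n ^ 4) / 2 \<le> 9 / 2 * W x + 32 * C^2 / real n ^ 4"
          using norm_\<sigma>_W[OF x, of k] by simp
        finally show ?thesis .
      qed
      then have "\<bar>\<Sum>k\<in>UNIV. dbigcut n k x * (\<sigma> k x \<bullet> Q x)\<bar> \<le> (\<Sum>k\<in>(UNIV::3 set). 9 / 2 * W x + 32 * C^2 / real n ^ 4)"
        by (intro order_trans[OF sum_abs sum_mono])
      also have "\<dots> = 27 / 2 * W x + 96 * C^2 / real n / real n ^ 3" using np by (simp add: eval_nat_numeral)
      finally show ?thesis unfolding gh using True by simp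
    qed
  qed
  moreover have "\<forall>\<^sub>F n in sequentially. (\<integral>x. g n x \<partial>lborel) - (\<integral>x. h n x \<partial>lborel)
     = ((\<Sum>j<N. drift e i j \<bullet> F) + (\<integral>x. indicator U x * contr (sym_grad du) (dcor_sum e i) x \<partial>lborel))
       - (\<integral>x. indicator U x * (bigcut n x * contr (sym_grad (dPsi e i)) du x) \<partial>lborel)"
  proof (rule eventually_sequentiallyI[of "2 * n0"])
    fix n assume n: "2 * n0 \<le> n"
    then have nn: "n0 \<le> n" by simp
    have "(\<integral>x. g n x \<partial>lborel) = (\<integral>x. indicator U x * contr \<sigma> (d\<Phi> n) x \<partial>lborel)
        + (\<integral>x. indicator U x * contr (sym_grad du) (dcor_sum e i) x \<partial>lborel)"
      unfolding g_def using n i\<Phi>[OF nn] idc by simp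
    then show "(\<integral>x. g n x \<partial>lborel) - (\<integral>x. h n x \<partial>lborel)
     = ((\<Sum>j<N. drift e i j \<bullet> F) + (\<integral>x. indicator U x * contr (sym_grad du) (dcor_sum e i) x \<partial>lborel))
       - (\<integral>x. indicator U x * (bigcut n x * contr (sym_grad (dPsi e i)) du x) \<partial>lborel)"
      unfolding h_def weak[OF nn] using n by simp
  qed
  ultimately have "(\<lambda>n. ((\<Sum>j<N. drift e i j \<bullet> F) + (\<integral>x. indicator U x * contr (sym_grad du) (dcor_sum e i) x \<partial>lborel))
       - (\<integral>x. indicator U x * (bigcut n x * contr (sym_grad (dPsi e i)) du x) \<partial>lborel)) \<longlonglongrightarrow> 0"
    by (rule Lim_transform_eventually)
  from tendsto_diff[OF tendsto_const[of "(\<Sum>j<N. drift e i j \<bullet> F)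
      + (\<integral>x. indicator U x * contr (sym_grad du) (dcor_sum e i) x \<partial>lborel)"] this] show ?thesis by simp
qed

text \<open>The same integral is computed by testing the stress of \<open>Psi e i\<close> with \<open>u\<close>, and the stress of \<open>u\<close>
  with the corrected \<open>Psi e i\<close>.\<close>

theorem velocity_formula:
  assumes "i < N"
  shows "8 * pi * (e \<bullet> V i) = (\<Sum>j<N. drift e i j \<bullet> F)
     + (\<integral>x. indicator U x * contr (sym_grad du) (dcor_sum e i) x \<partial>lborel)"
  using LIMSEQ_unique[OF reciprocal_limit[OF assms] corrected_limit[OF assms]] .

end

section \<open>Lipschitz bound for the velocities\<close>

lemma norm_sym_grad_le:
  assumes "\<And>k. norm (d k x) \<le> M"
  shows "norm (sym_grad d k x) \<le> 4 * M"
proof -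
  have "norm (\<chi> a. d a x $ k) \<le> (\<Sum>a\<in>UNIV. \<bar>(\<chi> a. d a x $ k) $ a\<bar>)" by (rule norm_le_l1_cart)
  also have "\<dots> \<le> (\<Sum>a\<in>(UNIV::3 set). M)"
  proof (rule sum_mono)
    fix a show "\<bar>(\<chi> a. d a x $ k) $ a\<bar> \<le> M"
      using component_le_norm_cart[of "d a x" k] assms[of a] by simp
  qed
  finally have "norm (\<chi> a. d a x $ k) \<le> 3 * M" by simp
  then show ?thesis unfolding sym_grad_def
    using norm_triangle_ineq[of "d k x" "\<chi> a. d a x $ k"] assms[of k] by linarith
qed

lemma contr_self: "contr T T x = (\<Sum>k\<in>UNIV. (norm (T k x))^2)"
  by (simp add: contr_def power2_norm_eq_inner)

lemma contr_self_nonneg: "0 \<le> contr T T x"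
  unfolding contr_self by (simp add: sum_nonneg)

lemma contr_young:
  assumes "\<tau> > 0"
  shows "\<bar>contr S T x\<bar> \<le> \<tau> / 2 * contr S S x + 1 / (2 * \<tau>) * contr T T x"
proof -
  have "\<bar>S k x \<bullet> T k x\<bar> \<le> \<tau> / 2 * (norm (S k x))^2 + 1 / (2 * \<tau>) * (norm (T k x))^2" for k
  proof -
    define s where "s = sqrt \<tau>"
    have s: "s > 0" "s^2 = \<tau>" using assms by (auto simp: s_def)
    have "\<bar>(s *\<^sub>R S k x) \<bullet> ((1 / s) *\<^sub>R T k x)\<bar> \<le> ((norm (s *\<^sub>R S k x))^2 + (norm ((1 / s) *\<^sub>R T k x))^2) / 2"
      by (rule abs_inner_le_half)
    then show ?thesis using s by (simp add: power_mult_distrib power_divide field_simps)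
  qed
  then have "(\<Sum>k\<in>UNIV. \<bar>S k x \<bullet> T k x\<bar>) \<le> (\<Sum>k\<in>UNIV. \<tau> / 2 * (norm (S k x))^2 + 1 / (2 * \<tau>) * (norm (T k x))^2)"
    by (rule sum_mono)
  then have "\<bar>contr S T x\<bar> \<le> (\<Sum>k\<in>UNIV. \<tau> / 2 * (norm (S k x))^2 + 1 / (2 * \<tau>) * (norm (T k x))^2)"
    unfolding contr_def by (rule order_trans[OF sum_abs])
  then show ?thesis unfolding contr_self sum_distrib_left sum.distrib .
qed

context stokes_flow
begin

definition dissipation :: real where
  "dissipation = (\<integral>x. indicator U x * contr (sym_grad du) (sym_grad du) x \<partial>lborel)"

lemma contr_\<sigma>_du: "x \<in> U \<Longrightarrow> contr \<sigma> du x = 1 / 2 * contr (sym_grad du) (sym_grad du) x"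
  using contr_\<sigma>[of du x] div_u[of x] contr_sym_grad(1)[of du du x] by simp

text \<open>Twice the power of the forces, because \<open>sym_grad\<close> is not halved and the
  pressure drops out.\<close>

lemma dissipation_eq: "dissipation = 2 * (\<Sum>i<N. V i \<bullet> F)"
proof -
  have eq: "indicator U x * contr \<sigma> du x = (1 / 2) * (indicator U x * contr (sym_grad du) (sym_grad du) x)" for x
    by (simp add: contr_\<sigma>_du indicator_def)
  then have "(\<integral>x. indicator U x * contr \<sigma> du x \<partial>lborel) = (1 / 2) * dissipation"
    unfolding eq dissipation_def by simp
  then show ?thesis using energy_identity by simp
qed

lemma integrable_dissipation: "integrable lborel (\<lambda>x. indicator U x * contr (sym_grad du) (sym_grad du) x)"
proof (rule integrable_on_U[where g="\<lambda>x. 30 * W x"])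
  show "continuous_on U (contr (sym_grad du) (sym_grad du))"
    by (intro continuous_contr continuous_sym_grad continuous_on_subset[OF continuous_du U_subset_D])
  show "\<bar>contr (sym_grad du) (sym_grad du) x\<bar> \<le> 30 * W x" if "x \<in> U" for x
    using contr_\<sigma>_du[OF that] abs_contr_\<sigma>_du[OF that] by simp
qed (use integrable_W W_nonneg in auto)

lemma dissipation_nonneg: "0 \<le> dissipation"
  unfolding dissipation_def by (rule Bochner_Integration.integral_nonneg) (simp add: contr_self_nonneg)

text \<open>Young's inequality with weight \<open>\<tau>\<close>; 13000 is an upper bound for 48 times the volume of a ball of
  radius 4.\<close>

lemma local_work_bound:
  assumes \<tau>: "\<tau> > 0" and c: "\<And>k. continuous_on D (d k)"
    and b: "\<And>j k x. j < N \<Longrightarrow> dist (X j) x \<le> 4 * R \<Longrightarrow> norm (d k x) \<le> M j" and M: "\<And>j. 0 \<le> M j"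
    and z: "\<And>x k. (\<And>j. j < N \<Longrightarrow> 4 * R \<le> dist (X j) x) \<Longrightarrow> d k x = 0"
  shows "\<bar>\<integral>x. indicator U x * contr (sym_grad du) d x \<partial>lborel\<bar>
     \<le> \<tau> / 4 * dissipation + 13000 / (4 * \<tau>) * R^3 * (\<Sum>j<N. (M j)^2)"
proof -
  obtain n0 :: nat where n0: "n0 \<ge> 1" "\<And>i. i < N \<Longrightarrow> norm (X i) + 4 * R \<le> real n0"
    using exists_radius by blast
  \<comment> \<open>A gradient bound M gives 4 M for each column of \<open>sym_grad\<close>, hence 3
    * 16 = 48 times M^2 for the square.\<close>
  define w where "w x = (\<Sum>j<N. indicator (cball (X j) (4 * R)) x * (48 * (M j)^2))" for x
  have w: "integrable lborel w" "(\<integral>x. w x \<partial>lborel) \<le> 13000 * R^3 * (\<Sum>j<N. (M j)^2)"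
  proof -
    have i: "integrable lborel (\<lambda>x. indicator (cball (X j) (4 * R)) x * (48 * (M j)^2))" for j
      using borel_integrable_compact[OF compact_cball[of "X j" "4 * R"], of "\<lambda>_. 48 * (M j)^2"] by simp
    then show "integrable lborel w" unfolding w_def by (intro Bochner_Integration.integrable_sum)
    have "(\<integral>x. w x \<partial>lborel) = (\<Sum>j<N. measure lborel (cball (X j) (4 * R)) * (48 * (M j)^2))"
      unfolding w_def by (subst Bochner_Integration.integral_sum[OF i]) simp
    also have "\<dots> = (\<Sum>j<N. (4 / 3 * pi * (4 * R)^3 * 48) * (M j)^2)"
      using R_pos by (simp add: content_cball unit_ball_vol_3 mult_ac)
    also have "\<dots> \<le> (\<Sum>j<N. (13000 * R^3) * (M j)^2)"
    proof (intro sum_mono mult_right_mono)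
      have "pi < 3.15" using pi_approx by simp
      then have "4 / 3 * pi * 64 * 48 * R^3 \<le> 13000 * R^3" using R_pos by (intro mult_right_mono) auto
      then show "4 / 3 * pi * (4 * R)^3 * 48 \<le> 13000 * R^3" by (simp add: power_mult_distrib mult_ac)
    qed simp
    finally show "(\<integral>x. w x \<partial>lborel) \<le> 13000 * R^3 * (\<Sum>j<N. (M j)^2)" by (simp add: sum_distrib_left)
  qed
  have sgw: "contr (sym_grad d) (sym_grad d) x \<le> w x" for x
  proof (cases "\<exists>j<N. dist (X j) x \<le> 4 * R")
    case False
    then have "d k x = 0" for k by (intro z) (simp add: not_le less_imp_le)
    then have "sym_grad d k x = 0" for k by (simp add: sym_grad_def vec_eq_iff)
    then have "contr (sym_grad d) (sym_grad d) x = 0" by (rule contr_eq_0)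
    then show ?thesis unfolding w_def by (simp add: sum_nonneg)
  next
    case True
    then obtain j where j: "j < N" "dist (X j) x \<le> 4 * R" by blast
    have "(norm (sym_grad d k x))^2 \<le> (4 * M j)^2" for k
      by (intro power_mono norm_sym_grad_le b[OF j]) simp
    then have "contr (sym_grad d) (sym_grad d) x \<le> (\<Sum>k\<in>(UNIV::3 set). (4 * M j)^2)"
      unfolding contr_self by (rule sum_mono)
    also have "\<dots> = indicator (cball (X j) (4 * R)) x * (48 * (M j)^2)"
      using j by (simp add: power_mult_distrib)
    also have "\<dots> \<le> w x" unfolding w_def
      using j by (intro member_le_sum[of j "{..<N}" "\<lambda>j. indicator (cball (X j) (4 * R)) x * (48 * (M j)^2)"]) auto
    finally show ?thesis .
  qed
  have pt: "\<bar>indicator U x * contr (sym_grad du) d x\<bar>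
     \<le> \<tau> / 4 * (indicator U x * contr (sym_grad du) (sym_grad du) x) + 1 / (4 * \<tau>) * w x" for x
  proof (cases "x \<in> U")
    case False
    have "0 \<le> w x" using sgw[of x] contr_self_nonneg order_trans by blast
    then show ?thesis using False \<tau> by simp
  next
    case True
    have "\<bar>contr (sym_grad du) d x\<bar> = 1 / 2 * \<bar>contr (sym_grad du) (sym_grad d) x\<bar>"
      by (subst contr_sym_grad(1)) simp
    also have "\<dots> \<le> 1 / 2 * (\<tau> / 2 * contr (sym_grad du) (sym_grad du) x + 1 / (2 * \<tau>) * contr (sym_grad d) (sym_grad d) x)"
      by (intro mult_left_mono contr_young \<tau>) simp
    also have "\<dots> \<le> 1 / 2 * (\<tau> / 2 * contr (sym_grad du) (sym_grad du) x + 1 / (2 * \<tau>) * w x)"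
      by (intro mult_left_mono add_left_mono sgw) (use \<tau> in auto)
    also have "\<dots> = \<tau> / 4 * contr (sym_grad du) (sym_grad du) x + 1 / (4 * \<tau>) * w x"
      by (simp add: distrib_left)
    finally show ?thesis using True by simp
  qed
  have id: "integrable lborel (\<lambda>x. indicator U x * contr (sym_grad du) d x)"
  proof (rule integrable_bounded_support[where B="real n0"])
    show "continuous_on D (contr (sym_grad du) d)"
      by (intro continuous_contr continuous_sym_grad continuous_du c)
    show "contr (sym_grad du) d x = 0" if "real n0 < norm x" for x
    proof (intro contr_eq_0 z)
      fix j assume j: "j < N"
      have "norm x \<le> norm (x - X j) + norm (X j)" using norm_triangle_ineq[of "x - X j" "X j"] by simp
      then show "4 * R \<le> dist (X j) x" using n0(2)[OF j] that by (simp add: dist_norm norm_minus_commute)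
    qed
  qed
  have "\<bar>\<integral>x. indicator U x * contr (sym_grad du) d x \<partial>lborel\<bar> \<le> (\<integral>x. \<bar>indicator U x * contr (sym_grad du) d x\<bar> \<partial>lborel)"
    by (rule integral_abs_bound)
  also have "\<dots> \<le> (\<integral>x. \<tau> / 4 * (indicator U x * contr (sym_grad du) (sym_grad du) x) + 1 / (4 * \<tau>) * w x \<partial>lborel)"
    by (rule integral_mono) (use id integrable_dissipation w pt in auto)
  also have "\<dots> = \<tau> / 4 * dissipation + 1 / (4 * \<tau>) * (\<integral>x. w x \<partial>lborel)"
    unfolding dissipation_def using integrable_dissipation w(1) by simp
  also have "\<dots> \<le> \<tau> / 4 * dissipation + 1 / (4 * \<tau>) * (13000 * R^3 * (\<Sum>j<N. (M j)^2))"
    by (intro add_left_mono mult_left_mono w(2)) (use \<tau> in auto)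
  finally show ?thesis by (simp add: mult_ac)
qed

text \<open>The centres are at least 16 R apart, so a displacement by 4 R costs at most a quarter of
  their distance.\<close>

lemma dist_kernel_arg:
  assumes "i < N" "j < N" "j \<noteq> i" "dist (X j) x \<le> 4 * R"
  shows "3 / 4 * dist (X i) (X j) \<le> norm (x - X i)" "R \<le> norm (x - X i)"
proof -
  have "dist (X i) (X j) \<le> norm (x - X i) + dist (X j) x"
    by (metis dist_commute dist_norm dist_triangle)
  moreover have "16 * R \<le> dist (X i) (X j)" using sep assms by auto
  ultimately show "3 / 4 * dist (X i) (X j) \<le> norm (x - X i)" "R \<le> norm (x - X i)"
    using assms(4) R_pos by linarith+
qed

lemma X_distinct: "i < N \<Longrightarrow> j < N \<Longrightarrow> j \<noteq> i \<Longrightarrow> 0 < dist (X i) (X j)"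
  using sep[of i j] R_pos by fastforce

lemma dcor_bound:
  assumes C: "\<And>k l y. R \<le> norm y \<Longrightarrow> norm (ddflow_potential R e k l y) \<le> C / norm y ^ 2" "0 \<le> C"
    and ij: "i < N" "j < N" "j \<noteq> i"
  shows "norm (dcor e i j k x) \<le> 40000 * C / dist (X i) (X j) ^ 2"
proof -
  interpret P: smooth_potential R "X j" "pot e i" "dpot e i" "ddpot e i" by (rule potential[OF ij])
  have "norm (dcor e i j k x) \<le> 20000 * (2 * C / dist (X i) (X j) ^ 2)"
    unfolding dcor_def
  proof (rule P.dcorrector_bound)
    fix k l x assume "x \<in> ball (X j) (4 * R)"
    then have x: "dist (X j) x \<le> 4 * R" by simp
    note a = dist_kernel_arg[OF ij x]
    have p: "0 < dist (X i) (X j)" by (rule X_distinct[OF ij])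
    have "norm (ddpot e i k l x) \<le> C / norm (x - X i) ^ 2" unfolding ddpot_def by (rule C(1)[OF a(2)])
    also have "\<dots> \<le> C / (3 / 4 * dist (X i) (X j))^2"
      by (intro divide_left_mono power_mono a(1) C(2) mult_pos_pos zero_less_power) (use p a R_pos in linarith)+
    also have "\<dots> = (16 / 9) * C / dist (X i) (X j) ^ 2" by (simp add: power_mult_distrib power_divide)
    also have "\<dots> \<le> 2 * C / dist (X i) (X j) ^ 2" using C(2) by (intro divide_right_mono) auto
    finally show "norm (ddpot e i k l x) \<le> 2 * C / dist (X i) (X j) ^ 2" .
  qed
  then show ?thesis by simp
qed

text \<open>The difference of the two correctors is the corrector of the difference of the
  potentials, and the kernel bound for differences trades one power of distance for a factor
  \<open>dist (X i) (X k)\<close>. The loss (4/3)^3 is rounded up to 3.\<close>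

lemma dcor_diff_bound:
  assumes C: "\<And>k l x y. R \<le> norm x \<Longrightarrow> R \<le> norm y \<Longrightarrow>
      norm (ddflow_potential R e k l x - ddflow_potential R e k l y) \<le> C * norm (x - y) / min (norm x) (norm y) ^ 3" "0 \<le> C"
    and ij: "i < N" "j < N" "j \<noteq> i" and kj: "k < N" "j \<noteq> k"
  shows "norm (dcor e i j l x - dcor e k j l x)
    \<le> 60000 * C * dist (X i) (X k) / min (dist (X i) (X j)) (dist (X k) (X j)) ^ 3"
proof -
  interpret P: smooth_potential R "X j" "pot e i" "dpot e i" "ddpot e i" by (rule potential[OF ij])
  interpret Q: smooth_potential R "X j" "pot e k" "dpot e k" "ddpot e k" by (rule potential[OF kj(1) ij(2) kj(2)])
  interpret S: smooth_potential R "X j" "\<lambda>x. pot e i x - pot e k x" "\<lambda>k' x. dpot e i k' x - dpot e k k' x"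
      "\<lambda>k' l x. ddpot e i k' l x - ddpot e k k' l x"
    by unfold_locales (auto intro!: has_partials_diff P.A Q.A P.dA Q.dA continuous_intros P.cddA Q.cddA R_pos)
  define m where "m = min (dist (X i) (X j)) (dist (X k) (X j))"
  have m: "0 < m" using X_distinct[OF ij] X_distinct[OF kj(1) ij(2) kj(2)] by (simp add: m_def)
  have "norm (dcor e i j l x - dcor e k j l x) \<le> 20000 * (3 * C * dist (X i) (X k) / m ^ 3)"
    unfolding dcor_def dcorrector_diff
  proof (rule S.dcorrector_bound)
    fix k' l x assume "x \<in> ball (X j) (4 * R)"
    then have x: "dist (X j) x \<le> 4 * R" by simp
    note a = dist_kernel_arg[OF ij x] and b = dist_kernel_arg[OF kj(1) ij(2) kj(2) x]
    have le: "3 / 4 * m \<le> min (norm (x - X i)) (norm (x - X k))" using a b by (auto simp: m_def)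
    have "norm (ddpot e i k' l x - ddpot e k k' l x) \<le> C * norm ((x - X i) - (x - X k)) / min (norm (x - X i)) (norm (x - X k)) ^ 3"
      unfolding ddpot_def by (rule C(1)[OF a(2) b(2)])
    also have "norm ((x - X i) - (x - X k)) = dist (X i) (X k)" by (simp add: dist_norm norm_minus_commute)
    also have "C * dist (X i) (X k) / min (norm (x - X i)) (norm (x - X k)) ^ 3 \<le> C * dist (X i) (X k) / (3 / 4 * m) ^ 3"
    proof (rule divide_left_mono)
      show "(3 / 4 * m) ^ 3 \<le> min (norm (x - X i)) (norm (x - X k)) ^ 3" using m by (intro power_mono le) auto
      show "0 \<le> C * dist (X i) (X k)" using C(2) by simp
      have "0 < min (norm (x - X i)) (norm (x - X k))" using le m by linarith
      then show "0 < min (norm (x - X i)) (norm (x - X k)) ^ 3 * (3 / 4 * m) ^ 3" using m by simp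
    qed
    also have "\<dots> = (64 / 27) * (C * dist (X i) (X k) / m ^ 3)" by (simp add: power_mult_distrib power_divide)
    also have "\<dots> \<le> 3 * (C * dist (X i) (X k) / m ^ 3)" using C(2) m by (intro mult_right_mono) auto
    finally show "norm (ddpot e i k' l x - ddpot e k k' l x) \<le> 3 * C * dist (X i) (X k) / m ^ 3" by simp
  qed
  then show ?thesis by (simp add: m_def)
qed

lemma continuous_dcor_sum: "i < N \<Longrightarrow> continuous_on S (dcor_sum e i k)"
  unfolding dcor_sum_def using cor_partials(3) by (intro continuous_intros) auto

lemma dcor_sum_near:
  assumes "i < N" "j < N" "dist (X j) x \<le> 4 * R"
  shows "dcor_sum e i k x = (if j = i then 0 else dcor e i j k x)"
proof -
  have o: "dcor e i l k x = 0" if "l \<in> {..<N} - {i}" "l \<noteq> j" for l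
  proof -
    have "12 * R \<le> dist (X l) x" by (rule far_from_others[OF assms(2) _ _ assms(3)]) (use that in auto)
    then show ?thesis using R_pos by (intro cor_outside) linarith
  qed
  have "dcor_sum e i k x = (\<Sum>l\<in>{..<N} - {i}. if l = j then dcor e i j k x else 0)"
    unfolding dcor_sum_def by (rule sum.cong) (use o in auto)
  also have "\<dots> = (if j = i then 0 else dcor e i j k x)" using assms(2) by auto
  finally show ?thesis .
qed

lemma dcor_sum_far: "(\<And>j. j < N \<Longrightarrow> 4 * R \<le> dist (X j) x) \<Longrightarrow> dcor_sum e i k x = 0"
  unfolding dcor_sum_def by (intro sum.neutral) (auto intro: cor_outside)

end

text \<open>One constant for all radii; as R depends on N this makes the later estimates uniform in
  N.\<close>

definition kernel_bounds :: "real \<Rightarrow> real^3 \<Rightarrow> bool" where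
  "kernel_bounds C e \<longleftrightarrow> 0 \<le> C \<and> (\<forall>R>0. \<forall>x y. R \<le> norm x \<longrightarrow> R \<le> norm y \<longrightarrow>
     norm (sphere_flow R e x) \<le> C / norm x \<and>
     norm (sphere_flow R e x - sphere_flow R e y) \<le> C * norm (x - y) / min (norm x) (norm y) ^ 2 \<and>
     (\<forall>k l. norm (ddflow_potential R e k l x) \<le> C / norm x ^ 2 \<and>
       norm (ddflow_potential R e k l x - ddflow_potential R e k l y) \<le> C * norm (x - y) / min (norm x) (norm y) ^ 3))"

lemma kernel_boundsD:
  assumes "kernel_bounds C e" "0 < R" "R \<le> norm x"
  shows "norm (sphere_flow R e x) \<le> C / norm x"
    and "norm (ddflow_potential R e k l x) \<le> C / norm x ^ 2"
    and "R \<le> norm y \<Longrightarrow> norm (sphere_flow R e x - sphere_flow R e y) \<le> C * norm (x - y) / min (norm x) (norm y) ^ 2"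
    and "R \<le> norm y \<Longrightarrow> norm (ddflow_potential R e k l x - ddflow_potential R e k l y)
       \<le> C * norm (x - y) / min (norm x) (norm y) ^ 3"
  using assms unfolding kernel_bounds_def by blast+

lemma kernel_bounds_exist: "\<exists>C. \<forall>a. kernel_bounds C (axis a 1)"
proof -
  have "\<forall>a. \<exists>C\<ge>0. \<forall>R>0. \<forall>x y. R \<le> norm x \<longrightarrow> R \<le> norm y \<longrightarrow>
     norm (sphere_flow R (axis a 1) x) \<le> C / norm x ^ 1 \<and>
     norm (sphere_flow R (axis a 1) x - sphere_flow R (axis a 1) y) \<le> C * norm (x - y) / min (norm x) (norm y) ^ (1 + 1)"
    using kern_sphere_flow unfolding kern_def by blast
  then obtain C1 where C1: "\<And>a. 0 \<le> C1 a" "\<And>a R x y. 0 < R \<Longrightarrow> R \<le> norm x \<Longrightarrow> R \<le> norm y \<Longrightarrow>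
     norm (sphere_flow R (axis a 1) x) \<le> C1 a / norm x ^ 1 \<and>
     norm (sphere_flow R (axis a 1) x - sphere_flow R (axis a 1) y) \<le> C1 a * norm (x - y) / min (norm x) (norm y) ^ (1 + 1)"
    by metis
  have "\<forall>a k l. \<exists>C\<ge>0. \<forall>R>0. \<forall>x y. R \<le> norm x \<longrightarrow> R \<le> norm y \<longrightarrow>
     norm (ddflow_potential R (axis a 1) k l x) \<le> C / norm x ^ 2 \<and>
     norm (ddflow_potential R (axis a 1) k l x - ddflow_potential R (axis a 1) k l y) \<le> C * norm (x - y) / min (norm x) (norm y) ^ (2 + 1)"
    using kern_ddflow_potential unfolding kern_def by blast
  then obtain C2 where C2: "\<And>a k l. 0 \<le> C2 a k l" "\<And>a k l R x y. 0 < R \<Longrightarrow> R \<le> norm x \<Longrightarrow> R \<le> norm y \<Longrightarrow>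
     norm (ddflow_potential R (axis a 1) k l x) \<le> C2 a k l / norm x ^ 2 \<and>
     norm (ddflow_potential R (axis a 1) k l x - ddflow_potential R (axis a 1) k l y) \<le> C2 a k l * norm (x - y) / min (norm x) (norm y) ^ (2 + 1)"
    by metis
  define C where "C = (\<Sum>a\<in>UNIV. C1 a) + (\<Sum>(a, k, l)\<in>UNIV. C2 a k l)"
  have n2: "0 \<le> (\<Sum>(a, k, l)\<in>UNIV. C2 a k l)" by (intro sum_nonneg) (auto simp: C2)
  have n1: "0 \<le> (\<Sum>a\<in>UNIV. C1 a)" by (intro sum_nonneg) (auto simp: C1)
  have c1: "C1 a \<le> C" for a
    using member_le_sum[of a UNIV C1] C1(1) n2 by (simp add: C_def)
  have c2: "C2 a k l \<le> C" for a k l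
    using member_le_sum[of "(a, k, l)" UNIV "\<lambda>(a, k, l). C2 a k l"] C2(1) n1 by (auto simp: C_def)
  have up: "u \<le> c * t / v \<Longrightarrow> c \<le> C \<Longrightarrow> 0 \<le> t \<Longrightarrow> 0 \<le> v \<Longrightarrow> u \<le> C * t / v" for u c t v :: real
    by (erule order_trans) (intro divide_right_mono mult_right_mono)
  have "kernel_bounds C (axis a 1)" for a
    unfolding kernel_bounds_def
  proof (intro conjI allI impI)
    show "0 \<le> C" using n1 n2 by (simp add: C_def)
    fix R :: real and x y :: "real^3" assume R: "0 < R" "R \<le> norm x" "R \<le> norm y"
    have m: "0 \<le> min (norm x) (norm y)" by simp
    show "norm (sphere_flow R (axis a 1) x) \<le> C / norm x"
      using up[of "norm (sphere_flow R (axis a 1) x)" "C1 a" 1 "norm x"] C1(2)[OF R, of a] c1 by simp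
    show "norm (sphere_flow R (axis a 1) x - sphere_flow R (axis a 1) y) \<le> C * norm (x - y) / min (norm x) (norm y) ^ 2"
      by (rule up[OF _ c1[of a]]) (use C1(2)[OF R, of a] m in \<open>simp_all add: numeral_2_eq_2\<close>)
    fix k l
    show "norm (ddflow_potential R (axis a 1) k l x) \<le> C / norm x ^ 2"
      using up[of "norm (ddflow_potential R (axis a 1) k l x)" "C2 a k l" 1 "norm x ^ 2"] C2(2)[OF R, of a k l] c2 by simp
    show "norm (ddflow_potential R (axis a 1) k l x - ddflow_potential R (axis a 1) k l y) \<le> C * norm (x - y) / min (norm x) (norm y) ^ 3"
      by (rule up[OF _ c2[of a k l]]) (use C2(2)[OF R, of a k l] m in \<open>simp_all add: numeral_3_eq_3 numeral_2_eq_2\<close>)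
  qed
  then show ?thesis by blast
qed

context stokes_flow
begin

text \<open>Zero on the diagonal, so that sums may run over all indices.\<close>

definition inv_sq :: "nat \<Rightarrow> nat \<Rightarrow> real" where
  "inv_sq i j = (if j = i then 0 else 1 / dist (X i) (X j) ^ 2)"

lemma inv_sq_nonneg: "0 \<le> inv_sq i j" by (simp add: inv_sq_def)

text \<open>The interaction 1 / dist is bounded by the mean of 1 and 1 / dist^2, which sums to O(N).
  For the correctors, one factor 1 / dist^2 is estimated by its maximum B N and the other one is
  summed. The term 4 / (3 R) is the speed of the particle in isolation.\<close>

lemma speed_estimate:
  fixes A B :: real
  assumes C: "kernel_bounds C e" and e: "norm e = 1" and \<tau>: "\<tau> > 0" and i: "i < N"
    and A: "(\<Sum>j<N. inv_sq i j) \<le> A * N" and B: "\<And>j. j < N \<Longrightarrow> inv_sq i j \<le> B * N"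
  shows "8 * pi * \<bar>e \<bullet> V i\<bar> \<le> norm F * (4 / (3 * R) + C * (N + A * N) / 2) + \<tau> / 4 * dissipation
     + 13000 / (4 * \<tau>) * R^3 * ((40000 * C)^2 * (B * N) * (A * N))"
proof -
  have C0: "0 \<le> C" using C by (simp add: kernel_bounds_def)
  have BN: "0 \<le> B * N" using B[OF i] by (simp add: inv_sq_def)
  have drift: "norm (drift e i j) \<le> (if j = i then 4 / (3 * R) else 0) + C * (1 + inv_sq i j) / 2" if j: "j < N" for j
  proof (cases "j = i")
    case True
    then show ?thesis using e R_pos C0 by (simp add: drift_def inv_sq_def)
  next
    case False
    have d: "0 < dist (X i) (X j)" by (rule X_distinct[OF i j False])
    have "R \<le> norm (X j - X i)" using sep[OF i j] False R_pos by (simp add: dist_norm norm_minus_commute)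
    from kernel_boundsD(1)[OF C R_pos this] have "norm (drift e i j) \<le> C / dist (X i) (X j)"
      using False by (simp add: drift_def Psi_def dist_norm norm_minus_commute)
    also have "\<dots> = C * (1 * (1 / dist (X i) (X j)))" by simp
    also have "\<dots> \<le> C * ((1^2 + (1 / dist (X i) (X j))^2) / 2)"
      using sum_squares_bound[of 1 "1 / dist (X i) (X j)"] by (intro mult_left_mono C0) simp
    finally show ?thesis using False by (simp add: inv_sq_def power_divide)
  qed
  have "\<bar>\<Sum>j<N. drift e i j \<bullet> F\<bar> \<le> (\<Sum>j<N. norm (drift e i j) * norm F)"
    by (rule order_trans[OF sum_abs sum_mono]) (rule Cauchy_Schwarz_ineq2)
  also have "\<dots> \<le> (\<Sum>j<N. ((if j = i then 4 / (3 * R) else 0) + C * (1 + inv_sq i j) / 2) * norm F)"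
    by (intro sum_mono mult_right_mono drift) auto
  also have "\<dots> = norm F * (4 / (3 * R) + C * (N + (\<Sum>j<N. inv_sq i j)) / 2)"
    using i by (simp add: sum_distrib_right[symmetric] sum.distrib sum_distrib_left[symmetric] sum_divide_distrib[symmetric] mult.commute)
  also have "\<dots> \<le> norm F * (4 / (3 * R) + C * (N + A * N) / 2)"
    using A C0 by (intro mult_left_mono add_left_mono divide_right_mono) auto
  finally have 1: "\<bar>\<Sum>j<N. drift e i j \<bullet> F\<bar> \<le> norm F * (4 / (3 * R) + C * (N + A * N) / 2)" .
  define M where "M j = 40000 * C * inv_sq i j" for j
  have w: "\<bar>\<integral>x. indicator U x * contr (sym_grad du) (dcor_sum e i) x \<partial>lborel\<bar>
     \<le> \<tau> / 4 * dissipation + 13000 / (4 * \<tau>) * R^3 * (\<Sum>j<N. (M j)^2)"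
  proof (rule local_work_bound[OF \<tau> continuous_dcor_sum[OF i]])
    show "norm (dcor_sum e i k x) \<le> M j" if "j < N" "dist (X j) x \<le> 4 * R" for j k x
    proof -
      have "norm (dcor e i j k x) \<le> 40000 * C / dist (X i) (X j) ^ 2" if "j \<noteq> i"
        by (rule dcor_bound[OF _ C0 i \<open>j < N\<close> that]) (rule kernel_boundsD[OF C R_pos])
      then show ?thesis unfolding dcor_sum_near[OF i that] M_def inv_sq_def by simp
    qed
    show "0 \<le> M j" for j using C0 inv_sq_nonneg by (simp add: M_def)
  qed (rule dcor_sum_far)
  have "(\<Sum>j<N. (M j)^2) \<le> (\<Sum>j<N. ((40000 * C)^2 * (B * N)) * inv_sq i j)"
  proof (rule sum_mono)
    fix j assume "j \<in> {..<N}"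
    then have "inv_sq i j * inv_sq i j \<le> B * N * inv_sq i j"
      by (intro mult_right_mono B inv_sq_nonneg) simp
    then have "(40000 * C)^2 * (inv_sq i j * inv_sq i j) \<le> (40000 * C)^2 * (B * N * inv_sq i j)"
      by (rule mult_left_mono) simp
    then show "(M j)^2 \<le> ((40000 * C)^2 * (B * N)) * inv_sq i j"
      by (simp add: M_def power2_eq_square mult_ac)
  qed
  also have "(\<Sum>j<N. ((40000 * C)^2 * (B * N)) * inv_sq i j) \<le> (40000 * C)^2 * (B * N) * (A * N)"
    unfolding sum_distrib_left[symmetric] using BN by (intro mult_left_mono A) simp
  finally have "13000 / (4 * \<tau>) * R^3 * (\<Sum>j<N. (M j)^2)
     \<le> 13000 / (4 * \<tau>) * R^3 * ((40000 * C)^2 * (B * N) * (A * N))"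
    by (rule mult_left_mono) (use \<tau> R_pos in simp)
  with w have 2: "\<bar>\<integral>x. indicator U x * contr (sym_grad du) (dcor_sum e i) x \<partial>lborel\<bar>
     \<le> \<tau> / 4 * dissipation + 13000 / (4 * \<tau>) * R^3 * ((40000 * C)^2 * (B * N) * (A * N))"
    by linarith
  have "8 * pi * \<bar>e \<bullet> V i\<bar> = \<bar>8 * pi * (e \<bullet> V i)\<bar>" by (simp add: abs_mult)
  then show ?thesis unfolding velocity_formula[OF i] using 1 2 by linarith
qed

text \<open>In the difference of the two drifts the singular terms \<open>j = i\<close> and \<open>j = k\<close> cancel, as the flow around
  a sphere is even; the coefficients \<open>c j\<close> record this.\<close>

lemma difference_estimate:
  fixes A B :: real
  assumes C: "kernel_bounds C e" and i: "i < N" and k: "k < N" "i \<noteq> k"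
    and A: "\<And>i. i < N \<Longrightarrow> (\<Sum>j<N. inv_sq i j) \<le> A * N" and B: "\<And>i j. i < N \<Longrightarrow> j < N \<Longrightarrow> inv_sq i j \<le> B * N"
  defines "\<delta> \<equiv> dist (X i) (X k)"
  shows "8 * pi * \<bar>e \<bullet> (V i - V k)\<bar> \<le> \<delta> * (norm F * C * (2 * (A * N)) + dissipation / 4
     + 13000 / 4 * R^3 * ((60000 * C)^2 * (B * N)^2 * (2 * (A * N))))"
proof -
  have C0: "0 \<le> C" using C by (simp add: kernel_bounds_def)
  have \<delta>: "0 < \<delta>" unfolding \<delta>_def using k by (intro X_distinct[OF i]) auto
  define t where "t j = inv_sq i j + inv_sq k j" for j
  have t0: "0 \<le> t j" for j using inv_sq_nonneg by (simp add: t_def)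
  have st: "(\<Sum>j<N. t j) \<le> 2 * (A * N)" using A[OF i] A[OF k(1)] by (simp add: t_def sum.distrib)
  have mt: "1 / min (dist (X i) (X j)) (dist (X k) (X j)) ^ 2 \<le> t j" if "j \<noteq> i" "j \<noteq> k" for j
    using that inv_sq_nonneg by (auto simp: t_def inv_sq_def min_def)
  have mB: "1 / min (dist (X i) (X j)) (dist (X k) (X j)) ^ 2 \<le> B * N" if "j \<noteq> i" "j \<noteq> k" "j < N" for j
    using B[OF i that(3)] B[OF k(1) that(3)] that by (auto simp: inv_sq_def min_def)
  define c where "c j = (if j = i then 1 else if j = k then -1 else (0::real))" for j
  have drift: "norm (drift e i j - drift e k j - c j *\<^sub>R (drift e i i - drift e k i)) \<le> C * \<delta> * t j" if j: "j < N" for j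
  proof -
    consider "j = i" | "j = k" | "j \<noteq> i" "j \<noteq> k" by blast
    then show ?thesis
    proof cases
      case 1
      then show ?thesis using C0 \<delta> t0 by (simp add: c_def)
    next
      case 2
      have "Psi e i (X k) = Psi e k (X i)"
        using sphere_flow_even[of R e "X k - X i"] by (simp add: Psi_def)
      then have "drift e i k - drift e k k + (drift e i i - drift e k i) = 0" using k by (simp add: drift_def)
      moreover have "drift e i j - drift e k j - c j *\<^sub>R (drift e i i - drift e k i)
          = drift e i k - drift e k k + (drift e i i - drift e k i)" using 2 k by (simp add: c_def)
      ultimately have "norm (drift e i j - drift e k j - c j *\<^sub>R (drift e i i - drift e k i)) = 0" by simp
      moreover have "0 \<le> C * \<delta> * t j" using C0 \<delta> t0 by simp
      ultimately show ?thesis by linarith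
    next
      case 3
      have "R \<le> norm (X j - X i)" "R \<le> norm (X j - X k)"
        using sep[OF i j] sep[OF k(1) j] 3 R_pos by (simp_all add: dist_norm norm_minus_commute)
      from kernel_boundsD(3)[OF C R_pos this]
      have "norm (drift e i j - drift e k j) \<le> C * norm ((X j - X i) - (X j - X k)) / min (norm (X j - X i)) (norm (X j - X k)) ^ 2"
        using 3 by (simp add: drift_def Psi_def)
      also have "\<dots> = C * \<delta> * (1 / min (dist (X i) (X j)) (dist (X k) (X j)) ^ 2)"
        by (simp add: \<delta>_def dist_norm norm_minus_commute)
      also have "\<dots> \<le> C * \<delta> * t j" using C0 \<delta> by (intro mult_left_mono mt 3) auto
      finally show ?thesis using 3 by (simp add: c_def)
    qed
  qed
  have c0: "(\<Sum>j<N. c j) = 0"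
  proof -
    have "(\<Sum>j<N. c j) = (\<Sum>j<N. (if j = i then 1 else 0) - (if j = k then 1 else 0))"
      by (rule sum.cong) (use k in \<open>auto simp: c_def\<close>)
    then show ?thesis using i k by (simp add: sum_subtractf)
  qed
  have dd: "(\<Sum>j<N. drift e i j \<bullet> F) - (\<Sum>j<N. drift e k j \<bullet> F)
      = (\<Sum>j<N. (drift e i j - drift e k j - c j *\<^sub>R (drift e i i - drift e k i)) \<bullet> F)"
  proof -
    have "(\<Sum>j<N. c j * ((drift e i i - drift e k i) \<bullet> F)) = 0"
      unfolding sum_distrib_right[symmetric] c0 by simp
    then show ?thesis by (simp add: inner_diff_left sum_subtractf)
  qed
  have "\<bar>(\<Sum>j<N. drift e i j \<bullet> F) - (\<Sum>j<N. drift e k j \<bullet> F)\<bar>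
      \<le> (\<Sum>j<N. norm (drift e i j - drift e k j - c j *\<^sub>R (drift e i i - drift e k i)) * norm F)"
    unfolding dd by (rule order_trans[OF sum_abs sum_mono]) (rule Cauchy_Schwarz_ineq2)
  also have "\<dots> \<le> (\<Sum>j<N. (C * \<delta> * t j) * norm F)"
    by (intro sum_mono mult_right_mono drift) auto
  also have "\<dots> = C * \<delta> * norm F * (\<Sum>j<N. t j)"
    by (simp add: sum_distrib_left sum_distrib_right mult_ac)
  also have "\<dots> \<le> C * \<delta> * norm F * (2 * (A * N))" using C0 \<delta> by (intro mult_left_mono st) auto
  finally have 1: "\<bar>(\<Sum>j<N. drift e i j \<bullet> F) - (\<Sum>j<N. drift e k j \<bullet> F)\<bar> \<le> C * \<delta> * norm F * (2 * (A * N))" .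
  \<comment> \<open>Near the ball i only the corrector of k is present, and vice versa; its bound,
    of order 1 / \<delta>^2, is written as \<delta> / \<delta>^3 to share the factor
    \<delta>.\<close>
  define M where "M j = 60000 * C * \<delta> * (if j = i \<or> j = k then 1 / \<delta> ^ 3
      else 1 / min (dist (X i) (X j)) (dist (X k) (X j)) ^ 3)" for j
  have M0: "0 \<le> M j" for j
    unfolding M_def using C0 \<delta> by simp
  define d where "d l x = dcor_sum e i l x - dcor_sum e k l x" for l x
  \<comment> \<open>The weight \<delta> in Young's inequality produces the Lipschitz factor in both
    terms: directly for the dissipation, and as \<delta>^2 / \<delta> for the correctors.\<close>
  have w: "\<bar>\<integral>x. indicator U x * contr (sym_grad du) d x \<partial>lborel\<bar>
     \<le> \<delta> / 4 * dissipation + 13000 / (4 * \<delta>) * R^3 * (\<Sum>j<N. (M j)^2)"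
  proof (rule local_work_bound[OF \<delta>])
    show "continuous_on D (d l)" for l unfolding d_def by (intro continuous_intros continuous_dcor_sum i k)
    show "norm (d l x) \<le> M j" if j: "j < N" "dist (X j) x \<le> 4 * R" for j l x
    proof -
      have s: "60000 * C * \<delta> * (1 / \<delta> ^ 3) = 60000 * C / \<delta> ^ 2" using \<delta> by (simp add: eval_nat_numeral)
      have sg: "norm (dcor e p q l x) \<le> 60000 * C / \<delta> ^ 2" if "p < N" "q < N" "q \<noteq> p" "dist (X p) (X q) = \<delta>" for p q
      proof -
        have "norm (dcor e p q l x) \<le> 40000 * C / dist (X p) (X q) ^ 2"
          by (rule dcor_bound[OF _ C0 that(1,2,3)]) (rule kernel_boundsD[OF C R_pos])
        also have "\<dots> \<le> 60000 * C / \<delta> ^ 2" unfolding that(4) using C0 by (intro divide_right_mono) auto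
        finally show ?thesis .
      qed
      consider "j = i" | "j = k" | "j \<noteq> i" "j \<noteq> k" by blast
      then show ?thesis
      proof cases
        case 1
        have "d l x = - dcor e k i l x"
          unfolding d_def dcor_sum_near[OF i j] dcor_sum_near[OF k(1) j] using 1 k by simp
        then show ?thesis using sg[OF k(1) i k(2)] 1 s by (simp add: M_def \<delta>_def dist_commute)
      next
        case 2
        have "d l x = dcor e i k l x"
          unfolding d_def dcor_sum_near[OF i j] dcor_sum_near[OF k(1) j] using 2 k by simp
        then show ?thesis using sg[OF i k(1)] 2 s k by (simp add: M_def \<delta>_def)
      next
        case 3
        have "d l x = dcor e i j l x - dcor e k j l x"
          unfolding d_def dcor_sum_near[OF i j] dcor_sum_near[OF k(1) j] using 3 by simp
        moreover have "norm (dcor e i j l x - dcor e k j l x)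
            \<le> 60000 * C * dist (X i) (X k) / min (dist (X i) (X j)) (dist (X k) (X j)) ^ 3"
          by (rule dcor_diff_bound[OF _ C0 i j(1) 3(1) k(1) 3(2)]) (rule kernel_boundsD[OF C R_pos])
        ultimately show ?thesis using 3 by (simp add: M_def \<delta>_def)
      qed
    qed
    show "d l x = 0" if "\<And>j. j < N \<Longrightarrow> 4 * R \<le> dist (X j) x" for x l
      using dcor_sum_far[OF that] by (simp add: d_def)
  qed (rule M0)
  have "(\<Sum>j<N. (M j)^2) \<le> (\<Sum>j<N. ((60000 * C * \<delta>)^2 * (B * N)^2) * t j)"
  proof (rule sum_mono)
    fix j assume j: "j \<in> {..<N}"
    \<comment> \<open>Of six inverse powers of the distance four are estimated by the maximum (B
      N)^2, and two are kept for the summation.\<close>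
    have key: "(1 / m ^ 3)^2 \<le> (B * N)^2 * t j" if "1 / m ^ 2 \<le> B * N" "1 / m ^ 2 \<le> t j" "0 \<le> m" for m
    proof -
      have "(1 / m ^ 3)^2 = (1 / m^2)^2 * (1 / m^2)" by (simp add: power_divide power_mult[symmetric] power_add[symmetric])
      also have "\<dots> \<le> (B * N)^2 * t j" by (intro mult_mono power_mono that) auto
      finally show ?thesis .
    qed
    have "(if j = i \<or> j = k then 1 / \<delta> ^ 3 else 1 / min (dist (X i) (X j)) (dist (X k) (X j)) ^ 3)^2 \<le> (B * N)^2 * t j"
    proof (cases "j = i \<or> j = k")
      case True
      have "1 / \<delta>^2 \<le> B * N" using B[OF i k(1)] k by (simp add: inv_sq_def \<delta>_def)
      moreover have "1 / \<delta>^2 \<le> t j" using True k by (auto simp: t_def inv_sq_def \<delta>_def dist_commute)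
      ultimately show ?thesis using key[of \<delta>] True \<delta> by simp
    next
      case False
      then show ?thesis using key[OF mB mt] j by simp
    qed
    then have "(60000 * C * \<delta>)^2 * (if j = i \<or> j = k then 1 / \<delta> ^ 3 else 1 / min (dist (X i) (X j)) (dist (X k) (X j)) ^ 3)^2
       \<le> (60000 * C * \<delta>)^2 * ((B * N)^2 * t j)" by (rule mult_left_mono) simp
    then show "(M j)^2 \<le> ((60000 * C * \<delta>)^2 * (B * N)^2) * t j"
      unfolding M_def power_mult_distrib by (simp only: mult.assoc)
  qed
  also have "(\<Sum>j<N. ((60000 * C * \<delta>)^2 * (B * N)^2) * t j) \<le> (60000 * C * \<delta>)^2 * (B * N)^2 * (2 * (A * N))"
    unfolding sum_distrib_left[symmetric] by (intro mult_left_mono st) simp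
  finally have "13000 / (4 * \<delta>) * R^3 * (\<Sum>j<N. (M j)^2)
     \<le> 13000 / (4 * \<delta>) * R^3 * ((60000 * C * \<delta>)^2 * (B * N)^2 * (2 * (A * N)))"
    by (rule mult_left_mono) (use \<delta> R_pos in simp)
  with w have 2: "\<bar>\<integral>x. indicator U x * contr (sym_grad du) d x \<partial>lborel\<bar>
     \<le> \<delta> / 4 * dissipation + 13000 / (4 * \<delta>) * R^3 * ((60000 * C * \<delta>)^2 * (B * N)^2 * (2 * (A * N)))"
    by linarith
  have id: "integrable lborel (\<lambda>x. indicator U x * contr (sym_grad du) (dcor_sum e p) x)" if p: "p < N" for p
  proof -
    obtain n0 :: nat where n0: "n0 \<ge> 1" "\<And>i. i < N \<Longrightarrow> norm (X i) + 4 * R \<le> real n0"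
      using exists_radius by blast
    show ?thesis
    proof (rule integrable_bounded_support[where B="real n0"])
      show "continuous_on D (contr (sym_grad du) (dcor_sum e p))"
        by (intro continuous_contr continuous_sym_grad continuous_du continuous_dcor_sum p)
      show "contr (sym_grad du) (dcor_sum e p) x = 0" if "real n0 < norm x" for x
      proof (intro contr_eq_0 dcor_sum_far)
        fix j assume j: "j < N"
        have "norm x \<le> norm (x - X j) + norm (X j)" using norm_triangle_ineq[of "x - X j" "X j"] by simp
        then show "4 * R \<le> dist (X j) x" using n0(2)[OF j] that by (simp add: dist_norm norm_minus_commute)
      qed
    qed
  qed
  have "(\<integral>x. indicator U x * contr (sym_grad du) d x \<partial>lborel)
    = (\<integral>x. indicator U x * contr (sym_grad du) (dcor_sum e i) x \<partial>lborel)
      - (\<integral>x. indicator U x * contr (sym_grad du) (dcor_sum e k) x \<partial>lborel)"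
    unfolding d_def[abs_def] contr_diff_right right_diff_distrib
    by (rule Bochner_Integration.integral_diff[OF id[OF i] id[OF k(1)]])
  then have f: "8 * pi * (e \<bullet> (V i - V k)) = ((\<Sum>j<N. drift e i j \<bullet> F) - (\<Sum>j<N. drift e k j \<bullet> F))
     + (\<integral>x. indicator U x * contr (sym_grad du) d x \<partial>lborel)"
    using velocity_formula[OF i, of e] velocity_formula[OF k(1), of e] by (simp add: inner_diff_right right_diff_distrib)
  have "8 * pi * \<bar>e \<bullet> (V i - V k)\<bar> = \<bar>8 * pi * (e \<bullet> (V i - V k))\<bar>" by (simp add: abs_mult)
  also have "\<dots> \<le> C * \<delta> * norm F * (2 * (A * N)) + (\<delta> / 4 * dissipation
      + 13000 / (4 * \<delta>) * R^3 * ((60000 * C * \<delta>)^2 * (B * N)^2 * (2 * (A * N))))"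
    unfolding f using 1 2 by linarith
  also have "13000 / (4 * \<delta>) * R^3 * ((60000 * C * \<delta>)^2 * (B * N)^2 * (2 * (A * N)))
     = \<delta> * (13000 / 4 * R^3 * ((60000 * C)^2 * (B * N)^2 * (2 * (A * N))))"
    using \<delta> by (simp add: power_mult_distrib power2_eq_square)
  finally show ?thesis by (simp add: algebra_simps)
qed

end

text \<open>\<open>P\<close> is the part of the speed due to the drifts, \<open>S\<close> the
  corrector part up to the weight in Young's inequality, \<open>Q\<close> the resulting bound for
  the dissipation. The number of particles does not enter.\<close>

definition lipschitz_const :: "real \<Rightarrow> real \<Rightarrow> real \<Rightarrow> real \<Rightarrow> real \<Rightarrow> real" where
  "lipschitz_const C r a A B =
     (let P = 8 * pi * a + 3 * pi * r * a * C * (1 + A);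
          S = 13000 / 4 * r^3 * ((40000 * C)^2 * B * A);
          Q = 10 * r * a * (P + S * (5 * r * a + 1) / 2)
      in 12 * pi * r * a * C * A + Q / 4 + 13000 / 4 * r^3 * ((60000 * C)^2 * B^2 * (2 * A)))"

lemma norm_le_axis:
  fixes v :: "real^3"
  assumes "\<And>b. 8 * pi * \<bar>axis b 1 \<bullet> v\<bar> \<le> s"
  shows "norm v \<le> s / 8"
proof -
  have "\<bar>v $ b\<bar> \<le> s / 24" for b
  proof -
    have "24 * \<bar>v $ b\<bar> \<le> 8 * pi * \<bar>v $ b\<bar>" using pi_gt3 by (intro mult_right_mono) auto
    also have "\<dots> \<le> s" using assms[of b] by (simp add: inner_axis')
    finally show ?thesis by simp
  qed
  then have "(\<Sum>b\<in>UNIV. \<bar>v $ b\<bar>) \<le> (\<Sum>b\<in>(UNIV::3 set). s / 24)" by (intro sum_mono)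
  then show ?thesis using norm_le_l1_cart[of v] by simp
qed

context stokes_flow
begin

text \<open>The speed is bounded in terms of the dissipation, and the dissipation by the total force
  times the largest speed. For a small weight \<tau> the circle closes by absorption; the difference
  estimate then has all its data.\<close>

theorem velocity_lipschitz:
  fixes r a A B :: real
  assumes C: "\<And>b. kernel_bounds C (axis b 1)" and N: "N \<ge> 1" and r: "r > 0" and R: "R = r / N"
    and a: "a \<ge> 0" and F: "norm F = 6 * pi * R * a" and A0: "A \<ge> 0" and B0: "B \<ge> 0"
    and A: "\<And>i. i < N \<Longrightarrow> (\<Sum>j<N. inv_sq i j) \<le> A * N" and B: "\<And>i j. i < N \<Longrightarrow> j < N \<Longrightarrow> inv_sq i j \<le> B * N"
    and i: "i < N" and k: "k < N"
  shows "norm (V i - V k) \<le> lipschitz_const C r a A B * dist (X i) (X k)"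
proof (cases "i = k")
  case False
  define P where "P = 8 * pi * a + 3 * pi * r * a * C * (1 + A)"
  define S where "S = 13000 / 4 * r^3 * ((40000 * C)^2 * B * A)"
  \<comment> \<open>Since 12 \<pi> is at most 40, the dissipation returns with the factor 5 r a
    \<tau> / 4, which has to be at most 1/2; the summand 1 keeps \<tau> defined for a = 0.\<close>
  define \<tau> where "\<tau> = 2 / (5 * r * a + 1)"
  define Q where "Q = 10 * r * a * (P + S * (5 * r * a + 1) / 2)"
  have N': "1 \<le> real N" using N by simp
  have C0: "0 \<le> C" using C[of 1] by (simp add: kernel_bounds_def)
  have ra: "0 \<le> r * a" using r a by simp
  have den: "0 < 5 * r * a + 1" using ra by (simp add: mult.assoc)
  have \<tau>: "\<tau> > 0" using den by (simp add: \<tau>_def)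
  have NF: "norm F * N = 6 * pi * r * a" using F R N' by simp
  have P0: "0 \<le> P" using r a C0 A0 by (simp add: P_def)
  have S0: "0 \<le> S" using r A0 B0 by (simp add: S_def)
  have speed: "norm (V l) \<le> (P + \<tau> / 4 * dissipation + S / \<tau>) / 8" if l: "l < N" for l
  proof (rule norm_le_axis)
    fix b
    have "8 * pi * \<bar>axis b 1 \<bullet> V l\<bar> \<le> norm F * (4 / (3 * R) + C * (N + A * N) / 2) + \<tau> / 4 * dissipation
     + 13000 / (4 * \<tau>) * R^3 * ((40000 * C)^2 * (B * N) * (A * N))"
      by (rule speed_estimate[OF C _ \<tau> l A[OF l] B[OF l]]) simp_all
    moreover have "norm F * (4 / (3 * R) + C * (N + A * N) / 2) = P"
    proof -
      have "norm F * (4 / (3 * R)) = 8 * pi * a" using F R_pos by simp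
      moreover have "norm F * (C * (N + A * N) / 2) = (norm F * N) * (C * (1 + A) / 2)" by (simp add: algebra_simps)
      ultimately show ?thesis unfolding NF by (simp add: P_def distrib_left mult_ac)
    qed
    moreover have "13000 / (4 * \<tau>) * R^3 * ((40000 * C)^2 * (B * N) * (A * N)) \<le> S / \<tau>"
    proof -
      have "R^3 * (N * N) = r^3 / N" using N' by (simp add: R eval_nat_numeral)
      also have "\<dots> \<le> r^3 / 1" using N' r by (intro divide_left_mono) auto
      finally have RN: "R^3 * (N * N) \<le> r^3" by simp
      have "13000 / (4 * \<tau>) * R^3 * ((40000 * C)^2 * (B * N) * (A * N))
          = (13000 / 4 * ((40000 * C)^2 * B * A) / \<tau>) * (R^3 * (N * N))" by (simp add: field_simps)
      also have "\<dots> \<le> (13000 / 4 * ((40000 * C)^2 * B * A) / \<tau>) * r^3"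
        using RN \<tau> A0 B0 by (intro mult_left_mono) auto
      also have "\<dots> = S / \<tau>" by (simp add: S_def)
      finally show ?thesis .
    qed
    ultimately show "8 * pi * \<bar>axis b 1 \<bullet> V l\<bar> \<le> P + \<tau> / 4 * dissipation + S / \<tau>" by linarith
  qed
  have diss: "dissipation \<le> Q"
  proof -
    define s where "s = (P + \<tau> / 4 * dissipation + S / \<tau>) / 8"
    have s0: "0 \<le> s" using P0 S0 \<tau> dissipation_nonneg by (simp add: s_def)
    have "(\<Sum>l<N. V l \<bullet> F) \<le> (\<Sum>l<N. s * norm F)"
    proof (rule sum_mono)
      fix l assume "l \<in> {..<N}"
      then have "norm (V l) \<le> s" using speed by (simp add: s_def)
      then have "norm (V l) * norm F \<le> s * norm F" by (rule mult_right_mono) simp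
      then show "V l \<bullet> F \<le> s * norm F" using norm_cauchy_schwarz[of "V l" F] by linarith
    qed
    also have "\<dots> = s * (norm F * N)" by simp
    also have "\<dots> = s * (6 * pi * r * a)" unfolding NF ..
    finally have "dissipation \<le> 2 * (s * (6 * pi * r * a))" unfolding dissipation_eq by linarith
    also have "\<dots> = (12 * pi) * (r * a * s)" by simp
    also have "\<dots> \<le> 40 * (r * a * s)"
    proof (rule mult_right_mono)
      have "pi < 3.15" using pi_approx by simp
      then show "12 * pi \<le> 40" by simp
    qed (use ra s0 in simp)
    also have "\<dots> = 5 * r * a * (P + S / \<tau>) + (5 * r * a * \<tau> / 4) * dissipation"
      by (simp add: s_def field_simps)
    also have "\<dots> \<le> 5 * r * a * (P + S / \<tau>) + (1 / 2) * dissipation"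
    proof (intro add_left_mono mult_right_mono dissipation_nonneg)
      show "5 * r * a * \<tau> / 4 \<le> 1 / 2" using den by (simp add: \<tau>_def field_simps)
    qed
    finally have "dissipation \<le> 10 * r * a * (P + S / \<tau>)" by (simp add: field_simps)
    moreover have "S / \<tau> = S * (5 * r * a + 1) / 2" by (simp add: \<tau>_def)
    ultimately show ?thesis by (simp add: Q_def)
  qed
  define L where "L = 12 * pi * r * a * C * A + Q / 4 + 13000 / 4 * r^3 * ((60000 * C)^2 * B^2 * (2 * A))"
  have L: "lipschitz_const C r a A B = L"
    by (simp add: lipschitz_const_def L_def Q_def P_def S_def)
  have "norm (V i - V k) \<le> (dist (X i) (X k) * L) / 8"
  proof (rule norm_le_axis)
    fix b
    have "8 * pi * \<bar>axis b 1 \<bullet> (V i - V k)\<bar> \<le> dist (X i) (X k) * (norm F * C * (2 * (A * N)) + dissipation / 4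
     + 13000 / 4 * R^3 * ((60000 * C)^2 * (B * N)^2 * (2 * (A * N))))"
      by (rule difference_estimate[OF C i k False A B])
    also have "\<dots> \<le> dist (X i) (X k) * L"
    proof (rule mult_left_mono)
      have "norm F * C * (2 * (A * N)) = (norm F * N) * (2 * C * A)" by simp
      then have 1: "norm F * C * (2 * (A * N)) = 12 * pi * r * a * C * A" unfolding NF by simp
      \<comment> \<open>The volume of the balls exactly compensates the three factors N: two from
        the maxima, one from the sum.\<close>
      have "R^3 * (N * N * N) = r^3" using N' by (simp add: R eval_nat_numeral)
      moreover have "13000 / 4 * R^3 * ((60000 * C)^2 * (B * N)^2 * (2 * (A * N)))
        = 13000 / 4 * (R^3 * (N * N * N)) * ((60000 * C)^2 * B^2 * (2 * A))" by (simp add: power2_eq_square)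
      ultimately have 2: "13000 / 4 * R^3 * ((60000 * C)^2 * (B * N)^2 * (2 * (A * N)))
        = 13000 / 4 * r^3 * ((60000 * C)^2 * B^2 * (2 * A))" by simp
      show "norm F * C * (2 * (A * N)) + dissipation / 4
     + 13000 / 4 * R^3 * ((60000 * C)^2 * (B * N)^2 * (2 * (A * N))) \<le> L"
        unfolding 1 2 L_def using diss by simp
    qed simp
    finally show "8 * pi * \<bar>axis b 1 \<bullet> (V i - V k)\<bar> \<le> dist (X i) (X k) * L" .
  qed
  moreover have "0 \<le> dist (X i) (X k) * L"
  proof -
    have "0 \<le> (r * a) * (P + S * (5 * r * a + 1) / 2)" using r a P0 S0
      by (intro mult_nonneg_nonneg add_nonneg_nonneg divide_nonneg_nonneg) auto
    then have "0 \<le> Q" by (simp add: Q_def mult.assoc)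
    then have "0 \<le> L" using r a C0 A0 by (simp add: L_def)
    then show ?thesis by simp
  qed
  ultimately show ?thesis unfolding L by (simp add: mult.commute)
qed simp

end

section \<open>Counting points in cubes\<close>

lemma infnorm_le_iff: "infnorm (x::real^'n) \<le> a \<longleftrightarrow> (\<forall>i. \<bar>x $ i\<bar> \<le> a)"
proof
  show "infnorm x \<le> a \<Longrightarrow> \<forall>i. \<bar>x $ i\<bar> \<le> a" using component_le_infnorm_cart order_trans by blast
  assume "\<forall>i. \<bar>x $ i\<bar> \<le> a"
  then show "infnorm x \<le> a" unfolding infnorm_cart by (intro cSup_least) auto
qed

text \<open>An upper bound in place of the supremum, so that it can be carried to larger cubes and
  later times.\<close>

definition cube_bound :: "nat \<Rightarrow> (nat \<Rightarrow> real^3) \<Rightarrow> real \<Rightarrow> nat \<Rightarrow> bool" where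
  "cube_bound N X l M \<longleftrightarrow> (\<forall>x. card {i. i < N \<and> infnorm (X i - x) \<le> l} \<le> M)"

text \<open>Eight cubes of half the size cover the cube; their centres are displaced by
  \<open>l\<close> or \<open>- l\<close> in each coordinate.\<close>

lemma cube_bound_double:
  assumes "cube_bound N X l M" "0 \<le> l"
  shows "cube_bound N X (2 * l) (8 * M)"
  unfolding cube_bound_def
proof
  fix x :: "real^3"
  define S where "S = (\<lambda>(a, b, c). vector [a, b, c] :: real^3) ` ({l, -l} \<times> {l, -l} \<times> {l, -l})"
  have fS: "finite S" by (simp add: S_def)
  have cS: "card S \<le> 8"
  proof -
    have "card S \<le> card ({l, -l} \<times> {l, -l} \<times> {l, -l})" unfolding S_def by (rule card_image_le) simp
    also have "\<dots> \<le> 2 * (2 * 2)" unfolding card_cartesian_product by (intro mult_le_mono) (auto simp: card_insert_if)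
    finally show ?thesis by simp
  qed
  have sub: "{i. i < N \<and> infnorm (X i - x) \<le> 2 * l} \<subseteq> (\<Union>v\<in>S. {i. i < N \<and> infnorm (X i - (x + v)) \<le> l})"
  proof
    fix i assume i: "i \<in> {i. i < N \<and> infnorm (X i - x) \<le> 2 * l}"
    define z where "z = X i - x"
    have z: "\<bar>z $ k\<bar> \<le> 2 * l" for k using i by (simp add: infnorm_le_iff z_def)
    define s where "s t = (if 0 \<le> t then l else - l)" for t :: real
    have s: "\<bar>t - s t\<bar> \<le> l" if "\<bar>t\<bar> \<le> 2 * l" for t using that by (auto simp: s_def)
    define v where "v = (vector [s (z$1), s (z$2), s (z$3)] :: real^3)"
    have "v \<in> S" unfolding S_def v_def
      by (rule image_eqI[of _ _ "(s (z$1), s (z$2), s (z$3))"]) (auto simp: s_def)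
    moreover have "infnorm (z - v) \<le> l" unfolding infnorm_le_iff forall_3 using s[OF z] by (simp add: v_def)
    ultimately show "i \<in> (\<Union>v\<in>S. {i. i < N \<and> infnorm (X i - (x + v)) \<le> l})"
      using i by (auto simp: z_def diff_diff_eq)
  qed
  have "card {i. i < N \<and> infnorm (X i - x) \<le> 2 * l} \<le> card (\<Union>v\<in>S. {i. i < N \<and> infnorm (X i - (x + v)) \<le> l})"
    by (rule card_mono[OF _ sub]) (use fS in auto)
  also have "\<dots> \<le> (\<Sum>v\<in>S. card {i. i < N \<and> infnorm (X i - (x + v)) \<le> l})" by (rule card_UN_le[OF fS])
  also have "\<dots> \<le> (\<Sum>v\<in>S. M)" using assms(1) by (intro sum_mono) (simp add: cube_bound_def)
  also have "\<dots> \<le> 8 * M" using cS by simp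
  finally show "card {i. i < N \<and> infnorm (X i - x) \<le> 2 * l} \<le> 8 * M" .
qed

lemma cube_bound_dyadic:
  assumes "cube_bound N X l M" "0 \<le> l"
  shows "cube_bound N X (2 ^ K * l) (8 ^ K * M)"
proof (induction K)
  case (Suc K)
  then have "cube_bound N X (2 * (2 ^ K * l)) (8 * (8 ^ K * M))" using assms(2) by (intro cube_bound_double) auto
  then show ?case by (simp add: mult.assoc)
qed (use assms in simp)

lemma max_count_cube_bound: "cube_bound N X l (max_count N l X)"
  unfolding cube_bound_def max_count_def
proof
  fix x
  have "bdd_above (range (\<lambda>x. card {i. i < N \<and> infnorm (X i - x) \<le> l}))"
  proof (rule bdd_aboveI)
    fix n assume "n \<in> range (\<lambda>x. card {i. i < N \<and> infnorm (X i - x) \<le> l})"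
    then obtain x where "n = card {i. i < N \<and> infnorm (X i - x) \<le> l}" by blast
    also have "\<dots> \<le> card {..<N}" by (rule card_mono) auto
    finally show "n \<le> N" by simp
  qed
  then show "card {i. i < N \<and> infnorm (X i - x) \<le> l} \<le> (SUP x. card {i. i < N \<and> infnorm (X i - x) \<le> l})"
    by (intro cSUP_upper) auto
qed

lemma max_count_le: "cube_bound N X l M \<Longrightarrow> max_count N l X \<le> M"
  unfolding cube_bound_def max_count_def by (intro cSUP_least) auto

text \<open>A cube centred at a particle contains it. Against the upper bound for the count this
  forces the lower bound for the minimal distance.\<close>

lemma max_count_pos:
  assumes "N \<ge> 1" "0 \<le> l"
  shows "1 \<le> max_count N l X"
proof -
  have "0 \<in> {i. i < N \<and> infnorm (X i - X 0) \<le> l}" using assms by (simp add: infnorm_0)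
  then have "0 < card {i. i < N \<and> infnorm (X i - X 0) \<le> l}" by (subst card_gt_0_iff) auto
  also have "\<dots> \<le> max_count N l X" using max_count_cube_bound unfolding cube_bound_def by blast
  finally show ?thesis by simp
qed

text \<open>If distances shrink at most by a factor two, a cube of half side \<open>l\<close> at the later time comes
  from a cube of half side \<open>8 l\<close>, because \<open>2 (2 \<surd>3) \<le> 8\<close>.\<close>

lemma cube_bound_later:
  assumes c: "cube_bound N X l M" and l: "0 \<le> l"
    and d: "\<And>i j. i < N \<Longrightarrow> j < N \<Longrightarrow> 1 / 2 * dist (X i) (X j) \<le> dist (Y i) (Y j)"
  shows "cube_bound N Y l (512 * M)"
  unfolding cube_bound_def
proof
  fix y
  show "card {i. i < N \<and> infnorm (Y i - y) \<le> l} \<le> 512 * M"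
  proof (cases "{i. i < N \<and> infnorm (Y i - y) \<le> l} = {}")
    case False
    then obtain k where k: "k < N" "infnorm (Y k - y) \<le> l" by blast
    have "{i. i < N \<and> infnorm (Y i - y) \<le> l} \<subseteq> {i. i < N \<and> infnorm (X i - X k) \<le> 2 ^ 3 * l}"
    proof
      fix i assume i: "i \<in> {i. i < N \<and> infnorm (Y i - y) \<le> l}"
      have "infnorm (Y i - Y k) \<le> 2 * l" unfolding infnorm_le_iff
      proof
        fix j
        have "\<bar>(Y i - y) $ j\<bar> \<le> l" "\<bar>(Y k - y) $ j\<bar> \<le> l" using i k by (auto simp: infnorm_le_iff)
        then show "\<bar>(Y i - Y k) $ j\<bar> \<le> 2 * l" by simp
      qed
      have "sqrt 3 \<le> (2::real)" by (rule real_le_lsqrt) auto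
      have "norm (Y i - Y k) \<le> sqrt 3 * infnorm (Y i - Y k)" using norm_le_infnorm[of "Y i - Y k"] by simp
      also have "\<dots> \<le> 2 * (2 * l)"
        using \<open>infnorm (Y i - Y k) \<le> 2 * l\<close> infnorm_pos_le[of "Y i - Y k"] \<open>sqrt 3 \<le> 2\<close>
        by (intro mult_mono) auto
      finally have "dist (X i) (X k) \<le> 8 * l" using d[of i k] i k by (simp add: dist_norm)
      then have "infnorm (X i - X k) \<le> 8 * l" using infnorm_le_norm[of "X i - X k"] by (simp add: dist_norm)
      then show "i \<in> {i. i < N \<and> infnorm (X i - X k) \<le> 2 ^ 3 * l}" using i by simp
    qed
    then have "card {i. i < N \<and> infnorm (Y i - y) \<le> l} \<le> card {i. i < N \<and> infnorm (X i - X k) \<le> 2 ^ 3 * l}"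
      by (intro card_mono) auto
    also have "\<dots> \<le> 8 ^ 3 * M" using cube_bound_dyadic[OF c l, of 3] unfolding cube_bound_def by blast
    finally show ?thesis by simp
  qed (simp only: card.empty)
qed

text \<open>Dyadic decomposition: the cube of half side \<open>2^K l\<close> holds at most \<open>8^K M\<close> points, and in its
  outer shell the summand is at most \<open>4 / (4^K l^2)\<close>.\<close>

lemma inverse_square_sum:
  assumes c: "cube_bound N X l M" and l: "0 < l" and D: "0 < D"
    and sep: "\<And>j. j < N \<Longrightarrow> j \<noteq> i \<Longrightarrow> D \<le> dist (X i) (X j) ^ 2"
  shows "(\<Sum>j\<in>{..<N} - {i}. 1 / dist (X i) (X j) ^ 2) \<le> N + M / D + 8 * M / l^2 * (1 + 2 / l)"
proof -
  define J where "J K = {j. j < N \<and> j \<noteq> i \<and> infnorm (X j - X i) \<le> 2 ^ K * l}" for K :: nat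
  define f where "f j = 1 / dist (X i) (X j) ^ 2" for j
  have f0: "0 \<le> f j" for j by (simp add: f_def)
  have fin: "finite (J K)" for K by (simp add: J_def)
  have cJ: "card (J K) \<le> 8 ^ K * M" for K
  proof -
    have "card (J K) \<le> card {j. j < N \<and> infnorm (X j - X i) \<le> 2 ^ K * l}" by (rule card_mono) (auto simp: J_def)
    also have "\<dots> \<le> 8 ^ K * M" using cube_bound_dyadic[OF c, of K] l unfolding cube_bound_def by simp
    finally show ?thesis .
  qed
  \<comment> \<open>The shell K contributes 8 * 8^K / 4^K = 8 * 2^K units; a geometric series of
    ratio two stays below its next term, so the induction closes.\<close>
  have rec: "sum f (J K) \<le> M / D + 8 * M / l^2 * 2 ^ K" for K
  proof (induction K)
    case 0
    have "sum f (J 0) \<le> (\<Sum>j\<in>J 0. 1 / D)"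
    proof (rule sum_mono)
      fix j assume "j \<in> J 0"
      then have "D \<le> dist (X i) (X j) ^ 2" using sep by (simp add: J_def)
      then show "f j \<le> 1 / D" unfolding f_def using D by (intro divide_left_mono mult_pos_pos) auto
    qed
    also have "\<dots> = card (J 0) * (1 / D)" by simp
    also have "\<dots> \<le> M * (1 / D)" using cJ[of 0] D by (intro mult_right_mono) auto
    finally have "sum f (J 0) \<le> M / D" by simp
    moreover have "0 \<le> 8 * M / l^2 * 2 ^ 0" by simp
    ultimately show ?case by linarith
  next
    case (Suc K)
    have sub: "J K \<subseteq> J (Suc K)"
    proof -
      have "2 ^ K * l \<le> 2 ^ Suc K * l" using l by (intro mult_right_mono) auto
      then show ?thesis unfolding J_def using order_trans by blast
    qed
    have "sum f (J (Suc K) - J K) \<le> (\<Sum>j\<in>J (Suc K) - J K. 1 / (2 ^ K * l)^2)"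
    proof (rule sum_mono)
      fix j assume "j \<in> J (Suc K) - J K"
      then have "2 ^ K * l < infnorm (X j - X i)" by (auto simp: J_def)
      also have "\<dots> \<le> dist (X i) (X j)" using infnorm_le_norm[of "X j - X i"] by (simp add: dist_norm norm_minus_commute)
      finally have "(2 ^ K * l)^2 \<le> dist (X i) (X j) ^ 2" using l by (intro power_mono) auto
      moreover have "0 < (2 ^ K * l)^2" using l by simp
      ultimately show "f j \<le> 1 / (2 ^ K * l)^2" unfolding f_def
        by (intro divide_left_mono mult_pos_pos) linarith+
    qed
    also have "\<dots> = card (J (Suc K) - J K) * (1 / (2 ^ K * l)^2)" by simp
    also have "\<dots> \<le> (8 ^ Suc K * M) * (1 / (2 ^ K * l)^2)"
    proof (rule mult_right_mono)
      have "card (J (Suc K) - J K) \<le> card (J (Suc K))" by (rule card_mono[OF fin]) auto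
      then have "card (J (Suc K) - J K) \<le> 8 ^ Suc K * M" using cJ[of "Suc K"] by linarith
      then show "real (card (J (Suc K) - J K)) \<le> real (8 ^ Suc K * M)" by (simp only: of_nat_le_iff)
    qed simp
    also have "\<dots> = 8 * M / l^2 * 2 ^ K"
    proof -
      have "(8::real) ^ K = (2 * 2 ^ 2) ^ K" by simp
      also have "\<dots> = 2 ^ K * (2 ^ K)^2" by (simp only: power_mult_distrib power_commutes flip: power_mult)
          (simp only: mult.commute)
      finally show ?thesis by (simp add: power_mult_distrib)
    qed
    finally have "sum f (J (Suc K) - J K) \<le> 8 * M / l^2 * 2 ^ K" .
    moreover have "sum f (J (Suc K)) = sum f (J (Suc K) - J K) + sum f (J K)"
      by (rule sum.subset_diff[OF sub fin])
    moreover have "8 * M / l^2 * 2 ^ Suc K = 8 * M / l^2 * 2 ^ K + 8 * M / l^2 * 2 ^ K" by simp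
    ultimately show ?case using Suc by linarith
  qed
  \<comment> \<open>The first dyadic cube of half side at least one. By minimality its size is less
    than doubled, and the summand 1 covers K = 0. Points outside contribute at most one each, hence
    the term N.\<close>
  obtain K :: nat where K: "1 \<le> 2 ^ K * l" "2 ^ K \<le> 1 + 2 / l"
  proof -
    obtain n where n: "1 / l < 2 ^ n" using real_arch_pow[of 2 "1 / l"] by auto
    define K where "K = (LEAST n. 1 / l \<le> (2::real) ^ n)"
    have K1: "1 / l \<le> 2 ^ K" unfolding K_def by (rule LeastI[of _ n]) (use n in simp)
    have "2 ^ K \<le> 1 + 2 / l"
    proof (cases K)
      case (Suc m)
      then have "\<not> 1 / l \<le> (2::real) ^ m" unfolding K_def using not_less_Least[of m "\<lambda>n. 1 / l \<le> (2::real) ^ n"] by simp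
      then show ?thesis using Suc by simp
    qed (use l in simp)
    then show ?thesis using that[of K] K1 l by (simp add: pos_divide_le_eq)
  qed
  have "(\<Sum>j\<in>{..<N} - {i}. f j) = sum f (({..<N} - {i}) - J K) + sum f (J K)"
    by (rule sum.subset_diff) (auto simp: J_def)
  also have "sum f (({..<N} - {i}) - J K) \<le> (\<Sum>j\<in>({..<N} - {i}) - J K. 1)"
  proof (rule sum_mono)
    fix j assume "j \<in> ({..<N} - {i}) - J K"
    then have "2 ^ K * l < infnorm (X j - X i)" by (auto simp: J_def)
    also have "\<dots> \<le> dist (X i) (X j)" using infnorm_le_norm[of "X j - X i"] by (simp add: dist_norm norm_minus_commute)
    finally have "1 \<le> dist (X i) (X j)" using K(1) by linarith
    then have "1 \<le> dist (X i) (X j) ^ 2" by (rule one_le_power)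
    then show "f j \<le> 1" by (simp add: f_def divide_le_eq)
  qed
  also have "(\<Sum>j\<in>({..<N} - {i}) - J K. 1) \<le> real N"
  proof -
    have "card (({..<N} - {i}) - J K) \<le> card {..<N}" by (rule card_mono) auto
    then show ?thesis by simp
  qed
  also have "sum f (J K) \<le> M / D + 8 * M / l^2 * (1 + 2 / l)"
  proof -
    have "8 * M / l^2 * 2 ^ K \<le> 8 * M / l^2 * (1 + 2 / l)" by (rule mult_left_mono[OF K(2)]) simp
    then show ?thesis using rec[of K] by linarith
  qed
  finally show ?thesis by (simp add: f_def add.assoc)
qed

section \<open>Propagation in time\<close>

text \<open>The squared distance times exp (2 L s) is nondecreasing. Derivatives are used in the
  open interval only, because the velocity estimate will be known strictly before time t.\<close>

lemma dist_lower_bound_exp: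
  fixes x y :: "real \<Rightarrow> 'a::real_inner"
  assumes t: "0 \<le> t" and x: "continuous_on {0..t} x" and y: "continuous_on {0..t} y"
    and d: "\<And>s. 0 < s \<Longrightarrow> s < t \<Longrightarrow> \<exists>v w. (x has_vector_derivative v) (at s) \<and>
      (y has_vector_derivative w) (at s) \<and> norm (v - w) \<le> L * dist (x s) (y s)"
  shows "exp (- (L * t)) * dist (x 0) (y 0) \<le> dist (x t) (y t)"
proof -
  define f where "f s = exp (2 * L * s) * ((x s - y s) \<bullet> (x s - y s))" for s
  have "f 0 \<le> f t"
  proof (rule DERIV_nonneg_imp_increasing_open[OF t])
    show "continuous_on {0..t} f" unfolding f_def by (intro continuous_intros x y)
    fix s assume "0 < s" "s < t"
    then obtain v w where vw: "(x has_vector_derivative v) (at s)" "(y has_vector_derivative w) (at s)"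
      "norm (v - w) \<le> L * dist (x s) (y s)" using d by blast
    define z where "z = x s - y s"
    have "((\<lambda>s. x s - y s) has_vector_derivative (v - w)) (at s)" by (intro derivative_intros vw)
    then have "((\<lambda>s. (x s - y s) \<bullet> (x s - y s)) has_derivative (\<lambda>h. z \<bullet> (h *\<^sub>R (v - w)) + (h *\<^sub>R (v - w)) \<bullet> z)) (at s)"
      unfolding has_vector_derivative_def z_def by (intro has_derivative_inner)
    then have "((\<lambda>s. (x s - y s) \<bullet> (x s - y s)) has_real_derivative 2 * (z \<bullet> (v - w))) (at s)"
      unfolding has_field_derivative_def
      by (rule has_derivative_eq_rhs) (auto simp: inner_commute[of "v - w" z])
    moreover have "((\<lambda>s. exp (2 * L * s)) has_real_derivative exp (2 * L * s) * (2 * L)) (at s)"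
      by (auto intro!: derivative_eq_intros)
    ultimately have "(f has_real_derivative exp (2 * L * s) * (2 * L) * ((x s - y s) \<bullet> (x s - y s))
        + 2 * (z \<bullet> (v - w)) * exp (2 * L * s)) (at s)"
      unfolding f_def by (intro DERIV_mult)
    moreover have "0 \<le> exp (2 * L * s) * (2 * L) * ((x s - y s) \<bullet> (x s - y s)) + 2 * (z \<bullet> (v - w)) * exp (2 * L * s)"
    proof -
      have "\<bar>z \<bullet> (v - w)\<bar> \<le> norm z * norm (v - w)" by (rule Cauchy_Schwarz_ineq2)
      moreover have "norm z * norm (v - w) \<le> norm z * (L * norm z)"
        using vw(3) by (intro mult_left_mono) (auto simp: z_def dist_norm)
      moreover have "norm z * (L * norm z) = L * (z \<bullet> z)" by (simp add: power2_norm_eq_inner[symmetric] power2_eq_square)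
      ultimately have "0 \<le> L * (z \<bullet> z) + z \<bullet> (v - w)" by linarith
      then have "0 \<le> 2 * exp (2 * L * s) * (L * (z \<bullet> z) + z \<bullet> (v - w))" by simp
      then show ?thesis by (simp add: z_def algebra_simps)
    qed
    ultimately show "\<exists>l. (f has_real_derivative l) (at s) \<and> 0 \<le> l" by blast
  qed
  then have "dist (x 0) (y 0) ^ 2 \<le> (exp (L * t) * dist (x t) (y t)) ^ 2"
    by (simp add: f_def dist_norm power2_norm_eq_inner power_mult_distrib flip: exp_double)
       (simp add: mult.assoc)
  then have "dist (x 0) (y 0) \<le> exp (L * t) * dist (x t) (y t)" by (rule power2_le_imp_le) simp
  then have "exp (- (L * t)) * dist (x 0) (y 0) \<le> exp (- (L * t)) * (exp (L * t) * dist (x t) (y t))"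
    by (intro mult_left_mono) auto
  also have "\<dots> = dist (x t) (y t)" unfolding mult.assoc[symmetric] exp_add[symmetric] by simp
  finally show ?thesis .
qed

text \<open>If a distance reaches one half there is a first such time, by compactness. Strictly
  before it the assumption of \<open>improve\<close> holds, and the improved bound 3/4 at that very
  time contradicts 1/2.\<close>

lemma bootstrap:
  fixes d :: "real \<Rightarrow> 'i \<Rightarrow> real"
  assumes fin: "finite I" and cont: "\<And>i. i \<in> I \<Longrightarrow> continuous_on {0..T} (\<lambda>t. d t i)"
    and pos: "\<And>i. i \<in> I \<Longrightarrow> 0 < d 0 i"
    and improve: "\<And>t i. 0 \<le> t \<Longrightarrow> t \<le> T \<Longrightarrow> (\<And>s i. 0 \<le> s \<Longrightarrow> s < t \<Longrightarrow> i \<in> I \<Longrightarrow> 1 / 2 * d 0 i \<le> d s i)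
       \<Longrightarrow> i \<in> I \<Longrightarrow> 3 / 4 * d 0 i \<le> d t i"
    and "0 \<le> t" "t \<le> T" "i \<in> I"
  shows "1 / 2 * d 0 i \<le> d t i"
proof (rule ccontr)
  assume neg: "\<not> 1 / 2 * d 0 i \<le> d t i"
  define S where "S = (\<Union>i\<in>I. {0..T} \<inter> (\<lambda>t. d t i) -` {..1 / 2 * d 0 i})"
  have "closed S" unfolding S_def
    by (intro closed_UN fin ballI continuous_closed_preimage cont) auto
  moreover have "bounded S" by (rule bounded_subset[of "{0..T}"]) (auto simp: S_def)
  ultimately have "compact S" by (simp add: compact_eq_bounded_closed)
  moreover have "t \<in> S" unfolding S_def using neg assms(5-7) by force
  ultimately obtain t0 where t0: "t0 \<in> S" "\<And>s. s \<in> S \<Longrightarrow> t0 \<le> s" using compact_attains_inf[of S] by blast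
  then obtain k where k: "k \<in> I" "0 \<le> t0" "t0 \<le> T" "d t0 k \<le> 1 / 2 * d 0 k" unfolding S_def by auto
  have "3 / 4 * d 0 k \<le> d t0 k"
  proof (rule improve[OF k(2,3) _ k(1)])
    fix s j assume s: "0 \<le> s" "s < t0" "j \<in> I"
    then have "s \<notin> S" using t0(2) by fastforce
    then show "1 / 2 * d 0 j \<le> d s j" using s k(3) unfolding S_def by auto
  qed
  then show False using k(4) pos[OF k(1)] by linarith
qed

text \<open>As long as distances are at least half the initial ones, they exceed D / 2, which is at
  least 16 R, and cubes hold at most 512 M points; this explains the form of \<open>A\<close> and
  \<open>B\<close>. With L T at most 1/4 the exponential factor stays above 1 - 1/4, the constant of
  the bootstrap.\<close>

lemma distances_halve_at_most:
  fixes r \<kappa> l D A B T :: real and g :: "real^3" and x :: "real \<Rightarrow> nat \<Rightarrow> real^3" and N M :: nat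
  assumes C: "\<And>b. kernel_bounds C (axis b 1)" and sed: "sedimentation r \<kappa> g N x"
    and r: "0 < r" and \<kappa>: "0 < \<kappa>" and N: "1 \<le> N"
    and D: "0 < D" "32 * (r / N) \<le> D" "\<And>i j. i < N \<Longrightarrow> j < N \<Longrightarrow> i \<noteq> j \<Longrightarrow> D \<le> dist (x 0 i) (x 0 j)"
    and c: "cube_bound N (x 0) l M" and l: "0 < l"
    and A: "N + (512 * real M) / (D / 2)^2 + 8 * (512 * real M) / l^2 * (1 + 2 / l) \<le> A * N"
    and B: "1 / (D / 2)^2 \<le> B * N" and B0: "0 \<le> B"
    and T: "\<bar>lipschitz_const C r (\<kappa> * norm g) A B\<bar> * T \<le> 1 / 4"
    and t: "0 \<le> t" "t \<le> T" and i: "i < N" and j: "j < N"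
  shows "1 / 2 * dist (x 0 i) (x 0 j) \<le> dist (x t i) (x t j)"
proof (cases "i = j")
  case False
  define R where "R = r / N"
  define F where "F = (6 * pi * R * \<kappa>) *\<^sub>R g"
  define L where "L = \<bar>lipschitz_const C r (\<kappa> * norm g) A B\<bar>"
  define I where "I = {(i, j). i < N \<and> j < N \<and> i \<noteq> j}"
  define d where "d t = (\<lambda>(i, j). dist (x t i) (x t j))" for t
  have R: "0 < R" using r N by (simp add: R_def)
  have cont: "continuous_on {0..} (\<lambda>t. x t i)" if "i < N" for i
    using sed that by (simp add: sedimentation_def Let_def)
  have A0: "0 \<le> A"
  proof -
    have "0 \<le> A * N" using A l by (intro order_trans[OF _ A]) simp
    then show ?thesis using N by (simp add: zero_le_mult_iff)
  qed
  have "finite I" by (rule finite_subset[of _ "{..<N} \<times> {..<N}"]) (auto simp: I_def)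
  then have "1 / 2 * d 0 (i, j) \<le> d t (i, j)"
  proof (rule bootstrap[where T = T])
    fix k assume "k \<in> I"
    then obtain i j where k: "k = (i, j)" "i < N" "j < N" "i \<noteq> j" by (auto simp: I_def)
    show "continuous_on {0..T} (\<lambda>t. d t k)" unfolding d_def k
      by (auto intro!: continuous_intros continuous_on_subset[OF cont] k)
    show "0 < d 0 k" unfolding d_def k using less_le_trans[OF D(1) D(3)[OF k(2-4)]] by simp
  next
    fix t k assume t: "0 \<le> t" "t \<le> T"
      and half: "\<And>s i. 0 \<le> s \<Longrightarrow> s < t \<Longrightarrow> i \<in> I \<Longrightarrow> 1 / 2 * d 0 i \<le> d s i" and "k \<in> I"
    then obtain i j where k: "k = (i, j)" "i < N" "j < N" "i \<noteq> j" by (auto simp: I_def)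
    have half': "1 / 2 * dist (x 0 i) (x 0 j) \<le> dist (x s i) (x s j)"
      if "0 \<le> s" "s < t" "i < N" "j < N" for s i j
      using half[of s "(i, j)"] that by (cases "i = j") (auto simp: I_def d_def)
    have Ds: "D / 2 \<le> dist (x s i) (x s j)" if "0 \<le> s" "s < t" "i < N" "j < N" "i \<noteq> j" for s i j
      using half'[OF that(1-4)] D(3)[OF that(3-5)] by linarith
    have disj: "disjoint_balls N R (x s)" if "0 \<le> s" "s < t" for s
      unfolding disjoint_balls_def
    proof (intro allI impI)
      fix i j assume ij: "i < N" "j < N" "i \<noteq> j"
      have "R + R < dist (x s i) (x s j)" using Ds[OF that ij] D(2) R by (simp add: R_def)
      then show "cball (x s i) R \<inter> cball (x s j) R = {}" by (rule disjoint_cballI)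
    qed
    have "exp (- (L * t)) * dist (x 0 i) (x 0 j) \<le> dist (x t i) (x t j)"
    proof (rule dist_lower_bound_exp[OF t(1)])
      show "continuous_on {0..t} (\<lambda>t. x t i)" "continuous_on {0..t} (\<lambda>t. x t j)"
        by (auto intro: continuous_on_subset[OF cont] k)
      fix s assume s: "0 < s" "s < t"
      have "\<forall>s'\<in>{0..s}. disjoint_balls N R (x s')" using disj s by auto
      then obtain u p V \<Omega> where st: "stokes_solution N R F (x s) u p V \<Omega>"
        and V: "\<forall>i<N. ((\<lambda>s. x s i) has_vector_derivative V i) (at s within {0..})"
        using sed s unfolding sedimentation_def Let_def R_def F_def by (meson less_imp_le)
      have V': "((\<lambda>s. x s i) has_vector_derivative V i) (at s)" if "i < N" for i
      proof -
        have "at s within {0..} = at s" using s by (intro at_within_interior) simp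
        then show ?thesis using V that by simp
      qed
      interpret stokes_flow N R "x s" F u p V \<Omega>
      proof
        show "0 < R" by (rule R)
        show "stokes_solution N R F (x s) u p V \<Omega>" by (rule st)
        show "16 * R \<le> dist (x s i) (x s j)" if "i < N" "j < N" "i \<noteq> j" for i j
          using Ds[OF _ s(2) that] D(2) s by (simp add: R_def)
      qed
      have sum: "(\<Sum>j<N. inv_sq i j) \<le> A * N" if "i < N" for i
      proof -
        have "(\<Sum>j<N. inv_sq i j) = (\<Sum>j\<in>{..<N} - {i}. 1 / dist (x s i) (x s j) ^ 2)"
          using that by (subst sum.remove[of _ i]) (auto simp: inv_sq_def intro!: sum.cong)
        also have "\<dots> \<le> N + real (512 * M) / (D / 2)^2 + 8 * real (512 * M) / l^2 * (1 + 2 / l)"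
        proof (rule inverse_square_sum[OF _ l])
          show "cube_bound N (x s) l (512 * M)"
            using c l half' s by (intro cube_bound_later[of N "x 0"]) auto
          show "(D / 2)^2 \<le> dist (x s i) (x s j) ^ 2" if "j < N" "j \<noteq> i" for j
            using Ds[of s i j] D(1) s that \<open>i < N\<close> by (intro power_mono) auto
        qed (use D in simp)
        also have "\<dots> \<le> A * N" using A by simp
        finally show ?thesis .
      qed
      have each: "inv_sq i j \<le> B * N" if "i < N" "j < N" for i j
      proof (cases "j = i")
        case False
        have "(D / 2)^2 \<le> dist (x s i) (x s j) ^ 2"
          using Ds[of s i j] D(1) s that False by (intro power_mono) auto
        then have "1 / dist (x s i) (x s j) ^ 2 \<le> 1 / (D / 2)^2"
          using D(1) by (intro divide_left_mono mult_pos_pos) (auto intro: less_le_trans[of _ "(D / 2)^2"])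
        then show ?thesis using False B by (simp add: inv_sq_def)
      qed (use B0 in \<open>simp add: inv_sq_def\<close>)
      have "norm (V i - V j) \<le> lipschitz_const C r (\<kappa> * norm g) A B * dist (x s i) (x s j)"
        using sum each k \<kappa> N r B0 A0 C R by (intro velocity_lipschitz) (auto simp: R_def F_def abs_mult)
      also have "\<dots> \<le> L * dist (x s i) (x s j)" unfolding L_def by (intro mult_right_mono) auto
      finally show "\<exists>v w. ((\<lambda>t. x t i) has_vector_derivative v) (at s) \<and>
          ((\<lambda>t. x t j) has_vector_derivative w) (at s) \<and> norm (v - w) \<le> L * dist (x s i) (x s j)"
        using V' k by blast
    qed
    moreover have "3 / 4 \<le> exp (- (L * t))"
    proof -
      have "L * t \<le> L * T" using t by (intro mult_left_mono) (auto simp: L_def)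
      then have "L * t \<le> 1 / 4" using T by (simp add: L_def)
      then show ?thesis using exp_ge_add_one_self[of "- (L * t)"] by linarith
    qed
    then have "3 / 4 * dist (x 0 i) (x 0 j) \<le> exp (- (L * t)) * dist (x 0 i) (x 0 j)"
      by (rule mult_right_mono) simp
    ultimately show "3 / 4 * d 0 k \<le> d t k" by (simp add: d_def k)
  qed (use t i j False in \<open>auto simp: I_def\<close>)
  then show ?thesis by (simp add: d_def)
qed simp

section \<open>Choice of the constants\<close>

lemma finite_pair_distances:
  fixes N :: nat
  shows "finite {dist (X i) (X j) |i j. i < N \<and> j < N \<and> i \<noteq> j}"
  by (rule finite_subset[of _ "(\<lambda>(i, j). dist (X i) (X j)) ` ({..<N} \<times> {..<N})"]) auto

lemma dmin_le: "i < N \<Longrightarrow> j < N \<Longrightarrow> i \<noteq> j \<Longrightarrow> dmin N X \<le> dist (X i) (X j)"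
  unfolding dmin_def by (rule Min_le[OF finite_pair_distances]) auto

lemma dmin_ge:
  assumes "2 \<le> N" "\<And>i j. i < N \<Longrightarrow> j < N \<Longrightarrow> i \<noteq> j \<Longrightarrow> m \<le> dist (X i) (X j)"
  shows "m \<le> dmin N X"
proof -
  have "dist (X 0) (X 1) \<in> {dist (X i) (X j) |i j. i < N \<and> j < N \<and> i \<noteq> j}" using assms(1)
    by (intro CollectI exI[of _ 0] exI[of _ 1]) auto
  then show ?thesis unfolding dmin_def using assms(2) finite_pair_distances[of X N] by (subst Min_ge_iff) auto
qed

text \<open>Everything follows from M \<le> Q N l^3 and l^3 \<le> E D^2. Together they bound M / D^2
  by Q N E, and with M \<ge> 1 they bound 1 / D^2. From D \<le> 2 l one gets l \<le> 4 E, which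
  bounds M / l^2. The coefficient 18432 is 2048 + 16384.\<close>

lemma admissible_bounds:
  fixes K l D E Q :: real
  assumes K: "0 < Q" and E: "0 < E" and l: "0 < l" and D: "0 < D" "D / 2 \<le> l" and lE: "l^3 / D^2 \<le> E"
    and N: "1 \<le> N" and M: "real M / (real N * l^3) \<le> Q" "1 \<le> M"
  shows "N + (512 * real M) / (D / 2)^2 + 8 * (512 * real M) / l^2 * (1 + 2 / l) \<le> (1 + 18432 * Q * E + 8192 * Q) * N"
    and "1 / (D / 2)^2 \<le> 4 * Q * E * N"
proof -
  have N': "0 < real N" using N by simp
  have M': "M \<le> Q * N * l^3" using M(1) l N' by (simp add: pos_divide_le_eq mult.assoc)
  have l3: "l^3 \<le> E * D^2" using lE D(1) by (simp add: pos_divide_le_eq)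
  have MD: "M \<le> Q * N * E * D^2"
  proof -
    have "Q * N * l^3 \<le> Q * N * (E * D^2)" using K by (intro mult_left_mono[OF l3]) simp
    then show ?thesis using M' by (simp add: mult.assoc)
  qed
  have l4: "l \<le> 4 * E"
  proof -
    have "D^2 \<le> (2 * l)^2" using D by (intro power_mono) auto
    then have "E * D^2 \<le> E * (2 * l)^2" using E by (intro mult_left_mono) auto
    then have "l * l^2 \<le> (4 * E) * l^2" using l3 by (simp add: power2_eq_square power3_eq_cube)
    then show ?thesis using l by (simp only: mult_le_cancel_right_pos zero_less_power)
  qed
  have 1: "(512 * real M) / (D / 2)^2 \<le> 2048 * (Q * N * E)"
    using MD D(1) by (simp add: power_divide pos_divide_le_eq mult.assoc)
  have 2: "8 * (512 * real M) / l^2 \<le> 16384 * (Q * N * E)"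
  proof -
    have "M \<le> (Q * N * l) * l^2" using M' by (simp add: power2_eq_square power3_eq_cube mult.assoc)
    also have "\<dots> \<le> (Q * N * (4 * E)) * l^2" using l4 K by (intro mult_right_mono mult_left_mono) auto
    finally show ?thesis using l by (simp add: pos_divide_le_eq mult_ac)
  qed
  have 3: "8 * (512 * real M) / l^2 * (2 / l) \<le> 8192 * (Q * N)"
  proof -
    have "8 * (512 * real M) / l^2 * (2 / l) = 8192 * M / l^3" by (simp add: power2_eq_square power3_eq_cube)
    also have "\<dots> \<le> 8192 * (Q * N)" using M' l by (simp add: pos_divide_le_eq)
    finally show ?thesis .
  qed
  have "8 * (512 * real M) / l^2 * (1 + 2 / l) = 8 * (512 * real M) / l^2 + 8 * (512 * real M) / l^2 * (2 / l)"
    by (simp only: distrib_left mult_1_right)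
  then have "N + (512 * real M) / (D / 2)^2 + 8 * (512 * real M) / l^2 * (1 + 2 / l) \<le> N + 18432 * (Q * N * E) + 8192 * (Q * N)"
    using 1 2 3 by linarith
  then show "N + (512 * real M) / (D / 2)^2 + 8 * (512 * real M) / l^2 * (1 + 2 / l) \<le> (1 + 18432 * Q * E + 8192 * Q) * N"
    by (simp only: distrib_right distrib_left mult_1_left mult_1_right mult_ac)
  have "1 \<le> Q * N * E * D^2" using MD M(2) by linarith
  then show "1 / (D / 2)^2 \<le> 4 * Q * E * N" using D(1) by (simp add: power_divide pos_divide_le_eq mult_ac)
qed

theorem theorem1p2:
  "\<exists>\<delta>>0. \<forall>r\<^sub>0>0. \<forall>Mbar>0. \<forall>E>0. Mbar powr (1 / 3) * r\<^sub>0 < \<delta> \<longrightarrow>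
     (\<exists>Nstar\<ge>1. \<forall>a\<ge>0. \<exists>T>0. \<forall>\<kappa>>0. \<forall>g :: real^3. \<kappa> * norm g = a \<longrightarrow>
       (\<forall>(l :: nat \<Rightarrow> real) (X :: nat \<Rightarrow> real \<Rightarrow> nat \<Rightarrow> real^3).
          (\<forall>N\<ge>1. l N > 0) \<longrightarrow>
          (\<lambda>N. X N 0) \<in> admissible Mbar E l \<longrightarrow>
          (\<forall>N\<ge>1. sedimentation r\<^sub>0 \<kappa> g N (X N)) \<longrightarrow>
          (\<forall>t\<in>{0..T}. \<forall>N\<ge>Nstar.
             dmin N (X N t) \<ge> 1 / 2 * dmin N (X N 0) \<and>
             max_count N (l N) (X N t) \<le> 8 ^ 4 * max_count N (l N) (X N 0))))"
proof -
  obtain C where C: "\<And>b. kernel_bounds C (axis b 1)" using kernel_bounds_exist by blast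
  show ?thesis
  proof (rule exI[of _ 1], intro conjI allI impI)
    fix r Q E :: real
    assume r: "0 < r" and Q: "0 < Q" and E: "0 < E"
    \<comment> \<open>As D^2 is at least 1 / (Q E N), this threshold yields 32 r / N \<le> D, with
      1024 = 32^2. From N = 2 on the minimal distance makes sense.\<close>
    define Ns where "Ns = max 2 (nat \<lceil>1024 * r^2 * Q * E\<rceil>)"
    define A where "A = 1 + 18432 * Q * E + 8192 * Q"
    define B where "B = 4 * Q * E"
    show "\<exists>Nstar\<ge>1. \<forall>a\<ge>0. \<exists>T>0. \<forall>\<kappa>>0. \<forall>g :: real^3. \<kappa> * norm g = a \<longrightarrow>
       (\<forall>(l :: nat \<Rightarrow> real) (X :: nat \<Rightarrow> real \<Rightarrow> nat \<Rightarrow> real^3).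
          (\<forall>N\<ge>1. l N > 0) \<longrightarrow>
          (\<lambda>N. X N 0) \<in> admissible Q E l \<longrightarrow>
          (\<forall>N\<ge>1. sedimentation r \<kappa> g N (X N)) \<longrightarrow>
          (\<forall>t\<in>{0..T}. \<forall>N\<ge>Nstar.
             dmin N (X N t) \<ge> 1 / 2 * dmin N (X N 0) \<and>
             max_count N (l N) (X N t) \<le> 8 ^ 4 * max_count N (l N) (X N 0)))"
    proof (rule exI[of _ Ns], intro conjI allI impI)
      show "1 \<le> Ns" by (simp add: Ns_def)
      fix a :: real assume "0 \<le> a"
      define L where "L = \<bar>lipschitz_const C r a A B\<bar>"
      \<comment> \<open>\<open>L\<close> is determined by r, a, Q and E, so T is fixed before
        \<open>\<kappa>\<close>, \<open>g\<close> and the configurations; the added 1 keeps the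
        denominator positive when L = 0.\<close>
      define T where "T = 1 / (4 * (L + 1))"
      have L0: "0 \<le> L" by (simp add: L_def)
      show "\<exists>T>0. \<forall>\<kappa>>0. \<forall>g :: real^3. \<kappa> * norm g = a \<longrightarrow>
       (\<forall>(l :: nat \<Rightarrow> real) (X :: nat \<Rightarrow> real \<Rightarrow> nat \<Rightarrow> real^3).
          (\<forall>N\<ge>1. l N > 0) \<longrightarrow>
          (\<lambda>N. X N 0) \<in> admissible Q E l \<longrightarrow>
          (\<forall>N\<ge>1. sedimentation r \<kappa> g N (X N)) \<longrightarrow>
          (\<forall>t\<in>{0..T}. \<forall>N\<ge>Ns.
             dmin N (X N t) \<ge> 1 / 2 * dmin N (X N 0) \<and>
             max_count N (l N) (X N t) \<le> 8 ^ 4 * max_count N (l N) (X N 0)))"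
      proof (rule exI[of _ T], intro conjI allI impI ballI)
        show "0 < T" using L0 by (simp add: T_def)
        fix \<kappa> :: real and g :: "real^3" and l :: "nat \<Rightarrow> real" and X :: "nat \<Rightarrow> real \<Rightarrow> nat \<Rightarrow> real^3"
          and t :: real and N :: nat
        assume \<kappa>: "0 < \<kappa>" and a: "\<kappa> * norm g = a" and lpos: "\<forall>N\<ge>1. 0 < l N"
          and adm: "(\<lambda>N. X N 0) \<in> admissible Q E l" and sed: "\<forall>N\<ge>1. sedimentation r \<kappa> g N (X N)"
          and t: "t \<in> {0..T}" and N: "Ns \<le> N"
        define D where "D = dmin N (X N 0)"
        define M where "M = max_count N (l N) (X N 0)"
        have N2: "2 \<le> N" using N by (simp add: Ns_def)
        have l: "0 < l N" using lpos N2 by simp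
        have "1024 * r^2 * Q * E \<le> real (nat \<lceil>1024 * r^2 * Q * E\<rceil>)" by (rule real_nat_ceiling_ge)
        also have "\<dots> \<le> real N" using N by (simp add: Ns_def)
        finally have Nr: "1024 * r^2 * Q * E \<le> real N" .
        have D: "0 < D" "D / 2 \<le> l N" "l N^3 / D^2 \<le> E"
          using adm N2 l unfolding admissible_def D_def by auto
        have "real M / (real N * \<bar>l N\<bar>^3) \<le> Q"
          using adm N2 unfolding admissible_def M_def by simp
        then have M: "real M / (real N * l N^3) \<le> Q" using l by simp
        have M1: "1 \<le> M" unfolding M_def using N2 l by (intro max_count_pos) auto
        have N1: "1 \<le> N" using N2 by simp
        note bounds = admissible_bounds[OF Q E l D N1 M M1]
        have DR: "32 * (r / N) \<le> D"
        proof -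
          have "4 \<le> 4 * Q * E * N * D^2" using bounds(2) D(1) by (simp add: power_divide pos_divide_le_eq)
          then have "real N \<le> Q * E * D^2 * (real N * real N)" using N1 by (simp add: mult_ac)
          then have "1024 * r^2 * Q * E \<le> Q * E * D^2 * (real N * real N)" using Nr by linarith
          then have "(Q * E) * (32 * r)^2 \<le> (Q * E) * (D * N)^2" by (simp add: power2_eq_square mult_ac)
          then have "(32 * r)^2 \<le> (D * N)^2" using Q E by (simp only: mult_le_cancel_left_pos mult_pos_pos)
          then have "32 * r \<le> D * N" by (rule power2_le_imp_le) (use D in simp)
          then show ?thesis using N1 by (simp add: pos_divide_le_eq)
        qed
        have half: "1 / 2 * dist (X N 0 i) (X N 0 j) \<le> dist (X N t i) (X N t j)" if "i < N" "j < N" for i j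
        proof (rule distances_halve_at_most[OF C _ r \<kappa> N1 D(1) DR _ _ l, where A = A and B = B and T = T])
          show "sedimentation r \<kappa> g N (X N)" using sed N1 by simp
          show "D \<le> dist (X N 0 i) (X N 0 j)" if "i < N" "j < N" "i \<noteq> j" for i j
            unfolding D_def using that by (rule dmin_le)
          show "cube_bound N (X N 0) (l N) M" unfolding M_def by (rule max_count_cube_bound)
          show "N + (512 * real M) / (D / 2)^2 + 8 * (512 * real M) / (l N)^2 * (1 + 2 / l N) \<le> A * N"
            unfolding A_def by (rule bounds(1))
          show "1 / (D / 2)^2 \<le> B * N" unfolding B_def by (rule bounds(2))
          show "0 \<le> B" using Q E by (simp add: B_def)
          show "\<bar>lipschitz_const C r (\<kappa> * norm g) A B\<bar> * T \<le> 1 / 4"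
            unfolding a T_def L_def[symmetric] using L0 by (simp add: divide_le_eq)
        qed (use t that in auto)
        show "1 / 2 * dmin N (X N 0) \<le> dmin N (X N t)"
        proof (rule dmin_ge[OF N2])
          fix i j assume ij: "i < N" "j < N" "i \<noteq> j"
          show "1 / 2 * dmin N (X N 0) \<le> dist (X N t i) (X N t j)"
            using half[OF ij(1,2)] dmin_le[OF ij, of "X N 0"] by linarith
        qed
        have "max_count N (l N) (X N t) \<le> 512 * M"
          unfolding M_def using l half by (intro max_count_le cube_bound_later[OF max_count_cube_bound]) auto
        \<comment> \<open>The factor obtained is 512 = 8^3.\<close>
        then show "max_count N (l N) (X N t) \<le> 8 ^ 4 * max_count N (l N) (X N 0)" by (simp add: M_def)
      qed
    qed
  qed simp
qed

end
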